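(* Let $d \ge 2$, $\alpha > 0$, $v > (d+1)\alpha$ and $0 < \varepsilon < 1$. There is a constant $c(\alpha,v,\varepsilon)$ such that for all $N \ge c(\alpha,v,\varepsilon)$ and every $x = (y,z) \in E$ one can construct, on some auxiliary probability space, a coupling $Q$ of the simple random walk $X_\cdot$ on $E$ under $P$ and of the random interlacement $\mathcal{I}^v$ at level $v$ on $\mathbb{Z}^{d+1}$, such that $$Q\big[(X_{[0,D^z_K]} - x) \cap A \subseteq \mathcal{I}^v \cap A\big] \ge 1 - c\,N^{-3d},$$ where $K = [\alpha N^d/h_N]$, $A = B(0,N^{1-\varepsilon})$ is viewed both as a subset of $E$ and of $\mathbb{Z}^{d+1}$, and $c$ is a constant depending only on $d$.
   Context: Fix $d\ge 2$, $N \ge 1$, $\mathbb{T} = (\mathbb{Z}/N\mathbb{Z})^d$ and the discrete cylinder $E = \mathbb{T}\times\mathbb{Z}$ (an abelian group, so $X_{[0,n]} - x$ means the translate of the set $X_{[0,n]}=\{X_0,\dots,X_n\}$ by $-x$). $P_x$ is the law of simple random walk $X_\cdot = (Y_\cdot, Z_\cdot)$ on $E$ started at $x$ ($Y$ the $\mathbb{T}$-component, $Z$ the $\mathbb{Z}$-component), and $P$ the law when $X_0$ is uniform on $\mathbb{T}\times\{0\}$. $B(x,r)$ denotes the closed $\ell^\infty$-ball of radius $r$ centered at $x$ (in $E$ or $\mathbb{Z}^{d+1}$); for large $N$ the ball $B(0,N^{1-\varepsilon})$ in $E$ is naturally identified with the corresponding ball in $\mathbb{Z}^{d+1}$. Set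 $r_N = N$, $h_N = [N(2+(\log N)^2)]$ ($[\cdot]$ the integer part), $I=[-r_N,r_N]$, $\tilde I = (-h_N,h_N)$, and for $z\in\mathbb{Z}$, $B(z) = \mathbb{T}\times(z+I)$, $\tilde B(z) = \mathbb{T}\times(z+\tilde I)$. With $H_U = \inf\{n\ge 0: X_n\in U\}$, $T_U = \inf\{n \ge 0: X_n\notin U\}$ and $\theta$ the time shift, define $R^z_1 = H_{B(z)}$, $D^z_1 = T_{\tilde B(z)}\circ\theta_{R^z_1} + R^z_1$, and for $k \ge 1$, $R^z_{k+1} = R^z_1\circ\theta_{D^z_k} + D^z_k$, $D^z_{k+1} = D^z_1\circ\theta_{D^z_k} + D^z_k$ (successive returns to $B(z)$ and departures from $\tilde B(z)$). Random interlacement at level $u\ge0$ on $\mathbb{Z}^{d+1}$: the random subset $\mathcal{I}^u$ of $\mathbb{Z}^{d+1}$ given by the union of the ranges of the doubly-infinite trajectories (modulo time-shift) with label at most $u$ in the Poisson point process of Sznitman with intensity $\nu(dw^* )\,du$; its law is characterized by $\mathbb{P}[\mathcal{I}^u\cap K = \emptyset] = \exp\{-u\,\mathrm{cap}(K)\}$ for all finite $K\subset\mathbb{Z}^{d+1}$, where $\mathrm{cap}(K) = \sum_{x\in K} P^{\mathbb{Z}^{d+1}}_x[\tilde H_K = \infty]$ and $\tilde H_K = \inf\{n\ge 1: X_n\in K\}$ for simple random walk on $\mathbb{Z}^{d+1}$. *)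

theory Defs
  imports "HOL-Probability.Probability"
begin

text \<open>Points of E = (Z/NZ)^d x Z and of Z^(d+1) are int lists of length d+1;
  the first d entries are the torus coordinates (representatives in {0..N-1}),
  entry d is the Z-coordinate.\<close>

definition Epts :: "nat \<Rightarrow> nat \<Rightarrow> int list set" where
  "Epts d N = {p. length p = d + 1 \<and> (\<forall>i<d. 0 \<le> p ! i \<and> p ! i < int N)}"

definition Zpts :: "nat \<Rightarrow> int list set" where
  "Zpts d = {p. length p = d + 1}"

definition mvE :: "nat \<Rightarrow> nat \<Rightarrow> int list \<Rightarrow> nat \<Rightarrow> int list" where
  "mvE d N p j = (let i = j div 2; s = (if even j then 1 else -1) in
      if i < d then p[i := (p ! i + s) mod int N] else p[i := p ! i + s])"

definition mvZ :: "int list \<Rightarrow> nat \<Rightarrow> int list" where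
  "mvZ p j = p[j div 2 := p ! (j div 2) + (if even j then 1 else -1)]"

definition ptransE :: "nat \<Rightarrow> nat \<Rightarrow> int list \<Rightarrow> int list \<Rightarrow> real" where
  "ptransE d N p q = real (card {j. j < 2 * (d + 1) \<and> mvE d N p j = q}) / real (2 * (d + 1))"

definition initE :: "nat \<Rightarrow> nat \<Rightarrow> int list \<Rightarrow> real" where
  "initE d N p = (if p \<in> Epts d N \<and> p ! d = 0 then 1 / real N ^ d else 0)"

definition walkZ :: "int list \<Rightarrow> nat list \<Rightarrow> int list" where
  "walkZ x js = foldl mvZ x js"

text \<open>Escape probability P_x[tilde H_K = infinity] on Z^(d+1), as the (monotone) limit of
  P_x[no visit to K at times 1..n].\<close>
definition escape :: "nat \<Rightarrow> int list set \<Rightarrow> int list \<Rightarrow> real" where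
  "escape d K x = lim (\<lambda>n. real (card {js. length js = n \<and> set js \<subseteq> {..<2 * (d + 1)} \<and>
        (\<forall>m\<in>{1..n}. walkZ x (take m js) \<notin> K)}) / real (2 * (d + 1)) ^ n)"

definition cap :: "nat \<Rightarrow> int list set \<Rightarrow> real" where
  "cap d K = (\<Sum>x\<in>K. escape d K x)"

text \<open>Coupling on the canonical space (paths in E) x (subsets of Z^(d+1)):
  first component has the law P of SRW on E (given by finite-dimensional distributions),
  second component has the law of random interlacements at level v.\<close>
definition is_coupling :: "nat \<Rightarrow> nat \<Rightarrow> real \<Rightarrow> ((nat \<Rightarrow> int list) \<times> int list set) measure \<Rightarrow> bool" where
  "is_coupling d N v Q \<longleftrightarrow>
     prob_space Q \<and>
     (\<forall>n p. {\<omega> \<in> space Q. fst \<omega> n = p} \<in> sets Q) \<and>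
     (\<forall>p. {\<omega> \<in> space Q. p \<in> snd \<omega>} \<in> sets Q) \<and>
     (\<forall>n ps. measure Q {\<omega> \<in> space Q. \<forall>k\<le>n. fst \<omega> k = ps k}
              = initE d N (ps 0) * (\<Prod>k<n. ptransE d N (ps k) (ps (Suc k)))) \<and>
     (AE \<omega> in Q. snd \<omega> \<subseteq> Zpts d) \<and>
     (\<forall>K. finite K \<longrightarrow> K \<subseteq> Zpts d \<longrightarrow>
          measure Q {\<omega> \<in> space Q. snd \<omega> \<inter> K = {}} = exp (- v * cap d K))"

definition hN :: "nat \<Rightarrow> nat" where
  "hN N = nat \<lfloor>real N * (2 + (ln (real N))\<^sup>2)\<rfloor>"

definition firstafter :: "(nat \<Rightarrow> bool) \<Rightarrow> enat \<Rightarrow> enat" where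
  "firstafter P s = (case s of \<infinity> \<Rightarrow> \<infinity>
      | enat m \<Rightarrow> (if \<exists>n\<ge>m. P n then enat (LEAST n. m \<le> n \<and> P n) else \<infinity>))"

text \<open>Successive departures: D_0 = 0 (convention), D_(k+1) = first exit of tilde B(z)
  after the first visit to B(z) after D_k.\<close>
fun Dseq :: "(nat \<Rightarrow> bool) \<Rightarrow> (nat \<Rightarrow> bool) \<Rightarrow> nat \<Rightarrow> enat" where
  "Dseq Pin Pout 0 = 0"
| "Dseq Pin Pout (Suc k) = firstafter Pout (firstafter Pin (Dseq Pin Pout k))"

definition Dtime :: "nat \<Rightarrow> nat \<Rightarrow> int \<Rightarrow> nat \<Rightarrow> (nat \<Rightarrow> int list) \<Rightarrow> enat" where
  "Dtime d N z k w = Dseq (\<lambda>n. \<bar>w n ! d - z\<bar> \<le> int N)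
                          (\<lambda>n. \<bar>w n ! d - z\<bar> \<ge> int (hN N)) k"

definition subE :: "nat \<Rightarrow> nat \<Rightarrow> int list \<Rightarrow> int list \<Rightarrow> int list" where
  "subE d N p x = map (\<lambda>i. if i < d then (p ! i - x ! i) mod int N else p ! i - x ! i) [0..<d + 1]"

definition ballE :: "nat \<Rightarrow> nat \<Rightarrow> real \<Rightarrow> int list set" where
  "ballE d N r = {q \<in> Epts d N. (\<forall>i<d. real_of_int (min (q ! i) (int N - q ! i)) \<le> r)
                               \<and> real_of_int \<bar>q ! d\<bar> \<le> r}"

definition toZ :: "nat \<Rightarrow> nat \<Rightarrow> int list \<Rightarrow> int list" where
  "toZ d N q = map (\<lambda>i. if i < d \<and> 2 * q ! i > int N then q ! i - int N else q ! i) [0..<d + 1]"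

end

theory Submission
  imports Defs "HOL-Real_Asymp.Real_Asymp"
begin

text \<open>Translate the walk by \<open>- x\<close> and decompose it into excursions between \<open>B(0)\<close> and the complement
  of the larger cylinder. Between two excursions the walk mixes, so each excursion enters the slice of
  height \<open>\<plusminus>N\<close> nearly uniformly. By reversal, the probability that it hits the box \<open>A\<close> first at \<open>x\<close> is
  then at most about \<open>(d + 1) h / N^d\<close> times the escape probability from \<open>x\<close>: the expected number of
  visits of the slice before leaving the large cylinder is at most \<open>(d + 1) (h + N)\<close>, and the walk
  started at \<open>x\<close> that leaves a slightly larger box escapes from \<open>A\<close> on the lattice up to a factor
  \<open>1 + \<delta>\<close>. Hence the trace of one excursion up to its return from distance \<open>N / 4\<close> is dominated by the
  trace of interlacements at level \<open>(1 + \<delta>) (d + 1) h / N^d\<close>. Each later return to \<open>A\<close> within the same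
  excursion has probability \<open>u2 cap(A)\<close>, which is at most a negative power of \<open>N\<close>, and is paid for by a further
  level \<open>w2\<close>; allowing \<open>j\<close> such returns in total costs an error of order \<open>B^K / 2^j\<close>. Since
  \<open>\<alpha> (d + 1) < v\<close>, there is room for \<open>j\<close> of order \<open>1 / w2\<close>, which beats \<open>B^K\<close>.

  All estimates are proved for finite time horizons by comparing recursions with explicit
  superharmonic functions, and the law of the trace of a random set is determined by its avoidance
  function, so that neither path measures nor stopping times enter before the final coupling.\<close>

section \<open>Stochastic domination of random sets\<close>

text \<open>Sweeping is what makes an excursion comparable with interlacements: \<open>esc D\<close>
  is, up to normalisation, the law with which trajectories launched from the equilibrium measure of
  a larger set enter \<open>D\<close>. A walk that enters \<open>D\<close> with density at most
  \<open>u * esc D\<close> can therefore be matched with the first trajectory of a Poisson cloud of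
  level slightly above \<open>u\<close>. Three such densities occur: near-uniform entrance
  (\<open>u1\<close>), return from afar (\<open>u2\<close>), and a uniform start on a slice that
  cuts the box (\<open>u3\<close>), since reversal says nothing about a start close to the box.
  Instead of the sharp decay of order d - 1, the Green function is only shown to decay like
  \<open>N powr (- 2 * b)\<close> with 2b = (1 - \<epsilon>/2)(d - 1), for which explicit Lyapunov
  functions exist. This is enough, because cap(A) is at most of order N to the power (1 -
  \<epsilon>)(d - 1): u2 cap(A) tends to zero, and 1/u2 outgrows the logarithm of B^K, which is at
  most 4 K u1 cap(A). The same margin leaves room for a box of radius N to the power 1 -
  \<epsilon>/2, from whose outside A is rarely hit.\<close>

lemma measure_bind_pmf:
  "measure (measure_pmf (bind_pmf \<mu> X)) S = (\<integral>i. measure (measure_pmf (X i)) S \<partial>measure_pmf \<mu>)"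
proof -
  have *: "measure (measure_pmf p) S = pmf (map_pmf (\<lambda>x. x \<in> S) p) True" for p
    by (simp add: pmf_map vimage_def)
  show ?thesis unfolding * by (simp only: map_bind_pmf pmf_bind)
qed

text \<open>Inclusion may fail with probability at most \<open>e\<close>, while both marginals stay
  exact. For \<open>e = 0\<close> this is the stochastic order with respect to inclusion.\<close>

definition sdom :: "real \<Rightarrow> 'a set pmf \<Rightarrow> 'a set pmf \<Rightarrow> bool" where
  "sdom e X Y \<longleftrightarrow> (\<exists>pq. map_pmf fst pq = X \<and> map_pmf snd pq = Y \<and>
     measure (measure_pmf pq) {st. \<not> fst st \<subseteq> snd st} \<le> e)"

lemma sdomI:
  assumes "map_pmf fst pq = X" "map_pmf snd pq = Y"
    "measure (measure_pmf pq) {st. \<not> fst st \<subseteq> snd st} \<le> e"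
  shows "sdom e X Y"
  using assms unfolding sdom_def by blast

lemma sdom_mono: "sdom e X Y \<Longrightarrow> e \<le> e' \<Longrightarrow> sdom e' X Y"
  unfolding sdom_def by force

lemma sdom_trivial:
  assumes "e \<ge> 1" shows "sdom e X Y"
proof (rule sdomI[of "pair_pmf X Y"])
  show "measure (measure_pmf (pair_pmf X Y)) {st. \<not> fst st \<subseteq> snd st} \<le> e"
    using assms measure_pmf.prob_le_1 order_trans by blast
qed (auto simp: map_fst_pair_pmf map_snd_pair_pmf)

lemma sdom_refl: "0 \<le> e \<Longrightarrow> sdom e X X"
  by (rule sdomI[of "map_pmf (\<lambda>x. (x, x)) X"]) (auto simp: pmf.map_comp o_def)

lemma sdom_0_rel: "sdom 0 X Y \<longleftrightarrow> rel_pmf (\<subseteq>) X Y"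
proof
  assume "sdom 0 X Y"
  then obtain pq where pq: "map_pmf fst pq = X" "map_pmf snd pq = Y"
    "measure (measure_pmf pq) {st. \<not> fst st \<subseteq> snd st} \<le> 0" unfolding sdom_def by blast
  have "measure (measure_pmf pq) {st. \<not> fst st \<subseteq> snd st} = 0"
    by (rule antisym[OF pq(3) measure_nonneg])
  then have "set_pmf pq \<inter> {st. \<not> fst st \<subseteq> snd st} = {}"
    by (simp only: measure_pmf_zero_iff)
  then show "rel_pmf (\<subseteq>) X Y"
    by (intro rel_pmf.intros[OF _ pq(1,2)]) force
next
  assume "rel_pmf (\<subseteq>) X Y"
  then obtain pq where pq: "\<And>x y. (x, y) \<in> set_pmf pq \<Longrightarrow> x \<subseteq> y" "map_pmf fst pq = X" "map_pmf snd pq = Y"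
    by (auto elim: rel_pmf.cases)
  have "measure (measure_pmf pq) {st. \<not> fst st \<subseteq> snd st} = 0"
    unfolding measure_pmf_zero_iff using pq(1) by fastforce
  then show "sdom 0 X Y" using pq by (intro sdomI[of pq]) auto
qed

text \<open>Two couplings with the common marginal \<open>Y\<close> are glued conditionally on it.
  Composing the relations \<open>snd st = y\<close> and inclusion through \<open>rel_pmf\<close>
  does this and leaves the first coupling intact, so its error is kept.\<close>

lemma sdom_trans0:
  assumes "sdom e X Y" "sdom 0 Y Z" shows "sdom e X Z"
proof -
  obtain pq where pq: "map_pmf fst pq = X" "map_pmf snd pq = Y"
    "measure (measure_pmf pq) {st. \<not> fst st \<subseteq> snd st} \<le> e" using assms(1) unfolding sdom_def by blast
  have 1: "rel_pmf (\<lambda>st y. snd st = y) pq Y"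
    unfolding pq(2)[symmetric] by (auto simp: pmf.rel_map intro: rel_pmf_reflI)
  have 2: "rel_pmf (\<subseteq>) Y Z" using assms(2) sdom_0_rel by blast
  have "rel_pmf ((\<lambda>st y. snd st = y) OO (\<subseteq>)) pq Z"
    unfolding pmf.rel_compp using 1 2 by blast
  then obtain t where t: "\<And>st z. (st, z) \<in> set_pmf t \<Longrightarrow> snd st \<subseteq> z" "map_pmf fst t = pq" "map_pmf snd t = Z"
    by (auto elim!: rel_pmf.cases simp: OO_def)
  let ?m = "map_pmf (\<lambda>(st, z). (fst st, z)) t"
  show ?thesis
  proof (rule sdomI[of ?m])
    show "map_pmf fst ?m = X" using t pq by (auto simp: pmf.map_comp o_def split_beta)
    show "map_pmf snd ?m = Z" using t pq by (auto simp: pmf.map_comp o_def split_beta)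
    have "measure (measure_pmf ?m) {st. \<not> fst st \<subseteq> snd st}
       = measure (measure_pmf t) {x. \<not> fst (fst x) \<subseteq> snd x}"
      by (simp add: split_beta vimage_def)
    also have "\<dots> = measure (measure_pmf t) ({x. \<not> fst (fst x) \<subseteq> snd x} \<inter> set_pmf t)"
      by (rule measure_Int_set_pmf[symmetric])
    also have "\<dots> \<le> measure (measure_pmf t) (fst -` {st. \<not> fst st \<subseteq> snd st})"
      by (rule measure_pmf.finite_measure_mono) (use t(1) in fastforce)+
    also have "\<dots> = measure (measure_pmf pq) {st. \<not> fst st \<subseteq> snd st}"
      unfolding t(2)[symmetric] by simp
    finally show "measure (measure_pmf ?m) {st. \<not> fst st \<subseteq> snd st} \<le> e" using pq(3) by linarith
  qed
qed

text \<open>Mixing the couplings of the pieces averages their failure probabilities. Keeping a class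
  \<open>H\<close> apart lets its larger error \<open>a\<close> be weighted by the probability of
  \<open>H\<close>; later \<open>H\<close> is the rare event that the box is hit.\<close>

lemma sdom_bind_split:
  fixes a b :: real
  assumes a: "\<And>i. i \<in> set_pmf \<mu> \<Longrightarrow> i \<in> H \<Longrightarrow> sdom a (X i) (Y i)"
    and b: "\<And>i. i \<in> set_pmf \<mu> \<Longrightarrow> i \<notin> H \<Longrightarrow> sdom b (X i) (Y i)"
    and "0 \<le> a" "0 \<le> b"
  shows "sdom (a * measure (measure_pmf \<mu>) H + b) (bind_pmf \<mu> X) (bind_pmf \<mu> Y)"
proof -
  define C where "C i pq \<longleftrightarrow> map_pmf fst pq = X i \<and> map_pmf snd pq = Y i \<and>
     measure (measure_pmf pq) {st. \<not> fst st \<subseteq> snd st} \<le> (if i \<in> H then a else b)" for i pq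
  have "\<exists>pq. C i pq" if "i \<in> set_pmf \<mu>" for i
    using a[OF that] b[OF that] unfolding sdom_def C_def by (cases "i \<in> H") simp_all
  then obtain pq where C: "\<And>i. i \<in> set_pmf \<mu> \<Longrightarrow> C i (pq i)" by metis
  have pq: "\<And>i. i \<in> set_pmf \<mu> \<Longrightarrow> map_pmf fst (pq i) = X i"
    "\<And>i. i \<in> set_pmf \<mu> \<Longrightarrow> map_pmf snd (pq i) = Y i"
    "\<And>i. i \<in> set_pmf \<mu> \<Longrightarrow> measure (measure_pmf (pq i)) {st. \<not> fst st \<subseteq> snd st} \<le> (if i \<in> H then a else b)"
    using C unfolding C_def by auto
  show ?thesis
  proof (rule sdomI[of "bind_pmf \<mu> pq"])
    show "map_pmf fst (bind_pmf \<mu> pq) = bind_pmf \<mu> X"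
      unfolding map_bind_pmf by (rule bind_pmf_cong) (auto simp: pq)
    show "map_pmf snd (bind_pmf \<mu> pq) = bind_pmf \<mu> Y"
      unfolding map_bind_pmf by (rule bind_pmf_cong) (auto simp: pq)
    have "measure (measure_pmf (bind_pmf \<mu> pq)) {st. \<not> fst st \<subseteq> snd st}
       = (\<integral>i. measure (measure_pmf (pq i)) {st. \<not> fst st \<subseteq> snd st} \<partial>measure_pmf \<mu>)"
      by (rule measure_bind_pmf)
    also have "\<dots> \<le> (\<integral>i. a * indicator H i + b \<partial>measure_pmf \<mu>)"
    proof (rule integral_mono_AE)
      show "integrable (measure_pmf \<mu>) (\<lambda>i. measure (measure_pmf (pq i)) {st. \<not> fst st \<subseteq> snd st})"
        by (rule measure_pmf.integrable_const_bound[where B=1]) auto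
      show "integrable (measure_pmf \<mu>) (\<lambda>i. a * indicator H i + b)"
        by (rule measure_pmf.integrable_const_bound[where B="a + b"])
           (use assms(3,4) in \<open>auto simp: indicator_def\<close>)
      show "AE i in measure_pmf \<mu>. measure (measure_pmf (pq i)) {st. \<not> fst st \<subseteq> snd st} \<le> a * indicator H i + b"
        using pq(3) assms(3,4) by (force simp: AE_measure_pmf_iff indicator_def)
    qed
    also have "\<dots> = (\<integral>i. a * indicator H i \<partial>measure_pmf \<mu>) + (\<integral>i. b \<partial>measure_pmf \<mu>)"
      by (rule Bochner_Integration.integral_add, rule measure_pmf.integrable_const_bound[where B=a])
         (use assms(3) in \<open>auto simp: indicator_def\<close>)
    also have "\<dots> = a * measure (measure_pmf \<mu>) H + b" by simp
    finally show "measure (measure_pmf (bind_pmf \<mu> pq)) {st. \<not> fst st \<subseteq> snd st} \<le> \<dots>" .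
  qed
qed

lemma sdom_bind:
  assumes "\<And>i. i \<in> set_pmf \<mu> \<Longrightarrow> sdom e (X i) (Y i)" "0 \<le> e"
  shows "sdom e (bind_pmf \<mu> X) (bind_pmf \<mu> Y)"
  using sdom_bind_split[of \<mu> "{}" 0 X Y e] assms by auto

lemma sdom_map_Un:
  assumes "sdom e X Y" "S \<subseteq> S'"
  shows "sdom e (map_pmf (\<lambda>T. S \<union> T) X) (map_pmf (\<lambda>T. S' \<union> T) Y)"
proof -
  obtain pq where pq: "map_pmf fst pq = X" "map_pmf snd pq = Y"
    "measure (measure_pmf pq) {st. \<not> fst st \<subseteq> snd st} \<le> e" using assms(1) unfolding sdom_def by blast
  let ?m = "map_pmf (\<lambda>st. (S \<union> fst st, S' \<union> snd st)) pq"
  show ?thesis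
  proof (rule sdomI[of ?m])
    show "map_pmf fst ?m = map_pmf (\<lambda>T. S \<union> T) X" unfolding pq(1)[symmetric] by (simp add: pmf.map_comp o_def)
    show "map_pmf snd ?m = map_pmf (\<lambda>T. S' \<union> T) Y" unfolding pq(2)[symmetric] by (simp add: pmf.map_comp o_def)
    have "measure (measure_pmf ?m) {st. \<not> fst st \<subseteq> snd st}
       = measure (measure_pmf pq) {st. \<not> S \<union> fst st \<subseteq> S' \<union> snd st}"
      by (simp add: vimage_def)
    also have "\<dots> \<le> measure (measure_pmf pq) {st. \<not> fst st \<subseteq> snd st}"
      by (rule measure_pmf.finite_measure_mono) (use assms(2) in auto)
    finally show "measure (measure_pmf ?m) {st. \<not> fst st \<subseteq> snd st} \<le> e" using pq(3) by linarith
  qed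
qed

lemma sdom_empty: "0 \<le> e \<Longrightarrow> sdom e (return_pmf {}) Y"
  by (rule sdom_mono[of 0]) (auto simp: sdom_0_rel rel_pmf_return_pmf1)

definition uni :: "'a set pmf \<Rightarrow> 'a set pmf \<Rightarrow> 'a set pmf" where
  "uni X Y = bind_pmf X (\<lambda>S. map_pmf (\<lambda>T. S \<union> T) Y)"

lemma sdom_uni_right:
  assumes "sdom e X Y" "0 \<le> e" shows "sdom e (uni Z X) (uni Z Y)"
  unfolding uni_def by (intro sdom_bind sdom_map_Un assms) auto

lemma uni_commute: "uni X Y = uni Y X"
  unfolding uni_def map_pmf_def
  by (subst bind_commute_pmf) (simp add: Un_commute)

lemma sdom_uni_left:
  assumes "sdom e X Y" "0 \<le> e" shows "sdom e (uni X Z) (uni Y Z)"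
  using sdom_uni_right[OF assms, of Z] by (simp add: uni_commute)

lemma sdom_uni_absorb: "sdom 0 Y (uni X Y)"
proof -
  have "sdom 0 (bind_pmf X (\<lambda>_. Y)) (uni X Y)"
    unfolding uni_def
    by (rule sdom_bind) (use sdom_map_Un[OF sdom_refl[of 0 Y], of "{}"] in \<open>auto simp: map_pmf_ident\<close>)
  then show ?thesis by (simp add: bind_pmf_const)
qed

section \<open>Avoidance probabilities of random finite sets\<close>

definition avoid :: "'a set pmf \<Rightarrow> 'a set \<Rightarrow> real" where
  "avoid X K = measure (measure_pmf X) {S. S \<inter> K = {}}"

lemma avoid_bind: "avoid (bind_pmf \<mu> X) K = (\<integral>i. avoid (X i) K \<partial>measure_pmf \<mu>)"
  unfolding avoid_def by (rule measure_bind_pmf)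

lemma avoid_return: "avoid (return_pmf S) K = (if S \<inter> K = {} then 1 else 0)"
  unfolding avoid_def by (simp add: measure_return_pmf indicator_def)

lemma avoid_map_Un: "avoid (map_pmf (\<lambda>T. S \<union> T) X) K = (if S \<inter> K = {} then avoid X K else 0)"
  unfolding avoid_def by (auto simp: vimage_def Int_Un_distrib2 intro!: arg_cong[where f="measure _"])

lemma avoid_uni: "avoid (uni X Y) K = avoid X K * avoid Y K"
proof -
  have "avoid (uni X Y) K = (\<integral>S. (if S \<inter> K = {} then avoid Y K else 0) \<partial>measure_pmf X)"
    unfolding uni_def avoid_bind avoid_map_Un ..
  also have "\<dots> = (\<integral>S. indicator {S. S \<inter> K = {}} S * avoid Y K \<partial>measure_pmf X)"
    by (intro Bochner_Integration.integral_cong) (auto simp: indicator_def)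
  also have "\<dots> = avoid X K * avoid Y K" unfolding avoid_def by simp
  finally show ?thesis .
qed

lemma avoid_map_Int: "avoid (map_pmf (\<lambda>T. T \<inter> A) X) K = avoid X (A \<inter> K)"
  unfolding avoid_def by (auto simp: vimage_def Int_assoc intro!: arg_cong[where f="measure _"])

lemma measure_subset_avoid:
  assumes "set_pmf X \<subseteq> Pow A"
  shows "measure (measure_pmf X) (Pow B) = avoid X (A - B)"
proof -
  have "measure (measure_pmf X) (Pow B) = measure (measure_pmf X) (Pow B \<inter> set_pmf X)"
    by (simp add: measure_Int_set_pmf)
  also have "Pow B \<inter> set_pmf X = {S. S \<inter> (A - B) = {}} \<inter> set_pmf X" using assms by auto
  also have "measure (measure_pmf X) \<dots> = avoid X (A - B)"
    by (simp add: measure_Int_set_pmf avoid_def)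
  finally show ?thesis .
qed

text \<open>Moebius inversion on the lattice of subsets, in a recursive form suited to induction
  over proper subsets.\<close>

lemma pmf_Pow_rec:
  assumes "finite B"
  shows "pmf X B = measure (measure_pmf X) (Pow B) - (\<Sum>S\<in>Pow B - {B}. pmf X S)"
proof -
  have "measure (measure_pmf X) (Pow B) = (\<Sum>S\<in>Pow B. pmf X S)"
    by (rule measure_measure_pmf_finite) (use assms in auto)
  also have "\<dots> = pmf X B + (\<Sum>S\<in>Pow B - {B}. pmf X S)"
    by (rule sum.remove) (use assms in auto)
  finally show ?thesis by linarith
qed

text \<open>For a subset of \<open>A\<close>, lying inside \<open>B\<close> means avoiding
  \<open>A - B\<close>. Avoidance probabilities are thus the distribution function for inclusion,
  from which Moebius inversion recovers the point masses.\<close>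

lemma avoid_unique:
  assumes "finite A" "set_pmf X \<subseteq> Pow A" "set_pmf Y \<subseteq> Pow A"
    and "\<And>K. K \<subseteq> A \<Longrightarrow> avoid X K = avoid Y K"
  shows "X = Y"
proof (rule pmf_eqI)
  have *: "pmf X B = pmf Y B" if "finite B" "B \<subseteq> A" for B
    using that
  proof (induction B rule: finite_psubset_induct)
    case (psubset B)
    have "measure (measure_pmf X) (Pow B) = measure (measure_pmf Y) (Pow B)"
      by (simp add: measure_subset_avoid[OF assms(2)] measure_subset_avoid[OF assms(3)] assms(4))
    moreover have "(\<Sum>S\<in>Pow B - {B}. pmf X S) = (\<Sum>S\<in>Pow B - {B}. pmf Y S)"
      by (intro sum.cong psubset.IH refl) (use psubset.prems in auto)
    ultimately show ?case using pmf_Pow_rec[OF psubset.hyps] by metis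
  qed
  fix B show "pmf X B = pmf Y B"
  proof (cases "B \<subseteq> A")
    case True then show ?thesis using * assms(1) finite_subset by blast
  next
    case False
    then have "B \<notin> set_pmf X" "B \<notin> set_pmf Y" using assms by auto
    then show ?thesis by (simp add: set_pmf_iff)
  qed
qed

text \<open>Convergence of the avoidance probabilities forces every point mass to converge, again by
  Moebius inversion, and no mass is lost because \<open>Pow A\<close> is finite. This yields laws of
  infinite traces without a measure on paths.\<close>

lemma avoid_limit:
  assumes fin: "finite A" and X: "\<And>n. set_pmf (X n) \<subseteq> Pow A"
    and lim: "\<And>K. K \<subseteq> A \<Longrightarrow> (\<lambda>n. avoid (X n) K) \<longlonglongrightarrow> a K"
  shows "\<exists>Y. set_pmf Y \<subseteq> Pow A \<and> (\<forall>K\<subseteq>A. avoid Y K = a K)"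
proof -
  have conv: "convergent (\<lambda>n. pmf (X n) B)" if "finite B" "B \<subseteq> A" for B
    using that
  proof (induction B rule: finite_psubset_induct)
    case (psubset B)
    have "(\<lambda>n. pmf (X n) B) = (\<lambda>n. avoid (X n) (A - B) - (\<Sum>S\<in>Pow B - {B}. pmf (X n) S))"
      by (simp add: pmf_Pow_rec[OF psubset.hyps] measure_subset_avoid[OF X])
    moreover have "convergent (\<lambda>n. \<Sum>S\<in>Pow B - {B}. pmf (X n) S)"
      by (intro convergent_sum psubset.IH) (use psubset.prems in auto)
    moreover have "convergent (\<lambda>n. avoid (X n) (A - B))"
      using lim[of "A - B"] by (auto simp: convergent_def)
    ultimately show ?case by (simp add: convergent_diff)
  qed
  define f where "f B = (if B \<subseteq> A then lim (\<lambda>n. pmf (X n) B) else 0)" for B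
  have f: "(\<lambda>n. pmf (X n) B) \<longlonglongrightarrow> f B" for B
  proof (cases "B \<subseteq> A")
    case True
    then show ?thesis using conv[of B] fin finite_subset unfolding f_def
      by (auto simp: convergent_LIMSEQ_iff)
  next
    case False
    then have "pmf (X n) B = 0" for n using X[of n] by (auto simp: pmf_eq_0_set_pmf)
    then show ?thesis using False by (simp add: f_def)
  qed
  have f0: "0 \<le> f B" for B by (rule LIMSEQ_le_const[OF f]) auto
  have "(\<lambda>n. \<Sum>B\<in>Pow A. pmf (X n) B) \<longlonglongrightarrow> (\<Sum>B\<in>Pow A. f B)" by (intro tendsto_sum f)
  moreover have "(\<Sum>B\<in>Pow A. pmf (X n) B) = 1" for n
    using fin X by (simp add: sum_pmf_eq_1)
  ultimately have f1: "(\<Sum>B\<in>Pow A. f B) = 1" by (simp add: LIMSEQ_const_iff)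
  have "(\<integral>\<^sup>+ x. ennreal (f x) \<partial>count_space UNIV) = (\<Sum>B\<in>Pow A. ennreal (f B))"
    by (rule nn_integral_count_space') (use fin in \<open>auto simp: f_def\<close>)
  also have "\<dots> = 1" using f0 f1 by (simp add: sum_ennreal)
  finally have nn: "(\<integral>\<^sup>+ x. ennreal (f x) \<partial>count_space UNIV) = 1" .
  define Y where "Y = embed_pmf f"
  have Y: "pmf Y B = f B" for B unfolding Y_def by (rule pmf_embed_pmf) (use f0 nn in auto)
  have YA: "set_pmf Y \<subseteq> Pow A" by (auto simp: set_pmf_iff Y f_def split: if_splits)
  moreover have "avoid Y K = a K" if "K \<subseteq> A" for K
  proof -
    have av: "avoid Z K = (\<Sum>B\<in>{B\<in>Pow A. B \<inter> K = {}}. pmf Z B)" if "set_pmf Z \<subseteq> Pow A" for Z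
    proof -
      have "avoid Z K = measure (measure_pmf Z) ({S. S \<inter> K = {}} \<inter> set_pmf Z)"
        by (simp add: avoid_def measure_Int_set_pmf)
      also have "{S. S \<inter> K = {}} \<inter> set_pmf Z = {B\<in>Pow A. B \<inter> K = {}} \<inter> set_pmf Z" using that by auto
      also have "measure (measure_pmf Z) \<dots> = measure (measure_pmf Z) {B\<in>Pow A. B \<inter> K = {}}"
        by (simp add: measure_Int_set_pmf)
      also have "\<dots> = (\<Sum>B\<in>{B\<in>Pow A. B \<inter> K = {}}. pmf Z B)"
        by (rule measure_measure_pmf_finite) (use fin in auto)
      finally show ?thesis .
    qed
    have "(\<lambda>n. avoid (X n) K) \<longlonglongrightarrow> avoid Y K"
      unfolding av[OF X] av[OF YA] Y by (intro tendsto_sum f)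
    then show ?thesis using lim[OF that] LIMSEQ_unique by blast
  qed
  ultimately show ?thesis by blast
qed

section \<open>Walks given by finitely many invertible moves\<close>

definition av :: "nat \<Rightarrow> (nat \<Rightarrow> real) \<Rightarrow> real" where
  "av m f = (\<Sum>j<m. f j) / real m"

definition steps :: "nat \<Rightarrow> nat pmf" where "steps m = pmf_of_set {..<m}"

lemma av_mono: "(\<And>j. j < m \<Longrightarrow> f j \<le> g j) \<Longrightarrow> av m f \<le> av m g"
  unfolding av_def by (intro divide_right_mono sum_mono) auto

lemma av_cong: "(\<And>j. j < m \<Longrightarrow> f j = g j) \<Longrightarrow> av m f = av m g"
  unfolding av_def by (metis (mono_tags, lifting) lessThan_iff sum.cong)

lemma av_const: "0 < m \<Longrightarrow> av m (\<lambda>_. c) = c"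
  unfolding av_def by simp

lemma av_add: "av m (\<lambda>j. f j + g j) = av m f + av m g"
  unfolding av_def by (simp add: sum.distrib add_divide_distrib)

lemma av_cmult: "av m (\<lambda>j. c * f j) = c * av m f"
  unfolding av_def by (simp add: sum_distrib_left)

lemma av_cmult_right: "av m (\<lambda>j. f j * c) = av m f * c"
  unfolding av_def by (simp add: sum_distrib_right)

lemma av_nonneg: "(\<And>j. j < m \<Longrightarrow> 0 \<le> f j) \<Longrightarrow> 0 \<le> av m f"
  unfolding av_def by (intro divide_nonneg_nonneg sum_nonneg) auto

lemma av_sum: "av m (\<lambda>j. \<Sum>i\<in>I. f i j) = (\<Sum>i\<in>I. av m (f i))"
  unfolding av_def by (subst sum.swap) (simp add: sum_divide_distrib)

lemma av_swap: "av m (\<lambda>j. av m (\<lambda>i. f i j)) = av m (\<lambda>i. av m (\<lambda>j. f i j))"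
proof -
  have "(\<Sum>j<m. \<Sum>i<m. f i j) = (\<Sum>i<m. \<Sum>j<m. f i j)" by (rule sum.swap)
  then show ?thesis unfolding av_def by (simp add: sum_divide_distrib[symmetric])
qed

lemma av_zero [simp]: "av m (\<lambda>j. 0) = 0" unfolding av_def by simp

lemma tendsto_av: "(\<And>j. j < m \<Longrightarrow> (\<lambda>n. f n j) \<longlonglongrightarrow> g j) \<Longrightarrow> (\<lambda>n. av m (f n)) \<longlonglongrightarrow> av m g"
  unfolding av_def by (cases "m = 0") (auto intro!: tendsto_intros)

lemma expectation_steps: "0 < m \<Longrightarrow> measure_pmf.expectation (steps m) f = av m f"
  unfolding steps_def av_def by (subst integral_pmf_of_set) (auto simp: lessThan_empty_iff)

lemma measure_bind_steps:
  "0 < m \<Longrightarrow> measure (measure_pmf (bind_pmf (steps m) X)) S = av m (\<lambda>j. measure (measure_pmf (X j)) S)"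
  by (simp only: measure_bind_pmf expectation_steps)

lemma avoid_bind_steps: "0 < m \<Longrightarrow> avoid (bind_pmf (steps m) X) K = av m (\<lambda>j. avoid (X j) K)"
  by (simp only: avoid_bind expectation_steps)

lemma set_steps: "0 < m \<Longrightarrow> set_pmf (steps m) = {..<m}"
  unfolding steps_def by (rule set_pmf_of_set) (auto simp: lessThan_empty_iff)

text \<open>Dominated convergence for a convolution. In the last-exit decomposition \<open>a\<close>
  is a killed transition kernel summed over time and \<open>b\<close> the escape probability within
  the time that remains.\<close>

lemma conv_limit:
  fixes a b :: "nat \<Rightarrow> real"
  assumes a: "\<And>i. 0 \<le> a i" "summable a" and b: "\<And>i. \<bar>b i\<bar> \<le> B" "b \<longlonglongrightarrow> \<beta>"
  shows "(\<lambda>n. \<Sum>i\<le>n. a i * b (n - i)) \<longlonglongrightarrow> suminf a * \<beta>"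
proof -
  define f where "f k n = (if k \<le> n then a k * b (n - k) else 0)" for k n
  have B: "0 \<le> B" using b(1)[of 0] by linarith
  have "(\<lambda>n. \<Sum>k. f k n) \<longlonglongrightarrow> (\<Sum>k. a k * \<beta>)"
  proof (rule tannerys_theorem[THEN conjunct2, THEN conjunct2])
    fix k
    have "(\<lambda>n. a k * b n) \<longlonglongrightarrow> a k * \<beta>" by (intro tendsto_intros b)
    then have "(\<lambda>n. f k (n + k)) \<longlonglongrightarrow> a k * \<beta>" by (simp add: f_def)
    then show "f k \<longlonglongrightarrow> a k * \<beta>" by (rule LIMSEQ_offset)
  next
    have "norm (f k n) \<le> a k * B" for k n
      using mult_left_mono[OF b(1)[of "n - k"] a(1)[of k]] a(1)[of k] B by (simp add: f_def abs_mult)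
    then show "\<forall>\<^sub>F (k, n) in sequentially \<times>\<^sub>F sequentially. norm (f k n) \<le> a k * B"
      by (simp add: always_eventually)
  qed (use a(2) in \<open>auto intro: summable_mult2\<close>)
  moreover have "(\<Sum>k. f k n) = (\<Sum>i\<le>n. a i * b (n - i))" for n
    by (subst suminf_finite[of "{..n}"]) (auto simp: f_def)
  ultimately show ?thesis using a(2) by (simp add: suminf_mult2)
qed

text \<open>\<open>iv\<close> names the inverse of a move, so that a uniformly chosen move gives a
  symmetric transition kernel. The lattice and the cylinder are both instances.\<close>

locale rwalk =
  fixes V :: "'a set" and mv :: "'a \<Rightarrow> nat \<Rightarrow> 'a" and m :: nat and iv :: "nat \<Rightarrow> nat"
  assumes m_pos: "0 < m"
    and closed: "\<And>p j. p \<in> V \<Longrightarrow> j < m \<Longrightarrow> mv p j \<in> V"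
    and iv_less: "\<And>j. j < m \<Longrightarrow> iv j < m"
    and iv_iv: "\<And>j. j < m \<Longrightarrow> iv (iv j) = j"
    and mv_iv: "\<And>p j. p \<in> V \<Longrightarrow> j < m \<Longrightarrow> mv (mv p j) (iv j) = p"
begin

text \<open>Conventions: the starting point counts neither for \<open>kk\<close>, \<open>vis\<close> (which need not start in
  \<open>U\<close>) nor for \<open>escn\<close> (avoid \<open>K\<close> at times \<open>1, \<dots>, n\<close>), but it does for \<open>avd\<close> (times \<open>0, \<dots>, n\<close>);
  \<open>hitd U\<close> looks for the first visit to the target, staying in \<open>U\<close> before.\<close>

fun kk :: "'a set \<Rightarrow> nat \<Rightarrow> 'a \<Rightarrow> 'a \<Rightarrow> real" where
  "kk U 0 x y = (if x = y then 1 else 0)"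
| "kk U (Suc n) x y = av m (\<lambda>j. if mv x j \<in> U then kk U n (mv x j) y else 0)"

fun hitd :: "'a set \<Rightarrow> nat \<Rightarrow> 'a \<Rightarrow> 'a \<Rightarrow> real" where
  "hitd U 0 x q = (if x = q then 1 else 0)"
| "hitd U (Suc n) x q = (if x = q then 1 else if x \<in> U then av m (\<lambda>j. hitd U n (mv x j) q) else 0)"

fun vis :: "'a set \<Rightarrow> ('a \<Rightarrow> real) \<Rightarrow> nat \<Rightarrow> 'a \<Rightarrow> real" where
  "vis U f 0 p = f p"
| "vis U f (Suc n) p = f p + av m (\<lambda>j. if mv p j \<in> U then vis U f n (mv p j) else 0)"

fun escn :: "'a set \<Rightarrow> nat \<Rightarrow> 'a \<Rightarrow> real" where
  "escn K 0 x = 1"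
| "escn K (Suc n) x = av m (\<lambda>j. if mv x j \<in> K then 0 else escn K n (mv x j))"

definition avd :: "'a set \<Rightarrow> nat \<Rightarrow> 'a \<Rightarrow> real" where
  "avd K n x = (if x \<in> K then 0 else escn K n x)"

lemma avd_Suc: "avd K (Suc n) x = (if x \<in> K then 0 else av m (\<lambda>j. avd K n (mv x j)))"
  by (simp add: avd_def)

lemma escn_Suc_avd: "escn K (Suc n) x = av m (\<lambda>j. avd K n (mv x j))"
  by (simp add: avd_def)

text \<open>Restricted to \<open>K\<close> this is the equilibrium measure, and \<open>ecap\<close>
  is its mass. In contrast \<open>avi K\<close> vanishes on \<open>K\<close>, because there the
  starting point counts.\<close>

definition esc :: "'a set \<Rightarrow> 'a \<Rightarrow> real" where "esc K x = lim (\<lambda>n. escn K n x)"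

definition avi :: "'a set \<Rightarrow> 'a \<Rightarrow> real" where "avi K x = lim (\<lambda>n. avd K n x)"

definition ecap :: "'a set \<Rightarrow> real" where "ecap K = (\<Sum>x\<in>K. esc K x)"

lemma escn_bounds: "0 \<le> escn K n x" "escn K n x \<le> 1"
proof (induction n arbitrary: x)
  case (Suc n)
  { case 1 show ?case by (auto intro!: av_nonneg Suc) }
  { case 2
    have "escn K (Suc n) x \<le> av m (\<lambda>_. 1)" unfolding escn.simps by (intro av_mono) (auto intro: Suc)
    then show ?case using av_const[OF m_pos] by simp }
qed auto

lemma escn_mono: "escn K (Suc n) x \<le> escn K n x"
proof (induction n arbitrary: x)
  case 0 show ?case by (simp only: escn.simps(1) escn_bounds(2))
next
  case (Suc n) show ?case unfolding escn.simps(2)[of K "Suc n"] escn.simps(2)[of K n]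
    by (rule av_mono) (use Suc in auto)
qed

lemma esc_lim: "(\<lambda>n. escn K n x) \<longlonglongrightarrow> esc K x"
proof -
  have "decseq (\<lambda>n. escn K n x)" by (rule decseq_SucI) (rule escn_mono)
  then obtain L where "(\<lambda>n. escn K n x) \<longlonglongrightarrow> L"
    by (rule decseq_convergent[of _ 0]) (use escn_bounds in auto)
  then have "convergent (\<lambda>n. escn K n x)" by (auto simp: convergent_def)
  then show ?thesis unfolding esc_def by (simp add: convergent_LIMSEQ_iff)
qed

lemma esc_bounds: "0 \<le> esc K x" "esc K x \<le> 1"
  by (rule LIMSEQ_le_const[OF esc_lim], use escn_bounds in auto)
     (rule LIMSEQ_le_const2[OF esc_lim], use escn_bounds in auto)

lemma avd_lim: "(\<lambda>n. avd K n x) \<longlonglongrightarrow> avi K x"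
proof -
  have "convergent (\<lambda>n. avd K n x)"
    unfolding avd_def using esc_lim[of K x] by (cases "x \<in> K") (auto simp: convergent_def)
  then show ?thesis unfolding avi_def by (simp add: convergent_LIMSEQ_iff)
qed

lemma avd_bounds: "0 \<le> avd K n x" "avd K n x \<le> 1"
  using escn_bounds unfolding avd_def by auto

lemma avi_bounds: "0 \<le> avi K x" "avi K x \<le> 1"
  by (rule LIMSEQ_le_const[OF avd_lim], use avd_bounds in auto)
     (rule LIMSEQ_le_const2[OF avd_lim], use avd_bounds in auto)

lemma avi_rec: "avi K x = (if x \<in> K then 0 else av m (\<lambda>j. avi K (mv x j)))"
proof (cases "x \<in> K")
  case True
  then have "(\<lambda>n. avd K n x) = (\<lambda>n. 0)" by (simp add: avd_def)
  then have "(\<lambda>n. 0) \<longlonglongrightarrow> avi K x" using avd_lim[of K x] by simp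
  then have "avi K x = 0" by (simp add: LIMSEQ_const_iff)
  then show ?thesis using True by simp
next
  case False
  have "(\<lambda>n. avd K (Suc n) x) \<longlonglongrightarrow> av m (\<lambda>j. avi K (mv x j))"
    using False by (simp add: avd_Suc tendsto_av avd_lim)
  moreover have "(\<lambda>n. avd K (Suc n) x) \<longlonglongrightarrow> avi K x"
    using avd_lim[of K x] by (rule LIMSEQ_Suc)
  ultimately have "avi K x = av m (\<lambda>j. avi K (mv x j))" by (blast intro: LIMSEQ_unique)
  then show ?thesis using False by simp
qed

lemma esc_avi: "esc K x = av m (\<lambda>j. avi K (mv x j))"
proof -
  have "(\<lambda>n. escn K (Suc n) x) \<longlonglongrightarrow> av m (\<lambda>j. avi K (mv x j))"
    unfolding escn_Suc_avd by (intro tendsto_av avd_lim)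
  then show ?thesis by (rule LIMSEQ_unique[OF LIMSEQ_Suc[OF esc_lim[of K x]]])
qed

lemma ecap_nonneg: "0 \<le> ecap K"
  unfolding ecap_def by (intro sum_nonneg esc_bounds)

lemma mv_iv': "p \<in> V \<Longrightarrow> j < m \<Longrightarrow> mv (mv p (iv j)) j = p"
  using mv_iv[of p "iv j"] by (simp add: iv_less iv_iv)

section \<open>Reversal, last visits and sweeping\<close>

lemma mv_eq_swap:
  assumes "x \<in> V" "y \<in> V"
  shows "av m (\<lambda>j. if mv x j = y then 1 else 0) = av m (\<lambda>j. if x = mv y j then 1 else 0)"
  unfolding av_def
  by (intro arg_cong[where f="\<lambda>x. x / real m"] sum.reindex_bij_witness[of _ iv iv])
     (use assms in \<open>auto simp: iv_less iv_iv mv_iv mv_iv'\<close>)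

text \<open>The recursion of \<open>kk\<close> removes the first step, this one the last: exchanging
  a move with its inverse turns a step into \<open>y\<close> into a step out of
  \<open>y\<close>.\<close>

lemma kk_end:
  assumes "x \<in> V" "y \<in> V"
  shows "kk U (Suc n) x y = (if y \<in> U then av m (\<lambda>j. kk U n x (mv y j)) else 0)"
  using assms
proof (induction n arbitrary: x)
  case 0
  have "kk U (Suc 0) x y = (if y \<in> U then av m (\<lambda>j. if mv x j = y then 1 else 0) else 0)"
  proof -
    have "(\<lambda>j. if mv x j \<in> U then kk U 0 (mv x j) y else 0) =
      (\<lambda>j. if y \<in> U then (if mv x j = y then 1 else 0) else 0)" by auto
    then show ?thesis by simp
  qed
  then show ?case using mv_eq_swap[OF 0] by simp
next
  case (Suc n)
  have "kk U (Suc (Suc n)) x y = av m (\<lambda>j. if mv x j \<in> U then kk U (Suc n) (mv x j) y else 0)"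
    by simp
  also have "\<dots> = av m (\<lambda>j. if mv x j \<in> U then (if y \<in> U then av m (\<lambda>i. kk U n (mv x j) (mv y i)) else 0) else 0)"
    by (rule av_cong) (use Suc closed in auto)
  also have "\<dots> = (if y \<in> U then av m (\<lambda>j. av m (\<lambda>i. if mv x j \<in> U then kk U n (mv x j) (mv y i) else 0)) else 0)"
  proof (cases "y \<in> U")
    case True then show ?thesis by (auto intro!: av_cong)
  next
    case False then show ?thesis by (simp cong: if_cong)
  qed
  also have "\<dots> = (if y \<in> U then av m (\<lambda>i. kk U (Suc n) x (mv y i)) else 0)"
    by (subst av_swap) simp
  finally show ?case .
qed

lemma kk_nonneg: "0 \<le> kk U n x y"
  by (induction n arbitrary: x) (auto intro!: av_nonneg)

text \<open>Reverse a path from \<open>x\<close> that meets \<open>q\<close> for the first time: it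
  starts at \<open>q\<close>, stays in \<open>U\<close> from then on and ends at \<open>x\<close>.
  As \<open>q\<close> is outside \<open>U\<close>, the sum over times counts each first visit
  once.\<close>

lemma hitd_kk:
  assumes "x \<in> V" "q \<in> V" "q \<notin> U"
  shows "hitd U n x q = (\<Sum>i\<le>n. kk U i q x)"
  using assms(1)
proof (induction n arbitrary: x)
  case (Suc n)
  have "(\<Sum>i\<le>Suc n. kk U i q x) = kk U 0 q x + (\<Sum>i\<le>n. kk U (Suc i) q x)"
    by (rule sum.atMost_Suc_shift)
  also have "(\<Sum>i\<le>n. kk U (Suc i) q x) = (if x \<in> U then av m (\<lambda>j. \<Sum>i\<le>n. kk U i q (mv x j)) else 0)"
    using kk_end[OF assms(2) Suc.prems] by (simp add: av_sum del: kk.simps)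
  also have "\<dots> = (if x \<in> U then av m (\<lambda>j. hitd U n (mv x j) q) else 0)"
    using Suc closed by (auto intro!: av_cong)
  finally show ?case using assms(3) by auto
qed auto

lemma vis_kk: "vis U (\<lambda>p. if p = x then 1 else 0) n q = (\<Sum>i\<le>n. kk U i q x)"
proof (induction n arbitrary: q)
  case (Suc n)
  have "(\<Sum>i\<le>Suc n. kk U i q x) = kk U 0 q x + (\<Sum>i\<le>n. kk U (Suc i) q x)"
    by (rule sum.atMost_Suc_shift)
  also have "(\<Sum>i\<le>n. kk U (Suc i) q x) = av m (\<lambda>j. if mv q j \<in> U then (\<Sum>i\<le>n. kk U i (mv q j) x) else 0)"
    by (simp add: av_sum[symmetric] if_distrib cong: if_cong) (auto intro!: av_cong)
  finally show ?case using Suc by (simp cong: if_cong)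
qed auto

text \<open>The form in which reversal is applied: a hitting probability becomes an expected number
  of visits by a walk started at the target, and such numbers are bounded by superharmonic
  functions.\<close>

lemma hitd_vis:
  assumes "x \<in> V" "q \<in> V" "q \<notin> U"
  shows "hitd U n x q = vis U (\<lambda>p. if p = x then 1 else 0) n q"
  using hitd_kk[OF assms] vis_kk by simp

lemma vis_sum: "vis U (\<lambda>p. \<Sum>x\<in>X. f x p) n q = (\<Sum>x\<in>X. vis U (f x) n q)"
proof (induction n arbitrary: q)
  case (Suc n)
  have "av m (\<lambda>j. if mv q j \<in> U then \<Sum>x\<in>X. vis U (f x) n (mv q j) else 0)
     = av m (\<lambda>j. \<Sum>x\<in>X. if mv q j \<in> U then vis U (f x) n (mv q j) else 0)"
    by (auto intro!: av_cong)
  then show ?case by (simp add: Suc av_sum sum.distrib cong: if_cong)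
qed auto

lemma hitd_bounds: "0 \<le> hitd U n x q" "hitd U n x q \<le> 1"
proof (induction n arbitrary: x)
  case (Suc n)
  { case 1 show ?case by (auto intro!: av_nonneg Suc) }
  { case 2
    have "av m (\<lambda>j. hitd U n (mv x j) q) \<le> av m (\<lambda>_. 1)" by (intro av_mono) (auto intro: Suc)
    then show ?case using av_const[OF m_pos] by simp }
qed auto

lemma hitd_Suc_mono: "hitd U n x q \<le> hitd U (Suc n) x q"
proof (induction n arbitrary: x)
  case 0 show ?case by (auto intro!: av_nonneg)
next
  case (Suc n) show ?case unfolding hitd.simps(2)[of U "Suc n"] hitd.simps(2)[of U n]
    using av_mono[OF Suc] by auto
qed

lemma hitd_mono: "n \<le> n' \<Longrightarrow> hitd U n x q \<le> hitd U n' x q"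
  by (rule lift_Suc_mono_le[of "\<lambda>n. hitd U n x q"]) (rule hitd_Suc_mono)

text \<open>Decomposition at the last visit to \<open>J\<close> before time \<open>n\<close>.\<close>

lemma last_visit:
  assumes "finite J" "D \<subseteq> J"
  shows "escn D n p = escn J n p + (\<Sum>i<n. \<Sum>x\<in>J. kk (- D) (Suc i) p x * escn J (n - Suc i) x)"
proof (induction n arbitrary: p)
  case (Suc n)
  let ?t = "\<lambda>i p. \<Sum>x\<in>J. kk (- D) i p x * escn J (n - i) x"
  have 0: "(if p' \<in> D then 0 else ?t 0 p') = (if p' \<in> J \<and> p' \<notin> D then escn J n p' else 0)" for p'
  proof -
    have "?t 0 p' = (\<Sum>x\<in>J. if x = p' then escn J n x else 0)" by (intro sum.cong) auto
    also have "\<dots> = (if p' \<in> J then escn J n p' else 0)" using assms(1) by (simp add: sum.delta)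
    finally show ?thesis by auto
  qed
  have "(\<Sum>i<Suc n. \<Sum>x\<in>J. kk (- D) (Suc i) p x * escn J (Suc n - Suc i) x)
      = (\<Sum>i<Suc n. \<Sum>x\<in>J. av m (\<lambda>j. if mv p j \<in> D then 0 else kk (- D) i (mv p j) x) * escn J (n - i) x)"
    by (intro sum.cong refl) (auto intro!: arg_cong2[where f="(*)"] av_cong)
  also have "\<dots> = av m (\<lambda>j. \<Sum>i<Suc n. \<Sum>x\<in>J. (if mv p j \<in> D then 0 else kk (- D) i (mv p j) x) * escn J (n - i) x)"
    by (simp only: av_sum av_cmult_right)
  also have "\<dots> = av m (\<lambda>j. if mv p j \<in> D then 0 else \<Sum>i<Suc n. ?t i (mv p j))"
    by (auto intro!: av_cong)
  also have "\<dots> = av m (\<lambda>j. (if mv p j \<in> D then 0 else ?t 0 (mv p j))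
       + (if mv p j \<in> D then 0 else \<Sum>i<n. ?t (Suc i) (mv p j)))"
    by (intro av_cong, simp only: sum.lessThan_Suc_shift) auto
  finally have 1: "escn J (Suc n) p + (\<Sum>i<Suc n. \<Sum>x\<in>J. kk (- D) (Suc i) p x * escn J (Suc n - Suc i) x)
     = av m (\<lambda>j. (if mv p j \<in> J then 0 else escn J n (mv p j))) +
       av m (\<lambda>j. (if mv p j \<in> D then 0 else ?t 0 (mv p j))
       + (if mv p j \<in> D then 0 else \<Sum>i<n. ?t (Suc i) (mv p j)))" by simp
  also have "\<dots> = av m (\<lambda>j. if mv p j \<in> D then 0 else escn D n (mv p j))"
    unfolding av_add[symmetric] 0
  proof (rule av_cong)
    fix j
    show "(if mv p j \<in> J then 0 else escn J n (mv p j)) +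
         ((if mv p j \<in> J \<and> mv p j \<notin> D then escn J n (mv p j) else 0) +
          (if mv p j \<in> D then 0 else \<Sum>i<n. ?t (Suc i) (mv p j))) =
         (if mv p j \<in> D then 0 else escn D n (mv p j))"
      unfolding Suc[of "mv p j"] using assms(2) by auto
  qed
  finally show ?case by simp
qed auto

lemma last_visit':
  assumes "finite J" "D \<subseteq> J" "q \<in> D"
  shows "escn D n q = (\<Sum>x\<in>J. \<Sum>i\<le>n. kk (- D) i q x * escn J (n - i) x)"
proof -
  have "(\<Sum>x\<in>J. kk (- D) 0 q x * escn J (n - 0) x) = (\<Sum>x\<in>J. if x = q then escn J n x else 0)"
    by (intro sum.cong) auto
  also have "\<dots> = escn J n q" using assms by (simp add: sum.delta subsetD)
  finally have 0: "(\<Sum>x\<in>J. kk (- D) 0 q x * escn J (n - 0) x) = escn J n q" .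
  have "(\<Sum>x\<in>J. \<Sum>i\<le>n. kk (- D) i q x * escn J (n - i) x)
      = (\<Sum>i<Suc n. \<Sum>x\<in>J. kk (- D) i q x * escn J (n - i) x)"
    by (subst sum.swap) (simp only: lessThan_Suc_atMost)
  also have "\<dots> = escn J n q + (\<Sum>i<n. \<Sum>x\<in>J. kk (- D) (Suc i) q x * escn J (n - Suc i) x)"
    by (simp only: sum.lessThan_Suc_shift 0)
  finally show ?thesis using last_visit[OF assms(1,2)] by simp
qed

text \<open>Sweeping. Split an escape from \<open>D\<close> at the last visit to \<open>J\<close>,
  say at \<open>x\<close>: afterwards the walk escapes from \<open>J\<close>, and the part before,
  read backwards, is a path from \<open>x\<close> that first meets \<open>D\<close> at
  \<open>q\<close>.\<close>

lemma sweep_pointwise: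
  assumes "finite J" "D \<subseteq> J" "J \<subseteq> V" "q \<in> D"
  shows "(\<lambda>n. \<Sum>x\<in>J. esc J x * hitd (- D) n x q) \<longlonglongrightarrow> esc D q"
proof -
  have h: "hitd (- D) n x q = (\<Sum>i\<le>n. kk (- D) i q x)" if "x \<in> J" for n x
    by (rule hitd_kk) (use assms that in auto)
  have s: "summable (\<lambda>i. kk (- D) i q x)" if "x \<in> J" for x
    by (rule bounded_imp_summable[where B=1]) (use h[OF that] hitd_bounds kk_nonneg in metis)+
  have "(\<lambda>n. escn D n q) \<longlonglongrightarrow> (\<Sum>x\<in>J. (\<Sum>i. kk (- D) i q x) * esc J x)"
    unfolding last_visit'[OF assms(1,2,4)]
    by (intro tendsto_sum conv_limit[where B=1] s kk_nonneg esc_lim) (use escn_bounds in \<open>auto simp: abs_le_iff add_increasing\<close>)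
  then have "esc D q = (\<Sum>x\<in>J. (\<Sum>i. kk (- D) i q x) * esc J x)"
    by (rule LIMSEQ_unique[OF esc_lim])
  moreover have "(\<lambda>n. \<Sum>x\<in>J. esc J x * hitd (- D) n x q) \<longlonglongrightarrow> (\<Sum>x\<in>J. (\<Sum>i. kk (- D) i q x) * esc J x)"
  proof (rule tendsto_sum)
    fix x assume x: "x \<in> J"
    have "(\<lambda>n. \<Sum>i\<le>n. kk (- D) i q x) \<longlonglongrightarrow> (\<Sum>i. kk (- D) i q x)"
      using s[OF x] by (simp add: summable_LIMSEQ')
    then show "(\<lambda>n. esc J x * hitd (- D) n x q) \<longlonglongrightarrow> (\<Sum>i. kk (- D) i q x) * esc J x"
      by (simp add: h[OF x] tendsto_mult_left mult.commute[of _ "esc J x"])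
  qed
  ultimately show ?thesis by simp
qed

lemma hitd_sum_avd:
  assumes "finite D"
  shows "(\<Sum>q\<in>D. hitd (- D) n x q) = 1 - avd D n x"
proof (induction n arbitrary: x)
  case 0
  then show ?case using assms by (auto simp: avd_def sum.delta' if_distrib cong: if_cong)
next
  case (Suc n)
  show ?case
  proof (cases "x \<in> D")
    case True
    have "(\<Sum>q\<in>D. hitd (- D) (Suc n) x q) = (\<Sum>q\<in>D. if x = q then 1 else 0)"
      by (intro sum.cong) (use True in auto)
    then show ?thesis using True assms by (simp add: avd_def sum.delta')
  next
    case False
    have "(\<Sum>q\<in>D. hitd (- D) (Suc n) x q) = (\<Sum>q\<in>D. av m (\<lambda>j. hitd (- D) n (mv x j) q))"
      by (intro sum.cong) (use False in auto)
    also have "\<dots> = av m (\<lambda>j. 1 - avd D n (mv x j))" by (simp add: av_sum[symmetric] Suc)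
    also have "\<dots> = av m (\<lambda>_. 1) - av m (\<lambda>j. avd D n (mv x j))"
      unfolding av_def by (simp add: sum_subtractf diff_divide_distrib)
    finally show ?thesis using False by (simp add: avd_Suc av_const[OF m_pos])
  qed
qed

text \<open>Sum the sweeping identity over the entrance points \<open>q\<close>: the weight
  \<open>esc J x\<close> is multiplied by the probability of ever meeting \<open>D\<close> from
  \<open>x\<close>.\<close>

lemma ecap_sweep:
  assumes "finite J" "D \<subseteq> J" "J \<subseteq> V"
  shows "ecap D = (\<Sum>x\<in>J. esc J x * (1 - avi D x))"
proof -
  have D: "finite D" using assms finite_subset by blast
  have "(\<lambda>n. \<Sum>q\<in>D. \<Sum>x\<in>J. esc J x * hitd (- D) n x q) \<longlonglongrightarrow> ecap D"
    unfolding ecap_def by (intro tendsto_sum sweep_pointwise assms)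
  moreover have "(\<Sum>q\<in>D. \<Sum>x\<in>J. esc J x * hitd (- D) n x q) = (\<Sum>x\<in>J. esc J x * (1 - avd D n x))" for n
    by (subst sum.swap) (simp add: sum_distrib_left[symmetric] hitd_sum_avd[OF D])
  moreover have "(\<lambda>n. \<Sum>x\<in>J. esc J x * (1 - avd D n x)) \<longlonglongrightarrow> (\<Sum>x\<in>J. esc J x * (1 - avi D x))"
    by (intro tendsto_intros avd_lim)
  ultimately show ?thesis by (simp add: LIMSEQ_unique)
qed

lemma ecap_mono:
  assumes "finite J" "D \<subseteq> J" "J \<subseteq> V"
  shows "ecap D \<le> ecap J"
proof -
  have "(\<Sum>x\<in>J. esc J x * (1 - avi D x)) \<le> (\<Sum>x\<in>J. esc J x)"
    by (intro sum_mono mult_left_le) (use avi_bounds esc_bounds in auto)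
  then show ?thesis using ecap_sweep[OF assms] by (simp add: ecap_def)
qed

end

section \<open>Traces of walks and Poisson clouds of trajectories\<close>

lemma set_uni: "set_pmf X \<subseteq> Pow A \<Longrightarrow> set_pmf Y \<subseteq> Pow A \<Longrightarrow> set_pmf (uni X Y) \<subseteq> Pow A"
  by (fastforce simp: uni_def)

text \<open>Thinning: an outcome \<open>Some q\<close> of \<open>Q\<close> is kept with the
  probability \<open>r q\<close> that lowers its mass to that of \<open>P\<close>, and becomes
  \<open>None\<close> otherwise. The mass at \<open>None\<close> then agrees because both totals are
  one.\<close>

lemma rel_option_pmf:
  fixes P Q :: "'b option pmf"
  assumes fin: "finite D" and P: "\<And>q. q \<notin> D \<Longrightarrow> pmf P (Some q) = 0"
    and Q: "\<And>q. q \<notin> D \<Longrightarrow> pmf Q (Some q) = 0"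
    and le: "\<And>q. q \<in> D \<Longrightarrow> pmf P (Some q) \<le> pmf Q (Some q)"
  shows "rel_pmf (\<lambda>a b. a = None \<or> a = b) P Q"
proof -
  define r where "r q = pmf P (Some q) / pmf Q (Some q)" for q
  have r: "0 \<le> r q" "r q \<le> 1" for q
    using le[of q] P[of q] by (cases "q \<in> D"; auto simp: r_def divide_le_eq_1 pmf_nonneg not_less)+
  define f where "f b = (case b of None \<Rightarrow> return_pmf (None, None)
     | Some q \<Rightarrow> map_pmf (\<lambda>t. (if t then Some q else None, Some q)) (bernoulli_pmf (r q)))" for b
  define J where "J = bind_pmf Q f"
  have None_eq: "pmf X None = 1 - (\<Sum>q\<in>D. pmf X (Some q))"
    if "\<And>q. q \<notin> D \<Longrightarrow> pmf X (Some q) = 0" for X :: "'b option pmf"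
  proof -
    have "(\<Sum>x\<in>insert None (Some ` D). pmf X x) = 1"
    proof (rule sum_pmf_eq_1)
      show "set_pmf X \<subseteq> insert None (Some ` D)"
      proof
        fix x assume "x \<in> set_pmf X" then show "x \<in> insert None (Some ` D)"
          using that by (cases x) (auto simp: set_pmf_iff)
      qed
    qed (use fin in auto)
    also have "(\<Sum>x\<in>insert None (Some ` D). pmf X x) = pmf X None + (\<Sum>q\<in>D. pmf X (Some q))"
      using fin by (subst sum.insert) (auto simp: sum.reindex)
    finally show ?thesis by simp
  qed
  have fst_f: "map_pmf fst (f b) = (case b of None \<Rightarrow> return_pmf None
     | Some q \<Rightarrow> map_pmf (\<lambda>t. if t then Some q else None) (bernoulli_pmf (r q)))" for b
    by (auto simp: f_def pmf.map_comp o_def split: option.splits)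
  have some: "pmf (map_pmf fst J) (Some q) = pmf P (Some q)" for q
  proof -
    have "pmf (map_pmf fst (f b)) (Some q) = indicator {Some q} b * r q" for b
    proof (cases "b = Some q")
      case True
      have "(\<lambda>t. if t then Some q else None) -` {Some q} = {True}" by (auto split: if_splits)
      then show ?thesis using True r[of q]
        by (simp add: fst_f pmf_map measure_pmf_single)
    next
      case False
      have "Some q \<notin> set_pmf (map_pmf fst (f b))"
        using False by (auto simp: fst_f split: option.splits if_splits)
      then have "pmf (map_pmf fst (f b)) (Some q) = 0" by (rule pmf_eq_0_set_pmf[THEN iffD2])
      then show ?thesis using False by simp
    qed
    then have "pmf (map_pmf fst J) (Some q) = pmf Q (Some q) * r q"
      unfolding J_def map_bind_pmf pmf_bind by (simp add: measure_pmf_single)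
    also have "\<dots> = pmf P (Some q)"
      using le[of q] P[of q] pmf_nonneg[of P "Some q"] by (cases "q \<in> D") (auto simp: r_def)
    finally show ?thesis .
  qed
  have fst_J: "map_pmf fst J = P"
  proof (rule pmf_eqI)
    fix x show "pmf (map_pmf fst J) x = pmf P x"
      using some None_eq[of "map_pmf fst J"] None_eq[of P] P by (cases x) auto
  qed
  have "map_pmf snd (f b) = return_pmf b" for b
    by (auto simp: f_def pmf.map_comp o_def map_pmf_const split: option.splits)
  then have snd_J: "map_pmf snd J = Q"
    unfolding J_def map_bind_pmf by (simp add: bind_return_pmf')
  show ?thesis
  proof (rule rel_pmf.intros[OF _ fst_J snd_J])
    fix a b assume "(a, b) \<in> set_pmf J"
    then show "a = None \<or> a = b" by (auto simp: J_def f_def split: option.splits if_splits)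
  qed
qed

context rwalk
begin

fun kapn :: "'a set \<Rightarrow> nat \<Rightarrow> 'a \<Rightarrow> 'a set pmf" where
  "kapn A 0 p = return_pmf ({p} \<inter> A)"
| "kapn A (Suc n) p = map_pmf (\<lambda>S. {p} \<inter> A \<union> S) (bind_pmf (steps m) (\<lambda>j. kapn A n (mv p j)))"

lemma set_kapn: "set_pmf (kapn A n p) \<subseteq> Pow A"
  by (induction n arbitrary: p) fastforce+

lemma avoid_kapn: "K \<subseteq> A \<Longrightarrow> avoid (kapn A n p) K = avd K n p"
proof (induction n arbitrary: p)
  case 0 then show ?case by (auto simp: avoid_return avd_def)
next
  case (Suc n)
  then show ?case by (auto simp: avoid_map_Un avoid_bind_steps[OF m_pos] avd_Suc)
qed

text \<open>The law of the trace on \<open>A\<close> of the (infinite) walk started at \<open>p\<close>.\<close>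

definition kap :: "'a set \<Rightarrow> 'a \<Rightarrow> 'a set pmf" where
  "kap A p = (SOME Y. set_pmf Y \<subseteq> Pow A \<and> (\<forall>K\<subseteq>A. avoid Y K = avi K p))"

lemma kap:
  assumes "finite A"
  shows "set_pmf (kap A p) \<subseteq> Pow A" "\<And>K. K \<subseteq> A \<Longrightarrow> avoid (kap A p) K = avi K p"
proof -
  have "\<exists>Y. set_pmf Y \<subseteq> Pow A \<and> (\<forall>K\<subseteq>A. avoid Y K = avi K p)"
    by (rule avoid_limit[OF assms, where X="\<lambda>n. kapn A n p"]) (use set_kapn in auto, simp add: avoid_kapn avd_lim)
  from someI_ex[OF this] show "set_pmf (kap A p) \<subseteq> Pow A" "\<And>K. K \<subseteq> A \<Longrightarrow> avoid (kap A p) K = avi K p"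
    unfolding kap_def by auto
qed

text \<open>First-step decomposition of the infinite trace, obtained by comparing avoidance
  functions. It takes the place of the Markov property.\<close>

lemma kap_rec:
  assumes "finite A"
  shows "kap A p = map_pmf (\<lambda>S. {p} \<inter> A \<union> S) (bind_pmf (steps m) (\<lambda>j. kap A (mv p j)))"
proof (rule avoid_unique[OF assms])
  show "set_pmf (map_pmf (\<lambda>S. {p} \<inter> A \<union> S) (bind_pmf (steps m) (\<lambda>j. kap A (mv p j)))) \<subseteq> Pow A"
    using kap(1)[OF assms] by fastforce
  fix K assume K: "K \<subseteq> A"
  show "avoid (kap A p) K = avoid (map_pmf (\<lambda>S. {p} \<inter> A \<union> S) (bind_pmf (steps m) (\<lambda>j. kap A (mv p j)))) K"
    using K by (subst kap(2)[OF assms K], subst avi_rec)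
      (auto simp: avoid_map_Un avoid_bind_steps[OF m_pos] kap(2)[OF assms])
qed (rule kap(1)[OF assms])

fun stopd :: "'a set \<Rightarrow> nat \<Rightarrow> 'a \<Rightarrow> 'a option pmf" where
  "stopd D 0 p = return_pmf (if p \<in> D then Some p else None)"
| "stopd D (Suc n) p = (if p \<in> D then return_pmf (Some p) else bind_pmf (steps m) (\<lambda>j. stopd D n (mv p j)))"

lemma pmf_stopd: "pmf (stopd D n p) (Some q) = (if q \<in> D then hitd (- D) n p q else 0)"
proof (induction n arbitrary: p)
  case (Suc n)
  then show ?case
    by (auto simp: pmf_bind expectation_steps[OF m_pos] pmf_return indicator_def)
qed auto

definition okap :: "'a set \<Rightarrow> 'a option \<Rightarrow> 'a set pmf" where
  "okap A z = (case z of None \<Rightarrow> return_pmf {} | Some q \<Rightarrow> kap A q)"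

text \<open>What the walk leaves on \<open>A\<close> after entering \<open>D\<close> is part of its
  whole trace. The induction over first steps replaces the strong Markov property at the
  entrance.\<close>

lemma stopd_kap:
  assumes "finite A"
  shows "sdom 0 (bind_pmf (stopd D n p) (okap A)) (kap A p)"
proof (induction n arbitrary: p)
  case 0
  then show ?case by (auto simp: okap_def bind_return_pmf intro: sdom_refl sdom_empty)
next
  case (Suc n)
  show ?case
  proof (cases "p \<in> D")
    case True
    then show ?thesis by (simp add: okap_def bind_return_pmf sdom_refl)
  next
    case False
    have "sdom 0 (bind_pmf (steps m) (\<lambda>j. bind_pmf (stopd D n (mv p j)) (okap A)))
       (bind_pmf (steps m) (\<lambda>j. kap A (mv p j)))"
      by (intro sdom_bind Suc) simp
    from sdom_map_Un[OF this, of "{}" "{p} \<inter> A"] show ?thesis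
      using False by (simp add: bind_assoc_pmf kap_rec[OF assms, of p] map_pmf_ident)
  qed
qed

text \<open>The normalised equilibrium measure. It is a probability law only for positive capacity,
  which is why capacity zero is a separate case below.\<close>

definition markp :: "'a set \<Rightarrow> 'a pmf" where
  "markp X = embed_pmf (\<lambda>x. if x \<in> X then esc X x / ecap X else 0)"

lemma pmf_markp:
  assumes "finite X" "0 < ecap X"
  shows "pmf (markp X) x = (if x \<in> X then esc X x / ecap X else 0)"
  unfolding markp_def
proof (rule pmf_embed_pmf)
  show "0 \<le> (if x \<in> X then esc X x / ecap X else 0)" for x using esc_bounds assms by simp
  have "(\<integral>\<^sup>+ x. ennreal (if x \<in> X then esc X x / ecap X else 0) \<partial>count_space UNIV)
     = (\<Sum>x\<in>X. ennreal (if x \<in> X then esc X x / ecap X else 0))"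
    by (rule nn_integral_count_space') (use assms in auto)
  also have "\<dots> = ennreal (\<Sum>x\<in>X. esc X x / ecap X)"
    by (subst sum_ennreal[symmetric]) (use esc_bounds assms in \<open>auto intro!: sum.cong\<close>)
  also have "(\<Sum>x\<in>X. esc X x / ecap X) = 1"
    using assms by (simp add: sum_divide_distrib[symmetric] ecap_def)
  finally show "(\<integral>\<^sup>+ x. ennreal (if x \<in> X then esc X x / ecap X else 0) \<partial>count_space UNIV) = 1" by simp
qed

lemma expectation_markp:
  assumes "finite X" "0 < ecap X"
  shows "measure_pmf.expectation (markp X) f = (\<Sum>x\<in>X. esc X x * f x) / ecap X"
proof -
  have "measure_pmf.expectation (markp X) f = (\<Sum>x\<in>X. pmf (markp X) x *\<^sub>R f x)"
    by (rule integral_measure_pmf[of X]) (use assms in \<open>auto simp: set_pmf_iff pmf_markp split: if_splits\<close>)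
  then show ?thesis by (simp add: pmf_markp[OF assms] sum_divide_distrib)
qed

definition cloud1 :: "'a set \<Rightarrow> 'a set \<Rightarrow> 'a set pmf" where
  "cloud1 X A = bind_pmf (markp X) (kap A)"

fun cloud :: "'a set \<Rightarrow> 'a set \<Rightarrow> nat \<Rightarrow> 'a set pmf" where
  "cloud X A 0 = return_pmf {}"
| "cloud X A (Suc k) = uni (cloud1 X A) (cloud X A k)"

text \<open>By sweeping, a trajectory whose start has the normalised equilibrium law of
  \<open>X\<close> meets \<open>K\<close> with probability \<open>ecap K / ecap X\<close>.\<close>

lemma avoid_cloud1:
  assumes "finite X" "X \<subseteq> V" "A \<subseteq> X" "0 < ecap X" "K \<subseteq> A"
  shows "avoid (cloud1 X A) K = 1 - ecap K / ecap X"
proof -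
  have A: "finite A" using assms finite_subset by blast
  have "avoid (cloud1 X A) K = (\<Sum>x\<in>X. esc X x * avi K x) / ecap X"
    unfolding cloud1_def avoid_bind expectation_markp[OF assms(1,4)]
    by (simp add: kap(2)[OF A assms(5)])
  also have "(\<Sum>x\<in>X. esc X x * avi K x) = ecap X - ecap K"
    using ecap_sweep[of X K] assms by (simp add: ecap_def right_diff_distrib sum_subtractf)
  finally show ?thesis using assms(4) by (simp add: diff_divide_distrib)
qed

lemma set_cloud: "finite A \<Longrightarrow> set_pmf (cloud X A k) \<subseteq> Pow A"
proof (induction k)
  case (Suc k)
  have "set_pmf (cloud1 X A) \<subseteq> Pow A" using kap(1)[OF Suc.prems] by (fastforce simp: cloud1_def)
  then show ?case using Suc by (simp add: set_uni)
qed auto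

lemma avoid_cloud:
  assumes "finite X" "X \<subseteq> V" "A \<subseteq> X" "0 < ecap X" "K \<subseteq> A"
  shows "avoid (cloud X A k) K = (1 - ecap K / ecap X) ^ k"
  by (induction k) (use avoid_cloud1[OF assms] in \<open>auto simp: avoid_return avoid_uni\<close>)

lemma expectation_poisson_power:
  assumes "0 < l" "\<bar>a\<bar> \<le> 1"
  shows "measure_pmf.expectation (poisson_pmf l) (\<lambda>k. a ^ k) = exp (- l * (1 - a))"
proof -
  have "measure_pmf.expectation (poisson_pmf l) (\<lambda>k. a ^ k)
     = integral\<^sup>L (count_space UNIV) (\<lambda>k. pmf (poisson_pmf l) k *\<^sub>R a ^ k)"
    unfolding measure_pmf_eq_density by (rule integral_density) auto
  also have "\<dots> = (\<Sum>k. pmf (poisson_pmf l) k *\<^sub>R a ^ k)"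
  proof (rule integral_count_space_nat)
    have "integrable (measure_pmf (poisson_pmf l)) (\<lambda>k. a ^ k)"
      by (rule measure_pmf.integrable_const_bound[where B=1])
         (use assms in \<open>auto simp: power_abs power_le_one\<close>)
    then show "integrable (count_space UNIV) (\<lambda>k. pmf (poisson_pmf l) k *\<^sub>R a ^ k)"
      unfolding measure_pmf_eq_density by (subst (asm) integrable_density) auto
  qed
  also have "\<dots> = (\<Sum>k. exp (- l) * ((l * a) ^ k /\<^sub>R fact k))"
    by (intro suminf_cong) (simp add: assms(1) power_mult_distrib field_simps)
  also have "\<dots> = exp (- l) * exp (l * a)"
    unfolding exp_def by (rule suminf_mult) (rule summable_exp_generic)
  finally show ?thesis by (simp add: exp_add[symmetric] algebra_simps)
qed

text \<open>The law of the trace on \<open>A\<close> of random interlacements at level \<open>w\<close>.\<close>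

definition poi :: "'a set \<Rightarrow> real \<Rightarrow> 'a set pmf" where
  "poi A w = (SOME Y. set_pmf Y \<subseteq> Pow A \<and> (\<forall>K\<subseteq>A. avoid Y K = exp (- w * ecap K)))"

text \<open>A Poisson number of independent trajectories turns the hitting probability of one into
  an exponential, in which \<open>ecap X\<close> cancels. The same law on \<open>A\<close> can thus
  be realised by launching from any larger finite set of positive capacity.\<close>

lemma avoid_poisson_cloud:
  assumes "finite X" "X \<subseteq> V" "A \<subseteq> X" "0 < ecap X" "K \<subseteq> A" "0 < w"
  shows "avoid (bind_pmf (poisson_pmf (w * ecap X)) (cloud X A)) K = exp (- w * ecap K)"
proof -
  have "ecap K \<le> ecap X" using assms by (intro ecap_mono) auto
  then have "\<bar>1 - ecap K / ecap X\<bar> \<le> 1" using assms(4) ecap_nonneg[of K] by (simp add: abs_le_iff field_simps)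
  then show ?thesis
    unfolding avoid_bind avoid_cloud[OF assms(1-5)]
    using assms by (subst expectation_poisson_power) auto
qed

lemma poi:
  assumes "finite A" "A \<subseteq> V" "0 \<le> w"
  shows "set_pmf (poi A w) \<subseteq> Pow A" "\<And>K. K \<subseteq> A \<Longrightarrow> avoid (poi A w) K = exp (- w * ecap K)"
proof -
  have "\<exists>Y. set_pmf Y \<subseteq> Pow A \<and> (\<forall>K\<subseteq>A. avoid Y K = exp (- w * ecap K))"
  proof (cases "0 < w * ecap A")
    case True
    then have "0 < ecap A" "0 < w" using assms ecap_nonneg[of A] by (auto simp: zero_less_mult_iff)
    then show ?thesis
      using avoid_poisson_cloud[of A A _ w] assms set_cloud[OF assms(1)]
      by (intro exI[of _ "bind_pmf (poisson_pmf (w * ecap A)) (cloud A A)"]) fastforce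
  next
    \<comment> \<open>Here \<open>markp A\<close> need not be a law, but monotonicity of the
      capacity makes every exponent zero, and the empty set has the right avoidance
      function.\<close>
    case False
    then have 0: "w * ecap A = 0" using mult_nonneg_nonneg[OF assms(3) ecap_nonneg[of A]] by (simp add: not_less)
    have "w * ecap K = 0" if "K \<subseteq> A" for K
    proof -
      have "w * ecap K \<le> w * ecap A" using ecap_mono[OF assms(1) that assms(2)] assms(3) by (rule mult_left_mono)
      then show ?thesis using 0 mult_nonneg_nonneg[OF assms(3) ecap_nonneg[of K]] by linarith
    qed
    then show ?thesis by (intro exI[of _ "return_pmf {}"]) (auto simp: avoid_return)
  qed
  from someI_ex[OF this] show "set_pmf (poi A w) \<subseteq> Pow A" "\<And>K. K \<subseteq> A \<Longrightarrow> avoid (poi A w) K = exp (- w * ecap K)"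
    unfolding poi_def by auto
qed

lemma poi_add:
  assumes "finite A" "A \<subseteq> V" "0 \<le> w" "0 \<le> w'"
  shows "uni (poi A w) (poi A w') = poi A (w + w')"
  by (rule avoid_unique[OF assms(1)])
     (use assms in \<open>auto simp: set_uni poi avoid_uni exp_add[symmetric] algebra_simps\<close>)

lemma poi_mono:
  assumes "finite A" "A \<subseteq> V" "0 \<le> w" "w \<le> w'"
  shows "sdom 0 (poi A w) (poi A w')"
  using poi_add[of A "w' - w" w] sdom_uni_absorb[of "poi A w" "poi A (w' - w)"] assms by simp

lemma poi_Int:
  assumes "finite X" "X \<subseteq> V" "A \<subseteq> X" "0 \<le> w"
  shows "map_pmf (\<lambda>S. S \<inter> A) (poi X w) = poi A w"
proof -
  have A: "finite A" "A \<subseteq> V" using assms finite_subset by blast+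
  show ?thesis
  proof (rule avoid_unique[OF A(1)])
    fix K assume K: "K \<subseteq> A"
    then show "avoid (map_pmf (\<lambda>S. S \<inter> A) (poi X w)) K = avoid (poi A w) K"
      using assms A by (simp add: avoid_map_Int poi Int_absorb1)
  qed (use poi(1)[OF A assms(4)] in auto)
qed

text \<open>The cloud is non-empty with the required probability, and its first trajectory enters \<open>D\<close>
  with the normalised equilibrium law of \<open>D\<close> (sweeping).\<close>

lemma entrance_sdom:
  assumes X: "finite X" "X \<subseteq> V" "A \<subseteq> X" "D \<subseteq> X"
    and O1: "\<And>q. q \<notin> D \<Longrightarrow> pmf O1 (Some q) = 0"
    and O2: "\<And>q. q \<in> D \<Longrightarrow> pmf O1 (Some q) \<le> u * esc D q"
    and u: "0 \<le> u" "0 < \<delta>" "u * (1 + \<delta>) * ecap X \<le> 1 - exp (- w * ecap X)" "0 < w"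
  shows "sdom 0 (bind_pmf O1 (okap A)) (poi A w)"
proof (cases "ecap X = 0")
  \<comment> \<open>Without capacity there is no cloud to compare with, but then
    \<open>esc D\<close> vanishes on \<open>D\<close>, so \<open>O1\<close> never enters
    \<open>D\<close>.\<close>
  case True
  have finD: "finite D" and A: "finite A" "A \<subseteq> V" using X finite_subset by blast+
  have "ecap D = 0" using ecap_mono[OF X(1,4,2)] True ecap_nonneg[of D] by simp
  then have "esc D q = 0" if "q \<in> D" for q
    using that finD esc_bounds by (simp add: ecap_def sum_nonneg_eq_0_iff)
  then have "pmf O1 (Some q) = 0" for q using O1[of q] O2[of q] by (cases "q \<in> D") (auto simp: antisym)
  then have "set_pmf O1 \<subseteq> {None}" by (auto simp: set_pmf_iff) (metis not_None_eq)
  then have "O1 = return_pmf None" by (simp add: set_pmf_subset_singleton)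
  then show ?thesis by (simp add: bind_return_pmf okap_def sdom_empty)
next
  case False
  then have cX: "0 < ecap X" using ecap_nonneg[of X] by simp
  have finD: "finite D" and A: "finite A" "A \<subseteq> V" using X finite_subset by blast+
  \<comment> \<open>The factor \<open>1 + \<delta>\<close> pays for a finite horizon: sweeping is an
    identity in the limit, so after finitely many steps the entrance masses reach
    \<open>esc D q\<close> up to this factor.\<close>
  have ev: "\<forall>\<^sub>F n in sequentially. esc D q \<le> (1 + \<delta>) * (\<Sum>x\<in>X. esc X x * hitd (- D) n x q)" if "q \<in> D" for q
  proof (cases "esc D q = 0")
    case True
    then show ?thesis using u esc_bounds hitd_bounds by (intro always_eventually allI) (auto intro!: mult_nonneg_nonneg sum_nonneg)
  next
    case False
    then have "0 < esc D q" using esc_bounds[of D q] by simp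
    have "(\<lambda>n. (1 + \<delta>) * (\<Sum>x\<in>X. esc X x * hitd (- D) n x q)) \<longlonglongrightarrow> (1 + \<delta>) * esc D q"
      by (intro tendsto_intros sweep_pointwise) (use X that in auto)
    moreover have "esc D q < (1 + \<delta>) * esc D q" using \<open>0 < esc D q\<close> u(2) by simp
    ultimately have "\<forall>\<^sub>F n in sequentially. esc D q < (1 + \<delta>) * (\<Sum>x\<in>X. esc X x * hitd (- D) n x q)"
      by (rule order_tendstoD)
    then show ?thesis by (rule eventually_mono) simp
  qed
  have "\<forall>\<^sub>F n in sequentially. \<forall>q\<in>D. esc D q \<le> (1 + \<delta>) * (\<Sum>x\<in>X. esc X x * hitd (- D) n x q)"
    using ev finD by (simp add: eventually_ball_finite_distrib)
  then obtain n where n: "\<And>q. q \<in> D \<Longrightarrow> esc D q \<le> (1 + \<delta>) * (\<Sum>x\<in>X. esc X x * hitd (- D) n x q)"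
    by (auto simp: eventually_sequentially)
  \<comment> \<open>\<open>M\<close> is the entrance into \<open>D\<close> within \<open>n\<close>
    steps of a single trajectory of the cloud, and \<open>R\<close> that of its first one, or
    \<open>None\<close> if the cloud is empty, an event of probability
    \<open>exp (- w * ecap X)\<close>.\<close>
  define M where "M = bind_pmf (markp X) (stopd D n)"
  define R where "R = bind_pmf (poisson_pmf (w * ecap X)) (\<lambda>k. if k = 0 then return_pmf None else M)"
  have wc: "0 < w * ecap X" using cX u by simp
  have pM: "pmf M (Some q) = (if q \<in> D then (\<Sum>x\<in>X. esc X x * hitd (- D) n x q) / ecap X else 0)" for q
    unfolding M_def pmf_bind expectation_markp[OF X(1) cX] by (simp add: pmf_stopd)
  have pR: "pmf R (Some q) = (1 - exp (- w * ecap X)) * pmf M (Some q)" for q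
  proof -
    have "pmf R (Some q) = (\<integral>k. indicator (- {0}) k * pmf M (Some q) \<partial>measure_pmf (poisson_pmf (w * ecap X)))"
      unfolding R_def pmf_bind by (intro Bochner_Integration.integral_cong) (auto simp: indicator_def)
    also have "\<dots> = measure (measure_pmf (poisson_pmf (w * ecap X))) (- {0}) * pmf M (Some q)" by simp
    also have "measure (measure_pmf (poisson_pmf (w * ecap X))) (- {0})
        = 1 - measure (measure_pmf (poisson_pmf (w * ecap X))) {0}"
      using measure_pmf.prob_compl[of "{0}" "poisson_pmf (w * ecap X)"] by (simp add: Compl_eq_Diff_UNIV)
    also have "\<dots> = 1 - exp (- w * ecap X)" using wc by (simp add: measure_pmf_single)
    finally show ?thesis .
  qed
  have "rel_pmf (\<lambda>a b. a = None \<or> a = b) O1 R"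
  proof (rule rel_option_pmf[OF finD O1])
    fix q assume q: "q \<in> D"
    let ?s = "\<Sum>x\<in>X. esc X x * hitd (- D) n x q"
    have s: "0 \<le> ?s" by (intro sum_nonneg mult_nonneg_nonneg esc_bounds hitd_bounds)
    have "pmf O1 (Some q) \<le> u * esc D q" by (rule O2[OF q])
    also have "\<dots> \<le> u * ((1 + \<delta>) * ?s)" using n[OF q] u by (intro mult_left_mono) auto
    also have "\<dots> = (u * (1 + \<delta>) * ecap X) * (?s / ecap X)" using cX by simp
    also have "\<dots> \<le> (1 - exp (- w * ecap X)) * (?s / ecap X)"
      using s cX by (intro mult_right_mono u) auto
    also have "\<dots> = pmf R (Some q)" using q by (simp add: pR pM)
    finally show "pmf O1 (Some q) \<le> pmf R (Some q)" .
  qed (auto simp: pR pM)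
  then have "rel_pmf (\<subseteq>) (bind_pmf O1 (okap A)) (bind_pmf R (okap A))"
  proof (rule rel_pmf_bindI)
    fix a b :: "'a option" assume "a = None \<or> a = b"
    then show "rel_pmf (\<subseteq>) (okap A a) (okap A b)"
      using sdom_empty[of 0 "okap A b"] sdom_refl[of 0 "okap A b"] by (auto simp: sdom_0_rel okap_def)
  qed
  then have 1: "sdom 0 (bind_pmf O1 (okap A)) (bind_pmf R (okap A))" by (simp add: sdom_0_rel)
  have 2: "sdom 0 (bind_pmf R (okap A)) (bind_pmf (poisson_pmf (w * ecap X)) (cloud X A))"
    unfolding R_def bind_assoc_pmf
  proof (rule sdom_bind)
    fix k
    have M: "sdom 0 (bind_pmf M (okap A)) (cloud1 X A)"
      unfolding M_def cloud1_def bind_assoc_pmf by (rule sdom_bind) (auto intro: stopd_kap A)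
    show "sdom 0 (bind_pmf (if k = 0 then return_pmf None else M) (okap A)) (cloud X A k)"
    proof (cases k)
      case 0 then show ?thesis by (simp add: bind_return_pmf okap_def sdom_empty)
    next
      case (Suc k')
      have "sdom 0 (cloud1 X A) (uni (cloud X A k') (cloud1 X A))" by (rule sdom_uni_absorb)
      then show ?thesis using Suc sdom_trans0[OF M] by (simp add: uni_commute)
    qed
  qed simp
  have 3: "bind_pmf (poisson_pmf (w * ecap X)) (cloud X A) = poi A w"
  proof (rule avoid_unique[OF A(1)])
    show "set_pmf (bind_pmf (poisson_pmf (w * ecap X)) (cloud X A)) \<subseteq> Pow A"
      using set_cloud[OF A(1)] by (simp add: UN_subset_iff)
    show "set_pmf (poi A w) \<subseteq> Pow A" using poi(1)[OF A] u by simp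
    fix K assume "K \<subseteq> A"
    then show "avoid (bind_pmf (poisson_pmf (w * ecap X)) (cloud X A)) K = avoid (poi A w) K"
      using avoid_poisson_cloud[OF X(1-3) cX _ u(4)] poi(2)[OF A] u(4) by simp
  qed
  show ?thesis using sdom_trans0[OF 1 2] 3 by simp
qed

end

section \<open>Lattice and cylinder\<close>

text \<open>Moves \<open>2 * i\<close> and \<open>2 * i + 1\<close> are the two opposite steps along
  coordinate \<open>i\<close>.\<close>

definition flip :: "nat \<Rightarrow> nat" where "flip j = (if even j then j + 1 else j - 1)"

lemma flip_div: "flip j div 2 = j div 2"
  unfolding flip_def by (auto elim!: oddE)

lemma even_flip: "even (flip j) \<longleftrightarrow> odd j"
  unfolding flip_def by auto

lemma flip_flip: "flip (flip j) = j"
  unfolding flip_def by auto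

lemma flip_less: "j < 2 * k \<Longrightarrow> flip j < 2 * k"
  unfolding flip_def by (auto elim!: evenE)

definition nm :: "nat \<Rightarrow> nat" where "nm d = 2 * (d + 1)"

lemma nm_pos: "0 < nm d" by (simp add: nm_def)

lemma flip_nm: "j < nm d \<Longrightarrow> flip j < nm d"
  unfolding nm_def by (rule flip_less)

lemma nm_div: "j < nm d \<Longrightarrow> j div 2 < d + 1"
  unfolding nm_def by auto

lemma rwalk_Z: "rwalk (Zpts d) mvZ (nm d) flip"
proof
  fix p j assume p: "p \<in> Zpts d" and j: "j < nm d"
  have i: "j div 2 < length p" using p nm_div[OF j] by (auto simp: Zpts_def)
  show "mvZ p j \<in> Zpts d" using p by (simp add: mvZ_def Zpts_def)
  show "mvZ (mvZ p j) (flip j) = p" using i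
    by (simp add: mvZ_def flip_div even_flip)
qed (auto simp: nm_pos flip_nm flip_flip)

lemma rwalk_E:
  assumes "0 < N" shows "rwalk (Epts d N) (mvE d N) (nm d) flip"
proof
  fix p j assume p: "p \<in> Epts d N" and j: "j < nm d"
  have l: "length p = d + 1" and b: "\<And>i. i < d \<Longrightarrow> 0 \<le> p ! i \<and> p ! i < int N"
    using p by (auto simp: Epts_def)
  have i: "j div 2 < d + 1" using nm_div[OF j] .
  show "mvE d N p j \<in> Epts d N"
    using assms l b i by (auto simp: mvE_def Let_def Epts_def nth_list_update)
  show "mvE d N (mvE d N p j) (flip j) = p"
  proof (cases "j div 2 < d")
    case True
    have "((p ! (j div 2) + s) mod int N - s) mod int N = p ! (j div 2)" for s
      using b[OF True] by (simp add: mod_diff_left_eq)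
    moreover have "((p ! (j div 2) - s) mod int N + s) mod int N = p ! (j div 2)" for s
      using b[OF True] by (simp add: mod_add_left_eq)
    ultimately show ?thesis using True l by (simp add: mvE_def Let_def flip_div even_flip)
  next
    case False then show ?thesis using i l by (simp add: mvE_def Let_def flip_div even_flip)
  qed
qed (auto simp: nm_pos flip_nm flip_flip)

text \<open>The number of admissible step lists satisfies the first-step recursion of
  \<open>escn\<close>, because such a list splits into its head and a list that is admissible from
  the next point.\<close>

lemma escape_esc: "escape d K x = rwalk.esc mvZ (nm d) K x"
proof -
  interpret Z: rwalk "Zpts d" mvZ "nm d" flip by (rule rwalk_Z)
  define m where "m = nm d"
  define S where "S n x = {js. length js = n \<and> set js \<subseteq> {..<m} \<and> (\<forall>k\<in>{1..n}. walkZ x (take k js) \<notin> K)}" for n x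
  have finS: "finite (S n x)" for n x
    by (rule finite_subset[OF _ finite_lists_length_eq[of "{..<m}" n]]) (auto simp: S_def)
  have *: "real (card (S n x)) / real m ^ n = Z.escn K n x" for n x
  proof (induction n arbitrary: x)
    case 0
    have "S 0 x = {[]}" by (auto simp: S_def)
    then show ?case by simp
  next
    case (Suc n)
    have "S (Suc n) x = (\<lambda>(j, js). j # js) ` (SIGMA j:{j\<in>{..<m}. mvZ x j \<notin> K}. S n (mvZ x j))"
    proof (intro set_eqI iffI)
      fix ks assume ks: "ks \<in> S (Suc n) x"
      then obtain j js where k: "ks = j # js" by (auto simp: S_def length_Suc_conv)
      have "mvZ x j \<notin> K" using ks k by (auto simp: S_def walkZ_def dest: bspec[of _ _ 1])
      moreover have "walkZ (mvZ x j) (take k js) \<notin> K" if "k \<in> {1..n}" for k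
        using ks k that by (auto simp: S_def walkZ_def dest: bspec[of _ _ "Suc k"])
      ultimately show "ks \<in> (\<lambda>(j, js). j # js) ` (SIGMA j:{j\<in>{..<m}. mvZ x j \<notin> K}. S n (mvZ x j))"
        using ks k by (auto simp: S_def)
    next
      fix ks assume "ks \<in> (\<lambda>(j, js). j # js) ` (SIGMA j:{j\<in>{..<m}. mvZ x j \<notin> K}. S n (mvZ x j))"
      then obtain j js where k: "ks = j # js" "j < m" "mvZ x j \<notin> K" "js \<in> S n (mvZ x j)" by auto
      have "walkZ x (take k ks) \<notin> K" if "k \<in> {1..Suc n}" for k
      proof -
        define k' where "k' = k - 1"
        have k': "k = Suc k'" "k' \<le> n" using that by (auto simp: k'_def)
        show ?thesis using k k' by (cases "k' = 0") (auto simp: S_def walkZ_def)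
      qed
      then show "ks \<in> S (Suc n) x" using k by (auto simp: S_def)
    qed
    then have "card (S (Suc n) x) = card (SIGMA j:{j\<in>{..<m}. mvZ x j \<notin> K}. S n (mvZ x j))"
      by (simp add: card_image inj_on_def)
    also have "\<dots> = (\<Sum>j\<in>{j\<in>{..<m}. mvZ x j \<notin> K}. card (S n (mvZ x j)))"
      using finS by (subst card_SigmaI) auto
    also have "\<dots> = (\<Sum>j<m. if mvZ x j \<notin> K then card (S n (mvZ x j)) else 0)"
      by (rule sum.inter_filter) simp
    finally have "real (card (S (Suc n) x)) / real m ^ Suc n
       = (\<Sum>j<m. if mvZ x j \<notin> K then real (card (S n (mvZ x j))) else 0) / real m / real m ^ n"
      by (simp add: if_distrib cong: if_cong)
    also have "\<dots> = (\<Sum>j<m. if mvZ x j \<in> K then 0 else real (card (S n (mvZ x j))) / real m ^ n) / real m"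
      by (simp add: sum_divide_distrib if_distrib divide_divide_eq_left mult.commute cong: if_cong) (auto intro!: sum.cong)
    also have "\<dots> = Z.escn K (Suc n) x"
      by (simp only: Suc Z.escn.simps av_def) (simp only: m_def)
    finally show ?case .
  qed
  have "escape d K x = lim (\<lambda>n. real (card (S n x)) / real m ^ n)"
    unfolding escape_def S_def m_def nm_def ..
  also have "\<dots> = Z.esc K x" unfolding * Z.esc_def ..
  finally show ?thesis .
qed

lemma cap_ecap: "cap d K = rwalk.ecap mvZ (nm d) K"
proof -
  interpret Z: rwalk "Zpts d" mvZ "nm d" flip by (rule rwalk_Z)
  show ?thesis by (simp add: cap_def Z.ecap_def escape_esc)
qed

section \<open>Powers of a squared distance as superharmonic functions\<close>

lemma sum_pairs: "(\<Sum>j<2 * n. f j) = (\<Sum>i<n. f (2 * i) + f (2 * i + 1))"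
  for f :: "nat \<Rightarrow> real"
  by (induction n) (auto simp: algebra_simps)

text \<open>Second-order Taylor expansion in \<open>y = x / t\<close>, with the second derivative of
  \<open>(1 + y) powr (- b)\<close> bounded by its value at \<open>- \<kappa>\<close>, the worst
  admissible point.\<close>

lemma powr_upper:
  fixes b \<kappa> t x :: real
  assumes b: "0 < b" and \<kappa>: "0 < \<kappa>" "\<kappa> < 1" and t: "0 < t" and x: "\<bar>x\<bar> \<le> \<kappa> * t"
  shows "(t + x) powr (- b) \<le> t powr (- b) - b * x * t powr (- b - 1)
      + b * (b + 1) / 2 * (1 - \<kappa>) powr (- b - 2) * x\<^sup>2 * t powr (- b - 2)"
proof -
  define y where "y = x / t"
  have y: "\<bar>y\<bar> \<le> \<kappa>" using x t by (simp add: y_def abs_mult field_simps)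
  define df where "df n s = (if n = 0 then (1 + s) powr (- b)
     else if n = 1 then - b * (1 + s) powr (- b - 1) else b * (b + 1) * (1 + s) powr (- b - 2))" for n :: nat and s :: real
  have "\<exists>u. \<bar>u\<bar> \<le> \<bar>y\<bar> \<and> (1 + y) powr (- b) = (\<Sum>m<2. df m 0 / fact m * y ^ m) + df 2 u / fact 2 * y ^ 2"
  proof (rule Maclaurin_bi_le)
    show "df 0 = (\<lambda>y. (1 + y) powr (- b))" by (auto simp: df_def)
    show "\<forall>m s. m < 2 \<and> \<bar>s\<bar> \<le> \<bar>y\<bar> \<longrightarrow> (df m has_real_derivative df (Suc m) s) (at s)"
    proof (intro allI impI)
      fix m s assume ms: "m < (2::nat) \<and> \<bar>s\<bar> \<le> \<bar>y\<bar>"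
      then have s: "0 < 1 + s" using y \<kappa> by linarith
      have "((\<lambda>s. (1 + s) powr (- b)) has_real_derivative - b * (1 + s) powr (- b - 1)) (at s)"
        using s by (auto intro!: derivative_eq_intros)
      moreover have "((\<lambda>s. - b * (1 + s) powr (- b - 1)) has_real_derivative b * (b + 1) * (1 + s) powr (- b - 2)) (at s)"
        using s by (auto intro!: derivative_eq_intros simp: algebra_simps)
      moreover have "m = 0 \<or> m = 1" using ms by auto
      ultimately show "(df m has_real_derivative df (Suc m) s) (at s)"
        by (auto simp: df_def[abs_def])
    qed
  qed
  then obtain u where u: "\<bar>u\<bar> \<le> \<bar>y\<bar>"
    "(1 + y) powr (- b) = (\<Sum>m<2. df m 0 / fact m * y ^ m) + df 2 u / fact 2 * y ^ 2" by blast
  have "(1 + u) powr (- b - 2) \<le> (1 - \<kappa>) powr (- b - 2)"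
    by (rule powr_mono2') (use u y \<kappa> b in auto)
  then have "df 2 u / fact 2 * y\<^sup>2 \<le> b * (b + 1) / 2 * (1 - \<kappa>) powr (- b - 2) * y\<^sup>2"
    using b by (auto simp: df_def intro!: mult_right_mono mult_left_mono)
  then have 1: "(1 + y) powr (- b) \<le> 1 - b * y + b * (b + 1) / 2 * (1 - \<kappa>) powr (- b - 2) * y\<^sup>2"
    using u(2) by (simp add: df_def numeral_2_eq_2)
  have "(t + x) powr (- b) = t powr (- b) * (1 + y) powr (- b)"
  proof -
    have "0 \<le> 1 + y" using y \<kappa> by linarith
    have "t + x = t * (1 + y)" using t by (simp add: y_def field_simps)
    then show ?thesis using t \<open>0 \<le> 1 + y\<close> by (simp add: powr_mult)
  qed
  also have "\<dots> \<le> t powr (- b) * (1 - b * y + b * (b + 1) / 2 * (1 - \<kappa>) powr (- b - 2) * y\<^sup>2)"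
    by (rule mult_left_mono[OF 1]) simp
  also have "\<dots> = t powr (- b) - b * x * (t powr (- b) / t)
      + b * (b + 1) / 2 * (1 - \<kappa>) powr (- b - 2) * x\<^sup>2 * (t powr (- b) / t\<^sup>2)"
    using t by (simp add: y_def power2_eq_square field_simps)
  also have "t powr (- b) / t = t powr (- b - 1)" using t by (simp add: powr_diff)
  also have "t powr (- b) / t\<^sup>2 = t powr (- b - 2)" using t by (simp add: powr_diff powr_numeral)
  finally show ?thesis .
qed

text \<open>\<open>(a + |x|\<^sup>2) powr (- b)\<close> is superharmonic for \<open>b < (d - 1) / 2\<close>; the form below, in
  terms of the increments of the squared norm, also covers the periodised norm on the cylinder.\<close>

lemma lyapunov:
  fixes d :: nat and b :: real
  assumes "0 < b" "b < (real d - 1) / 2"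
  obtains a \<gamma> where "2 \<le> a" "0 < \<gamma>"
    "\<And>s D t \<mu>. (\<And>i. i \<le> d \<Longrightarrow> 0 \<le> s i) \<Longrightarrow> t = a + (\<Sum>i<d + 1. s i) \<Longrightarrow>
      (\<And>i. i \<le> d \<Longrightarrow> (D (2 * i))\<^sup>2 + (D (2 * i + 1))\<^sup>2 \<le> 8 * s i + 2) \<Longrightarrow>
      (\<Sum>j<2 * (d + 1). D j) \<ge> 2 * (real d + 1) - \<gamma> - \<mu> * t \<Longrightarrow>
      (\<Sum>j<2 * (d + 1). (t + D j) powr (- b)) \<le> 2 * (real d + 1) * t powr (- b) + b * t powr (- b - 1) * (\<mu> * t - \<gamma>)"
proof -
  \<comment> \<open>First-order gain minus second-order loss, in units of
    \<open>b * t powr (- b - 1)\<close>. At \<open>\<kappa> = 0\<close> it is positive exactly when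
    \<open>b < (d - 1) / 2\<close>.\<close>
  define g where "g \<kappa> = 2 * (real d + 1) - 4 * (b + 1) * (1 - \<kappa>) powr (- b - 2)" for \<kappa> :: real
  have "(g \<longlongrightarrow> 2 * (real d + 1) - 4 * (b + 1) * (1 - 0) powr (- b - 2)) (at_right 0)"
    unfolding g_def by (intro tendsto_intros) auto
  then have "(g \<longlongrightarrow> 2 * (real d + 1) - 4 * (b + 1)) (at_right 0)" by simp
  moreover have "0 < 2 * (real d + 1) - 4 * (b + 1)" using assms by (simp add: field_simps)
  ultimately have "\<forall>\<^sub>F \<kappa> in at_right 0. 0 < g \<kappa>" by (rule order_tendstoD)
  moreover have "\<forall>\<^sub>F \<kappa> in at_right 0. \<kappa> \<in> {0<..<(1::real)}" by (rule eventually_at_right_real) simp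
  ultimately have "\<forall>\<^sub>F \<kappa> in at_right 0. 0 < g \<kappa> \<and> \<kappa> \<in> {0<..<1}" by (rule eventually_conj)
  then obtain \<kappa> where \<kappa>: "0 < g \<kappa>" "0 < \<kappa>" "\<kappa> < 1"
    using eventually_happens'[OF trivial_limit_at_right_real] by auto
  \<comment> \<open>The gain is divided into three: one share for the defect allowed in the sum of
    \<open>D\<close>, one for the lower-order term \<open>c * (real d + 1) / t\<close>, and one that
    survives as strict drift.\<close>
  define \<gamma> where "\<gamma> = g \<kappa> / 3"
  define c where "c = (b + 1) * (1 - \<kappa>) powr (- b - 2)"
  have c: "0 < c" using assms \<kappa> by (simp add: c_def)
  have \<gamma>: "0 < \<gamma>" using \<kappa> by (simp add: \<gamma>_def)
  have gc: "4 * c = 2 * (real d + 1) - 3 * \<gamma>"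
  proof -
    have "g \<kappa> = 2 * (real d + 1) - 4 * c" unfolding g_def c_def by simp
    then show ?thesis unfolding \<gamma>_def by (simp add: field_simps)
  qed
  \<comment> \<open>The second summand forces \<open>\<bar>D j\<bar> \<le> \<kappa> * t\<close>,
    because \<open>(D j)\<^sup>2 \<le> 9 * t\<close>. The third makes the lower-order term at most
    \<open>\<gamma>\<close>.\<close>
  define a where "a = 2 + 9 / \<kappa>\<^sup>2 + c * (real d + 1) / \<gamma>"
  show ?thesis
  proof (rule that[of a \<gamma>])
    show "2 \<le> a" using c \<gamma> by (simp add: a_def)
    show "0 < \<gamma>" by fact
    fix s D :: "nat \<Rightarrow> real" and t \<mu> :: real
    assume s: "\<And>i. i \<le> d \<Longrightarrow> 0 \<le> s i" and t: "t = a + (\<Sum>i<d + 1. s i)"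
      and D2: "\<And>i. i \<le> d \<Longrightarrow> (D (2 * i))\<^sup>2 + (D (2 * i + 1))\<^sup>2 \<le> 8 * s i + 2"
      and D1: "(\<Sum>j<2 * (d + 1). D j) \<ge> 2 * (real d + 1) - \<gamma> - \<mu> * t"
    have sn: "0 \<le> (\<Sum>i<d + 1. s i)" by (rule sum_nonneg) (use s in auto)
    have ta: "a \<le> t" using t sn by simp
    have t2: "2 \<le> t" "9 / \<kappa>\<^sup>2 \<le> t" "c * (real d + 1) / \<gamma> \<le> t" using ta c \<gamma> \<kappa>
      by (auto simp: a_def add_increasing add_increasing2 intro: order_trans[rotated])
    have t0: "0 < t" using t2 by simp
    have Dj: "\<bar>D j\<bar> \<le> \<kappa> * t" if "j < 2 * (d + 1)" for j
    proof -
      define i where "i = j div 2"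
      have i: "i \<le> d" "j = 2 * i \<or> j = 2 * i + 1" using that by (auto simp: i_def)
      have "s i \<le> (\<Sum>i<d + 1. s i)" by (rule member_le_sum) (use i s in auto)
      then have "s i \<le> t" using t ta \<open>2 \<le> t\<close> c \<gamma> by (simp add: a_def add_increasing)
      then have "(D j)\<^sup>2 \<le> 9 * t" using D2[OF i(1)] i(2) t2(1) by (elim disjE) (simp, smt (verit) zero_le_power2)+
      also have "9 * t \<le> (\<kappa>\<^sup>2 * t) * t" using t2(2) \<kappa> t0 by (intro mult_right_mono) (auto simp: field_simps)
      also have "\<dots> = (\<kappa> * t)\<^sup>2" by (simp add: power2_eq_square)
      finally show ?thesis using \<kappa> t0 by (simp add: abs_le_square_iff[symmetric])
    qed
    have "(\<Sum>j<2 * (d + 1). (t + D j) powr (- b)) \<le> (\<Sum>j<2 * (d + 1). t powr (- b) - b * D j * t powr (- b - 1)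
      + b * (b + 1) / 2 * (1 - \<kappa>) powr (- b - 2) * (D j)\<^sup>2 * t powr (- b - 2))"
      by (intro sum_mono powr_upper) (use Dj \<kappa> t0 assms in auto)
    also have "\<dots> = 2 * (real d + 1) * t powr (- b) - b * t powr (- b - 1) * (\<Sum>j<2 * (d + 1). D j)
      + b * (c / 2) * t powr (- b - 2) * (\<Sum>j<2 * (d + 1). (D j)\<^sup>2)"
    proof -
      have "(\<Sum>j\<in>J. P - b * D j * Q + c' * (D j)\<^sup>2 * R) =
        real (card J) * P - b * Q * (\<Sum>j\<in>J. D j) + c' * R * (\<Sum>j\<in>J. (D j)\<^sup>2)" for J :: "nat set" and P Q R c' :: real
        by (simp add: sum.distrib sum_subtractf sum_distrib_left algebra_simps)
      from this[where J="{..<2 * (d + 1)}"] show ?thesis by (simp only: card_lessThan c_def) (simp add: algebra_simps)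
    qed
    also have "(\<Sum>j<2 * (d + 1). (D j)\<^sup>2) = (\<Sum>i<d + 1. (D (2 * i))\<^sup>2 + (D (2 * i + 1))\<^sup>2)"
      by (rule sum_pairs)
    also have "b * (c / 2) * t powr (- b - 2) * \<dots> \<le> b * (c / 2) * t powr (- b - 2) * (8 * t + 2 * (real d + 1))"
    proof (rule mult_left_mono)
      have "(\<Sum>i<d + 1. (D (2 * i))\<^sup>2 + (D (2 * i + 1))\<^sup>2) \<le> (\<Sum>i<d + 1. 8 * s i + 2)"
        by (rule sum_mono) (use D2 in auto)
      also have "\<dots> = 8 * (\<Sum>i<d + 1. s i) + 2 * (real d + 1)"
        by (simp only: sum.distrib sum_distrib_left[symmetric]) (simp add: algebra_simps)
      also have "\<dots> \<le> 8 * t + 2 * (real d + 1)" using t \<open>2 \<le> t\<close> t2 c \<gamma> by (simp add: a_def add_increasing)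
      finally show "(\<Sum>i<d + 1. (D (2 * i))\<^sup>2 + (D (2 * i + 1))\<^sup>2) \<le> 8 * t + 2 * (real d + 1)" .
    qed (use assms c in auto)
    also have "b * (c / 2) * t powr (- b - 2) * (8 * t + 2 * (real d + 1)) = b * t powr (- b - 1) * (4 * c + c * (real d + 1) / t)"
    proof -
      have eq: "t powr (- b - 2) = t powr (- b - 1) / t"
      proof -
        have "- b - 2 = (- b - 1) - 1" by simp
        then have "t powr (- b - 2) = t powr ((- b - 1) - 1)" by (rule arg_cong)
        then show ?thesis using t0 by (simp only: powr_diff[of t "- b - 1" 1] powr_one)
      qed
      show ?thesis unfolding eq using t0 by (simp add: field_simps)
    qed
    also have "\<dots> \<le> b * t powr (- b - 1) * (4 * c + \<gamma>)"
      using t2(3) t0 \<gamma> assms by (intro mult_left_mono) (auto simp: field_simps)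
    finally have "(\<Sum>j<2 * (d + 1). (t + D j) powr (- b)) \<le> 2 * (real d + 1) * t powr (- b)
       - b * t powr (- b - 1) * (\<Sum>j<2 * (d + 1). D j) + b * t powr (- b - 1) * (4 * c + \<gamma>)" by simp
    also have "\<dots> \<le> 2 * (real d + 1) * t powr (- b)
       - b * t powr (- b - 1) * (2 * (real d + 1) - \<gamma> - \<mu> * t) + b * t powr (- b - 1) * (4 * c + \<gamma>)"
      using D1 assms by (intro add_mono diff_mono mult_left_mono) auto
    also have "\<dots> = 2 * (real d + 1) * t powr (- b) + b * t powr (- b - 1) * (\<mu> * t - \<gamma>)"
      unfolding gc by (simp add: algebra_simps)
    finally show "(\<Sum>j<2 * (d + 1). (t + D j) powr (- b)) \<le> 2 * (real d + 1) * t powr (- b) + b * t powr (- b - 1) * (\<mu> * t - \<gamma>)" .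
  qed
qed

section \<open>Comparison of exits, visits and escapes\<close>

context rwalk
begin

text \<open>The probability of leaving \<open>C\<close> before meeting \<open>A\<close> within
  \<open>n\<close> steps. It mediates between cylinder and lattice, whose walks agree as long as
  they stay in a small box \<open>C\<close>.\<close>

fun exn :: "'a set \<Rightarrow> 'a set \<Rightarrow> nat \<Rightarrow> 'a \<Rightarrow> real" where
  "exn A C 0 p = (if p \<in> A then 0 else if p \<notin> C then 1 else 0)"
| "exn A C (Suc n) p = (if p \<in> A then 0 else if p \<notin> C then 1 else av m (\<lambda>j. exn A C n (mv p j)))"

lemma exn_bounds: "0 \<le> exn A C n p" "exn A C n p \<le> 1"
proof (induction n arbitrary: p)
  case (Suc n)
  { case 1 show ?case by (auto intro!: av_nonneg Suc) }
  { case 2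
    have "av m (\<lambda>j. exn A C n (mv p j)) \<le> av m (\<lambda>_. 1)" by (intro av_mono) (auto intro: Suc)
    then show ?case using av_const[OF m_pos] by simp }
qed auto

lemma exn_avd:
  assumes far: "\<And>p n. p \<in> V \<Longrightarrow> p \<notin> C \<Longrightarrow> p \<notin> A \<Longrightarrow> 1 - \<delta> \<le> avd A n p" and \<delta>: "0 \<le> \<delta>" "\<delta> \<le> 1"
    and p: "p \<in> V"
  shows "exn A C n p * (1 - \<delta>) \<le> avd A n' p"
  using p
proof (induction n arbitrary: p n')
  case 0 then show ?case using far[of p n'] avd_bounds by auto
next
  case (Suc n)
  show ?case
  proof (cases "p \<in> A \<or> p \<notin> C")
    case True then show ?thesis using far[of p n'] avd_bounds Suc.prems by auto
  next
    case False
    show ?thesis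
    proof (cases n')
      case 0
      have "exn A C (Suc n) p * (1 - \<delta>) \<le> 1 * 1"
        by (rule mult_mono) (simp_all only: exn_bounds, use \<delta> in auto)
      then show ?thesis using 0 False by (simp add: avd_def)
    next
      case n': (Suc n'')
      have "av m (\<lambda>j. exn A C n (mv p j)) * (1 - \<delta>) = av m (\<lambda>j. exn A C n (mv p j) * (1 - \<delta>))"
        by (simp add: av_cmult_right)
      also have "\<dots> \<le> av m (\<lambda>j. avd A n'' (mv p j))" by (rule av_mono) (use Suc closed in auto)
      finally show ?thesis using False n' by (simp add: avd_Suc)
    qed
  qed
qed

text \<open>A walk that has left \<open>C\<close> before meeting \<open>A\<close> avoids
  \<open>A\<close> afterwards with probability at least \<open>1 - \<delta>\<close>. The bound is
  uniform in the horizon \<open>n'\<close> and so passes to the limit.\<close>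

lemma exn_esc:
  assumes far: "\<And>p n. p \<in> V \<Longrightarrow> p \<notin> C \<Longrightarrow> p \<notin> A \<Longrightarrow> 1 - \<delta> \<le> avd A n p" and \<delta>: "0 \<le> \<delta>" "\<delta> \<le> 1"
    and x: "x \<in> V"
  shows "av m (\<lambda>j. exn A C n (mv x j)) * (1 - \<delta>) \<le> esc A x"
proof (rule LIMSEQ_le_const[OF LIMSEQ_Suc[OF esc_lim]])
  have "av m (\<lambda>j. exn A C n (mv x j)) * (1 - \<delta>) \<le> escn A (Suc n') x" for n'
    unfolding escn_Suc_avd av_cmult_right[symmetric]
    by (rule av_mono) (use exn_avd[OF far \<delta>] closed x in auto)
  then show "\<exists>N. \<forall>n'\<ge>N. av m (\<lambda>j. exn A C n (mv x j)) * (1 - \<delta>) \<le> escn A (Suc n') x" by blast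
qed

text \<open>Nothing is counted inside \<open>C\<close>, so the walk must first leave
  \<open>C\<close> without meeting \<open>A\<close>. It then stands in \<open>R\<close> outside
  \<open>C\<close>, from where \<open>S\<close> bounds the expected count; \<open>R\<close> is a
  neighbourhood of \<open>C\<close> that keeps the hypothesis on \<open>S\<close> local.\<close>

lemma vis_exn:
  assumes S: "\<And>p n. p \<in> V \<Longrightarrow> p \<in> R \<Longrightarrow> p \<notin> C \<Longrightarrow> p \<in> U \<Longrightarrow> vis U f n p \<le> S" "0 \<le> S"
    and R: "\<And>p j. p \<in> V \<Longrightarrow> p \<in> C \<Longrightarrow> j < m \<Longrightarrow> mv p j \<in> R"
    and f: "\<And>p. p \<in> C \<Longrightarrow> f p = 0" and UA: "U \<inter> A = {}"
    and p: "p \<in> V" "p \<in> R"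
  shows "(if p \<in> U then vis U f n p else 0) \<le> S * exn A C n p"
  using p
proof (induction n arbitrary: p)
  case 0
  have "f p \<le> S" if "p \<in> U" "p \<notin> C" using S(1)[of p 0] 0 that by simp
  then show ?case using f[of p] S(2) UA by auto
next
  case (Suc n)
  show ?case
  proof (cases "p \<in> U \<and> p \<in> C")
    case True
    have "vis U f (Suc n) p = av m (\<lambda>j. if mv p j \<in> U then vis U f n (mv p j) else 0)" using True f by simp
    also have "\<dots> \<le> av m (\<lambda>j. S * exn A C n (mv p j))"
      by (rule av_mono) (use Suc R closed True in auto)
    also have "\<dots> = S * exn A C (Suc n) p" using True UA by (auto simp: av_cmult)
    finally show ?thesis using True by simp
  next
    case False
    then show ?thesis using S(1)[of p "Suc n"] S(2) Suc.prems UA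
      mult_nonneg_nonneg[OF S(2) exn_bounds(1)[of A C "Suc n" p]] by (auto simp del: vis.simps)
  qed
qed

text \<open>Supermartingale argument: inside \<open>B\<close> the function \<open>\<psi>\<close>
  falls on average by at least \<open>f\<close> per step, so it dominates the expected total of
  \<open>f\<close> collected while the walk stays in \<open>U\<close>.\<close>

lemma vis_super:
  assumes super: "\<And>p. p \<in> V \<Longrightarrow> p \<in> B \<Longrightarrow> f p + av m (\<lambda>j. \<psi> (mv p j)) \<le> \<psi> p"
    and pos: "\<And>p j. p \<in> V \<Longrightarrow> p \<in> B \<Longrightarrow> j < m \<Longrightarrow> 0 \<le> \<psi> (mv p j)"
    and UB: "U \<subseteq> B" and p: "p \<in> V" "p \<in> B"
  shows "vis U f n p \<le> \<psi> p"
  using p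
proof (induction n arbitrary: p)
  case 0
  have "0 \<le> av m (\<lambda>j. \<psi> (mv p j))" by (rule av_nonneg) (use pos 0 in auto)
  then show ?case using super[OF 0] by simp
next
  case (Suc n)
  have "av m (\<lambda>j. if mv p j \<in> U then vis U f n (mv p j) else 0) \<le> av m (\<lambda>j. \<psi> (mv p j))"
    by (rule av_mono) (use Suc pos UB closed in auto)
  then show ?case using super[OF Suc.prems] by simp
qed

text \<open>After reversal the walk starts at \<open>q\<close> in \<open>A\<close> and its visits to
  \<open>X\<close> are counted. It gets there only by leaving \<open>C\<close> without returning to
  \<open>A\<close>, and this yields a factor comparable with the escape probability from
  \<open>q\<close>.\<close>

lemma hit_sum_bound:
  assumes S: "\<And>p n. p \<in> V \<Longrightarrow> p \<in> R \<Longrightarrow> p \<notin> C \<Longrightarrow> p \<in> U \<Longrightarrow> vis U (\<lambda>p. if p \<in> X then 1 else 0) n p \<le> S" "0 \<le> S"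
    and R: "\<And>p j. p \<in> V \<Longrightarrow> p \<in> C \<Longrightarrow> j < m \<Longrightarrow> mv p j \<in> R"
    and X: "finite X" "X \<subseteq> V" "X \<inter> C = {}" and UA: "U \<inter> A = {}"
    and q: "q \<in> V" "q \<in> A" "q \<in> C"
  shows "(\<Sum>x\<in>X. hitd U n x q) \<le> S * av m (\<lambda>j. exn A C n (mv q j))"
proof -
  let ?f = "\<lambda>p. if p \<in> X then 1 else (0::real)"
  \<comment> \<open>The horizon is raised by one so that the first step of the reversed walk, away
    from \<open>q\<close>, can be split off.\<close>
  have "(\<Sum>x\<in>X. hitd U n x q) \<le> (\<Sum>x\<in>X. hitd U (Suc n) x q)"
    by (intro sum_mono hitd_Suc_mono)
  also have "\<dots> = (\<Sum>x\<in>X. vis U (\<lambda>p. if p = x then 1 else 0) (Suc n) q)"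
    by (intro sum.cong hitd_vis refl) (use X UA q in auto)
  also have "\<dots> = vis U (\<lambda>p. \<Sum>x\<in>X. if p = x then 1 else 0) (Suc n) q" by (rule vis_sum[symmetric])
  also have "(\<lambda>p. \<Sum>x\<in>X. if p = x then 1 else 0) = ?f" using X(1) by (auto simp: fun_eq_iff)
  also have "vis U ?f (Suc n) q = av m (\<lambda>j. if mv q j \<in> U then vis U ?f n (mv q j) else 0)"
    using X q by auto
  also have "\<dots> \<le> av m (\<lambda>j. S * exn A C n (mv q j))"
    by (intro av_mono vis_exn[where R=R, OF S R]) (use X UA q closed R in auto)
  finally show ?thesis by (simp add: av_cmult)
qed

lemma subharmonic_le_avd:
  assumes sub: "\<And>p. p \<in> V \<Longrightarrow> p \<notin> D \<Longrightarrow> \<xi> p \<le> av m (\<lambda>j. \<xi> (mv p j))"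
    and le: "\<And>p. p \<in> V \<Longrightarrow> \<xi> p \<le> 1" "\<And>p. p \<in> D \<Longrightarrow> \<xi> p \<le> 0" and p: "p \<in> V"
  shows "\<xi> p \<le> avd D n p"
  using p
proof (induction n arbitrary: p)
  case 0 then show ?case using le by (simp add: avd_def)
next
  case (Suc n)
  show ?case
  proof (cases "p \<in> D")
    case True then show ?thesis using le by (simp add: avd_def)
  next
    case False
    have "\<xi> p \<le> av m (\<lambda>j. \<xi> (mv p j))" by (rule sub[OF Suc.prems False])
    also have "\<dots> \<le> av m (\<lambda>j. avd D n (mv p j))" by (rule av_mono) (use Suc closed in auto)
    finally show ?thesis using False by (simp add: avd_Suc)
  qed
qed

lemma subharmonic_le_esc:
  assumes sub: "\<And>p. p \<in> V \<Longrightarrow> p \<notin> D \<Longrightarrow> \<xi> p \<le> av m (\<lambda>j. \<xi> (mv p j))"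
    and le: "\<And>p. p \<in> V \<Longrightarrow> \<xi> p \<le> 1" "\<And>p. p \<in> D \<Longrightarrow> \<xi> p \<le> 0" and q: "q \<in> V"
  shows "av m (\<lambda>j. \<xi> (mv q j)) \<le> esc D q"
proof (rule LIMSEQ_le_const[OF LIMSEQ_Suc[OF esc_lim]])
  have "av m (\<lambda>j. \<xi> (mv q j)) \<le> escn D (Suc n) q" for n
    unfolding escn_Suc_avd
    by (rule av_mono) (use subharmonic_le_avd[OF sub le] closed q in auto)
  then show "\<exists>N. \<forall>n\<ge>N. av m (\<lambda>j. \<xi> (mv q j)) \<le> escn D (Suc n) q" by blast
qed

text \<open>Summation by parts against the harmonic function \<open>avi A\<close>.\<close>

lemma ecap_le_cutoff:
  assumes S: "finite S" "S \<subseteq> V" and A: "A \<subseteq> S"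
    and supp: "\<And>p. p \<in> V \<Longrightarrow> \<chi>f p \<noteq> 0 \<Longrightarrow> p \<in> S \<and> (\<forall>j<m. mv p j \<in> S)"
    and one: "\<And>p. p \<in> A \<Longrightarrow> 1 \<le> \<chi>f p"
    and B: "\<And>p. p \<in> S \<Longrightarrow> av m (\<lambda>j. \<chi>f (mv p j)) - \<chi>f p \<le> B" "0 \<le> B"
  shows "ecap A \<le> real (card S) * B"
proof -
  let ?g = "avi A"
  \<comment> \<open>The generator applied to \<open>avi A\<close> is \<open>esc A\<close> on
    \<open>A\<close> and zero elsewhere, so pairing it with the cutoff bounds the capacity.\<close>
  have L: "av m (\<lambda>j. ?g (mv p j)) - ?g p = (if p \<in> A then esc A p else 0)" for p
    using avi_rec[of A p] esc_avi[of A p] by auto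
  have "ecap A \<le> (\<Sum>p\<in>A. \<chi>f p * esc A p)"
    unfolding ecap_def by (rule sum_mono) (use one esc_bounds(1) mult_right_mono[of 1 _ "esc A _"] in force)
  also have "\<dots> = (\<Sum>p\<in>S. \<chi>f p * (if p \<in> A then esc A p else 0))"
    using A S by (intro sum.mono_neutral_cong_left) auto
  also have "\<dots> = (\<Sum>p\<in>S. \<chi>f p * av m (\<lambda>j. ?g (mv p j))) - (\<Sum>p\<in>S. \<chi>f p * ?g p)"
    by (simp only: L[symmetric] right_diff_distrib sum_subtractf)
  also have "(\<Sum>p\<in>S. \<chi>f p * av m (\<lambda>j. ?g (mv p j))) = (\<Sum>p\<in>S. \<Sum>j<m. \<chi>f p * ?g (mv p j)) / m"
    by (simp add: av_def sum_divide_distrib sum_distrib_left)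
  also have "(\<Sum>p\<in>S. \<Sum>j<m. \<chi>f p * ?g (mv p j)) = (\<Sum>(p, j)\<in>S \<times> {..<m}. \<chi>f p * ?g (mv p j))"
    by (rule sum.cartesian_product)
  also have "\<dots> = (\<Sum>(p, j)\<in>S \<times> {..<m}. ?g p * \<chi>f (mv p j))"
  \<comment> \<open>Every oriented edge is exchanged with its reverse. An edge leaving
    \<open>S\<close> has a zero of the cutoff at both endpoints, so discarding zero terms makes the
    exchange a bijection.\<close>
  proof (rule sum.reindex_bij_witness_not_neutral[where i="\<lambda>(p, j). (mv p j, iv j)" and j="\<lambda>(p, j). (mv p j, iv j)"
        and S'="{(p, j) \<in> S \<times> {..<m}. \<chi>f p = 0}" and T'="{(p, j) \<in> S \<times> {..<m}. \<chi>f (mv p j) = 0}"])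
    show "finite {(p, j). (p, j) \<in> S \<times> {..<m} \<and> \<chi>f p = 0}" "finite {(p, j). (p, j) \<in> S \<times> {..<m} \<and> \<chi>f (mv p j) = 0}"
      by (rule finite_subset[of _ "S \<times> {..<m}"]; use S in auto)+
    fix b assume "b \<in> S \<times> {..<m} - {(p, j). (p, j) \<in> S \<times> {..<m} \<and> \<chi>f (mv p j) = 0}"
    moreover obtain p j where "b = (p, j)" by (cases b)
    ultimately have b: "b = (p, j)" "p \<in> S" "p \<in> V" "j < m" "\<chi>f (mv p j) \<noteq> 0" "mv p j \<in> V" using S closed by auto
    show "(case case b of (p, j) \<Rightarrow> (mv p j, iv j) of (p, j) \<Rightarrow> (mv p j, iv j)) = b"
      using b by (simp add: mv_iv iv_iv)
    show "(case b of (p, j) \<Rightarrow> (mv p j, iv j)) \<in> S \<times> {..<m} - {(p, j). (p, j) \<in> S \<times> {..<m} \<and> \<chi>f p = 0}"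
      using b supp[of "mv p j"] by (auto simp: iv_less)
  next
    fix a assume "a \<in> S \<times> {..<m} - {(p, j). (p, j) \<in> S \<times> {..<m} \<and> \<chi>f p = 0}"
    moreover obtain p j where "a = (p, j)" by (cases a)
    ultimately have a: "a = (p, j)" "p \<in> S" "p \<in> V" "j < m" "\<chi>f p \<noteq> 0" "mv p j \<in> S" using S supp[of "fst a"] by auto
    show "(case case a of (p, j) \<Rightarrow> (mv p j, iv j) of (p, j) \<Rightarrow> (mv p j, iv j)) = a"
      using a by (simp add: mv_iv iv_iv)
    show "(case a of (p, j) \<Rightarrow> (mv p j, iv j)) \<in> S \<times> {..<m} - {(p, j). (p, j) \<in> S \<times> {..<m} \<and> \<chi>f (mv p j) = 0}"
      using a by (auto simp: iv_less mv_iv)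
  next
    fix a assume "a \<in> S \<times> {..<m}"
    moreover obtain p j where "a = (p, j)" by (cases a)
    ultimately have a: "a = (p, j)" "p \<in> V" "j < m" using S by auto
    show "(case case a of (p, j) \<Rightarrow> (mv p j, iv j) of (p, j) \<Rightarrow> ?g p * \<chi>f (mv p j)) = (case a of (p, j) \<Rightarrow> \<chi>f p * ?g (mv p j))"
      using a by (simp add: mv_iv)
  qed auto
  also have "\<dots> = (\<Sum>p\<in>S. \<Sum>j<m. ?g p * \<chi>f (mv p j))"
    by (rule sum.cartesian_product[symmetric])
  also have "\<dots> / m - (\<Sum>p\<in>S. \<chi>f p * ?g p) = (\<Sum>p\<in>S. ?g p * (av m (\<lambda>j. \<chi>f (mv p j)) - \<chi>f p))"
    by (simp add: av_def sum_divide_distrib sum_distrib_left right_diff_distrib sum_subtractf mult.commute)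
  also have "\<dots> \<le> (\<Sum>p\<in>S. B)"
  proof (rule sum_mono)
    fix p assume "p \<in> S"
    have "?g p * (av m (\<lambda>j. \<chi>f (mv p j)) - \<chi>f p) \<le> ?g p * B"
      by (rule mult_left_mono[OF B(1)[OF \<open>p \<in> S\<close>]]) (rule avi_bounds)
    also have "\<dots> \<le> 1 * B" by (rule mult_right_mono) (use avi_bounds B in auto)
    finally show "?g p * (av m (\<lambda>j. \<chi>f (mv p j)) - \<chi>f p) \<le> B" by simp
  qed
  finally show ?thesis by simp
qed

end

section \<open>Estimates on the lattice\<close>

definition zbox :: "nat \<Rightarrow> nat \<Rightarrow> int list set" where
  "zbox d R = {p. length p = d + 1 \<and> (\<forall>i\<le>d. \<bar>p ! i\<bar> \<le> int R)}"

definition nsq :: "nat \<Rightarrow> int list \<Rightarrow> real" where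
  "nsq d p = (\<Sum>i<d + 1. (real_of_int (p ! i))\<^sup>2)"

lemma zbox_Zpts: "zbox d R \<subseteq> Zpts d"
  by (auto simp: zbox_def Zpts_def)

lemma zbox_mono: "R \<le> R' \<Longrightarrow> zbox d R \<subseteq> zbox d R'"
  by (fastforce simp: zbox_def)

lemma zbox_lists: "zbox d R = {p. set p \<subseteq> {- int R..int R} \<and> length p = d + 1}"
proof (intro set_eqI iffI)
  fix p assume "p \<in> zbox d R"
  then show "p \<in> {p. set p \<subseteq> {- int R..int R} \<and> length p = d + 1}"
    by (fastforce simp: zbox_def in_set_conv_nth abs_le_iff less_Suc_eq_le)
next
  fix p assume p: "p \<in> {p. set p \<subseteq> {- int R..int R} \<and> length p = d + 1}"
  then have "p ! i \<in> {- int R..int R}" if "i \<le> d" for i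
    using that by (auto dest!: subsetD[OF _ nth_mem[of i p]])
  then show "p \<in> zbox d R" using p by (auto simp: zbox_def abs_le_iff minus_le_iff)
qed

lemma finite_zbox: "finite (zbox d R)"
  unfolding zbox_lists by (rule finite_lists_length_eq) simp

lemma card_zbox: "card (zbox d R) = (2 * R + 1) ^ (d + 1)"
  unfolding zbox_lists by (subst card_lists_length_eq) (auto simp: nat_add_distrib nat_mult_distrib)

lemma sum_update:
  fixes s :: "nat \<Rightarrow> int \<Rightarrow> real"
  assumes "length p = d + 1" "k < d + 1"
  shows "(\<Sum>i<d + 1. s i (p[k := v] ! i)) = (\<Sum>i<d + 1. s i (p ! i)) + (s k v - s k (p ! k))"
proof -
  have k: "k \<in> {..<d + 1}" "finite {..<d + 1}" using assms by auto
  have "(\<Sum>i<d + 1. s i (p[k := v] ! i)) = s k (p[k := v] ! k) + (\<Sum>i\<in>{..<d + 1} - {k}. s i (p[k := v] ! i))"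
    by (rule sum.remove[OF k(2,1)])
  also have "(\<Sum>i\<in>{..<d + 1} - {k}. s i (p[k := v] ! i)) = (\<Sum>i\<in>{..<d + 1} - {k}. s i (p ! i))"
    by (rule sum.cong) (use assms in auto)
  also have "\<dots> = (\<Sum>i<d + 1. s i (p ! i)) - s k (p ! k)"
    using sum.remove[OF k(2,1), of "\<lambda>i. s i (p ! i)"] by simp
  finally show ?thesis using assms by simp
qed

definition sg :: "nat \<Rightarrow> int" where "sg j = (if even j then 1 else - 1)"

lemma sg_simps [simp]: "sg (2 * i) = 1" "sg (Suc (2 * i)) = - 1" "(2 * i) div 2 = i" "Suc (2 * i) div 2 = i"
  by (auto simp: sg_def)

lemma mvZ_sg: "mvZ p j = p[j div 2 := p ! (j div 2) + sg j]"
  by (simp add: mvZ_def sg_def)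

lemma nsq_mvZ:
  assumes "p \<in> Zpts d" "j < nm d"
  shows "nsq d (mvZ p j) = nsq d p + (2 * real_of_int (sg j) * real_of_int (p ! (j div 2)) + 1)"
proof -
  have "nsq d (mvZ p j) = nsq d p + ((real_of_int (p ! (j div 2) + sg j))\<^sup>2 - (real_of_int (p ! (j div 2)))\<^sup>2)"
    unfolding nsq_def mvZ_sg
    by (rule sum_update[where s="\<lambda>i v. (real_of_int v)\<^sup>2"]) (use assms nm_div in \<open>auto simp: Zpts_def\<close>)
  also have "(real_of_int (p ! (j div 2) + sg j))\<^sup>2 - (real_of_int (p ! (j div 2)))\<^sup>2
      = 2 * real_of_int (sg j) * real_of_int (p ! (j div 2)) + 1"
    by (auto simp: sg_def power2_eq_square algebra_simps)
  finally show ?thesis .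
qed

lemma nsq_nonneg: "0 \<le> nsq d p"
  unfolding nsq_def by (intro sum_nonneg) auto

lemma nsq_ge: "i \<le> d \<Longrightarrow> (real_of_int (p ! i))\<^sup>2 \<le> nsq d p"
  unfolding nsq_def by (rule member_le_sum[where f="\<lambda>i. (real_of_int (p ! i))\<^sup>2"]) auto

lemma nsq_le_zbox:
  assumes "p \<in> zbox d R" shows "nsq d p \<le> (real d + 1) * (real R)\<^sup>2"
proof -
  have "(real_of_int (p ! i))\<^sup>2 \<le> (real R)\<^sup>2" if "i < d + 1" for i
  proof -
    have "\<bar>p ! i\<bar> \<le> int R" using assms that by (auto simp: zbox_def)
    then have "\<bar>real_of_int (p ! i)\<bar> \<le> \<bar>real R\<bar>" by linarith
    then show ?thesis by (simp only: abs_le_square_iff)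
  qed
  then have "nsq d p \<le> (\<Sum>i<d + 1. (real R)\<^sup>2)" unfolding nsq_def by (intro sum_mono) auto
  then show ?thesis by (simp add: algebra_simps)
qed

lemma superharmonic_Z:
  assumes "0 < b" "b < (real d - 1) / 2"
  obtains a where "2 \<le> a" "\<And>p. p \<in> Zpts d \<Longrightarrow>
     av (nm d) (\<lambda>j. (a + nsq d (mvZ p j)) powr (- b)) \<le> (a + nsq d p) powr (- b)"
proof -
  obtain a \<gamma> where a: "2 \<le> a" "0 < \<gamma>"
    and L: "\<And>s D t \<mu>. (\<And>i. i \<le> d \<Longrightarrow> 0 \<le> s i) \<Longrightarrow> t = a + (\<Sum>i<d + 1. s i) \<Longrightarrow>
      (\<And>i. i \<le> d \<Longrightarrow> (D (2 * i))\<^sup>2 + (D (2 * i + 1))\<^sup>2 \<le> 8 * s i + 2) \<Longrightarrow>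
      (\<Sum>j<2 * (d + 1). D j) \<ge> 2 * (real d + 1) - \<gamma> - \<mu> * t \<Longrightarrow>
      (\<Sum>j<2 * (d + 1). (t + D j) powr (- b)) \<le> 2 * (real d + 1) * t powr (- b) + b * t powr (- b - 1) * (\<mu> * t - \<gamma>)"
    using lyapunov[OF assms] by (smt (verit))
  show ?thesis
  proof (rule that[OF a(1)])
    fix p assume p: "p \<in> Zpts d"
    define D where "D j = 2 * real_of_int (sg j) * real_of_int (p ! (j div 2)) + 1" for j
    define t where "t = a + nsq d p"
    have t: "t = a + (\<Sum>i<d + 1. (real_of_int (p ! i))\<^sup>2)" by (simp only: t_def nsq_def)
    have "(\<Sum>j<2 * (d + 1). (t + D j) powr (- b))
       \<le> 2 * (real d + 1) * t powr (- b) + b * t powr (- b - 1) * (0 * t - \<gamma>)"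
    proof (rule L[OF _ t])
      have "D (2 * i) = 2 * real_of_int (p ! i) + 1" "D (2 * i + 1) = 1 - 2 * real_of_int (p ! i)" for i
        by (simp_all add: D_def)
      then show "(D (2 * i))\<^sup>2 + (D (2 * i + 1))\<^sup>2 \<le> 8 * (real_of_int (p ! i))\<^sup>2 + 2" for i
        by (simp only: power2_eq_square) (simp add: algebra_simps)
      have "(\<Sum>j<2 * (d + 1). D j) = 2 * (real d + 1)"
        unfolding sum_pairs by (simp add: D_def)
      then show "(\<Sum>j<2 * (d + 1). D j) \<ge> 2 * (real d + 1) - \<gamma> - 0 * t" using a by simp
    qed simp
    also have "\<dots> \<le> 2 * (real d + 1) * t powr (- b)" using a assms by simp
    finally have *: "(\<Sum>j<nm d. (t + D j) powr (- b)) \<le> real (nm d) * t powr (- b)"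
      by (simp add: nm_def algebra_simps)
    have "av (nm d) (\<lambda>j. (a + nsq d (mvZ p j)) powr (- b)) = av (nm d) (\<lambda>j. (t + D j) powr (- b))"
      by (rule av_cong) (simp add: nsq_mvZ[OF p] t_def D_def add.assoc)
    also have "\<dots> \<le> t powr (- b)" unfolding av_def using * nm_pos[of d] by (simp add: field_simps)
    finally show "av (nm d) (\<lambda>j. (a + nsq d (mvZ p j)) powr (- b)) \<le> (a + nsq d p) powr (- b)"
      by (simp add: t_def)
  qed
qed

text \<open>The test function is the positive part of \<open>2 - nsq d p / Q\<close>, squared. It is
  at least one on the box, lives on a box with radius of order \<open>r\<close>, and its discrete
  Laplacian is at most of order \<open>1 / r ^ 2\<close>; over \<open>r ^ (d + 1)\<close> points, up
  to constants, this gives the exponent \<open>d - 1\<close>.\<close>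

lemma ecap_zbox:
  assumes "1 \<le> d" "1 \<le> r"
  shows "cap d (zbox d r) \<le> 17 * (4 * real d + 5) ^ (d + 1) * real r ^ (d - 1)"
proof -
  interpret Z: rwalk "Zpts d" mvZ "nm d" flip by (rule rwalk_Z)
  define Q where "Q = (real d + 1) * (real r)\<^sup>2"
  have Q: "0 < Q" using assms by (simp add: Q_def)
  define f where "f p = (max 0 (2 - nsq d p / Q))\<^sup>2" for p
  define R where "R = 2 * (d + 1) * r"
  define B where "B = (8 * (real d + 1) * (real R)\<^sup>2 + 2 * (real d + 1)) / (real (nm d) * Q\<^sup>2)"
  have supp: "p \<in> zbox d (R - 1)" if p: "p \<in> Zpts d" "f p \<noteq> 0" for p
  proof -
    have "nsq d p < 2 * Q" using p(2) Q by (auto simp: f_def max_def field_simps split: if_splits)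
    also have "2 * Q \<le> (real (R - 1))\<^sup>2"
    proof -
      have "real (R - 1) = 2 * (real d + 1) * real r - 1" using assms by (simp add: R_def of_nat_diff algebra_simps)
      also have "\<dots> \<ge> (2 * real d + 1) * real r" using assms by (simp add: algebra_simps)
      finally have "((2 * real d + 1) * real r)\<^sup>2 \<le> (real (R - 1))\<^sup>2" by (intro power_mono) auto
      moreover have "2 * Q \<le> ((2 * real d + 1) * real r)\<^sup>2"
      proof -
        have "1 \<le> real d" "0 \<le> real d * real d" using assms(1) by auto
        then have "2 * (real d + 1) \<le> (2 * real d + 1)\<^sup>2" unfolding power2_eq_square by (simp only: algebra_simps)
        then show ?thesis unfolding Q_def power_mult_distrib by (metis mult.assoc mult_right_mono zero_le_power2)
      qed
      ultimately show ?thesis by linarith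
    qed
    finally have n: "nsq d p < (real (R - 1))\<^sup>2" .
    have "\<bar>p ! i\<bar> \<le> int (R - 1)" if "i \<le> d" for i
    proof -
      have "(real_of_int (p ! i))\<^sup>2 \<le> (real (R - 1))\<^sup>2" using nsq_ge[OF that, of p] n by linarith
      then have "\<bar>real_of_int (p ! i)\<bar> \<le> real (R - 1)" by (simp add: abs_le_square_iff[symmetric])
      then show ?thesis by linarith
    qed
    then show ?thesis using p by (auto simp: zbox_def Zpts_def)
  qed
  have R1: "1 \<le> R" using assms by (simp add: R_def)
  have nb: "mvZ p j \<in> zbox d R" if "p \<in> zbox d (R - 1)" "j < nm d" for p j
  proof -
    have l: "length p = d + 1" and b: "\<And>i. i \<le> d \<Longrightarrow> \<bar>p ! i\<bar> \<le> int (R - 1)"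
      using that(1) by (auto simp: zbox_def)
    have "\<bar>mvZ p j ! i\<bar> \<le> int R" if "i \<le> d" for i
      using b[OF that] R1 l that by (cases "i = j div 2") (auto simp: mvZ_sg sg_def)
    then show ?thesis using l by (simp add: zbox_def mvZ_sg)
  qed
  have "Z.ecap (zbox d r) \<le> real (card (zbox d R)) * B"
  proof (rule Z.ecap_le_cutoff[where \<chi>f=f])
    show "zbox d r \<subseteq> zbox d R" by (rule zbox_mono) (simp add: R_def)
    show "p \<in> zbox d R \<and> (\<forall>j<nm d. mvZ p j \<in> zbox d R)" if "p \<in> Zpts d" "f p \<noteq> 0" for p
      using supp[OF that] nb zbox_mono[of "R - 1" R d] by auto
    show "1 \<le> f p" if "p \<in> zbox d r" for p
    proof -
      have "nsq d p / Q \<le> 1" using nsq_le_zbox[OF that] Q by (simp add: Q_def)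
      then show ?thesis by (simp add: f_def)
    qed
    show "0 \<le> B" by (simp add: B_def)
    fix p assume p: "p \<in> zbox d R"
    then have pZ: "p \<in> Zpts d" using zbox_Zpts by blast
    define t where "t = nsq d p / Q"
    define D where "D j = (2 * real_of_int (sg j) * real_of_int (p ! (j div 2)) + 1) / Q" for j
    \<comment> \<open>Squaring removes the kink of the positive part: the cutoff lies below its
      first-order expansion plus the square of the increment, also across the boundary of its
      support.\<close>
    have step: "(max 0 (2 - (t + x)))\<^sup>2 \<le> (max 0 (2 - t))\<^sup>2 - 2 * max 0 (2 - t) * x + x\<^sup>2" for x :: real
    proof (cases "2 - t < 0")
      case True
      then have "\<bar>max 0 (2 - (t + x))\<bar> \<le> \<bar>x\<bar>" by (auto simp: max_def)
      then show ?thesis using True by (simp only: abs_le_square_iff) (simp add: max_def)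
    next
      case False
      have "\<bar>max 0 (2 - (t + x))\<bar> \<le> \<bar>2 - t - x\<bar>" by (auto simp: max_def)
      then have "(max 0 (2 - (t + x)))\<^sup>2 \<le> (2 - t - x)\<^sup>2" by (simp only: abs_le_square_iff)
      then show ?thesis using False by (simp add: max_def power2_eq_square algebra_simps)
    qed
    have "av (nm d) (\<lambda>j. f (mvZ p j)) = av (nm d) (\<lambda>j. (max 0 (2 - (t + D j)))\<^sup>2)"
      by (rule av_cong) (simp add: f_def nsq_mvZ[OF pZ] t_def D_def add_divide_distrib)
    also have "\<dots> \<le> av (nm d) (\<lambda>j. f p - 2 * max 0 (2 - t) * D j + (D j)\<^sup>2)"
      by (rule av_mono) (use step in \<open>simp add: f_def t_def\<close>)
    also have "\<dots> = f p - 2 * max 0 (2 - t) * (\<Sum>j<nm d. D j) / nm d + (\<Sum>j<nm d. (D j)\<^sup>2) / nm d"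
      unfolding av_def using nm_pos[of d]
      by (simp add: sum.distrib sum_subtractf sum_distrib_left[symmetric] add_divide_distrib diff_divide_distrib)
    also have "(\<Sum>j<nm d. D j) = real (nm d) / Q"
      unfolding nm_def sum_pairs by (simp add: D_def sum.distrib add_divide_distrib[symmetric] del: sum.lessThan_Suc)
    also have "(\<Sum>j<nm d. (D j)\<^sup>2) \<le> (8 * (real d + 1) * (real R)\<^sup>2 + 2 * (real d + 1)) / Q\<^sup>2"
    proof -
      have "(\<Sum>j<nm d. (D j)\<^sup>2) = (\<Sum>i<d + 1. (8 * (real_of_int (p ! i))\<^sup>2 + 2) / Q\<^sup>2)"
        unfolding nm_def sum_pairs
      proof (rule sum.cong[OF refl])
        fix i
        have "D (2 * i) = (2 * real_of_int (p ! i) + 1) / Q" "D (2 * i + 1) = (1 - 2 * real_of_int (p ! i)) / Q"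
          by (simp_all add: D_def)
        moreover have "(u + 1)\<^sup>2 + (1 - u)\<^sup>2 = 2 * u\<^sup>2 + 2" for u :: real
          by (simp add: power2_eq_square algebra_simps)
        ultimately show "(D (2 * i))\<^sup>2 + (D (2 * i + 1))\<^sup>2 = (8 * (real_of_int (p ! i))\<^sup>2 + 2) / Q\<^sup>2"
          by (simp only: power_divide add_divide_distrib[symmetric] power_mult_distrib) simp
      qed
      also have "\<dots> = (8 * nsq d p + 2 * (real d + 1)) / Q\<^sup>2"
        unfolding sum_divide_distrib[symmetric] nsq_def sum.distrib sum_distrib_left by simp
      also have "\<dots> \<le> (8 * (real d + 1) * (real R)\<^sup>2 + 2 * (real d + 1)) / Q\<^sup>2"
        using nsq_le_zbox[OF p] by (intro divide_right_mono add_right_mono) (simp_all only: mult.assoc, auto)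
      finally show ?thesis .
    qed
    then have "f p - 2 * max 0 (2 - t) * (real (nm d) / Q) / nm d + (\<Sum>j<nm d. (D j)\<^sup>2) / nm d
       \<le> f p - 0 + (8 * (real d + 1) * (real R)\<^sup>2 + 2 * (real d + 1)) / Q\<^sup>2 / nm d"
      using Q by (intro add_mono diff_mono divide_right_mono) auto
    finally show "av (nm d) (\<lambda>j. f (mvZ p j)) - f p \<le> B" by (simp add: B_def mult.commute)
  qed (use finite_zbox zbox_Zpts in auto)
  also have "real (card (zbox d R)) * B \<le> 17 * (4 * real d + 5) ^ (d + 1) * real r ^ (d - 1)"
  proof -
    have r: "1 \<le> real r" using assms by simp
    have "real (card (zbox d R)) = (4 * (real d + 1) * real r + 1) ^ (d + 1)"
      by (simp add: card_zbox R_def algebra_simps)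
    also have "\<dots> \<le> ((4 * real d + 5) * real r) ^ (d + 1)"
      by (rule power_mono) (use r in \<open>auto simp: algebra_simps\<close>)
    finally have 1: "real (card (zbox d R)) \<le> (4 * real d + 5) ^ (d + 1) * real r ^ (d + 1)"
      by (simp only: power_mult_distrib)
    have "B = (16 * (real d + 1)\<^sup>2 * (real r)\<^sup>2 + 1) / ((real d + 1)\<^sup>2 * (real r)\<^sup>2 * (real r)\<^sup>2)"
    proof -
      have "B = (2 * (real d + 1)) * (16 * (real d + 1)\<^sup>2 * (real r)\<^sup>2 + 1) / ((2 * (real d + 1)) * ((real d + 1)\<^sup>2 * (real r)\<^sup>2 * (real r)\<^sup>2))"
        unfolding B_def Q_def R_def nm_def by (simp add: power2_eq_square algebra_simps)
      then show ?thesis by simp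
    qed
    also have "\<dots> \<le> (17 * ((real d + 1)\<^sup>2 * (real r)\<^sup>2)) / ((real d + 1)\<^sup>2 * (real r)\<^sup>2 * (real r)\<^sup>2)"
    proof (rule divide_right_mono)
      have "1 \<le> (real d + 1)\<^sup>2 * (real r)\<^sup>2" using r by (intro mult_ge1_I one_le_power) auto
      then show "16 * (real d + 1)\<^sup>2 * (real r)\<^sup>2 + 1 \<le> 17 * ((real d + 1)\<^sup>2 * (real r)\<^sup>2)" by linarith
    qed simp
    also have "\<dots> = 17 / (real r)\<^sup>2" using r by (simp add: field_simps)
    finally have 2: "B \<le> 17 / (real r)\<^sup>2" .
    have "real (card (zbox d R)) * B \<le> (4 * real d + 5) ^ (d + 1) * real r ^ (d + 1) * (17 / (real r)\<^sup>2)"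
      by (rule mult_mono[OF 1 2]) (auto simp: B_def)
    also have "real r ^ (d + 1) = real r ^ (d - 1) * (real r)\<^sup>2"
      using assms(1) by (simp add: power_add[symmetric])
    finally have "real (card (zbox d R)) * B \<le>
      (4 * real d + 5) ^ (d + 1) * (real r ^ (d - 1) * (real r)\<^sup>2) * (17 / (real r)\<^sup>2)" .
    moreover have "x * (y * z) * (17 / z) = 17 * x * y" if "z \<noteq> 0" for x y z :: real
      using that by simp
    ultimately show ?thesis using r by simp
  qed
  finally show ?thesis by (simp only: cap_ecap)
qed

text \<open>The height above a slice is a positive harmonic function off the slice; it is glued to
  \<open>1 - F / c\<close> at height \<open>L\<close>.\<close>

lemma esc_disc:
  fixes s :: int and L :: nat
  assumes super: "\<And>p. p \<in> Zpts d \<Longrightarrow> av (nm d) (\<lambda>j. F (mvZ p j)) \<le> F p"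
    and F: "\<And>p. 0 \<le> F p" "0 < c" "\<And>p. p \<in> D \<Longrightarrow> c \<le> F p"
    and D: "D \<subseteq> {p \<in> Zpts d. p ! d = s}"
    and L: "1 \<le> L" "\<And>p. p \<in> Zpts d \<Longrightarrow> int L \<le> \<bar>p ! d - s\<bar> \<Longrightarrow> F p \<le> c / 2"
    and q: "q \<in> D"
  shows "1 / (4 * real L * (real d + 1)) \<le> rwalk.esc mvZ (nm d) D q"
proof -
  interpret Z: rwalk "Zpts d" mvZ "nm d" flip by (rule rwalk_Z)
  define x1 where "x1 p = \<bar>real_of_int (p ! d - s)\<bar> / (4 * real L)" for p :: "int list"
  define x2 where "x2 p = 1 - F p / c" for p
  \<comment> \<open>At height \<open>L\<close> the branch \<open>x1\<close> equals 1/4 while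
    \<open>x2\<close> is at least 1/2. The maximum is therefore \<open>x2\<close> there already, and
    dropping \<open>x1\<close> beyond keeps the function subharmonic.\<close>
  define x where "x p = (if \<bar>p ! d - s\<bar> \<le> int L then max (x1 p) (x2 p) else x2 p)" for p
  have m2: "{..<nm d} = insert (2 * d) (insert (2 * d + 1) {..<2 * d})" by (auto simp: nm_def)
  have height: "mvZ p (2 * d) ! d = p ! d + 1" "mvZ p (2 * d + 1) ! d = p ! d - 1"
     "j < 2 * d \<Longrightarrow> mvZ p j ! d = p ! d" if "p \<in> Zpts d" for p j
    using that by (auto simp: mvZ_sg Zpts_def nth_list_update sg_def)
  have avh: "av (nm d) (\<lambda>j. g (mvZ p j ! d)) = (g (p ! d + 1) + g (p ! d - 1) + 2 * real d * g (p ! d)) / real (nm d)"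
    if "p \<in> Zpts d" for p and g :: "int \<Rightarrow> real"
    unfolding av_def m2 using height[OF that] by simp
  have sub1: "x1 p \<le> av (nm d) (\<lambda>j. x1 (mvZ p j))" if "p \<in> Zpts d" for p
  proof -
    have "2 * \<bar>u\<bar> \<le> \<bar>u + 1\<bar> + \<bar>u - 1\<bar>" for u :: real by (auto simp: abs_if)
    from this[of "real_of_int (p ! d - s)"]
    have "2 * \<bar>real_of_int (p ! d - s)\<bar> \<le> \<bar>real_of_int (p ! d + 1 - s)\<bar> + \<bar>real_of_int (p ! d - 1 - s)\<bar>"
      by (simp add: algebra_simps)
    then have "real (nm d) * \<bar>real_of_int (p ! d - s)\<bar> \<le> \<bar>real_of_int (p ! d + 1 - s)\<bar> + \<bar>real_of_int (p ! d - 1 - s)\<bar> + 2 * real d * \<bar>real_of_int (p ! d - s)\<bar>"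
      by (simp add: nm_def algebra_simps)
    then have "\<bar>real_of_int (p ! d - s)\<bar> \<le> av (nm d) (\<lambda>j. \<bar>real_of_int (mvZ p j ! d - s)\<bar>)"
      unfolding avh[OF that, of "\<lambda>v. \<bar>real_of_int (v - s)\<bar>"]
      using nm_pos[of d] by (subst pos_le_divide_eq) (simp_all only: of_nat_0_less_iff mult.commute)
    then have "\<bar>real_of_int (p ! d - s)\<bar> * (1 / (4 * real L)) \<le> av (nm d) (\<lambda>j. \<bar>real_of_int (mvZ p j ! d - s)\<bar>) * (1 / (4 * real L))"
      by (rule mult_right_mono) simp
    then show ?thesis unfolding x1_def av_cmult_right[symmetric] by simp
  qed
  have sub2: "x2 p \<le> av (nm d) (\<lambda>j. x2 (mvZ p j))" if "p \<in> Zpts d" for p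
  proof -
    have "av (nm d) (\<lambda>j. x2 (mvZ p j)) = 1 - av (nm d) (\<lambda>j. F (mvZ p j)) / c"
      unfolding x2_def av_def using nm_pos[of d]
      by (simp add: sum_subtractf diff_divide_distrib sum_divide_distrib[symmetric] mult.commute)
    then show ?thesis using super[OF that] F(2) by (simp add: x2_def divide_right_mono)
  qed
  have x2x: "x2 p \<le> x p" for p by (simp add: x_def)
  have far: "x1 p \<le> x2 p" if "p \<in> Zpts d" "int L = \<bar>p ! d - s\<bar>" for p
  proof -
    have "\<bar>real_of_int (p ! d - s)\<bar> = real L" using that by linarith
    then have "x1 p = 1 / 4" using L(1) by (simp add: x1_def)
    moreover have "1 / 2 \<le> x2 p" using L(2)[of p] that F(2) by (simp add: x2_def field_simps)
    ultimately show ?thesis by simp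
  qed
  have "av (nm d) (\<lambda>j. x (mvZ q j)) \<le> Z.esc D q"
  proof (rule Z.subharmonic_le_esc)
    fix p assume p: "p \<in> Zpts d"
    show "x p \<le> 1"
    proof -
      have "x2 p \<le> 1" using F by (simp add: x2_def)
      moreover have "x1 p \<le> 1" if "\<bar>p ! d - s\<bar> \<le> int L"
      proof -
        have "\<bar>real_of_int (p ! d - s)\<bar> \<le> real L" using that by linarith
        then show ?thesis using L(1) by (simp add: x1_def field_simps)
      qed
      ultimately show ?thesis by (simp add: x_def)
    qed
    have x2: "x2 p \<le> av (nm d) (\<lambda>j. x (mvZ p j))"
      by (rule order_trans[OF sub2[OF p]]) (rule av_mono, rule x2x)
    show "x p \<le> av (nm d) (\<lambda>j. x (mvZ p j))"
    proof (cases "\<bar>p ! d - s\<bar> < int L")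
      case True
      have "\<bar>mvZ p j ! d - s\<bar> \<le> int L" if "j < nm d" for j
      proof -
        have "j < 2 * d \<or> j = 2 * d \<or> j = 2 * d + 1" using that by (auto simp: nm_def)
        then show ?thesis using True height[OF p] by auto
      qed
      then have "av (nm d) (\<lambda>j. x1 (mvZ p j)) \<le> av (nm d) (\<lambda>j. x (mvZ p j))"
        by (intro av_mono) (simp add: x_def)
      then show ?thesis using sub1[OF p] x2 True by (simp add: x_def)
    next
      case False
      then have "x p = x2 p" using far[OF p] by (auto simp: x_def)
      then show ?thesis using x2 by simp
    qed
  next
    fix p assume "p \<in> D"
    then have "x1 p = 0" "x2 p \<le> 0" using D F by (auto simp: x1_def x2_def)
    then show "x p \<le> 0" by (simp add: x_def)
  next
    show "q \<in> Zpts d" using q D by auto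
  qed
  moreover have "1 / (4 * real L * (real d + 1)) \<le> av (nm d) (\<lambda>j. x (mvZ q j))"
  proof -
    have qs: "q \<in> Zpts d" "q ! d = s" using q D by auto
    \<comment> \<open>From \<open>q\<close> only the two vertical moves leave the slice, each
      gaining \<open>1 / (4 * L)\<close>. Averaged over \<open>2 * (d + 1)\<close> moves this is the
      claimed bound.\<close>
    define g where "g v = (if v = s then 0 else 1 / (4 * real L))" for v
    have "av (nm d) (\<lambda>j. g (mvZ q j ! d)) = 1 / (4 * real L * (real d + 1))"
      unfolding avh[OF qs(1)] qs(2) using L(1) by (simp add: g_def nm_def field_simps)
    moreover have "g (mvZ q j ! d) \<le> x (mvZ q j)" if "j < nm d" for j
    proof -
      have j: "j < 2 * d \<or> j = 2 * d \<or> j = 2 * d + 1" using that by (auto simp: nm_def)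
      then have h: "\<bar>mvZ q j ! d - s\<bar> \<le> int L" using height[OF qs(1)] qs L(1) by auto
      have "g (mvZ q j ! d) = x1 (mvZ q j)" using j height[OF qs(1)] qs by (auto simp: g_def x1_def)
      then show ?thesis using h by (simp add: x_def)
    qed
    ultimately show ?thesis using av_mono[of "nm d" "\<lambda>j. g (mvZ q j ! d)" "\<lambda>j. x (mvZ q j)"] by simp
  qed
  ultimately show ?thesis by linarith
qed

section \<open>Green function of the cylinder\<close>

text \<open>The squared chord length on a circle of radius \<open>1 / w\<close>. It behaves like the
  square of \<open>x\<close> near zero and has period \<open>N\<close> for
  \<open>w = 2 * pi / N\<close>.\<close>

definition tsq :: "real \<Rightarrow> real \<Rightarrow> real" where
  "tsq w x = 2 / w\<^sup>2 * (1 - cos (w * x))"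

lemma tsq_nonneg: "0 \<le> tsq w x"
  unfolding tsq_def by simp

lemma one_minus_cos: "1 - cos w = 2 * (sin (w / 2))\<^sup>2" for w :: real
  using cos_double_sin[of "w / 2"] by simp

lemma one_minus_cos_le: "1 - cos w \<le> w\<^sup>2 / 2" for w :: real
proof -
  have "\<bar>sin (w / 2)\<bar> \<le> \<bar>w / 2\<bar>" by (rule abs_sin_x_le_abs_x)
  then have "(sin (w / 2))\<^sup>2 \<le> (w / 2)\<^sup>2" by (simp only: abs_le_square_iff)
  then show ?thesis by (simp add: one_minus_cos power_divide)
qed

text \<open>The increments obey the bounds for a plain square, except that the second difference
  shrinks away from zero. The loss \<open>w ^ 2 * tsq w x\<close> has the form
  \<open>\<mu> * t\<close> that \<open>lyapunov\<close> tolerates.\<close>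

lemma tsq_increments:
  fixes w x :: real
  assumes "0 < w"
  defines "P \<equiv> tsq w (x + 1) - tsq w x" and "M \<equiv> tsq w (x - 1) - tsq w x"
  shows "P\<^sup>2 + M\<^sup>2 \<le> 8 * tsq w x + 2" "P + M \<ge> 4 * (1 - cos w) / w\<^sup>2 - w\<^sup>2 * tsq w x"
proof -
  define \<theta> where "\<theta> = w * x"
  define h where "h = w / 2"
  have P: "P = 2 / w\<^sup>2 * (cos \<theta> - cos (\<theta> + w))" and M: "M = 2 / w\<^sup>2 * (cos \<theta> - cos (\<theta> - w))"
  proof -
    have "w * (x + 1) = \<theta> + w" "w * (x - 1) = \<theta> - w" by (simp_all add: \<theta>_def algebra_simps)
    then show "P = 2 / w\<^sup>2 * (cos \<theta> - cos (\<theta> + w))" "M = 2 / w\<^sup>2 * (cos \<theta> - cos (\<theta> - w))"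
      unfolding P_def M_def tsq_def \<theta>_def[symmetric] by (simp_all only: right_diff_distrib[symmetric]) simp_all
  qed
  have c1: "cos \<theta> - cos (\<theta> + w) = 2 * sin (\<theta> + h) * sin h"
    using cos_diff_cos[of \<theta> "\<theta> + w"] by (simp add: h_def field_simps)
  have c2: "cos \<theta> - cos (\<theta> - w) = - 2 * sin (\<theta> - h) * sin h"
  proof -
    have "cos \<theta> - cos (\<theta> - w) = 2 * sin ((\<theta> + (\<theta> - w)) / 2) * sin ((\<theta> - w - \<theta>) / 2)" by (rule cos_diff_cos)
    also have "(\<theta> + (\<theta> - w)) / 2 = \<theta> - h" by (simp add: h_def field_simps)
    also have "(\<theta> - w - \<theta>) / 2 = - h" by (simp add: h_def)
    finally show ?thesis by simp
  qed
  have sh: "(sin h)\<^sup>2 \<le> h\<^sup>2" using abs_sin_x_le_abs_x[of h] by (simp only: abs_le_square_iff)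
  have w2: "0 < w\<^sup>2" using assms(1) by simp
  have "P\<^sup>2 + M\<^sup>2 = (16 / w ^ 4) * (sin h)\<^sup>2 * ((sin (\<theta> + h))\<^sup>2 + (sin (\<theta> - h))\<^sup>2)"
    unfolding P M c1 c2
    by (simp add: power_mult_distrib power_divide power_mult[symmetric] distrib_left add_divide_distrib mult_ac)
  also have "(sin (\<theta> + h))\<^sup>2 + (sin (\<theta> - h))\<^sup>2 = 2 * ((sin \<theta>)\<^sup>2 * (cos h)\<^sup>2) + 2 * ((cos \<theta>)\<^sup>2 * (sin h)\<^sup>2)"
    unfolding sin_add sin_diff by (simp add: power2_eq_square algebra_simps)
  also have "(16 / w ^ 4) * (sin h)\<^sup>2 * \<dots> \<le> (16 / w ^ 4) * (w\<^sup>2 / 4) * (4 * (1 - cos \<theta>) + w\<^sup>2 / 2)"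
  proof (intro mult_mono mult_left_mono)
    show "(sin h)\<^sup>2 \<le> w\<^sup>2 / 4" using sh by (simp add: h_def power_divide)
    have "(sin \<theta>)\<^sup>2 * (cos h)\<^sup>2 \<le> (sin \<theta>)\<^sup>2 * 1" by (rule mult_left_mono) (auto simp: abs_square_le_1)
    moreover have "(sin \<theta>)\<^sup>2 \<le> 2 * (1 - cos \<theta>)"
    proof -
      have "(sin \<theta>)\<^sup>2 = (1 - cos \<theta>) * (1 + cos \<theta>)" by (simp add: sin_squared_eq power2_eq_square algebra_simps)
      also have "\<dots> \<le> (1 - cos \<theta>) * 2" using cos_le_one[of \<theta>] by (intro mult_left_mono) auto
      finally show ?thesis by simp
    qed
    moreover have "(cos \<theta>)\<^sup>2 * (sin h)\<^sup>2 \<le> 1 * h\<^sup>2" by (rule mult_mono) (use sh in \<open>auto simp: abs_square_le_1\<close>)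
    ultimately show "2 * ((sin \<theta>)\<^sup>2 * (cos h)\<^sup>2) + 2 * ((cos \<theta>)\<^sup>2 * (sin h)\<^sup>2) \<le> 4 * (1 - cos \<theta>) + w\<^sup>2 / 2"
      by (simp add: h_def power_divide)
  qed auto
  also have "\<dots> = 8 * tsq w x + 2"
    unfolding tsq_def \<theta>_def[symmetric] using assms(1) by (simp add: field_simps eval_nat_numeral)
  finally show "P\<^sup>2 + M\<^sup>2 \<le> 8 * tsq w x + 2" .
  have "P + M = 4 / w\<^sup>2 * (1 - cos w) * cos \<theta>"
    unfolding P M cos_add cos_diff distrib_left[symmetric]
    by (simp add: algebra_simps add_divide_distrib diff_divide_distrib)
  also have "cos \<theta> = 1 - w\<^sup>2 / 2 * tsq w x" unfolding tsq_def \<theta>_def using w2 by (simp add: field_simps)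
  also have "4 / w\<^sup>2 * (1 - cos w) * (1 - w\<^sup>2 / 2 * tsq w x) = 4 * (1 - cos w) / w\<^sup>2 - 2 * (1 - cos w) * tsq w x"
    using w2 by (simp add: field_simps)
  also have "\<dots> \<ge> 4 * (1 - cos w) / w\<^sup>2 - w\<^sup>2 * tsq w x"
    using mult_right_mono[OF one_minus_cos_le[of w] tsq_nonneg[of w x]] by linarith
  finally show "P + M \<ge> 4 * (1 - cos w) / w\<^sup>2 - w\<^sup>2 * tsq w x" by simp
qed

lemma tsq_mod:
  assumes "0 < N"
  shows "tsq (2 * pi / real N) (real_of_int (x mod int N - c)) = tsq (2 * pi / real N) (real_of_int (x - c))"
proof -
  let ?w = "2 * pi / real N"
  have "x - c = (x mod int N - c) + x div int N * int N" by simp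
  then have "real_of_int (x - c) = real_of_int (x mod int N - c) + real_of_int (x div int N) * real N"
    by (metis of_int_add of_int_mult of_int_of_nat_eq)
  then have "?w * real_of_int (x - c) = ?w * real_of_int (x mod int N - c) + real_of_int (x div int N) * (2 * of_real pi)"
    using assms by (simp add: field_simps)
  then show ?thesis unfolding tsq_def by (simp only: cos.plus_of_int)
qed

definition csq :: "nat \<Rightarrow> nat \<Rightarrow> int list \<Rightarrow> nat \<Rightarrow> int \<Rightarrow> real" where
  "csq d N c i x = (if i < d then tsq (2 * pi / real N) (real_of_int (x - c ! i)) else (real_of_int (x - c ! i))\<^sup>2)"

text \<open>Squared distance to \<open>c\<close> after embedding the torus as a product of circles,
  with the plain square in the vertical coordinate.\<close>

definition ccq :: "nat \<Rightarrow> nat \<Rightarrow> int list \<Rightarrow> int list \<Rightarrow> real" where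
  "ccq d N c p = (\<Sum>i<d + 1. csq d N c i (p ! i))"

definition mvi :: "nat \<Rightarrow> nat \<Rightarrow> int list \<Rightarrow> nat \<Rightarrow> int" where
  "mvi d N p j = (if j div 2 < d then (p ! (j div 2) + sg j) mod int N else p ! (j div 2) + sg j)"

lemma mvE_mvi: "mvE d N p j = p[j div 2 := mvi d N p j]"
  by (auto simp: mvE_def mvi_def Let_def sg_def)

lemma csq_mvi:
  assumes "0 < N"
  shows "csq d N c (j div 2) (mvi d N p j) = csq d N c (j div 2) (p ! (j div 2) + sg j)"
  using tsq_mod[OF assms, of "p ! (j div 2) + sg j" "c ! (j div 2)"] by (simp add: csq_def mvi_def)

lemma ccq_mvE:
  assumes "p \<in> Epts d N" "j < nm d" "0 < N"
  shows "ccq d N c (mvE d N p j) = ccq d N c p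
     + (csq d N c (j div 2) (p ! (j div 2) + sg j) - csq d N c (j div 2) (p ! (j div 2)))"
  unfolding ccq_def mvE_mvi csq_mvi[OF assms(3), symmetric]
  by (rule sum_update[where s="csq d N c"]) (use assms nm_div in \<open>auto simp: Epts_def\<close>)

lemma csq_nonneg: "0 \<le> csq d N c i x"
  by (simp add: csq_def tsq_nonneg)

text \<open>The power is superharmonic as long as \<open>a + ccq\<close> stays below
  \<open>\<gamma> / w ^ 2\<close>, that is, up to distances of order \<open>N\<close>. Farther out
  the curvature of the circles leaves an explicit positive error.\<close>

lemma av_ccq_powr:
  assumes b: "0 < b" "b < (real d - 1) / 2"
  obtains a \<gamma> N0 where "2 \<le> a" "0 < \<gamma>"
    "\<And>N c p. N0 \<le> N \<Longrightarrow> 0 < N \<Longrightarrow> p \<in> Epts d N \<Longrightarrow>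
      av (nm d) (\<lambda>j. (a + ccq d N c (mvE d N p j)) powr (- b)) \<le> (a + ccq d N c p) powr (- b)
        + b / real (nm d) * (a + ccq d N c p) powr (- b - 1) * ((2 * pi / real N)\<^sup>2 * (a + ccq d N c p) - \<gamma>)"
proof -
  obtain a \<gamma> where a: "2 \<le> a" "0 < \<gamma>"
    and L: "\<And>s D t \<mu>. (\<And>i. i \<le> d \<Longrightarrow> 0 \<le> s i) \<Longrightarrow> t = a + (\<Sum>i<d + 1. s i) \<Longrightarrow>
      (\<And>i. i \<le> d \<Longrightarrow> (D (2 * i))\<^sup>2 + (D (2 * i + 1))\<^sup>2 \<le> 8 * s i + 2) \<Longrightarrow>
      (\<Sum>j<2 * (d + 1). D j) \<ge> 2 * (real d + 1) - \<gamma> - \<mu> * t \<Longrightarrow>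
      (\<Sum>j<2 * (d + 1). (t + D j) powr (- b)) \<le> 2 * (real d + 1) * t powr (- b) + b * t powr (- b - 1) * (\<mu> * t - \<gamma>)"
    using lyapunov[OF b] by (smt (verit))
  \<comment> \<open>Each coordinate may fall short of the flat value 2 by
    \<open>\<gamma> / (d + 1)\<close>, which adds up to the defect \<open>\<gamma>\<close> allowed
    by \<open>lyapunov\<close>.\<close>
  have "((\<lambda>N. 4 * (1 - cos (2 * pi / real N)) / (2 * pi / real N)\<^sup>2) \<longlongrightarrow> 2) sequentially"
    by real_asymp (simp add: power2_eq_square field_simps)
  moreover have "2 - \<gamma> / real (d + 1) < 2" using a(2) by simp
  ultimately have "\<forall>\<^sub>F N in sequentially. 2 - \<gamma> / real (d + 1) < 4 * (1 - cos (2 * pi / real N)) / (2 * pi / real N)\<^sup>2"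
    by (rule order_tendstoD)
  then obtain N0 where N0: "\<And>N. N0 \<le> N \<Longrightarrow> 2 - \<gamma> / real (d + 1) < 4 * (1 - cos (2 * pi / real N)) / (2 * pi / real N)\<^sup>2"
    by (auto simp: eventually_sequentially)
  show ?thesis
  proof (rule that[OF a])
    fix N :: nat and c p assume N: "N0 \<le> N" "0 < N" and p: "p \<in> Epts d N"
    define w where "w = 2 * pi / real N"
    have w: "0 < w" using N by (simp add: w_def)
    define D where "D j = csq d N c (j div 2) (p ! (j div 2) + sg j) - csq d N c (j div 2) (p ! (j div 2))" for j
    define s where "s i = csq d N c i (p ! i)" for i
    define t where "t = a + ccq d N c p"
    have t: "t = a + (\<Sum>i<d + 1. s i)" by (simp only: t_def ccq_def s_def)
    have sn: "0 \<le> s i" for i by (simp add: s_def csq_nonneg)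
    have D: "D (2 * i) = csq d N c i (p ! i + 1) - s i" "D (2 * i + 1) = csq d N c i (p ! i - 1) - s i" for i
      by (simp_all add: D_def s_def)
    define k where "k = 4 * (1 - cos w) / w\<^sup>2"
    have k: "2 - \<gamma> / real (d + 1) \<le> k" using N0[OF N(1)] by (simp add: k_def w_def)
    have D1: "(D (2 * i))\<^sup>2 + (D (2 * i + 1))\<^sup>2 \<le> 8 * s i + 2 \<and> min k 2 - w\<^sup>2 * s i \<le> D (2 * i) + D (2 * i + 1)" for i
    proof (cases "i < d")
      case True
      define u where "u = real_of_int (p ! i - c ! i)"
      have "csq d N c i (p ! i + 1) = tsq w (u + 1)" "csq d N c i (p ! i - 1) = tsq w (u - 1)" "s i = tsq w u"
        using True by (simp_all add: csq_def w_def s_def u_def algebra_simps)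
      then have e: "D (2 * i) = tsq w (u + 1) - tsq w u" "D (2 * i + 1) = tsq w (u - 1) - tsq w u" "s i = tsq w u"
        unfolding D by simp_all
      show ?thesis unfolding e using tsq_increments[OF w, of u] unfolding k_def[symmetric] by linarith
    next
      case False
      define u where "u = real_of_int (p ! i - c ! i)"
      have si: "s i = u\<^sup>2" "D (2 * i) = 2 * u + 1" "D (2 * i + 1) = 1 - 2 * u"
        using False by (simp_all only: D) (simp_all add: s_def csq_def u_def power2_eq_square algebra_simps)
      have "0 \<le> w\<^sup>2 * s i" using sn by simp
      moreover have "(2 * u + 1)\<^sup>2 + (1 - 2 * u)\<^sup>2 = 8 * u\<^sup>2 + 2" by (simp add: power2_eq_square algebra_simps)
      moreover have "min k 2 \<le> 2" by simp
      ultimately show ?thesis unfolding si by (intro conjI; linarith)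
    qed
    have "(\<Sum>j<2 * (d + 1). (t + D j) powr (- b))
       \<le> 2 * (real d + 1) * t powr (- b) + b * t powr (- b - 1) * (w\<^sup>2 * t - \<gamma>)"
    proof (rule L[OF sn t])
      show "(D (2 * i))\<^sup>2 + (D (2 * i + 1))\<^sup>2 \<le> 8 * s i + 2" for i using D1 by simp
      have "2 * (real d + 1) - \<gamma> - w\<^sup>2 * t \<le> (\<Sum>i<d + 1. 2 - \<gamma> / real (d + 1)) - w\<^sup>2 * (\<Sum>i<d + 1. s i)"
      proof -
        have "(\<Sum>i<d + 1. 2 - \<gamma> / real (d + 1)) = real (d + 1) * (2 - \<gamma> / real (d + 1))" by simp
        also have "\<dots> = 2 * (real d + 1) - \<gamma>" by (simp add: field_simps)
        finally have e: "(\<Sum>i<d + 1. 2 - \<gamma> / real (d + 1)) = 2 * (real d + 1) - \<gamma>" .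
        have "w\<^sup>2 * (\<Sum>i<d + 1. s i) \<le> w\<^sup>2 * t" unfolding t using a by (intro mult_left_mono) auto
        then show ?thesis unfolding e by simp
      qed
      also have "\<dots> = (\<Sum>i<d + 1. (2 - \<gamma> / real (d + 1)) - w\<^sup>2 * s i)"
        by (simp only: sum_subtractf sum_distrib_left)
      also have "\<dots> \<le> (\<Sum>i<d + 1. D (2 * i) + D (2 * i + 1))"
      proof (rule sum_mono)
        fix i
        have "2 - \<gamma> / real (d + 1) \<le> min k 2" using k a by simp
        then show "(2 - \<gamma> / real (d + 1)) - w\<^sup>2 * s i \<le> D (2 * i) + D (2 * i + 1)" using D1[of i] by linarith
      qed
      also have "\<dots> = (\<Sum>j<2 * (d + 1). D j)" by (rule sum_pairs[symmetric])
      finally show "(\<Sum>j<2 * (d + 1). D j) \<ge> 2 * (real d + 1) - \<gamma> - w\<^sup>2 * t" .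
    qed
    then have *: "(\<Sum>j<nm d. (t + D j) powr (- b)) \<le> real (nm d) * t powr (- b) + b * t powr (- b - 1) * (w\<^sup>2 * t - \<gamma>)"
      by (simp add: nm_def algebra_simps)
    have "av (nm d) (\<lambda>j. (a + ccq d N c (mvE d N p j)) powr (- b)) = (\<Sum>j<nm d. (t + D j) powr (- b)) / real (nm d)"
      unfolding av_def[symmetric] by (rule av_cong) (simp add: ccq_mvE[OF p _ N(2)] t_def D_def add.assoc)
    also have "\<dots> \<le> (real (nm d) * t powr (- b) + b * t powr (- b - 1) * (w\<^sup>2 * t - \<gamma>)) / real (nm d)"
      by (rule divide_right_mono[OF *]) simp
    also have "\<dots> = t powr (- b) + b / real (nm d) * t powr (- b - 1) * (w\<^sup>2 * t - \<gamma>)"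
      using nm_pos[of d] by (simp add: add_divide_distrib)
    finally show "av (nm d) (\<lambda>j. (a + ccq d N c (mvE d N p j)) powr (- b)) \<le> (a + ccq d N c p) powr (- b)
        + b / real (nm d) * (a + ccq d N c p) powr (- b - 1) * ((2 * pi / real N)\<^sup>2 * (a + ccq d N c p) - \<gamma>)"
      by (simp only: t_def w_def)
  qed
qed

lemma height_mvE:
  assumes "p \<in> Epts d N"
  shows "mvE d N p (2 * d) ! d = p ! d + 1" "mvE d N p (2 * d + 1) ! d = p ! d - 1"
     "j < 2 * d \<Longrightarrow> mvE d N p j ! d = p ! d"
  using assms by (auto simp: mvE_mvi mvi_def Epts_def nth_list_update sg_def)

lemma av_height_mvE:
  assumes "p \<in> Epts d N"
  shows "av (nm d) (\<lambda>j. g (mvE d N p j ! d)) = (g (p ! d + 1) + g (p ! d - 1) + 2 * real d * g (p ! d)) / real (nm d)"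
proof -
  have m2: "{..<nm d} = insert (2 * d) (insert (2 * d + 1) {..<2 * d})" by (auto simp: nm_def)
  show ?thesis unfolding av_def m2 using height_mvE[OF assms] by simp
qed

lemma height_mvE_le:
  assumes "p \<in> Epts d N" "j < nm d" shows "\<bar>mvE d N p j ! d - p ! d\<bar> \<le> 1"
proof -
  have "j < 2 * d \<or> j = 2 * d \<or> j = 2 * d + 1" using assms(2) by (auto simp: nm_def)
  then show ?thesis using height_mvE[OF assms(1)] by auto
qed

text \<open>The power of \<open>ccq\<close> fails to be superharmonic only at distances of order
  \<open>N\<close>. The squared height grows by a fixed amount per step, so \<open>e\<close> times
  the square of \<open>h\<close> minus that of the height has constant negative drift and repairs
  the failure; its size produces the factor with \<open>h / N\<close>.\<close>

lemma green_cylinder: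
  assumes b: "0 < b" "b < (real d - 1) / 2"
  obtains C N0 where "0 < C"
    "\<And>N h c p U n. N0 \<le> N \<Longrightarrow> 0 < N \<Longrightarrow> p \<in> Epts d N \<Longrightarrow> c \<in> Epts d N \<Longrightarrow> \<bar>p ! d\<bar> < int h \<Longrightarrow> U \<subseteq> {p. \<bar>p ! d\<bar> < int h} \<Longrightarrow>
       (real N)\<^sup>2 / 64 \<le> ccq d N c p \<Longrightarrow>
       rwalk.vis (mvE d N) (nm d) U (\<lambda>p. if p = c then 1 else 0) n p \<le> C * real N powr (- 2 * b) * (1 + (real h / real N)\<^sup>2)"
proof -
  obtain a \<gamma> N1 where a: "2 \<le> a" "0 < \<gamma>"
    and S: "\<And>N c p. N1 \<le> N \<Longrightarrow> 0 < N \<Longrightarrow> p \<in> Epts d N \<Longrightarrow>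
      av (nm d) (\<lambda>j. (a + ccq d N c (mvE d N p j)) powr (- b)) \<le> (a + ccq d N c p) powr (- b)
        + b / real (nm d) * (a + ccq d N c p) powr (- b - 1) * ((2 * pi / real N)\<^sup>2 * (a + ccq d N c p) - \<gamma>)"
    using av_ccq_powr[OF b] by metis
  have "((\<lambda>N. (2 * pi / real N)\<^sup>2 * a) \<longlongrightarrow> 0) sequentially" by real_asymp
  then have "\<forall>\<^sub>F N in sequentially. (2 * pi / real N)\<^sup>2 * a < \<gamma> / 2"
    by (rule order_tendstoD) (use a in simp)
  then obtain N2 where N2: "\<And>N. N2 \<le> N \<Longrightarrow> (2 * pi / real N)\<^sup>2 * a < \<gamma> / 2"
    by (auto simp: eventually_sequentially)
  \<comment> \<open>Normalises the drift at \<open>c\<close> to -1, after half of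
    \<open>\<gamma>\<close> has been given up to the term \<open>w ^ 2 * a\<close>.\<close>
  define C1 where "C1 = real (nm d) * 2 / (b * \<gamma> * a powr (- b - 1))"
  define C2 where "C2 = b / 2 * \<gamma> powr (- b) * (2 * pi) powr (2 + 2 * b)"
  have C1: "0 < C1" using a b nm_pos[of d] by (simp add: C1_def)
  have C2: "0 < C2" using a b by (simp add: C2_def)
  show ?thesis
  proof (rule that[of "C1 * (64 powr b + C2)" "max N1 N2"])
    show "0 < C1 * (64 powr b + C2)" using C1 C2 by (simp add: add_pos_pos)
    fix N h :: nat and c p U n
    assume N: "max N1 N2 \<le> N" "0 < N" and p: "p \<in> Epts d N" and c: "c \<in> Epts d N" and ph: "\<bar>p ! d\<bar> < int h"
      and U: "U \<subseteq> {p. \<bar>p ! d\<bar> < int h}" and far: "(real N)\<^sup>2 / 64 \<le> ccq d N c p"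
    interpret E: rwalk "Epts d N" "mvE d N" "nm d" flip by (rule rwalk_E[OF N(2)])
    define w where "w = 2 * pi / real N"
    have w: "0 < w" using N by (simp add: w_def)
    define t where "t p = a + ccq d N c p" for p
    have tpos: "a \<le> t p" for p unfolding t_def ccq_def using csq_nonneg by (simp add: sum_nonneg)
    \<comment> \<open>Without its helpful part \<open>- \<gamma>\<close> the error is a multiple of
      \<open>t powr (- b)\<close>. This decreases in \<open>t\<close>, and the error is positive
      only beyond \<open>t = \<gamma> / w ^ 2\<close>.\<close>
    define e where "e = b / 2 * w\<^sup>2 * (\<gamma> / w\<^sup>2) powr (- b)"
    have e: "0 \<le> e" using b by (simp add: e_def)
    have epos: "b / 2 * t p powr (- b - 1) * (w\<^sup>2 * t p - \<gamma>) \<le> e" for p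
    proof (cases "w\<^sup>2 * t p \<le> \<gamma>")
      case True
      then have "b / 2 * t p powr (- b - 1) * (w\<^sup>2 * t p - \<gamma>) \<le> 0" using b by (intro mult_nonneg_nonpos) auto
      then show ?thesis using e by simp
    next
      case False
      have tp: "0 < t p" using tpos[of p] a by simp
      have "b / 2 * t p powr (- b - 1) * (w\<^sup>2 * t p - \<gamma>) \<le> b / 2 * t p powr (- b - 1) * (w\<^sup>2 * t p)"
        using b a by (intro mult_left_mono) auto
      also have "\<dots> = b / 2 * w\<^sup>2 * (t p powr (- b - 1) * t p)" by simp
      also have "t p powr (- b - 1) * t p = t p powr (- b)" using tp by (simp add: powr_diff)
      also have "b / 2 * w\<^sup>2 * t p powr (- b) \<le> e" unfolding e_def
      proof (intro mult_left_mono powr_mono2')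
        show "\<gamma> / w\<^sup>2 \<le> t p" using False w by (simp add: field_simps)
      qed (use b a w in auto)
      finally show ?thesis .
    qed
    define \<psi> where "\<psi> p = C1 * (t p powr (- b) + e * ((real h)\<^sup>2 - (real_of_int (p ! d))\<^sup>2))" for p
    have avz: "av (nm d) (\<lambda>j. (real_of_int (mvE d N p j ! d))\<^sup>2) = (real_of_int (p ! d))\<^sup>2 + 2 / real (nm d)" if "p \<in> Epts d N" for p
      unfolding av_height_mvE[OF that, of "\<lambda>v. (real_of_int v)\<^sup>2"]
      by (simp add: nm_def power2_eq_square field_simps)
    have "E.vis U (\<lambda>p. if p = c then 1 else 0) n p \<le> \<psi> p"
    proof (rule E.vis_super[where B="{p. \<bar>p ! d\<bar> < int h}"])
      fix q assume q: "q \<in> Epts d N" "q \<in> {p. \<bar>p ! d\<bar> < int h}"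
      have "av (nm d) (\<lambda>j. \<psi> (mvE d N q j)) = C1 * (av (nm d) (\<lambda>j. t (mvE d N q j) powr (- b)) + e * ((real h)\<^sup>2 - av (nm d) (\<lambda>j. (real_of_int (mvE d N q j ! d))\<^sup>2)))"
      proof -
        have "av (nm d) (\<lambda>j. (real h)\<^sup>2 - (real_of_int (mvE d N q j ! d))\<^sup>2) = (real h)\<^sup>2 - av (nm d) (\<lambda>j. (real_of_int (mvE d N q j ! d))\<^sup>2)"
          unfolding av_def using nm_pos[of d] by (simp add: sum_subtractf diff_divide_distrib)
        then show ?thesis unfolding \<psi>_def av_cmult av_add by simp
      qed
      also have "\<dots> = C1 * (av (nm d) (\<lambda>j. t (mvE d N q j) powr (- b)) + e * ((real h)\<^sup>2 - (real_of_int (q ! d))\<^sup>2 - 2 / real (nm d)))"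
        by (simp only: avz[OF q(1)] diff_diff_eq)
      also have "\<dots> \<le> C1 * (t q powr (- b) + b / real (nm d) * t q powr (- b - 1) * (w\<^sup>2 * t q - \<gamma>)
           + e * ((real h)\<^sup>2 - (real_of_int (q ! d))\<^sup>2 - 2 / real (nm d)))"
        using S[OF _ N(2) q(1), of c] N(1) C1 by (intro mult_left_mono add_right_mono) (auto simp: t_def w_def)
      also have "\<dots> = \<psi> q + C1 * 2 / real (nm d) * (b / 2 * t q powr (- b - 1) * (w\<^sup>2 * t q - \<gamma>) - e)"
      proof -
        have "C1 * (T + b / M * P * W + e * (H - 2 / M)) = C1 * (T + e * H) + C1 * 2 / M * (b / 2 * P * W - e)"
          for T M P W H :: real
          by (cases "M = 0") (simp_all add: field_simps)
        then show ?thesis unfolding \<psi>_def by simp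
      qed
      also have "\<dots> \<le> \<psi> q - (if q = c then 1 else 0)"
      proof (cases "q = c")
        case True
        have "csq d N c i (c ! i) = 0" for i by (simp add: csq_def tsq_def)
        then have tc: "t q = a" unfolding t_def ccq_def True by simp
        have "w\<^sup>2 * a - \<gamma> \<le> - (\<gamma> / 2)" using N2[of N] N(1) by (simp add: w_def)
        then have "b / 2 * a powr (- b - 1) * (w\<^sup>2 * a - \<gamma>) \<le> b / 2 * a powr (- b - 1) * (- (\<gamma> / 2))"
          using b by (intro mult_left_mono) auto
        also have "\<dots> = - (b * \<gamma> * a powr (- b - 1) / 4)" by simp
        finally have "b / 2 * t q powr (- b - 1) * (w\<^sup>2 * t q - \<gamma>) - e \<le> - (b * \<gamma> * a powr (- b - 1) / 4)"
          using e unfolding tc by linarith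
        then have "C1 * 2 / real (nm d) * (b / 2 * t q powr (- b - 1) * (w\<^sup>2 * t q - \<gamma>) - e) \<le> C1 * 2 / real (nm d) * (- (b * \<gamma> * a powr (- b - 1) / 4))"
          using C1 by (intro mult_left_mono) auto
        also have "\<dots> = - 1" unfolding C1_def using a b nm_pos[of d] by simp
        finally show ?thesis using True by simp
      next
        case False
        have "b / 2 * t q powr (- b - 1) * (w\<^sup>2 * t q - \<gamma>) - e \<le> 0" using epos[of q] by linarith
        then have "C1 * 2 / real (nm d) * (b / 2 * t q powr (- b - 1) * (w\<^sup>2 * t q - \<gamma>) - e) \<le> 0"
          using C1 by (intro mult_nonneg_nonpos) auto
        then show ?thesis using False by simp
      qed
      finally show "(if q = c then 1 else 0) + av (nm d) (\<lambda>j. \<psi> (mvE d N q j)) \<le> \<psi> q" by simp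
      fix j assume j: "j < nm d"
      have "\<bar>mvE d N q j ! d\<bar> \<le> int h" using height_mvE_le[OF q(1) j] q(2) by auto
      then have "\<bar>real_of_int (mvE d N q j ! d)\<bar> \<le> \<bar>real h\<bar>" by linarith
      then have "(real_of_int (mvE d N q j ! d))\<^sup>2 \<le> (real h)\<^sup>2" by (simp only: abs_le_square_iff)
      then show "0 \<le> \<psi> (mvE d N q j)" unfolding \<psi>_def using C1 e by simp
    qed (use U p ph in auto)
    also have "\<psi> p \<le> C1 * (64 powr b * real N powr (- 2 * b) + C2 * real N powr (- 2 * b) * (real h / real N)\<^sup>2)"
      unfolding \<psi>_def
    proof (intro mult_left_mono add_mono)
      have "t p powr (- b) \<le> ((real N)\<^sup>2 / 64) powr (- b)"
        by (rule powr_mono2') (use b N far a in \<open>auto simp: t_def\<close>)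
      also have "\<dots> = 64 powr b * real N powr (- 2 * b)"
        using N by (simp add: powr_divide powr_powr powr_minus field_simps flip: powr_numeral)
      finally show "t p powr (- b) \<le> 64 powr b * real N powr (- 2 * b)" .
      have "e = C2 * real N powr (- 2 * b) / (real N)\<^sup>2"
      proof -
        have "(\<gamma> / w\<^sup>2) powr (- b) = \<gamma> powr (- b) * w powr (2 * b)"
          using w a by (simp add: powr_divide powr_powr powr_minus field_simps flip: powr_numeral)
        then have "e = b / 2 * \<gamma> powr (- b) * (w powr 2 * w powr (2 * b))" using w by (simp add: e_def powr_numeral)
        also have "w powr 2 * w powr (2 * b) = w powr (2 + 2 * b)" by (simp add: powr_add)
        also have "\<dots> = (2 * pi) powr (2 + 2 * b) / real N powr (2 + 2 * b)" using N by (simp add: w_def powr_divide)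
        also have "real N powr (2 + 2 * b) = (real N)\<^sup>2 * real N powr (2 * b)" using N by (simp add: powr_add powr_numeral)
        finally show ?thesis by (simp add: C2_def powr_minus field_simps)
      qed
      then have e': "e = C2 * real N powr (- 2 * b) / (real N)\<^sup>2" .
      have "e * ((real h)\<^sup>2 - (real_of_int (p ! d))\<^sup>2) \<le> C2 * real N powr (- 2 * b) / (real N)\<^sup>2 * (real h)\<^sup>2"
      proof -
        have "C2 * real N powr (- 2 * b) / (real N)\<^sup>2 * ((real h)\<^sup>2 - (real_of_int (p ! d))\<^sup>2) \<le> C2 * real N powr (- 2 * b) / (real N)\<^sup>2 * (real h)\<^sup>2"
          using C2 by (intro mult_left_mono) auto
        then show ?thesis unfolding e' .
      qed
      then show "e * ((real h)\<^sup>2 - (real_of_int (p ! d))\<^sup>2) \<le> C2 * real N powr (- 2 * b) * (real h / real N)\<^sup>2"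
        by (simp add: power_divide)
    qed (use C1 in auto)
    also have "\<dots> \<le> C1 * (64 powr b + C2) * real N powr (- 2 * b) * (1 + (real h / real N)\<^sup>2)"
    proof -
      have "64 powr b * x + C2 * x * y \<le> (64 powr b + C2) * x * (1 + y)" if "0 \<le> x" "0 \<le> y" for x y
        using that C2 by (simp add: algebra_simps)
      from this[of "real N powr (- 2 * b)" "(real h / real N)\<^sup>2"] show ?thesis
        using C1 by (simp add: mult.assoc)
    qed
    finally show "E.vis U (\<lambda>p. if p = c then 1 else 0) n p \<le> C1 * (64 powr b + C2) * real N powr (- 2 * b) * (1 + (real h / real N)\<^sup>2)" .
  qed
qed

section \<open>Mixing\<close>

text \<open>A bounded convex sequence decreases. Adding up the slopes that convexity with rate
  \<open>l\<close> forces on \<open>L\<close> steps gives a drop of at least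
  \<open>l * L ^ 2 * f (a + 2 * L)\<close>, so every \<open>2 * L\<close> steps divide
  \<open>f\<close> by at least 4.\<close>

lemma convex_decay:
  fixes f :: "nat \<Rightarrow> real"
  assumes f: "\<And>s. 0 \<le> f s" "\<And>s. f s \<le> B" and l: "0 < l"
    and conv: "\<And>s. l * f (Suc s) \<le> f (Suc (Suc s)) + f s - 2 * f (Suc s)"
    and L: "4 \<le> l * (real L)\<^sup>2"
  shows "f (2 * L * k) \<le> B / 4 ^ k"
proof -
  have dec: "f (Suc s) \<le> f s" for s
  proof (rule ccontr)
    assume "\<not> f (Suc s) \<le> f s"
    then have D: "0 < f (Suc s) - f s" by simp
    have step: "f (Suc s) - f s \<le> f (Suc (s + k)) - f (s + k)" for k
    proof (induction k)
      case (Suc k)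
      have "0 \<le> l * f (Suc (s + k))" using l f by simp
      then show ?case using conv[of "s + k"] Suc by simp
    qed simp
    have "f s + real k * (f (Suc s) - f s) \<le> f (s + k)" for k
    proof (induction k)
      case (Suc k) then show ?case using step[of k] by (simp add: algebra_simps)
    qed simp
    then have le: "real k * (f (Suc s) - f s) \<le> B" for k
      using f(1)[of s] f(2)[of "s + k"] by (smt (verit))
    obtain k where "B < real k * (f (Suc s) - f s)" using ex_less_of_nat_mult[OF D] by blast
    then show False using le[of k] by simp
  qed
  have anti: "f t \<le> f s" if "s \<le> t" for s t
    by (rule lift_Suc_antimono_le[of f, OF dec that])
  have *: "f s - f (Suc s) \<ge> real i * l * f (s + i)" for s i
  proof (induction i arbitrary: s)
    case 0 then show ?case using dec by simp
  next
    case (Suc i)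
    have "l * f (s + Suc i) \<le> l * f (Suc s)" using l anti[of "Suc s" "s + Suc i"] by (intro mult_left_mono) auto
    then show ?case using Suc[of "Suc s"] conv[of s] by (simp add: algebra_simps)
  qed
  have quarter: "f (a + 2 * L) \<le> f a / 4" for a
  proof -
    have s: "real L * l * f (a + 2 * L) \<le> f (a + i) - f (a + Suc i)" if "i < L" for i
    proof -
      have "real L * l * f (a + 2 * L) \<le> real L * l * f (a + i + L)"
        using l that by (intro mult_left_mono anti) auto
      then show ?thesis using *[of L "a + i"] by simp
    qed
    have "real j * (real L * l * f (a + 2 * L)) \<le> f a - f (a + j)" if "j \<le> L" for j
      using that
    proof (induction j)
      case (Suc j) then show ?case using s[of j] by (simp add: algebra_simps)
    qed simp
    from this[of L] have "l * (real L)\<^sup>2 * f (a + 2 * L) \<le> f a - f (a + L)"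
      by (simp add: power2_eq_square algebra_simps)
    moreover have "4 * f (a + 2 * L) \<le> l * (real L)\<^sup>2 * f (a + 2 * L)"
      by (rule mult_right_mono[OF L f(1)])
    ultimately show ?thesis using f(1)[of "a + L"] by simp
  qed
  show ?thesis
  proof (induction k)
    case 0 then show ?case using f by simp
  next
    case (Suc k)
    have "f (2 * L * Suc k) \<le> f (2 * L * k) / 4" using quarter[of "2 * L * k"] by (simp add: algebra_simps)
    also have "\<dots> \<le> B / 4 ^ Suc k" using Suc by simp
    finally show ?case .
  qed
qed

definition slice :: "nat \<Rightarrow> nat \<Rightarrow> int \<Rightarrow> int list set" where
  "slice d N z = {p \<in> Epts d N. p ! d = z}"

lemma slice_eq: "slice d N z = (\<lambda>ys. ys @ [z]) ` {ys. set ys \<subseteq> {0..<int N} \<and> length ys = d}"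
proof (intro set_eqI iffI)
  fix p assume p: "p \<in> slice d N z"
  then have l: "length p = d + 1" "p ! d = z" by (auto simp: slice_def Epts_def)
  then have "p \<noteq> []" by auto
  then have "p = butlast p @ [last p]" by simp
  moreover have "last p = z" using l by (simp add: last_conv_nth \<open>p \<noteq> []\<close>)
  moreover have "set (butlast p) \<subseteq> {0..<int N}"
    using p l by (auto simp: slice_def Epts_def in_set_conv_nth nth_butlast)
  ultimately show "p \<in> (\<lambda>ys. ys @ [z]) ` {ys. set ys \<subseteq> {0..<int N} \<and> length ys = d}"
    using l by (auto intro!: image_eqI[of _ _ "butlast p"])
next
  fix p assume "p \<in> (\<lambda>ys. ys @ [z]) ` {ys. set ys \<subseteq> {0..<int N} \<and> length ys = d}"
  then obtain ys where ys: "p = ys @ [z]" "set ys \<subseteq> {0..<int N}" "length ys = d" by auto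
  have "ys ! i \<in> {0..<int N}" if "i < d" for i using ys that by (meson nth_mem subsetD)
  then show "p \<in> slice d N z" using ys by (auto simp: slice_def Epts_def nth_append)
qed

lemma finite_slice: "finite (slice d N z)"
  unfolding slice_eq by (intro finite_imageI finite_lists_length_eq) simp

lemma card_slice: "card (slice d N z) = N ^ d"
  unfolding slice_eq by (subst card_image) (auto simp: inj_on_def card_lists_length_eq)

context
  fixes d N :: nat
  assumes N: "0 < N"
begin

interpretation E: rwalk "Epts d N" "mvE d N" "nm d" flip by (rule rwalk_E[OF N])

lemma slice_Epts: "p \<in> slice d N z \<Longrightarrow> p \<in> Epts d N"
  by (simp add: slice_def)

lemma nm_lateral: "j < 2 * d \<Longrightarrow> j < nm d" "2 * d < nm d" "2 * d + 1 < nm d"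
  by (auto simp: nm_def)

lemma flip_lateral: "j < 2 * d \<Longrightarrow> flip j < 2 * d" "flip (2 * d) = 2 * d + 1" "flip (2 * d + 1) = 2 * d"
  "flip (Suc (2 * d)) = 2 * d"
  by (auto simp: flip_less) (auto simp: flip_def)

lemma mv_slice:
  assumes "p \<in> slice d N z"
  shows "j < 2 * d \<Longrightarrow> mvE d N p j \<in> slice d N z" "mvE d N p (2 * d) \<in> slice d N (z + 1)"
    "mvE d N p (2 * d + 1) \<in> slice d N (z - 1)"
  using E.closed[OF slice_Epts[OF assms]] height_mvE[OF slice_Epts[OF assms]] nm_lateral assms
  unfolding slice_def by auto

lemma sum_slice_lateral: "j < 2 * d \<Longrightarrow> (\<Sum>p\<in>slice d N z. g (mvE d N p j)) = (\<Sum>p\<in>slice d N z. g p)"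
  by (rule sum.reindex_bij_witness[where i="\<lambda>p. mvE d N p (flip j)" and j="\<lambda>p. mvE d N p j"])
     (auto simp: mv_slice flip_lateral E.mv_iv E.mv_iv' slice_Epts nm_lateral)

lemma sum_slice_up: "(\<Sum>p\<in>slice d N z. g (mvE d N p (2 * d))) = (\<Sum>p\<in>slice d N (z + 1). g p)"
proof (rule sum.reindex_bij_witness[where i="\<lambda>p. mvE d N p (2 * d + 1)" and j="\<lambda>p. mvE d N p (2 * d)"])
  fix p assume "p \<in> slice d N z"
  then show "mvE d N (mvE d N p (2 * d)) (2 * d + 1) = p" "mvE d N p (2 * d) \<in> slice d N (z + 1)"
    using E.mv_iv[of p "2 * d"] nm_lateral by (auto simp: slice_Epts flip_lateral mv_slice)
next
  fix p assume p: "p \<in> slice d N (z + 1)"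
  then show "mvE d N (mvE d N p (2 * d + 1)) (2 * d) = p"
    using E.mv_iv[of p "2 * d + 1"] nm_lateral by (auto simp: slice_Epts flip_lateral)
  show "mvE d N p (2 * d + 1) \<in> slice d N z" using mv_slice(3)[OF p] by simp
qed simp

lemma sum_slice_down: "(\<Sum>p\<in>slice d N z. g (mvE d N p (2 * d + 1))) = (\<Sum>p\<in>slice d N (z - 1). g p)"
proof (rule sum.reindex_bij_witness[where i="\<lambda>p. mvE d N p (2 * d)" and j="\<lambda>p. mvE d N p (2 * d + 1)"])
  fix p assume "p \<in> slice d N z"
  then show "mvE d N (mvE d N p (2 * d + 1)) (2 * d) = p" "mvE d N p (2 * d + 1) \<in> slice d N (z - 1)"
    using E.mv_iv[of p "2 * d + 1"] nm_lateral mv_slice(3) by (auto simp: slice_Epts flip_lateral)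
next
  fix p assume p: "p \<in> slice d N (z - 1)"
  then show "mvE d N (mvE d N p (2 * d)) (2 * d + 1) = p"
    using E.mv_iv[of p "2 * d"] nm_lateral by (auto simp: slice_Epts flip_lateral)
  show "mvE d N p (2 * d) \<in> slice d N z" using mv_slice(2)[OF p] by simp
qed simp

lemma sum_nm: "(\<Sum>j<nm d. f j) = (\<Sum>j<2 * d. f j) + f (2 * d) + f (2 * d + 1)" for f :: "nat \<Rightarrow> real"
proof -
  have m2: "{..<nm d} = insert (2 * d) (insert (2 * d + 1) {..<2 * d})" by (auto simp: nm_def)
  show ?thesis unfolding m2 by simp
qed

lemma sum_slice_moves:
  fixes g :: "int list \<Rightarrow> real"
  shows "(\<Sum>p\<in>slice d N z. \<Sum>j<nm d. g (mvE d N p j))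
    = 2 * real d * (\<Sum>p\<in>slice d N z. g p) + (\<Sum>p\<in>slice d N (z + 1). g p) + (\<Sum>p\<in>slice d N (z - 1). g p)"
proof -
  have "(\<Sum>p\<in>slice d N z. \<Sum>j<2 * d. g (mvE d N p j)) = (\<Sum>j<2 * d. \<Sum>p\<in>slice d N z. g (mvE d N p j))"
    by (rule sum.swap)
  also have "\<dots> = (\<Sum>j<2 * d. \<Sum>p\<in>slice d N z. g p)"
    by (rule sum.cong) (auto intro: sum_slice_lateral)
  finally show ?thesis unfolding sum_nm sum.distrib sum_slice_up sum_slice_down by simp
qed

lemma L2_lateral: "j < 2 * d \<Longrightarrow> L2_set (\<lambda>p. g (mvE d N p j)) (slice d N z) = L2_set g (slice d N z)"
  unfolding L2_set_def by (simp add: sum_slice_lateral[of j "\<lambda>p. (g p)\<^sup>2"])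

text \<open>The torus translation by \<open>e\<close>, written with successive unit moves so that
  differences along it telescope into gradients of single moves.\<close>

fun trans :: "(nat \<Rightarrow> nat) \<Rightarrow> nat \<Rightarrow> int list \<Rightarrow> int list" where
  "trans e 0 p = p"
| "trans e (Suc i) p = ((\<lambda>p. mvE d N p (2 * i)) ^^ (e i)) (trans e i p)"

lemma iter_mv:
  assumes "i < d" "p \<in> Epts d N"
  shows "((\<lambda>p. mvE d N p (2 * i)) ^^ k) p = p[i := (p ! i + int k) mod int N]"
proof (induction k)
  case 0 then show ?case using assms by (simp add: Epts_def)
next
  case (Suc k)
  have "i < length p" using assms by (simp add: Epts_def)
  then show ?case using Suc assms by (simp add: mvE_mvi mvi_def mod_add_left_eq) (simp add: algebra_simps)
qed

lemma trans_nth: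
  assumes "k \<le> d" "p \<in> Epts d N"
  shows "trans e k p \<in> Epts d N \<and> (\<forall>i\<le>d. trans e k p ! i = (if i < k then (p ! i + int (e i)) mod int N else p ! i))"
  using assms(1)
proof (induction k)
  case 0 then show ?case using assms by simp
next
  case (Suc k)
  then have IH: "trans e k p \<in> Epts d N" "\<And>i. i \<le> d \<Longrightarrow> trans e k p ! i = (if i < k then (p ! i + int (e i)) mod int N else p ! i)"
    by auto
  have k: "k < d" using Suc by simp
  have l: "length (trans e k p) = d + 1" using IH(1) by (simp add: Epts_def)
  have eq: "trans e (Suc k) p = (trans e k p)[k := (p ! k + int (e k)) mod int N]"
    using iter_mv[OF k IH(1)] IH(2)[of k] k by simp
  have "trans e (Suc k) p \<in> Epts d N" unfolding eq using IH(1) N k l by (auto simp: Epts_def nth_list_update)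
  moreover have "trans e (Suc k) p ! i = (if i < Suc k then (p ! i + int (e i)) mod int N else p ! i)" if "i \<le> d" for i
    unfolding eq using IH(2)[OF that] k l that by (cases "i = k") auto
  ultimately show ?case by blast
qed

text \<open>Torus translations act simply transitively on a slice: different vectors take
  \<open>p\<close> to different points, and the cardinalities agree.\<close>

lemma sum_trans:
  assumes "p \<in> slice d N z"
  shows "(\<Sum>e\<in>PiE {..<d} (\<lambda>_. {..<N}). g (trans e d p)) = (\<Sum>p\<in>slice d N z. g p)"
proof -
  have pE: "p \<in> Epts d N" "p ! d = z" using assms by (auto simp: slice_def)
  let ?P = "PiE {..<d} (\<lambda>_. {..<N})"
  have inj: "inj_on (\<lambda>e. trans e d p) ?P"
  proof (rule inj_onI)
    fix e e' assume e: "e \<in> ?P" "e' \<in> ?P" and eq: "trans e d p = trans e' d p"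
    have "e i = e' i" if "i < d" for i
    proof -
      have "(p ! i + int (e i)) mod int N = (p ! i + int (e' i)) mod int N"
        using trans_nth[OF order_refl pE(1), of e] trans_nth[OF order_refl pE(1), of e'] eq that by (metis less_imp_le)
      then have "int (e i) mod int N = int (e' i) mod int N"
        by (metis add_diff_cancel_left' mod_diff_left_eq)
      moreover have "e i < N" "e' i < N" using e that by auto
      ultimately show ?thesis by simp
    qed
    then show "e = e'" using e by (intro PiE_ext) auto
  qed
  have sub: "(\<lambda>e. trans e d p) ` ?P \<subseteq> slice d N z"
    using trans_nth[OF order_refl pE(1)] pE(2) by (auto simp: slice_def)
  have "card ((\<lambda>e. trans e d p) ` ?P) = card (slice d N z)"
    unfolding card_slice by (subst card_image[OF inj]) (simp add: card_PiE)
  then have "(\<lambda>e. trans e d p) ` ?P = slice d N z" by (intro card_subset_eq finite_slice sub)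
  then show ?thesis using sum.reindex[OF inj, of g] by (simp add: o_def)
qed

text \<open>Telescope over the \<open>k\<close> moves; all summands have the same norm because a
  lateral move permutes the slice.\<close>

lemma L2_iter:
  assumes "i < d"
  shows "L2_set (\<lambda>p. g (((\<lambda>p. mvE d N p (2 * i)) ^^ k) p) - g p) (slice d N z)
    \<le> real k * L2_set (\<lambda>p. g (mvE d N p (2 * i)) - g p) (slice d N z)"
proof (induction k)
  case 0 then show ?case by (simp add: L2_set_def)
next
  case (Suc k)
  let ?S = "\<lambda>p. mvE d N p (2 * i)"
  have i: "2 * i < 2 * d" using assms by simp
  have "L2_set (\<lambda>p. g ((?S ^^ Suc k) p) - g p) (slice d N z)
     = L2_set (\<lambda>p. (g ((?S ^^ k) (?S p)) - g (?S p)) + (g (?S p) - g p)) (slice d N z)"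
    by (simp add: funpow_Suc_right del: funpow.simps)
  also have "\<dots> \<le> L2_set (\<lambda>p. g ((?S ^^ k) (?S p)) - g (?S p)) (slice d N z) + L2_set (\<lambda>p. g (?S p) - g p) (slice d N z)"
    by (rule L2_set_triangle_ineq)
  also have "L2_set (\<lambda>p. g ((?S ^^ k) (?S p)) - g (?S p)) (slice d N z) = L2_set (\<lambda>p. g ((?S ^^ k) p) - g p) (slice d N z)"
    by (rule L2_lateral[OF i, of "\<lambda>p. g ((?S ^^ k) p) - g p"])
  finally show ?case using Suc by (simp add: algebra_simps)
qed

lemma L2_iter_invariant:
  assumes "i < d"
  shows "L2_set (\<lambda>p. g (((\<lambda>p. mvE d N p (2 * i)) ^^ k) p)) (slice d N z) = L2_set g (slice d N z)"
proof (induction k)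
  case (Suc k)
  then show ?case using L2_lateral[of "2 * i" "\<lambda>p. g (((\<lambda>p. mvE d N p (2 * i)) ^^ k) p)"] assms
    by (simp add: funpow_Suc_right del: funpow.simps)
qed simp

lemma L2_trans_invariant:
  "k \<le> d \<Longrightarrow> L2_set (\<lambda>p. f (trans e k p)) (slice d N z) = L2_set f (slice d N z)"
proof (induction k arbitrary: f)
  case (Suc k)
  let ?S = "(\<lambda>p. mvE d N p (2 * k)) ^^ e k"
  have "L2_set (\<lambda>p. f (trans e (Suc k) p)) (slice d N z) = L2_set (\<lambda>p. f (?S p)) (slice d N z)"
    using Suc.IH[of "\<lambda>p. f (?S p)"] Suc.prems by simp
  then show ?case using L2_iter_invariant[of k] Suc.prems by simp
qed simp

lemma L2_trans:
  assumes "k \<le> d"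
  shows "L2_set (\<lambda>p. g (trans e k p) - g p) (slice d N z)
    \<le> (\<Sum>i<k. real (e i) * L2_set (\<lambda>p. g (mvE d N p (2 * i)) - g p) (slice d N z))"
  using assms
proof (induction k)
  case 0 show ?case by (simp add: L2_set_def)
next
  case (Suc k)
  let ?S = "(\<lambda>p. mvE d N p (2 * k)) ^^ e k"
  have k: "k < d" "k \<le> d" using Suc.prems by auto
  have "L2_set (\<lambda>p. g (trans e (Suc k) p) - g p) (slice d N z)
    = L2_set (\<lambda>p. (g (?S (trans e k p)) - g (trans e k p)) + (g (trans e k p) - g p)) (slice d N z)" by simp
  also have "\<dots> \<le> L2_set (\<lambda>p. g (?S (trans e k p)) - g (trans e k p)) (slice d N z) + L2_set (\<lambda>p. g (trans e k p) - g p) (slice d N z)"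
    by (rule L2_set_triangle_ineq)
  also have "L2_set (\<lambda>p. g (?S (trans e k p)) - g (trans e k p)) (slice d N z) = L2_set (\<lambda>p. g (?S p) - g p) (slice d N z)"
    by (rule L2_trans_invariant[OF k(2), of "\<lambda>p. g (?S p) - g p"])
  also have "\<dots> \<le> real (e k) * L2_set (\<lambda>p. g (mvE d N p (2 * k)) - g p) (slice d N z)"
    by (rule L2_iter[OF k(1)])
  finally show ?case using Suc.IH[OF k(2)] by simp
qed

lemma L2_set_sum_le: "finite I \<Longrightarrow> L2_set (\<lambda>p. \<Sum>i\<in>I. f i p) A \<le> (\<Sum>i\<in>I. L2_set (f i) A)"
proof (induction I rule: finite_induct)
  case (insert i I)
  have "L2_set (\<lambda>p. f i p + (\<Sum>i\<in>I. f i p)) A \<le> L2_set (f i) A + L2_set (\<lambda>p. \<Sum>i\<in>I. f i p) A"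
    by (rule L2_set_triangle_ineq)
  then show ?case using insert by simp
qed (simp add: L2_set_def)

text \<open>For mean zero, \<open>- g p\<close> is the average over all translations of the
  increment of \<open>g\<close> from \<open>p\<close>. Minkowski and telescoping bound each
  increment in norm by \<open>N\<close> times the sum of the \<open>d\<close> gradient norms, and
  Cauchy-Schwarz contributes the factor \<open>d\<close>.\<close>

lemma poincare_slice:
  assumes mean: "(\<Sum>p\<in>slice d N z. g p) = 0"
  shows "(\<Sum>p\<in>slice d N z. (g p)\<^sup>2) \<le> real d * (real N)\<^sup>2 * (\<Sum>i<d. \<Sum>p\<in>slice d N z. (g (mvE d N p (2 * i)) - g p)\<^sup>2)"
proof -
  let ?P = "PiE {..<d} (\<lambda>_. {..<N})"
  define D where "D i = L2_set (\<lambda>p. g (mvE d N p (2 * i)) - g p) (slice d N z)" for i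
  have finP: "finite ?P" by (intro finite_PiE) auto
  have cardP: "card ?P = N ^ d" by (simp add: card_PiE)
  have D0: "0 \<le> D i" for i by (simp add: D_def L2_set_nonneg)
  have one: "L2_set (\<lambda>p. g (trans e d p) - g p) (slice d N z) \<le> real N * (\<Sum>i<d. D i)" if "e \<in> ?P" for e
  proof -
    have "L2_set (\<lambda>p. g (trans e d p) - g p) (slice d N z) \<le> (\<Sum>i<d. real (e i) * D i)"
      unfolding D_def by (rule L2_trans) simp
    also have "\<dots> \<le> (\<Sum>i<d. real N * D i)"
      using that D0 by (intro sum_mono mult_right_mono) (auto simp: PiE_iff less_imp_le)
    finally show ?thesis by (simp add: sum_distrib_left)
  qed
  have "L2_set (\<lambda>p. real (N ^ d) * g p) (slice d N z) = L2_set (\<lambda>p. \<Sum>e\<in>?P. g (trans e d p) - g p) (slice d N z)"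
  proof -
    have "(\<Sum>e\<in>?P. g (trans e d p) - g p) = - (real (N ^ d) * g p)" if "p \<in> slice d N z" for p
      unfolding sum_subtractf sum_trans[OF that] mean by (simp add: cardP)
    then show ?thesis unfolding L2_set_def by simp
  qed
  also have "\<dots> \<le> (\<Sum>e\<in>?P. L2_set (\<lambda>p. g (trans e d p) - g p) (slice d N z))"
    by (rule L2_set_sum_le[OF finP])
  also have "\<dots> \<le> (\<Sum>e\<in>?P. real N * (\<Sum>i<d. D i))" by (rule sum_mono) (rule one)
  also have "\<dots> = real (N ^ d) * (real N * (\<Sum>i<d. D i))" by (simp add: cardP)
  finally have "real (N ^ d) * L2_set g (slice d N z) \<le> real (N ^ d) * (real N * (\<Sum>i<d. D i))"
    by (simp add: L2_set_right_distrib)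
  then have "L2_set g (slice d N z) \<le> real N * (\<Sum>i<d. D i)" using N by simp
  then have "(L2_set g (slice d N z))\<^sup>2 \<le> (real N * (\<Sum>i<d. D i))\<^sup>2" by (rule power_mono) (rule L2_set_nonneg)
  also have "\<dots> = (real N)\<^sup>2 * (\<Sum>i<d. D i)\<^sup>2" by (rule power_mult_distrib)
  also have "\<dots> \<le> (real N)\<^sup>2 * ((\<Sum>i<d. (D i)\<^sup>2) * real (card {..<d}))"
    by (intro mult_left_mono sum_squared_le_sum_of_squares) auto
  also have "(\<Sum>i<d. (D i)\<^sup>2) = (\<Sum>i<d. \<Sum>p\<in>slice d N z. (g (mvE d N p (2 * i)) - g p)\<^sup>2)"
    unfolding D_def L2_set_def by (simp add: sum_nonneg)
  finally show ?thesis unfolding L2_set_def by (simp add: sum_nonneg mult_ac)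
qed

text \<open>\<open>hitd far\<close> describes the point at which a walk from outside enters the
  inner cylinder, since the walk is stopped on reaching height \<open>N\<close> or
  \<open>- N\<close>.\<close>

definition far :: "int list set" where "far = {p. int N < \<bar>p ! d\<bar>}"

text \<open>Summing over a slice removes the torus coordinates and leaves the averaging recursion of
  the height, with boundary value at most 1. Divided by \<open>N ^ d\<close>, it says that a uniform
  start enters each point with probability at most \<open>1 / N ^ d\<close>.\<close>

lemma hitd_slice_sum:
  assumes \<sigma>: "\<sigma> = 1 \<or> \<sigma> = - 1" and z: "int N \<le> \<sigma> * z" and q: "q \<in> slice d N (\<sigma> * int N)"
  shows "(\<Sum>p\<in>slice d N z. E.hitd far n p q) \<le> 1"
  using z
proof (induction n arbitrary: z)
  case 0
  have "(\<Sum>p\<in>slice d N z. E.hitd far 0 p q) = (\<Sum>p\<in>slice d N z. if q = p then 1 else 0)" by (intro sum.cong) auto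
  then show ?case by (simp add: finite_slice sum.delta)
next
  case (Suc n)
  show ?case
  proof (cases "int N = \<sigma> * z")
    case True
    have "(\<Sum>p\<in>slice d N z. E.hitd far (Suc n) p q) = (\<Sum>p\<in>slice d N z. if q = p then 1 else 0)"
    proof (rule sum.cong[OF refl])
      fix p assume "p \<in> slice d N z"
      then have "p \<notin> far" using True \<sigma> by (auto simp: far_def slice_def)
      then show "E.hitd far (Suc n) p q = (if q = p then 1 else 0)" by auto
    qed
    then show ?thesis by (simp add: finite_slice sum.delta)
  next
    case False
    then have z: "int N < \<sigma> * z" using Suc by simp
    have "(\<Sum>p\<in>slice d N z. E.hitd far (Suc n) p q) = (\<Sum>p\<in>slice d N z. (\<Sum>j<nm d. E.hitd far n (mvE d N p j) q) / real (nm d))"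
    proof (rule sum.cong[OF refl])
      fix p assume p: "p \<in> slice d N z"
      then have "p \<in> far" "p \<noteq> q" using z q \<sigma> by (auto simp: far_def slice_def)
      then show "E.hitd far (Suc n) p q = (\<Sum>j<nm d. E.hitd far n (mvE d N p j) q) / real (nm d)"
        by (simp add: av_def)
    qed
    also have "\<dots> \<le> (2 * real d * 1 + 1 + 1) / real (nm d)"
      unfolding sum_divide_distrib[symmetric] sum_slice_moves[where g="\<lambda>p. E.hitd far n p q"] using z \<sigma>
      by (intro divide_right_mono add_mono mult_left_mono Suc.IH) auto
    also have "\<dots> = 1" by (simp add: nm_def)
    finally show ?thesis .
  qed
qed

text \<open>To reach the opposite side the walk would have to cross the inner cylinder, where it is
  stopped.\<close>

lemma hitd_wrong_side:
  assumes \<sigma>: "\<sigma> = 1 \<or> \<sigma> = - 1" and q: "q \<in> slice d N (\<sigma> * int N)" and p: "p \<in> Epts d N" "\<sigma> * p ! d \<le> - int N"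
  shows "E.hitd far n p q = 0"
  using p
proof (induction n arbitrary: p)
  case 0 then show ?case using q \<sigma> N by (auto simp: slice_def)
next
  case (Suc n)
  have "p \<noteq> q" using Suc.prems q \<sigma> N by (auto simp: slice_def)
  moreover have "av (nm d) (\<lambda>j. E.hitd far n (mvE d N p j) q) = 0" if "p \<in> far"
  proof -
    have "E.hitd far n (mvE d N p j) q = 0" if j: "j < nm d" for j
    proof (rule Suc.IH)
      show "mvE d N p j \<in> Epts d N" using E.closed Suc.prems j by simp
      show "\<sigma> * mvE d N p j ! d \<le> - int N"
        using height_mvE_le[OF Suc.prems(1) j] Suc.prems(2) \<open>p \<in> far\<close> \<sigma> by (auto simp: far_def)
    qed
    then have "av (nm d) (\<lambda>j. E.hitd far n (mvE d N p j) q) = av (nm d) (\<lambda>j. 0)" by (intro av_cong) auto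
    then show ?thesis by simp
  qed
  ultimately show ?case by auto
qed

text \<open>The variance of the hitting probabilities over a slice is a convex function of the height, and the Poincare inequality
  turns convexity into exponential decay.\<close>

lemma mixing:
  assumes d: "1 \<le> d" and q: "q \<in> Epts d N" "\<bar>q ! d\<bar> = int N" and p: "p \<in> Epts d N" "int N \<le> \<bar>p ! d\<bar>"
  shows "E.hitd far n p q \<le> 1 / real N ^ d + real N ^ d / 2 ^ ((nat \<bar>p ! d\<bar> - N) div (4 * d * N))"
proof -
  define \<sigma> :: int where "\<sigma> = (if q ! d = int N then 1 else - 1)"
  have \<sigma>: "\<sigma> = 1 \<or> \<sigma> = - 1" by (simp add: \<sigma>_def)
  have \<sigma>2: "\<sigma> * \<sigma> = 1" using \<sigma> by auto
  have qs: "q \<in> slice d N (\<sigma> * int N)" using q by (auto simp: slice_def \<sigma>_def)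
  show ?thesis
  proof (cases "\<sigma> * p ! d \<le> - int N")
    case True
    then show ?thesis using hitd_wrong_side[OF \<sigma> qs p(1)] by (simp add: add_nonneg_nonneg)
  next
    case False
    define s0 where "s0 = nat \<bar>p ! d\<bar> - N"
    have ph: "p ! d = \<sigma> * int (N + s0)" using False p \<sigma> by (auto simp: s0_def of_nat_diff)
    \<comment> \<open>The limit in time is exactly harmonic on \<open>far\<close>, unlike the
      probabilities with a finite horizon, which it dominates by monotonicity.\<close>
    define u where "u p = lim (\<lambda>n. E.hitd far n p q)" for p
    have ulim: "(\<lambda>n. E.hitd far n p q) \<longlonglongrightarrow> u p" for p
    proof -
      have "incseq (\<lambda>n. E.hitd far n p q)" by (rule incseq_SucI) (rule E.hitd_Suc_mono)
      then obtain L where "(\<lambda>n. E.hitd far n p q) \<longlonglongrightarrow> L"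
        by (rule incseq_convergent[of _ 1]) (use E.hitd_bounds in auto)
      then show ?thesis unfolding u_def by (simp add: limI)
    qed
    have u01: "0 \<le> u p" "u p \<le> 1" for p
      by (rule LIMSEQ_le_const[OF ulim], use E.hitd_bounds in auto)
         (rule LIMSEQ_le_const2[OF ulim], use E.hitd_bounds in auto)
    have ule: "E.hitd far n p q \<le> u p" for n p
      by (rule incseq_le[OF _ ulim]) (rule incseq_SucI, rule E.hitd_Suc_mono)
    have uharm: "u p = av (nm d) (\<lambda>j. u (mvE d N p j))" if "p \<in> far" for p
    proof -
      have "p \<noteq> q" using that q by (auto simp: far_def)
      have "(\<lambda>n. E.hitd far (Suc n) p q) \<longlonglongrightarrow> av (nm d) (\<lambda>j. u (mvE d N p j))"
        using \<open>p \<noteq> q\<close> that by (simp add: tendsto_av ulim)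
      then show ?thesis by (rule LIMSEQ_unique[OF LIMSEQ_Suc[OF ulim]])
    qed
    \<comment> \<open>\<open>v\<close> is the deviation from the slice average. It is again
      harmonic, because the average is harmonic as a function of the height.\<close>
    define M where "M z = (\<Sum>p\<in>slice d N z. u p)" for z
    define v where "v p = u p - M (p ! d) / real N ^ d" for p
    have M1: "M z \<le> 1" if "int N \<le> \<sigma> * z" for z
      unfolding M_def
      by (rule LIMSEQ_le_const2[OF tendsto_sum[OF ulim]]) (use hitd_slice_sum[OF \<sigma> that qs] in auto)
    have M0: "0 \<le> M z" for z unfolding M_def using u01 by (simp add: sum_nonneg)
    have Mrec: "real (nm d) * M z = 2 * real d * M z + M (z + 1) + M (z - 1)" if "int N < \<sigma> * z" for z
    proof -
      have "real (nm d) * M z = (\<Sum>p\<in>slice d N z. \<Sum>j<nm d. u (mvE d N p j))"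
        unfolding M_def sum_distrib_left
      proof (rule sum.cong[OF refl])
        fix p assume "p \<in> slice d N z"
        then have "p \<in> far" using that \<sigma> by (auto simp: far_def slice_def)
        from uharm[OF this] show "real (nm d) * u p = (\<Sum>j<nm d. u (mvE d N p j))"
          using nm_pos[of d] by (simp add: av_def field_simps)
      qed
      then show ?thesis unfolding sum_slice_moves M_def by simp
    qed
    have vharm: "(\<Sum>j<nm d. v (mvE d N p j)) = real (nm d) * v p" if "p \<in> slice d N z" "int N < \<sigma> * z" for p z
    proof -
      have pE: "p \<in> Epts d N" "p ! d = z" using that by (auto simp: slice_def)
      have "p \<in> far" using that \<sigma> by (auto simp: far_def slice_def)
      then have 1: "(\<Sum>j<nm d. u (mvE d N p j)) = real (nm d) * u p"
        using uharm nm_pos[of d] by (simp add: av_def field_simps)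
      have "(\<Sum>j<nm d. M (mvE d N p j ! d)) = real (nm d) * av (nm d) (\<lambda>j. M (mvE d N p j ! d))"
        using nm_pos[of d] by (simp add: av_def)
      also have "\<dots> = real (nm d) * M z"
        unfolding av_height_mvE[OF pE(1)] using Mrec[OF that(2)] nm_pos[of d] pE(2) by (simp add: field_simps)
      finally show ?thesis unfolding v_def sum_subtractf sum_divide_distrib[symmetric] 1 pE(2) by (simp add: algebra_simps)
    qed
    have vmean: "(\<Sum>p\<in>slice d N z. v p) = 0" for z
    proof -
      have "(\<Sum>p\<in>slice d N z. v p) = M z - (\<Sum>p\<in>slice d N z. M z / real N ^ d)"
        unfolding v_def sum_subtractf M_def[symmetric] by (auto simp: slice_def intro!: sum.cong)
      then show ?thesis using N by (simp add: card_slice)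
    qed
    define f where "f s = (\<Sum>p\<in>slice d N (\<sigma> * int (N + s)). (v p)\<^sup>2)" for s
    have f0: "0 \<le> f s" for s by (simp add: f_def sum_nonneg)
    have fB: "f s \<le> real N ^ d" for s
    proof -
      have "(v p)\<^sup>2 \<le> 1" if "p \<in> slice d N (\<sigma> * int (N + s))" for p
      proof -
        have z: "int N \<le> \<sigma> * (p ! d)" using that \<sigma> by (auto simp: slice_def)
        have "1 \<le> real N ^ d" using N by (simp add: one_le_power)
        then have "M (p ! d) / real N ^ d \<le> 1" using M1[OF z] by (simp add: divide_le_eq)
        moreover have "0 \<le> M (p ! d) / real N ^ d" using M0 by simp
        ultimately have "\<bar>v p\<bar> \<le> 1" using u01[of p] unfolding v_def by linarith
        then show ?thesis by (simp add: abs_square_le_1)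
      qed
      then have "f s \<le> (\<Sum>p\<in>slice d N (\<sigma> * int (N + s)). 1)" unfolding f_def by (rule sum_mono)
      then show ?thesis by (simp add: card_slice)
    qed
    \<comment> \<open>The inverse Poincare constant: the lateral gradients of \<open>v\<close>
      contribute at least \<open>l * f\<close> to the second difference of \<open>f\<close>.\<close>
    define l where "l = 1 / (real d * (real N)\<^sup>2)"
    have l: "0 < l" using d N by (simp add: l_def)
    have conv: "l * f (Suc s) \<le> f (Suc (Suc s)) + f s - 2 * f (Suc s)" for s
    proof -
      define z where "z = \<sigma> * int (N + Suc s)"
      have z: "int N < \<sigma> * z" using \<sigma> by (auto simp: z_def)
      have fz: "f (Suc s) = (\<Sum>p\<in>slice d N z. (v p)\<^sup>2)" by (simp add: f_def z_def)
      have fnb: "(\<Sum>p\<in>slice d N (z + 1). (v p)\<^sup>2) + (\<Sum>p\<in>slice d N (z - 1). (v p)\<^sup>2) = f (Suc (Suc s)) + f s"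
        using \<sigma> by (auto simp: f_def z_def algebra_simps)
      have "f (Suc s) \<le> real d * (real N)\<^sup>2 * (\<Sum>i<d. \<Sum>p\<in>slice d N z. (v (mvE d N p (2 * i)) - v p)\<^sup>2)"
        unfolding fz by (rule poincare_slice[OF vmean])
      then have "l * f (Suc s) \<le> (\<Sum>i<d. \<Sum>p\<in>slice d N z. (v (mvE d N p (2 * i)) - v p)\<^sup>2)"
        using d N by (simp add: l_def field_simps)
      also have "\<dots> \<le> (\<Sum>i<d. \<Sum>p\<in>slice d N z. (v (mvE d N p (2 * i)) - v p)\<^sup>2 + (v (mvE d N p (2 * i + 1)) - v p)\<^sup>2)"
        by (intro sum_mono) simp
      also have "\<dots> = (\<Sum>p\<in>slice d N z. \<Sum>j<2 * d. (v (mvE d N p j) - v p)\<^sup>2)"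
        unfolding sum_pairs by (rule sum.swap)
      also have "\<dots> \<le> (\<Sum>p\<in>slice d N z. \<Sum>j<nm d. (v (mvE d N p j) - v p)\<^sup>2)"
        by (intro sum_mono) (simp add: sum_nm)
      also have "\<dots> = (\<Sum>p\<in>slice d N z. (\<Sum>j<nm d. (v (mvE d N p j))\<^sup>2) - real (nm d) * (v p)\<^sup>2)"
      proof (rule sum.cong[OF refl])
        fix p assume p: "p \<in> slice d N z"
        have "(\<Sum>j<nm d. (v (mvE d N p j) - v p)\<^sup>2) = (\<Sum>j<nm d. (v (mvE d N p j))\<^sup>2 + (v p)\<^sup>2 - 2 * v p * v (mvE d N p j))"
          by (intro sum.cong refl) (simp add: power2_diff)
        also have "\<dots> = (\<Sum>j<nm d. (v (mvE d N p j))\<^sup>2) + real (nm d) * (v p)\<^sup>2 - 2 * v p * (\<Sum>j<nm d. v (mvE d N p j))"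
          by (simp add: sum_subtractf sum.distrib sum_distrib_left)
        also have "\<dots> = (\<Sum>j<nm d. (v (mvE d N p j))\<^sup>2) - real (nm d) * (v p)\<^sup>2"
          unfolding vharm[OF p z] by (simp add: power2_eq_square)
        finally show "(\<Sum>j<nm d. (v (mvE d N p j) - v p)\<^sup>2) = (\<Sum>j<nm d. (v (mvE d N p j))\<^sup>2) - real (nm d) * (v p)\<^sup>2" .
      qed
      also have "\<dots> = 2 * real d * f (Suc s) + (f (Suc (Suc s)) + f s) - real (nm d) * f (Suc s)"
        unfolding sum_subtractf sum_slice_moves[where g="\<lambda>p. (v p)\<^sup>2"] sum_distrib_left[symmetric] fz fnb[symmetric]
        by simp
      also have "\<dots> = f (Suc (Suc s)) + f s - 2 * f (Suc s)" by (simp add: nm_def algebra_simps)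
      finally show ?thesis .
    qed
    \<comment> \<open>For \<open>L = 2 * d * N\<close> one has \<open>l * L ^ 2 = 4 * d\<close>, so
      \<open>4 * d * N\<close> levels divide the variance by 4. Taking a square root at the end
      leaves a factor 2 per block for the pointwise deviation.\<close>
    have L4: "4 \<le> l * (real (2 * d * N))\<^sup>2" using d N by (simp add: l_def power2_eq_square field_simps)
    define k where "k = s0 div (4 * d * N)"
    have dec: "f (2 * (2 * d * N) * i) \<le> real N ^ d / 4 ^ i" for i
      by (rule convex_decay[where f=f and l=l, OF f0 fB l conv L4])
    have anti: "f (Suc s) \<le> f s" for s
    proof (rule ccontr)
      assume "\<not> f (Suc s) \<le> f s"
      then have D: "0 < f (Suc s) - f s" by simp
      have step: "f (Suc s) - f s \<le> f (Suc (s + k)) - f (s + k)" for k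
      proof (induction k)
        case (Suc k)
        have "0 \<le> l * f (Suc (s + k))" using l f0 by simp
        then show ?case using conv[of "s + k"] Suc by simp
      qed simp
      have "f s + real k * (f (Suc s) - f s) \<le> f (s + k)" for k
      proof (induction k)
        case (Suc k) then show ?case using step[of k] by (simp add: algebra_simps)
      qed simp
      then have le: "real k * (f (Suc s) - f s) \<le> real N ^ d" for k
        using f0[of s] fB[of "s + k"] by (smt (verit))
      obtain k where "real N ^ d < real k * (f (Suc s) - f s)" using ex_less_of_nat_mult[OF D] by blast
      then show False using le[of k] by simp
    qed
    have "s0 div (4 * d * N) * (4 * d * N) \<le> s0" by (rule div_times_less_eq_dividend)
    then have "2 * (2 * d * N) * k \<le> s0" by (simp add: k_def mult_ac)
    then have "f s0 \<le> f (2 * (2 * d * N) * k)"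
      by (rule lift_Suc_antimono_le[of f, OF anti])
    also have "\<dots> \<le> real N ^ d / 4 ^ k" by (rule dec)
    finally have fs: "f s0 \<le> real N ^ d / 4 ^ k" .
    have pz: "p \<in> slice d N (\<sigma> * int (N + s0))" using p ph by (simp add: slice_def)
    have "(v p)\<^sup>2 \<le> f s0" unfolding f_def by (rule member_le_sum[OF pz]) (auto simp: finite_slice)
    also have "\<dots> \<le> (real N ^ d / 2 ^ k)\<^sup>2"
    proof -
      have "1 \<le> real N ^ d" using N by (simp add: one_le_power)
      then have "real N ^ d / 4 ^ k \<le> (real N ^ d)\<^sup>2 / 4 ^ k" by (intro divide_right_mono self_le_power) auto
      also have "(real N ^ d)\<^sup>2 / 4 ^ k = (real N ^ d)\<^sup>2 / (2 ^ k)\<^sup>2" unfolding power2_eq_square power_mult_distrib[symmetric] by simp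
      also have "(real N ^ d)\<^sup>2 / (2 ^ k)\<^sup>2 = (real N ^ d / 2 ^ k)\<^sup>2" by (rule power_divide[symmetric])
      finally show ?thesis using fs by linarith
    qed
    finally have "\<bar>v p\<bar> \<le> \<bar>real N ^ d / 2 ^ k\<bar>" by (simp only: abs_le_square_iff)
    then have "v p \<le> real N ^ d / 2 ^ k" by simp
    moreover have "M (p ! d) / real N ^ d \<le> 1 / real N ^ d"
      using M1[of "p ! d"] ph \<sigma> by (intro divide_right_mono) auto
    ultimately have "u p \<le> 1 / real N ^ d + real N ^ d / 2 ^ k" unfolding v_def by linarith
    then show ?thesis using ule[of n p] unfolding k_def s0_def by linarith
  qed
qed

end

section \<open>Excursions in the cylinder\<close>

lemma map_Un_empty [simp]: "map_pmf ((\<union>) {}) P = P"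
proof -
  have "(\<union>) {} = (id :: 'a set \<Rightarrow> 'a set)" by auto
  then show ?thesis by (simp add: pmf.map_id)
qed

context rwalk
begin

text \<open>Besides the stopping point it returns the number of steps left, so that the rest of a
  walk with finite horizon can be started there.\<close>

fun stopt :: "'a set \<Rightarrow> nat \<Rightarrow> 'a \<Rightarrow> ('a \<times> nat) option pmf" where
  "stopt W 0 p = return_pmf (if p \<in> W then Some (p, 0) else None)"
| "stopt W (Suc n) p = (if p \<in> W then return_pmf (Some (p, Suc n)) else bind_pmf (steps m) (\<lambda>j. stopt W n (mv p j)))"

lemma measure_stopt:
  "measure (measure_pmf (stopt W n p)) {x. \<exists>n'. x = Some (q, n')} = (if q \<in> W then hitd (- W) n p q else 0)"
proof (induction n arbitrary: p)
  case 0 then show ?case by (auto simp: indicator_def)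
next
  case (Suc n)
  then show ?case by (auto simp: measure_bind_steps[OF m_pos] indicator_def)
qed

lemma set_stopt:
  assumes "I p" "\<And>p j. I p \<Longrightarrow> p \<notin> W \<Longrightarrow> j < m \<Longrightarrow> I (mv p j)" "Some (q, n') \<in> set_pmf (stopt W n p)"
  shows "I q \<and> q \<in> W \<and> n' \<le> n"
  using assms(1,3)
proof (induction n arbitrary: p)
  case 0 then show ?case by (auto split: if_splits)
next
  case (Suc n)
  show ?case
  proof (cases "p \<in> W")
    case True then show ?thesis using Suc.prems by auto
  next
    case False
    then obtain j where "j < m" "Some (q, n') \<in> set_pmf (stopt W n (mv p j))"
      using Suc.prems by (auto simp: set_steps[OF m_pos])
    then show ?thesis using Suc.IH[of "mv p j"] assms(2)[OF Suc.prems(1) False] by auto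
  qed
qed

text \<open>The induction step of the domination. If the stage \<open>Q\<close> enters
  \<open>D\<close> with density at most \<open>u * esc D\<close>, the level \<open>w\<close> pays
  for the lattice walk started at the entrance point, and the level \<open>l\<close> for what
  follows. The error \<open>a\<close> after a hit is weighted by the probability of a hit, at most
  \<open>u * ecap D\<close>.\<close>

lemma step_sdom:
  fixes Q :: "'o pmf" and ct and hx :: "'o \<Rightarrow> 'a option"
  assumes X: "finite X" "X \<subseteq> V" "A \<subseteq> X" "D \<subseteq> X"
    and Q: "\<And>q. q \<in> D \<Longrightarrow> measure (measure_pmf Q) {x. hx x = Some q} \<le> u * esc D q"
    and hxD: "\<And>x q. x \<in> set_pmf Q \<Longrightarrow> hx x = Some q \<Longrightarrow> q \<in> D"
    and hit: "\<And>x q. x \<in> set_pmf Q \<Longrightarrow> hx x = Some q \<Longrightarrow> sdom a (ct x) (uni (kap A q) (poi A l))"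
    and miss: "\<And>x. x \<in> set_pmf Q \<Longrightarrow> hx x = None \<Longrightarrow> sdom b (ct x) (poi A l)"
    and ab: "0 \<le> a" "0 \<le> b" and u: "0 \<le> u" "0 < \<delta>" "u * (1 + \<delta>) * ecap X \<le> 1 - exp (- w * ecap X)" "0 < w"
    and l: "0 \<le> l"
  shows "sdom (a * (u * ecap D) + b) (bind_pmf Q ct) (poi A (w + l))"
proof -
  have fin: "finite D" "finite A" "A \<subseteq> V" using X finite_subset by blast+
  define H where "H = {x. hx x \<noteq> None}"
  define Y where "Y x = uni (okap A (hx x)) (poi A l)" for x
  have uni_empty: "uni (return_pmf {}) P = P" for P :: "'a set pmf"
    by (simp add: uni_def bind_return_pmf)
  have "sdom (a * measure (measure_pmf Q) H + b) (bind_pmf Q ct) (bind_pmf Q Y)"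
    by (rule sdom_bind_split[OF _ _ ab]) (use hit miss in \<open>auto simp: H_def Y_def okap_def uni_empty\<close>)
  moreover have "measure (measure_pmf Q) H \<le> u * ecap D"
  proof -
    have "measure (measure_pmf Q) H = measure (measure_pmf Q) (H \<inter> set_pmf Q)" by (simp add: measure_Int_set_pmf)
    also have "\<dots> \<le> measure (measure_pmf Q) (\<Union>q\<in>D. {x. hx x = Some q})"
      by (rule measure_pmf.finite_measure_mono) (use hxD in \<open>auto simp: H_def\<close>)
    also have "\<dots> \<le> (\<Sum>q\<in>D. measure (measure_pmf Q) {x. hx x = Some q})"
      by (rule measure_pmf.finite_measure_subadditive_finite) (use fin in auto)
    also have "\<dots> \<le> (\<Sum>q\<in>D. u * esc D q)" by (rule sum_mono) (rule Q)
    finally show ?thesis by (simp add: ecap_def sum_distrib_left)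
  qed
  ultimately have 1: "sdom (a * (u * ecap D) + b) (bind_pmf Q ct) (bind_pmf Q Y)"
    by (rule sdom_mono[rotated, OF add_right_mono[OF mult_left_mono[OF _ ab(1)]], rotated])
  have eq: "bind_pmf Q Y = uni (bind_pmf (map_pmf hx Q) (okap A)) (poi A l)"
    by (simp add: Y_def[abs_def] uni_def bind_assoc_pmf bind_map_pmf)
  have pm: "pmf (map_pmf hx Q) (Some q) = measure (measure_pmf Q) {x. hx x = Some q}" for q
    by (simp add: pmf_map vimage_def)
  have "sdom 0 (bind_pmf (map_pmf hx Q) (okap A)) (poi A w)"
  proof (rule entrance_sdom[OF X _ _ u])
    fix q assume "q \<notin> D"
    then have "Some q \<notin> set_pmf (map_pmf hx Q)" using hxD by (auto simp: eq_commute)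
    then show "pmf (map_pmf hx Q) (Some q) = 0" by (rule pmf_eq_0_set_pmf[THEN iffD2])
  qed (simp add: pm Q)
  then have "sdom 0 (bind_pmf Q Y) (uni (poi A w) (poi A l))"
    unfolding eq by (rule sdom_uni_left) simp
  also have "uni (poi A w) (poi A l) = poi A (w + l)" using poi_add fin u l by simp
  finally show ?thesis by (rule sdom_trans0[OF 1])
qed

end

lemma bind_pmf_of_set_split:
  assumes A: "finite A" "A - S \<noteq> {}"
  shows "bind_pmf (pmf_of_set A) f = bind_pmf (map_pmf (\<lambda>p. if p \<in> S then Some p else None) (pmf_of_set A))
     (\<lambda>x. case x of None \<Rightarrow> bind_pmf (pmf_of_set (A - S)) f | Some p \<Rightarrow> f p)"
proof (rule pmf_eqI)
  fix y
  have ne: "A \<noteq> {}" using A by auto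
  let ?g = "\<lambda>p. pmf (f p) y"
  have c: "real (card (A - S)) \<noteq> 0" using A by simp
  have "(\<Sum>p\<in>A. if p \<in> S then ?g p else sum ?g (A - S) / real (card (A - S)))
      = (\<Sum>p\<in>A \<inter> S. ?g p) + (\<Sum>p\<in>A - S. sum ?g (A - S) / real (card (A - S)))"
    by (subst sum.If_cases[OF A(1)]) (simp add: Int_def Diff_eq)
  also have "\<dots> = (\<Sum>p\<in>A \<inter> S. ?g p) + sum ?g (A - S)" using c by simp
  also have "\<dots> = sum ?g A" using sum.Int_Diff[OF A(1), of ?g S] by simp
  finally show "pmf (bind_pmf (pmf_of_set A) f) y = pmf (bind_pmf (map_pmf (\<lambda>p. if p \<in> S then Some p else None) (pmf_of_set A))
     (\<lambda>x. case x of None \<Rightarrow> bind_pmf (pmf_of_set (A - S)) f | Some p \<Rightarrow> f p)) y"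
    using A ne
    by (simp add: bind_map_pmf pmf_bind integral_pmf_of_set if_distrib[where f="case_option _ _"]
        if_distrib[where f="\<lambda>z. pmf z y"] cong: if_cong)
qed

section \<open>The chart between boxes of the cylinder and of the lattice\<close>

definition tz :: "nat \<Rightarrow> int \<Rightarrow> int" where "tz N y = (if int N < 2 * y then y - int N else y)"

lemma tz_unique:
  assumes "0 \<le> y" "y < int N" "y mod int N = t mod int N" "2 * \<bar>t\<bar> < int N"
  shows "tz N y = t"
proof -
  obtain k where k: "y - t = int N * k" using assms(3) by (metis mod_eq_dvd_iff dvdE)
  have N: "0 < int N" using assms by simp
  have "int N * (- 1) < int N * k" "int N * k < int N * 2" using k assms by linarith+
  then have "- 1 < k" "k < 2" using N by (simp_all only: mult_less_cancel_left_pos)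
  then consider "k = 0" | "k = 1" by linarith
  then show ?thesis using k assms by cases (auto simp: tz_def)
qed

lemma toZ_nth: "i \<le> d \<Longrightarrow> toZ d N p ! i = (if i < d then tz N (p ! i) else p ! i)"
  unfolding toZ_def tz_def by (auto simp: nth_append simp del: upt_Suc)

lemma length_toZ: "length (toZ d N p) = d + 1"
  by (simp add: toZ_def del: upt_Suc)

lemma toZ_Zpts: "toZ d N p \<in> Zpts d"
  by (simp add: Zpts_def length_toZ)

lemma inj_on_toZ: "inj_on (toZ d N) (Epts d N)"
proof (rule inj_onI)
  fix p q assume pq: "p \<in> Epts d N" "q \<in> Epts d N" "toZ d N p = toZ d N q"
  show "p = q"
  proof (rule nth_equalityI)
    show "length p = length q" using pq by (simp add: Epts_def)
    fix i assume "i < length p"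
    then have i: "i \<le> d" using pq by (simp add: Epts_def)
    have eq: "toZ d N p ! i = toZ d N q ! i" using pq by simp
    show "p ! i = q ! i"
    proof (cases "i < d")
      case True
      then have "0 \<le> p ! i" "p ! i < int N" "0 \<le> q ! i" "q ! i < int N" using pq by (auto simp: Epts_def)
      then show ?thesis using eq True unfolding toZ_nth[OF i] by (auto simp: tz_def split: if_splits)
    next
      case False then show ?thesis using eq unfolding toZ_nth[OF i] by simp
    qed
  qed
qed

text \<open>The chart cuts every circle opposite to zero; the margin 2 keeps a single step away from
  the cut.\<close>

lemma toZ_mvE:
  assumes p: "p \<in> Epts d N" and j: "j < nm d" and small: "\<And>i. i < d \<Longrightarrow> 2 * \<bar>toZ d N p ! i\<bar> + 2 < int N"
  shows "toZ d N (mvE d N p j) = mvZ (toZ d N p) j"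
proof (rule nth_equalityI)
  show "length (toZ d N (mvE d N p j)) = length (mvZ (toZ d N p) j)" by (simp add: length_toZ mvZ_def)
  fix i assume "i < length (toZ d N (mvE d N p j))"
  then have i: "i \<le> d" by (simp add: length_toZ)
  have l: "length p = d + 1" using p by (simp add: Epts_def)
  have jd: "j div 2 \<le> d" using nm_div[OF j] by simp
  show "toZ d N (mvE d N p j) ! i = mvZ (toZ d N p) j ! i"
  proof (cases "i = j div 2 \<and> i < d")
    case False
    then show ?thesis using i l jd by (auto simp: toZ_nth mvE_mvi mvi_def mvZ_sg length_toZ nth_list_update)
  next
    case True
    then have id: "i < d" and ij: "j div 2 = i" by auto
    have N: "0 < int N" using p id by (fastforce simp: Epts_def)
    have "tz N ((p ! i + sg j) mod int N) = tz N (p ! i) + sg j"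
    proof (rule tz_unique)
      show "(p ! i + sg j) mod int N mod int N = (tz N (p ! i) + sg j) mod int N"
      proof -
        have "tz N (p ! i) mod int N = p ! i mod int N" by (simp add: tz_def)
        then show ?thesis by (metis mod_add_left_eq mod_mod_trivial)
      qed
      show "2 * \<bar>tz N (p ! i) + sg j\<bar> < int N"
      proof -
        have "2 * \<bar>tz N (p ! i)\<bar> + 2 < int N" using small[OF id] id by (simp add: toZ_nth)
        moreover have "\<bar>sg j\<bar> = 1" by (simp add: sg_def)
        moreover have "2 * x < n" if "2 * y + 2 < n" "s = 1" "x \<le> y + s" for x y s n :: int
          using that by linarith
        ultimately show ?thesis using abs_triangle_ineq[of "tz N (p ! i)" "sg j"] by blast
      qed
    qed (use N in auto)
    then show ?thesis using id l by (simp add: toZ_nth mvE_mvi mvi_def mvZ_sg length_toZ ij)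
  qed
qed

text \<open>\<open>r\<close> is the radius of the box, \<open>R1\<close> an intermediate radius, and
  \<open>h\<close> the height of the large cylinder. The factor 16 keeps the intermediate box well
  inside the chart and away from points outside \<open>ebox (N div 4)\<close>.\<close>

locale cylinder =
  fixes d N h r R1 :: nat
  assumes N: "0 < N" and Nh: "N < h" and rR: "r \<le> R1" and RN: "16 * (R1 + 1) \<le> N" and d1: "1 \<le> d"
begin

interpretation Z: rwalk "Zpts d" mvZ "nm d" flip by (rule rwalk_Z)
interpretation E: rwalk "Epts d N" "mvE d N" "nm d" flip by (rule rwalk_E[OF N])

definition Abox :: "int list set" where "Abox = zbox d r"

definition ebox :: "nat \<Rightarrow> int list set" where
  "ebox R = {p \<in> Epts d N. toZ d N p \<in> zbox d R}"

text \<open>An automaton that reads positions. Its flag is set while an excursion runs, and its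
  counter holds the departures still to come; cleared flag and counter zero form an absorbing state
  in which nothing is recorded.\<close>

definition upd :: "bool \<Rightarrow> nat \<Rightarrow> int list \<Rightarrow> bool \<times> nat" where
  "upd b k p = (if b then (if int h \<le> \<bar>p ! d\<bar> then (False, k - 1) else (True, k))
     else (if 0 < k \<and> \<bar>p ! d\<bar> \<le> int N then (True, k) else (False, k)))"

definition col :: "bool \<Rightarrow> int list \<Rightarrow> int list set" where
  "col b p = (if b then {toZ d N p} \<inter> Abox else {})"

text \<open>The law of the trace on \<open>Abox\<close> of \<open>n\<close> steps of the walk from \<open>p\<close>, up to the \<open>k\<close>-th
  departure from now; the flag tells whether the current excursion has already started.\<close>

fun law :: "nat \<Rightarrow> bool \<Rightarrow> nat \<Rightarrow> int list \<Rightarrow> int list set pmf" where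
  "law 0 b k p = return_pmf (col (fst (upd b k p)) p)"
| "law (Suc n) b k p = map_pmf (\<lambda>S. col (fst (upd b k p)) p \<union> S)
     (bind_pmf (steps (nm d)) (\<lambda>j. law n (fst (upd b k p)) (snd (upd b k p)) (mvE d N p j)))"

lemma law_upd_eq:
  assumes "upd b k p = upd b' k' p" shows "law n b k p = law n b' k' p"
  using assms by (cases n) auto

lemma law_exit: "int h \<le> \<bar>p ! d\<bar> \<Longrightarrow> law n True (Suc k) p = law n False k p"
  by (rule law_upd_eq) (use Nh in \<open>auto simp: upd_def\<close>)

lemma law_enter: "\<bar>p ! d\<bar> \<le> int N \<Longrightarrow> law n False (Suc k) p = law n True (Suc k) p"
  by (rule law_upd_eq) (use Nh in \<open>auto simp: upd_def\<close>)

lemma law_done: "law n False 0 p = return_pmf {}"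
  by (induction n arbitrary: p) (auto simp: upd_def col_def bind_pmf_const)

definition outcome :: "bool \<Rightarrow> nat \<Rightarrow> (int list \<times> nat) option \<Rightarrow> int list set pmf" where
  "outcome b k x = (case x of None \<Rightarrow> return_pmf {} | Some (q, n) \<Rightarrow> law n b k q)"

text \<open>Strong Markov property at the entrance into \<open>W\<close>: before it the automaton
  keeps its state and records nothing, so only the entrance point and the remaining time
  matter.\<close>

lemma law_stop:
  assumes W: "\<And>p. p \<notin> W \<Longrightarrow> p \<in> Epts d N \<Longrightarrow> upd b k p = (b, k) \<and> col b p = {}" and p: "p \<in> Epts d N"
  shows "law n b k p = bind_pmf (E.stopt W n p) (outcome b k)"
  using p
proof (induction n arbitrary: p)
  case 0
  then show ?case using W[of p] by (auto simp: bind_return_pmf outcome_def)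
next
  case (Suc n)
  show ?case
  proof (cases "p \<in> W")
    case True then show ?thesis by (simp add: bind_return_pmf outcome_def)
  next
    case False
    have "bind_pmf (steps (nm d)) (\<lambda>j. law n b k (mvE d N p j)) = bind_pmf (steps (nm d)) (\<lambda>j. bind_pmf (E.stopt W n (mvE d N p j)) (outcome b k))"
      by (rule bind_pmf_cong[OF refl]) (use Suc E.closed in \<open>auto simp: set_steps[OF nm_pos]\<close>)
    then show ?thesis using False W[of p] Suc.prems by (simp add: bind_assoc_pmf)
  qed
qed

definition Wout :: "int list set" where "Wout = ebox r \<union> {p. int h \<le> \<bar>p ! d\<bar>}"
definition Win :: "int list set" where "Win = {p. \<bar>p ! d\<bar> \<le> int N}"

lemma law_out: "p \<in> Epts d N \<Longrightarrow> law n True k p = bind_pmf (E.stopt Wout n p) (outcome True k)"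
  by (rule law_stop) (auto simp: Wout_def ebox_def Abox_def upd_def col_def)

lemma law_in: "p \<in> Epts d N \<Longrightarrow> law n False k p = bind_pmf (E.stopt Win n p) (outcome False k)"
  by (rule law_stop) (auto simp: Win_def upd_def col_def)

lemma Win_far: "- Win = far d N"
  by (auto simp: Win_def far_def[OF N])

definition hx :: "(int list \<times> nat) option \<Rightarrow> int list option" where
  "hx x = (case x of None \<Rightarrow> None | Some (q, n) \<Rightarrow> if q \<in> ebox r then Some (toZ d N q) else None)"

lemma hx_measure:
  assumes "x \<in> ebox r"
  shows "{y. hx y = Some (toZ d N x)} = {y. \<exists>n'. y = Some (x, n')}"
proof -
  have "q = x" if "q \<in> ebox r" "toZ d N q = toZ d N x" for q
    using inj_onD[OF inj_on_toZ that(2)] that assms by (auto simp: ebox_def)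
  then show ?thesis using assms by (auto simp: hx_def split: option.splits if_splits)
qed

lemma set_stopt_out:
  assumes "p \<in> Epts d N" "\<bar>p ! d\<bar> \<le> int h" "Some (q, n') \<in> set_pmf (E.stopt Wout n p)"
  shows "q \<in> Epts d N" "q \<in> ebox r \<or> \<bar>q ! d\<bar> = int h"
proof -
  have "(q \<in> Epts d N \<and> \<bar>q ! d\<bar> \<le> int h) \<and> q \<in> Wout \<and> n' \<le> n"
  proof (rule E.set_stopt[OF _ _ assms(3)])
    show "mvE d N p j \<in> Epts d N \<and> \<bar>mvE d N p j ! d\<bar> \<le> int h"
      if "p \<in> Epts d N \<and> \<bar>p ! d\<bar> \<le> int h" "p \<notin> Wout" "j < nm d" for p j
      using that E.closed height_mvE_le[of p d N j] by (auto simp: Wout_def)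
  qed (use assms in auto)
  then show "q \<in> Epts d N" "q \<in> ebox r \<or> \<bar>q ! d\<bar> = int h" by (auto simp: Wout_def)
qed

lemma set_stopt_in:
  assumes \<sigma>: "\<sigma> = 1 \<or> \<sigma> = - 1" and "p \<in> Epts d N" "int N \<le> \<sigma> * p ! d"
    "Some (q, n') \<in> set_pmf (E.stopt Win n p)"
  shows "q \<in> slice d N (\<sigma> * int N)" "n' \<le> n"
proof -
  have "(q \<in> Epts d N \<and> int N \<le> \<sigma> * q ! d) \<and> q \<in> Win \<and> n' \<le> n"
  proof (rule E.set_stopt[OF _ _ assms(4)])
    show "mvE d N p j \<in> Epts d N \<and> int N \<le> \<sigma> * mvE d N p j ! d"
      if "p \<in> Epts d N \<and> int N \<le> \<sigma> * p ! d" "p \<notin> Win" "j < nm d" for p j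
      using that E.closed height_mvE_le[of p d N j] \<sigma> by (auto simp: Win_def)
  qed (use assms in auto)
  then show "q \<in> slice d N (\<sigma> * int N)" "n' \<le> n" using \<sigma> by (auto simp: Win_def slice_def)
qed

lemma ebox_mono: "R \<le> R' \<Longrightarrow> ebox R \<subseteq> ebox R'"
  unfolding ebox_def using zbox_mono by blast

lemma finite_Abox: "finite Abox" "Abox \<subseteq> Zpts d"
  by (auto simp: Abox_def finite_zbox intro: subsetD[OF zbox_Zpts])

end

text \<open>The analytic inputs. Each \<open>u\<close> bounds a density relative to an escape
  probability, and the matching \<open>w\<close> is the level that pays for it: index 1 for an
  excursion whose start has density at most \<open>\<rho>\<close>, index 2 for a return from outside
  \<open>ebox (N div 4)\<close>, index 3 for a uniform start inside the intermediate box.\<close>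

locale cylinder_est = cylinder +
  fixes u1 u2 u3 w1 w2 w3 \<delta> \<rho> S1 :: real
  assumes pos: "0 \<le> u2" "0 \<le> u3" "0 < w1" "0 < w2" "0 < w3" "0 < \<delta>" "0 \<le> \<rho>" "0 \<le> S1"
    and mix: "\<And>n p q. p \<in> Epts d N \<Longrightarrow> \<bar>p ! d\<bar> = int h \<Longrightarrow> q \<in> Epts d N \<Longrightarrow> \<bar>q ! d\<bar> = int N \<Longrightarrow>
      rwalk.hitd (mvE d N) (nm d) (far d N) n p q \<le> \<rho>"
    and hitS: "\<And>n x z. x \<in> ebox r \<Longrightarrow> \<bar>z\<bar> \<le> int N \<Longrightarrow>
      (\<Sum>q\<in>slice d N z - ebox R1. rwalk.hitd (mvE d N) (nm d) (- Wout) n q x) \<le> S1 * rwalk.esc mvZ (nm d) Abox (toZ d N x)"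
    and u1: "u1 = \<rho> * S1"
    and hit2: "\<And>n p x. p \<in> Epts d N \<Longrightarrow> \<bar>p ! d\<bar> < int h \<Longrightarrow> p \<notin> ebox (N div 4) \<Longrightarrow> x \<in> ebox r \<Longrightarrow>
      rwalk.hitd (mvE d N) (nm d) (- Wout) n p x \<le> u2 * rwalk.esc mvZ (nm d) Abox (toZ d N x)"
    and disc: "\<And>q z. q \<in> zbox d R1 \<Longrightarrow> q ! d = z \<Longrightarrow>
      1 / real N ^ d \<le> u3 * rwalk.esc mvZ (nm d) {q \<in> zbox d R1. q ! d = z} q"
    and dens: "1 / real N ^ d \<le> \<rho>" "\<And>z. slice d N z - ebox R1 \<noteq> {} \<and> 1 / real (card (slice d N z - ebox R1)) \<le> \<rho>"
    and c1: "u1 * (1 + \<delta>) * rwalk.ecap mvZ (nm d) Abox \<le> 1 - exp (- w1 * rwalk.ecap mvZ (nm d) Abox)"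
    and c2: "u2 * (1 + \<delta>) * rwalk.ecap mvZ (nm d) Abox \<le> 1 - exp (- w2 * rwalk.ecap mvZ (nm d) Abox)"
    and c3: "u3 * (1 + \<delta>) * rwalk.ecap mvZ (nm d) (zbox d R1) \<le> 1 - exp (- w3 * rwalk.ecap mvZ (nm d) (zbox d R1))"
    and c4: "u2 * rwalk.ecap mvZ (nm d) Abox \<le> 1 / 4"
begin

interpretation Z: rwalk "Zpts d" mvZ "nm d" flip by (rule rwalk_Z)
interpretation E: rwalk "Epts d N" "mvE d N" "nm d" flip by (rule rwalk_E[OF N])

abbreviation "poiA \<equiv> Z.poi Abox"
abbreviation "kapA \<equiv> Z.kap Abox"

text \<open>Growth of the error per excursion: 1 for missing the box, plus 4 times the bound on the
  hitting probability, since the error after a hit is four times as large.\<close>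

definition B :: real where "B = 1 + 4 * (u1 * Z.ecap Abox)"

lemma u1_nonneg: "0 \<le> u1" using pos u1 by simp

lemma B1: "1 \<le> B" unfolding B_def using u1_nonneg Z.ecap_nonneg[of Abox] by simp

text \<open>The induction hypothesis for a walk at height \<open>h\<close> with \<open>k\<close>
  departures left. The number \<open>j\<close> is a budget for further returns to the box: each
  additional level \<open>w2\<close> halves the error.\<close>

definition far_ok :: "nat \<Rightarrow> bool" where
  "far_ok k \<longleftrightarrow> (\<forall>j n p. p \<in> Epts d N \<longrightarrow> \<bar>p ! d\<bar> = int h \<longrightarrow>
     sdom (B ^ k / 2 ^ j) (law n False k p) (poiA (real k * w1 + real j * w2)))"

lemma intensity_nonneg: "0 \<le> real k * w1 + real j * w2" using pos by simp

lemma Bk: "0 \<le> B ^ k / 2 ^ j" "1 \<le> B ^ k" "0 \<le> B ^ k" using B1 by auto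

lemma B_step: "4 * (B ^ k / 2 ^ j) * (u1 * Z.ecap Abox) + B ^ k / 2 ^ j = B ^ Suc k / 2 ^ j"
proof -
  define x where "x = B ^ k / 2 ^ j"
  have "4 * x * (u1 * Z.ecap Abox) + x = B * x" by (simp add: B_def algebra_simps)
  then show ?thesis by (simp add: x_def)
qed

lemma ebox_Epts: "p \<in> ebox R \<Longrightarrow> p \<in> Epts d N" by (simp add: ebox_def)

lemma ebox_height: "p \<in> ebox R \<Longrightarrow> \<bar>p ! d\<bar> \<le> int R"
  unfolding ebox_def zbox_def using toZ_nth[of d d N p] by auto

lemma rN4: "r \<le> N div 4" "R1 \<le> N div 4"
proof -
  show "R1 \<le> N div 4" using RN by (subst less_eq_div_iff_mult_less_eq) auto
  then show "r \<le> N div 4" using rR by linarith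
qed

lemma N4: "4 * int (N div 4) \<le> int N" "16 \<le> int N"
proof -
  have "16 \<le> N" using RN by simp
  then show "16 \<le> int N" by simp
  show "4 * int (N div 4) \<le> int N" by linarith
qed

lemma uni_bind: "uni (bind_pmf \<mu> X) P = bind_pmf \<mu> (\<lambda>i. uni (X i) P)"
  by (simp add: uni_def bind_assoc_pmf)

lemma uni_map_Un: "uni (map_pmf (\<lambda>S. C \<union> S) X) P = map_pmf (\<lambda>S. C \<union> S) (uni X P)"
proof -
  have "(\<union>) (C \<union> x) = (\<lambda>y. C \<union> (x \<union> y))" for x by auto
  then show ?thesis by (simp add: uni_def bind_map_pmf map_bind_pmf pmf.map_comp o_def)
qed

text \<open>Until the walk leaves \<open>ebox (N div 4)\<close>, it can be run together with a walk on the lattice.\<close>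

lemma segment:
  assumes out: "\<And>n p. p \<in> Epts d N \<Longrightarrow> \<bar>p ! d\<bar> < int h \<Longrightarrow> p \<notin> ebox (N div 4) \<Longrightarrow> sdom e (law n True k p) P"
    and e: "0 \<le> e" and p: "p \<in> ebox (N div 4)"
  shows "sdom e (law n True k p) (uni (kapA (toZ d N p)) P)"
  using p
proof (induction n arbitrary: p)
  case (0 p)
  let ?C = "{toZ d N p} \<inter> Abox"
  have ph: "\<bar>p ! d\<bar> < int h" using ebox_height[OF 0] Nh by linarith
  have l: "law 0 True k p = map_pmf (\<lambda>S. ?C \<union> S) (return_pmf {})" using ph by (simp add: upd_def col_def)
  show ?case
    unfolding l Z.kap_rec[OF finite_Abox(1), of "toZ d N p"] uni_map_Un
    by (intro sdom_map_Un sdom_empty e order_refl)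
next
  case (Suc n p)
  let ?C = "{toZ d N p} \<inter> Abox"
  have ph: "\<bar>p ! d\<bar> \<le> int (N div 4)" by (rule ebox_height[OF Suc.prems])
  then have ph': "\<bar>p ! d\<bar> < int h" using Nh by linarith
  have l: "law (Suc n) True k p = map_pmf (\<lambda>S. ?C \<union> S) (bind_pmf (steps (nm d)) (\<lambda>j. law n True k (mvE d N p j)))"
    using ph' by (simp add: upd_def col_def)
  show ?case
    unfolding l Z.kap_rec[OF finite_Abox(1), of "toZ d N p"] uni_map_Un uni_bind
  proof (intro sdom_map_Un sdom_bind e order_refl)
    fix j assume "j \<in> set_pmf (steps (nm d))"
    then have j: "j < nm d" by (simp add: set_steps[OF nm_pos])
    have pE: "p \<in> Epts d N" using Suc.prems by (rule ebox_Epts)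
    have tz: "toZ d N (mvE d N p j) = mvZ (toZ d N p) j"
    proof (rule toZ_mvE[OF pE j])
      fix i assume "i < d"
      then have "\<bar>toZ d N p ! i\<bar> \<le> int (N div 4)" using Suc.prems by (simp add: ebox_def zbox_def)
      then show "2 * \<bar>toZ d N p ! i\<bar> + 2 < int N" using N4 by linarith
    qed
    show "sdom e (law n True k (mvE d N p j)) (uni (kapA (mvZ (toZ d N p) j)) P)"
    proof (cases "mvE d N p j \<in> ebox (N div 4)")
      case True then show ?thesis using Suc.IH[of "mvE d N p j"] tz by simp
    next
      case False
      have "\<bar>mvE d N p j ! d\<bar> < int h" using height_mvE_le[OF pE j] ph Nh N4 by linarith
      then have "sdom e (law n True k (mvE d N p j)) P" using out[of "mvE d N p j"] False E.closed[OF pE j] by simp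
      then show ?thesis by (rule sdom_trans0) (rule sdom_uni_absorb)
    qed
  qed
qed

lemma hx_Some:
  assumes "p \<in> Epts d N" "\<bar>p ! d\<bar> \<le> int h" "y \<in> set_pmf (E.stopt Wout n p)" "hx y = Some q"
  obtains x n' where "y = Some (x, n')" "x \<in> ebox r" "q = toZ d N x" "q \<in> Abox"
  using assms by (auto simp: hx_def ebox_def Abox_def split: option.splits if_splits)

lemma hx_None:
  assumes "p \<in> Epts d N" "\<bar>p ! d\<bar> \<le> int h" "y \<in> set_pmf (E.stopt Wout n p)" "hx y = None"
  shows "y = None \<or> (\<exists>x n'. y = Some (x, n') \<and> x \<in> Epts d N \<and> \<bar>x ! d\<bar> = int h)"
proof (cases y)
  case (Some a)
  then obtain x n' where y: "y = Some (x, n')" by (cases a) auto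
  then show ?thesis using set_stopt_out[OF assms(1,2), of x n' n] assms(3,4) by (auto simp: hx_def split: if_splits)
qed simp

lemma Abox_toZ:
  assumes "q \<in> Abox" obtains x where "x \<in> ebox r" "q = toZ d N x"
proof -
  define x where "x = map (\<lambda>i. if i < d then q ! i mod int N else q ! i) [0..<d + 1]"
  have q: "length q = d + 1" "\<And>i. i \<le> d \<Longrightarrow> \<bar>q ! i\<bar> \<le> int r" using assms by (auto simp: Abox_def zbox_def)
  have xn: "x ! i = (if i < d then q ! i mod int N else q ! i)" if "i \<le> d" for i
    using that by (auto simp: x_def nth_append simp del: upt_Suc)
  have xE: "x \<in> Epts d N" unfolding Epts_def using N xn by (auto simp: x_def simp del: upt_Suc)
  have xq: "toZ d N x = q"
  proof (rule nth_equalityI)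
    show "length (toZ d N x) = length q" using q by (simp add: length_toZ)
    fix i assume "i < length (toZ d N x)"
    then have i: "i \<le> d" by (simp add: length_toZ)
    have "tz N (q ! i mod int N) = q ! i"
      by (rule tz_unique) (use N q(2)[OF i] rR RN in auto)
    then show "toZ d N x ! i = q ! i" using i by (simp add: toZ_nth xn)
  qed
  have "x \<in> ebox r" unfolding ebox_def using xE assms xq by (simp add: Abox_def)
  then show ?thesis using xq[symmetric] by (rule that)
qed

text \<open>A walk run until \<open>Wout\<close> either enters the box, where \<open>seg\<close>
  takes over, or leaves the large cylinder, where the hypothesis for \<open>k\<close> applies, or
  runs out of time and leaves nothing.\<close>

lemma excursion_sdom:
  assumes IH: "far_ok k"
    and seg: "\<And>n p. p \<in> ebox r \<Longrightarrow> sdom (4 * (B ^ k / 2 ^ j)) (law n True (Suc k) p) (uni (kapA (toZ d N p)) (poiA (real k * w1 + real j * w2)))"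
    and Q: "\<And>y. y \<in> set_pmf Q \<Longrightarrow> y = None \<or> (\<exists>n p. y \<in> set_pmf (E.stopt Wout n p) \<and> p \<in> Epts d N \<and> \<bar>p ! d\<bar> \<le> int h)"
    and u: "\<And>x. x \<in> ebox r \<Longrightarrow> measure (measure_pmf Q) {y. \<exists>n'. y = Some (x, n')} \<le> u * Z.esc Abox (toZ d N x)"
    and u0: "0 \<le> u" "0 < w" "u * (1 + \<delta>) * Z.ecap Abox \<le> 1 - exp (- w * Z.ecap Abox)"
  shows "sdom (4 * (B ^ k / 2 ^ j) * (u * Z.ecap Abox) + B ^ k / 2 ^ j)
     (bind_pmf Q (outcome True (Suc k))) (poiA (w + (real k * w1 + real j * w2)))"
proof (rule Z.step_sdom[where X=Abox and hx=hx and \<delta>=\<delta>])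
  fix q assume "q \<in> Abox"
  then obtain x where x: "x \<in> ebox r" "q = toZ d N x" by (rule Abox_toZ)
  show "measure (measure_pmf Q) {y. hx y = Some q} \<le> u * Z.esc Abox q"
    using u[OF x(1)] by (simp add: x(2) hx_measure[OF x(1)])
next
  fix y q assume y: "y \<in> set_pmf Q" "hx y = Some q"
  then have "y \<noteq> None" by (cases y) (auto simp: hx_def)
  then obtain n p where np: "y \<in> set_pmf (E.stopt Wout n p)" "p \<in> Epts d N" "\<bar>p ! d\<bar> \<le> int h" using Q[OF y(1)] by auto
  obtain x n' where x: "y = Some (x, n')" "x \<in> ebox r" "q = toZ d N x" "q \<in> Abox"
    by (rule hx_Some[OF np(2,3,1) y(2)])
  show "q \<in> Abox" by fact
  show "sdom (4 * (B ^ k / 2 ^ j)) (outcome True (Suc k) y) (uni (kapA q) (poiA (real k * w1 + real j * w2)))"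
    using seg[OF x(2)] x by (simp add: outcome_def)
next
  fix y assume y: "y \<in> set_pmf Q" "hx y = None"
  show "sdom (B ^ k / 2 ^ j) (outcome True (Suc k) y) (poiA (real k * w1 + real j * w2))"
  proof (cases "y = None")
    case True then show ?thesis using Bk by (simp add: outcome_def sdom_empty)
  next
    case False
    then obtain n p where np: "y \<in> set_pmf (E.stopt Wout n p)" "p \<in> Epts d N" "\<bar>p ! d\<bar> \<le> int h" using Q[OF y(1)] by auto
    obtain x n' where x: "y = Some (x, n')" "x \<in> Epts d N" "\<bar>x ! d\<bar> = int h"
      using hx_None[OF np(2,3,1) y(2)] False by auto
    then show ?thesis using IH unfolding far_ok_def by (simp add: outcome_def law_exit)
  qed
qed (use finite_Abox u0 pos intensity_nonneg Bk in auto)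

text \<open>Induction on the budget \<open>j\<close>; for \<open>j = 0\<close> the error is at least
  1 and the claim is trivial. Otherwise the box is reached with probability at most 1/4 by
  \<open>c4\<close>. With \<open>x = B ^ k / 2 ^ j\<close> the error is then at most
  \<open>4 * x / 4 + x\<close>, which equals \<open>4 * (x / 2)\<close>; this explains the constant
  4.\<close>

lemma back_sdom:
  assumes IH: "far_ok k" and p: "p \<in> Epts d N" "\<bar>p ! d\<bar> < int h" "p \<notin> ebox (N div 4)"
  shows "sdom (4 * (B ^ k / 2 ^ j)) (law n True (Suc k) p) (poiA (real k * w1 + real j * w2))"
  using p
proof (induction j arbitrary: n p)
  case 0 then show ?case using Bk(2)[of k] by (intro sdom_trivial) auto
next
  case (Suc j)
  have "sdom (4 * (B ^ k / 2 ^ j) * (u2 * Z.ecap Abox) + B ^ k / 2 ^ j)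
     (bind_pmf (E.stopt Wout n p) (outcome True (Suc k))) (poiA (w2 + (real k * w1 + real j * w2)))"
  proof (rule excursion_sdom[OF IH])
    fix n p assume "p \<in> ebox r"
    then have "p \<in> ebox (N div 4)" using ebox_mono[OF rN4(1)] by blast
    then show "sdom (4 * (B ^ k / 2 ^ j)) (law n True (Suc k) p) (uni (kapA (toZ d N p)) (poiA (real k * w1 + real j * w2)))"
      using Bk by (intro segment Suc.IH) auto
  next
    fix x assume "x \<in> ebox r"
    then show "measure (measure_pmf (E.stopt Wout n p)) {y. \<exists>n'. y = Some (x, n')} \<le> u2 * Z.esc Abox (toZ d N x)"
      using hit2[OF Suc.prems] by (simp add: E.measure_stopt Wout_def)
  qed (use pos c2 Suc.prems in \<open>auto intro!: exI[of _ n] exI[of _ p]\<close>)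
  moreover have "4 * (B ^ k / 2 ^ j) * (u2 * Z.ecap Abox) + B ^ k / 2 ^ j \<le> 4 * (B ^ k / 2 ^ Suc j)"
    using mult_left_mono[OF c4, of "4 * (B ^ k / 2 ^ j)"] Bk(1)[of k j] by simp
  ultimately show ?case
    using sdom_mono law_out[OF Suc.prems(1)] by (simp add: algebra_simps)
qed

lemma segment_sdom:
  assumes "far_ok k" "p \<in> ebox (N div 4)"
  shows "sdom (4 * (B ^ k / 2 ^ j)) (law n True (Suc k) p) (uni (kapA (toZ d N p)) (poiA (real k * w1 + real j * w2)))"
  by (rule segment) (use assms back_sdom Bk in auto)

text \<open>If the entrance density is at most \<open>\<rho>\<close>, the box is first met at
  \<open>x\<close> with probability at most \<open>\<rho>\<close> times the sum of the hitting
  probabilities over the slice, and \<open>hitS\<close> turns this into \<open>u1\<close> times the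
  escape probability.\<close>

lemma enter_sdom:
  assumes IH: "far_ok k" and \<sigma>: "\<sigma> = 1 \<or> \<sigma> = - 1"
    and Q0: "\<And>q n'. Some (q, n') \<in> set_pmf Q0 \<Longrightarrow> q \<in> slice d N (\<sigma> * int N) \<and> n' \<le> n"
    and Q\<rho>: "\<And>q. q \<in> slice d N (\<sigma> * int N) \<Longrightarrow> measure (measure_pmf Q0) {y. \<exists>n'. y = Some (q, n')} \<le> \<rho>"
  shows "sdom (B ^ Suc k / 2 ^ j) (bind_pmf Q0 (outcome False (Suc k))) (poiA (real (Suc k) * w1 + real j * w2))"
proof -
  define Q where "Q = bind_pmf Q0 (\<lambda>y. case y of None \<Rightarrow> return_pmf None | Some (q, n') \<Rightarrow> E.stopt Wout n' q)"
  let ?F = "slice d N (\<sigma> * int N)"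
  \<comment> \<open>Height \<open>N\<close> is beyond the intermediate box, so \<open>hitS\<close>
    covers the full slice.\<close>
  have FR: "?F - ebox R1 = ?F"
    using ebox_height \<sigma> RN N by (fastforce simp: slice_def)
  have F: "q \<in> Epts d N" "\<bar>q ! d\<bar> = int N" if "q \<in> ?F" for q using that \<sigma> by (auto simp: slice_def)
  have eq: "bind_pmf Q0 (outcome False (Suc k)) = bind_pmf Q (outcome True (Suc k))"
    unfolding Q_def bind_assoc_pmf
  proof (rule bind_pmf_cong[OF refl])
    fix y assume y: "y \<in> set_pmf Q0"
    show "outcome False (Suc k) y = bind_pmf (case y of None \<Rightarrow> return_pmf None | Some (q, n') \<Rightarrow> E.stopt Wout n' q) (outcome True (Suc k))"
    proof (cases y)
      case None then show ?thesis by (simp add: outcome_def bind_return_pmf)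
    next
      case (Some a)
      then obtain q n' where a: "y = Some (q, n')" by (cases a) auto
      then have "q \<in> ?F" using Q0 y by blast
      then show ?thesis using a F[of q] by (simp add: outcome_def law_enter law_out[symmetric])
    qed
  qed
  have "sdom (4 * (B ^ k / 2 ^ j) * (u1 * Z.ecap Abox) + B ^ k / 2 ^ j)
     (bind_pmf Q (outcome True (Suc k))) (poiA (w1 + (real k * w1 + real j * w2)))"
  proof (rule excursion_sdom[OF IH])
    fix n p assume "p \<in> ebox r"
    then show "sdom (4 * (B ^ k / 2 ^ j)) (law n True (Suc k) p) (uni (kapA (toZ d N p)) (poiA (real k * w1 + real j * w2)))"
      using ebox_mono[OF rN4(1)] by (intro segment_sdom IH) auto
  next
    fix y assume "y \<in> set_pmf Q"
    then obtain y0 where y0: "y0 \<in> set_pmf Q0" "y \<in> set_pmf (case y0 of None \<Rightarrow> return_pmf None | Some (q, n') \<Rightarrow> E.stopt Wout n' q)"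
      by (auto simp: Q_def)
    show "y = None \<or> (\<exists>n p. y \<in> set_pmf (E.stopt Wout n p) \<and> p \<in> Epts d N \<and> \<bar>p ! d\<bar> \<le> int h)"
    proof (cases y0)
      case (Some a)
      then obtain q n' where a: "y0 = Some (q, n')" by (cases a) auto
      then have "q \<in> ?F" using Q0 y0 by blast
      then show ?thesis using F[of q] a y0 Nh by (intro disjI2 exI[of _ n'] exI[of _ q]) auto
    qed (use y0 in auto)
  next
    fix x assume x: "x \<in> ebox r"
    have "measure (measure_pmf Q) {y. \<exists>n'. y = Some (x, n')}
      = (\<integral>y. measure (measure_pmf (case y of None \<Rightarrow> return_pmf None | Some (q, n') \<Rightarrow> E.stopt Wout n' q)) {y. \<exists>n'. y = Some (x, n')} \<partial>measure_pmf Q0)"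
      unfolding Q_def by (rule measure_bind_pmf)
    also have "\<dots> \<le> (\<integral>y. (\<Sum>q\<in>?F. indicator {y. \<exists>n'. y = Some (q, n')} y * E.hitd (- Wout) n q x) \<partial>measure_pmf Q0)"
    proof (rule integral_mono_AE)
      show "integrable (measure_pmf Q0) (\<lambda>y. measure (measure_pmf (case y of None \<Rightarrow> return_pmf None | Some (q, n') \<Rightarrow> E.stopt Wout n' q)) {y. \<exists>n'. y = Some (x, n')})"
        by (rule measure_pmf.integrable_const_bound[where B=1]) auto
      show "integrable (measure_pmf Q0) (\<lambda>y. \<Sum>q\<in>?F. indicator {y. \<exists>n'. y = Some (q, n')} y * E.hitd (- Wout) n q x)"
        by (intro Bochner_Integration.integrable_sum integrable_mult_left measure_pmf.integrable_const_bound[where B=1]) (auto simp: indicator_def)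
      show "AE y in measure_pmf Q0. measure (measure_pmf (case y of None \<Rightarrow> return_pmf None | Some (q, n') \<Rightarrow> E.stopt Wout n' q)) {y. \<exists>n'. y = Some (x, n')}
         \<le> (\<Sum>q\<in>?F. indicator {y. \<exists>n'. y = Some (q, n')} y * E.hitd (- Wout) n q x)"
        unfolding AE_measure_pmf_iff
      proof
        fix y assume y: "y \<in> set_pmf Q0"
        show "measure (measure_pmf (case y of None \<Rightarrow> return_pmf None | Some (q, n') \<Rightarrow> E.stopt Wout n' q)) {y. \<exists>n'. y = Some (x, n')}
         \<le> (\<Sum>q\<in>?F. indicator {y. \<exists>n'. y = Some (q, n')} y * E.hitd (- Wout) n q x)"
        proof (cases y)
          case None then show ?thesis by (simp add: indicator_def)
        next
          case (Some a)
          then obtain q n' where a: "y = Some (q, n')" by (cases a) auto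
          then have q: "q \<in> ?F" "n' \<le> n" using Q0 y by blast+
          have "(\<Sum>q\<in>?F. indicator {y. \<exists>n'. y = Some (q, n')} y * E.hitd (- Wout) n q x) = (\<Sum>q'\<in>?F. if q = q' then E.hitd (- Wout) n q' x else 0)"
            by (intro sum.cong) (auto simp: a indicator_def)
          also have "\<dots> = E.hitd (- Wout) n q x" using q by (simp add: finite_slice sum.delta)
          \<comment> \<open>The time left after the entrance is random; monotonicity of
            \<open>hitd\<close> replaces it by the full horizon.\<close>
          finally show ?thesis using a x E.hitd_mono[OF q(2), of "- Wout" q x]
            by (simp add: E.measure_stopt Wout_def)
        qed
      qed
    qed
    also have "\<dots> = (\<Sum>q\<in>?F. measure (measure_pmf Q0) {y. \<exists>n'. y = Some (q, n')} * E.hitd (- Wout) n q x)"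
    proof (subst Bochner_Integration.integral_sum)
      show "integrable (measure_pmf Q0) (\<lambda>y. indicator {y. \<exists>n'. y = Some (q, n')} y * E.hitd (- Wout) n q x)" for q
        by (intro integrable_mult_left measure_pmf.integrable_const_bound[where B=1]) (auto simp: indicator_def)
    qed simp
    also have "\<dots> \<le> (\<Sum>q\<in>?F. \<rho> * E.hitd (- Wout) n q x)"
      by (intro sum_mono mult_right_mono Q\<rho> E.hitd_bounds)
    also have "\<dots> = \<rho> * (\<Sum>q\<in>?F - ebox R1. E.hitd (- Wout) n q x)" unfolding FR by (simp add: sum_distrib_left)
    also have "\<dots> \<le> \<rho> * (S1 * Z.esc Abox (toZ d N x))"
      by (rule mult_left_mono[OF hitS[OF x]]) (use \<sigma> pos in auto)
    finally show "measure (measure_pmf Q) {y. \<exists>n'. y = Some (x, n')} \<le> u1 * Z.esc Abox (toZ d N x)"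
      by (simp add: u1 mult.assoc)
  qed (use u1_nonneg pos c1 in auto)
  then show ?thesis unfolding eq B_step by (simp add: algebra_simps)
qed

lemma far_ok: "far_ok k"
proof (induction k)
  case 0
  show ?case unfolding far_ok_def by (auto simp: law_done intro: sdom_empty)
next
  case (Suc k)
  show ?case unfolding far_ok_def
  proof (intro allI impI)
    fix j n p assume p: "p \<in> Epts d N" "\<bar>p ! d\<bar> = int h"
    define \<sigma> :: int where "\<sigma> = (if 0 \<le> p ! d then 1 else - 1)"
    have \<sigma>: "\<sigma> = 1 \<or> \<sigma> = - 1" "int N \<le> \<sigma> * p ! d" using p Nh by (auto simp: \<sigma>_def)
    have "sdom (B ^ Suc k / 2 ^ j) (bind_pmf (E.stopt Win n p) (outcome False (Suc k))) (poiA (real (Suc k) * w1 + real j * w2))"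
    proof (rule enter_sdom[OF Suc \<sigma>(1)])
      show "q \<in> slice d N (\<sigma> * int N) \<and> n' \<le> n" if "Some (q, n') \<in> set_pmf (E.stopt Win n p)" for q n'
        using set_stopt_in[OF \<sigma>(1) p(1) \<sigma>(2) that] by blast
      fix q assume "q \<in> slice d N (\<sigma> * int N)"
      then have "q \<in> Epts d N" "\<bar>q ! d\<bar> = int N" using \<sigma> by (auto simp: slice_def)
      then show "measure (measure_pmf (E.stopt Win n p)) {y. \<exists>n'. y = Some (q, n')} \<le> \<rho>"
        using mix[OF p] pos by (simp add: E.measure_stopt Win_far)
    qed
    then show "sdom (B ^ Suc k / 2 ^ j) (law n False (Suc k) p) (poiA (real (Suc k) * w1 + real j * w2))"
      by (simp only: law_in[OF p(1)])
  qed
qed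

lemma slice_ne: "slice d N z \<noteq> {}" using dens(2)[of z] by blast

text \<open>A uniform start beyond the inner cylinder enters it with density at most
  \<open>1 / N ^ d\<close> by the slice sum, so the excursion step applies at once.\<close>

lemma start_outside:
  assumes z: "int N < \<bar>z\<bar>"
  shows "sdom (B ^ Suc k / 2 ^ j) (bind_pmf (pmf_of_set (slice d N z)) (law n False (Suc k))) (poiA (real (Suc k) * w1 + real j * w2))"
proof -
  define \<sigma> :: int where "\<sigma> = (if 0 \<le> z then 1 else - 1)"
  have \<sigma>: "\<sigma> = 1 \<or> \<sigma> = - 1" "int N \<le> \<sigma> * z" using z by (auto simp: \<sigma>_def)
  define Q0 where "Q0 = bind_pmf (pmf_of_set (slice d N z)) (E.stopt Win n)"
  have set: "set_pmf (pmf_of_set (slice d N z)) = slice d N z" by (rule set_pmf_of_set[OF slice_ne finite_slice])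
  have "bind_pmf (pmf_of_set (slice d N z)) (law n False (Suc k)) = bind_pmf Q0 (outcome False (Suc k))"
    unfolding Q0_def bind_assoc_pmf
  proof (rule bind_pmf_cong[OF refl])
    fix p assume "p \<in> set_pmf (pmf_of_set (slice d N z))"
    then have "p \<in> slice d N z" by (simp only: set)
    then show "law n False (Suc k) p = bind_pmf (E.stopt Win n p) (outcome False (Suc k))"
      by (simp add: slice_def law_in)
  qed
  moreover have "sdom (B ^ Suc k / 2 ^ j) (bind_pmf Q0 (outcome False (Suc k))) (poiA (real (Suc k) * w1 + real j * w2))"
  proof (rule enter_sdom[OF far_ok \<sigma>(1)])
    show "q \<in> slice d N (\<sigma> * int N) \<and> n' \<le> n" if s: "Some (q, n') \<in> set_pmf Q0" for q n'
    proof -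
      obtain p where p: "p \<in> slice d N z" "Some (q, n') \<in> set_pmf (E.stopt Win n p)"
        using s by (auto simp: Q0_def set)
      have "p \<in> Epts d N" "int N \<le> \<sigma> * p ! d" using p \<sigma> by (auto simp: slice_def)
      from set_stopt_in[OF \<sigma>(1) this p(2)] show ?thesis by blast
    qed
    fix q assume q: "q \<in> slice d N (\<sigma> * int N)"
    then have "q \<in> Win" using \<sigma> by (auto simp: slice_def Win_def)
    then have "measure (measure_pmf Q0) {y. \<exists>n'. y = Some (q, n')} = (\<Sum>p\<in>slice d N z. E.hitd (far d N) n p q) / real (card (slice d N z))"
      unfolding Q0_def measure_bind_pmf
      by (subst integral_pmf_of_set[OF slice_ne finite_slice]) (simp add: E.measure_stopt Win_far)
    also have "\<dots> \<le> 1 / real N ^ d" unfolding card_slice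
      using hitd_slice_sum[OF N \<sigma> q] by (simp add: divide_right_mono)
    finally show "measure (measure_pmf Q0) {y. \<exists>n'. y = Some (q, n')} \<le> \<rho>" using dens(1) by linarith
  qed
  ultimately show ?thesis by simp
qed

text \<open>The reversal estimate excludes starting points in the intermediate box. Such a start is
  treated as an entrance into the disc \<open>D\<close> that the slice cuts out of this box: its
  density \<open>1 / N ^ d\<close> is at most \<open>u3 * esc D\<close>, and the level
  \<open>w3\<close> pays for it once.\<close>

lemma start_inside:
  assumes z: "\<bar>z\<bar> \<le> int N"
  shows "sdom (5 * (B ^ Suc k / 2 ^ j)) (bind_pmf (pmf_of_set (slice d N z)) (law n False (Suc k)))
    (poiA (w3 + (real (Suc k) * w1 + real j * w2)))"
proof -
  let ?S = "slice d N z"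
  define D where "D = {q \<in> zbox d R1. q ! d = z}"
  have lawT: "law n False (Suc k) p = law n True (Suc k) p" if "p \<in> ?S" for p
    using that z by (intro law_enter) (auto simp: slice_def)
  have set: "set_pmf (pmf_of_set ?S) = ?S" by (rule set_pmf_of_set[OF slice_ne finite_slice])
  have ne: "?S - ebox R1 \<noteq> {}" and fin: "finite (?S - ebox R1)" using dens(2) finite_slice by auto
  have set': "set_pmf (pmf_of_set (?S - ebox R1)) = ?S - ebox R1" by (rule set_pmf_of_set[OF ne fin])
  have out: "sdom (B ^ Suc k / 2 ^ j) (bind_pmf (pmf_of_set (?S - ebox R1)) (law n True (Suc k))) (poiA (real (Suc k) * w1 + real j * w2))"
  proof -
    define Q where "Q = bind_pmf (pmf_of_set (?S - ebox R1)) (E.stopt Wout n)"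
    have SE: "p \<in> Epts d N" "\<bar>p ! d\<bar> \<le> int h" if "p \<in> ?S" for p using that z Nh by (auto simp: slice_def)
    have eq: "bind_pmf (pmf_of_set (?S - ebox R1)) (law n True (Suc k)) = bind_pmf Q (outcome True (Suc k))"
      unfolding Q_def bind_assoc_pmf by (rule bind_pmf_cong[OF refl]) (use set' SE in \<open>auto simp: law_out\<close>)
    have "sdom (4 * (B ^ k / 2 ^ j) * (u1 * Z.ecap Abox) + B ^ k / 2 ^ j)
       (bind_pmf Q (outcome True (Suc k))) (poiA (w1 + (real k * w1 + real j * w2)))"
    proof (rule excursion_sdom[OF far_ok])
      fix n p assume "p \<in> ebox r"
      then show "sdom (4 * (B ^ k / 2 ^ j)) (law n True (Suc k) p) (uni (kapA (toZ d N p)) (poiA (real k * w1 + real j * w2)))"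
        using ebox_mono[OF rN4(1)] by (intro segment_sdom far_ok) auto
    next
      fix y assume "y \<in> set_pmf Q"
      then obtain p where "p \<in> ?S" "y \<in> set_pmf (E.stopt Wout n p)" by (auto simp: Q_def set')
      then show "y = None \<or> (\<exists>n p. y \<in> set_pmf (E.stopt Wout n p) \<and> p \<in> Epts d N \<and> \<bar>p ! d\<bar> \<le> int h)"
        using SE by blast
    next
      fix x assume x: "x \<in> ebox r"
      have "measure (measure_pmf Q) {y. \<exists>n'. y = Some (x, n')} = (\<Sum>p\<in>?S - ebox R1. E.hitd (- Wout) n p x) / real (card (?S - ebox R1))"
        unfolding Q_def measure_bind_pmf
        by (subst integral_pmf_of_set[OF ne fin]) (use x in \<open>simp add: E.measure_stopt Wout_def\<close>)
      also have "\<dots> = (1 / real (card (?S - ebox R1))) * (\<Sum>p\<in>?S - ebox R1. E.hitd (- Wout) n p x)" by simp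
      also have "\<dots> \<le> \<rho> * (S1 * Z.esc Abox (toZ d N x))"
        by (intro mult_mono hitS x z sum_nonneg E.hitd_bounds) (use dens(2) pos in auto)
      finally show "measure (measure_pmf Q) {y. \<exists>n'. y = Some (x, n')} \<le> u1 * Z.esc Abox (toZ d N x)"
        by (simp add: u1 mult.assoc)
    qed (use u1_nonneg pos c1 in auto)
    then show ?thesis unfolding eq B_step by (simp add: algebra_simps)
  qed
  define Q where "Q = map_pmf (\<lambda>p. if p \<in> ebox R1 then Some p else None) (pmf_of_set ?S)"
  define ct where "ct x = (case x of None \<Rightarrow> bind_pmf (pmf_of_set (?S - ebox R1)) (law n True (Suc k)) | Some p \<Rightarrow> law n True (Suc k) p)" for x
  have "bind_pmf (pmf_of_set ?S) (law n False (Suc k)) = bind_pmf (pmf_of_set ?S) (law n True (Suc k))"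
    by (rule bind_pmf_cong[OF refl]) (use set lawT in auto)
  also have "\<dots> = bind_pmf Q ct"
    unfolding Q_def ct_def by (rule bind_pmf_of_set_split[OF finite_slice ne])
  finally have eq: "bind_pmf (pmf_of_set ?S) (law n False (Suc k)) = bind_pmf Q ct" .
  have Dsub: "D \<subseteq> zbox d R1" by (auto simp: D_def)
  have setQ: "x = None \<or> (\<exists>p. x = Some p \<and> p \<in> ?S \<and> p \<in> ebox R1)" if "x \<in> set_pmf Q" for x
    using that by (auto simp: Q_def set)
  have "sdom (4 * (B ^ Suc k / 2 ^ j) * (u3 * Z.ecap D) + B ^ Suc k / 2 ^ j) (bind_pmf Q ct) (poiA (w3 + (real (Suc k) * w1 + real j * w2)))"
  proof (rule Z.step_sdom[where X="zbox d R1" and hx="map_option (toZ d N)" and \<delta>=\<delta>])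
    show "Abox \<subseteq> zbox d R1" unfolding Abox_def by (rule zbox_mono[OF rR])
    fix q assume q: "q \<in> D"
    have "measure (measure_pmf Q) {x. map_option (toZ d N) x = Some q} = measure (measure_pmf (pmf_of_set ?S)) {p. p \<in> ebox R1 \<and> toZ d N p = q}"
      unfolding Q_def by (simp add: vimage_def) (rule arg_cong[where f="measure _"], auto split: if_splits)
    also have "\<dots> = real (card (?S \<inter> {p. p \<in> ebox R1 \<and> toZ d N p = q})) / real (card ?S)"
      by (rule measure_pmf_of_set[OF slice_ne finite_slice])
    also have "\<dots> \<le> 1 / real (card ?S)"
    proof (rule divide_right_mono)
      have "card (?S \<inter> {p. p \<in> ebox R1 \<and> toZ d N p = q}) \<le> Suc 0"
      proof (subst card_le_Suc0_iff_eq)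
        show "\<forall>a1\<in>?S \<inter> {p. p \<in> ebox R1 \<and> toZ d N p = q}. \<forall>a2\<in>?S \<inter> {p. p \<in> ebox R1 \<and> toZ d N p = q}. a1 = a2"
          using inj_onD[OF inj_on_toZ[of d N]] by (auto simp: slice_def)
      qed (use finite_slice in auto)
      then show "real (card (?S \<inter> {p. p \<in> ebox R1 \<and> toZ d N p = q})) \<le> 1" by simp
    qed simp
    also have "\<dots> \<le> u3 * Z.esc D q" using q disc by (simp add: D_def card_slice)
    finally show "measure (measure_pmf Q) {x. map_option (toZ d N) x = Some q} \<le> u3 * Z.esc D q" .
  next
    fix x q assume x: "x \<in> set_pmf Q" "map_option (toZ d N) x = Some q"
    then obtain p where p: "x = Some p" "p \<in> ?S" "p \<in> ebox R1" "q = toZ d N p" using setQ[OF x(1)] by auto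
    have "toZ d N p ! d = z" using p by (simp add: slice_def toZ_nth)
    then show "q \<in> D" using p by (simp add: D_def ebox_def)
    have "sdom (4 * (B ^ k / 2 ^ j)) (law n True (Suc k) p) (uni (kapA (toZ d N p)) (poiA (real k * w1 + real j * w2)))"
      using ebox_mono[OF rN4(2)] p by (intro segment_sdom far_ok) auto
    then have 1: "sdom (4 * (B ^ Suc k / 2 ^ j)) (law n True (Suc k) p) (uni (kapA (toZ d N p)) (poiA (real k * w1 + real j * w2)))"
      by (rule sdom_mono) (use mult_right_mono[OF B1 Bk(1)[of k j]] in simp)
    have "sdom 0 (uni (kapA (toZ d N p)) (poiA (real k * w1 + real j * w2))) (uni (kapA (toZ d N p)) (poiA (real (Suc k) * w1 + real j * w2)))"
      by (intro sdom_uni_right Z.poi_mono finite_Abox intensity_nonneg order_refl) (use pos in \<open>simp add: algebra_simps\<close>)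
    from sdom_trans0[OF 1 this] show "sdom (4 * (B ^ Suc k / 2 ^ j)) (ct x) (uni (kapA q) (poiA (real (Suc k) * w1 + real j * w2)))"
      using p by (simp add: ct_def)
  next
    fix x assume x: "x \<in> set_pmf Q" "map_option (toZ d N) x = None"
    then show "sdom (B ^ Suc k / 2 ^ j) (ct x) (poiA (real (Suc k) * w1 + real j * w2))"
      using out by (simp add: ct_def)
  qed (use Dsub finite_zbox zbox_Zpts pos c3 intensity_nonneg[of "Suc k" j] Bk(1)[of "Suc k" j] in \<open>auto simp del: of_nat_Suc\<close>)
  \<comment> \<open>By \<open>c3\<close> the factor \<open>u3 * Z.ecap D\<close> is at most 1, so
    the two errors add up to 4 + 1.\<close>
  moreover have "4 * (B ^ Suc k / 2 ^ j) * (u3 * Z.ecap D) + B ^ Suc k / 2 ^ j \<le> 5 * (B ^ Suc k / 2 ^ j)"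
  proof -
    have "u3 * Z.ecap D \<le> u3 * Z.ecap (zbox d R1)"
      by (intro mult_left_mono Z.ecap_mono finite_zbox Dsub zbox_Zpts pos)
    also have "\<dots> \<le> u3 * (1 + \<delta>) * Z.ecap (zbox d R1)"
      using pos Z.ecap_nonneg by (intro mult_right_mono) (auto simp: mult_le_cancel_left1)
    also have "\<dots> \<le> 1" using c3 by (simp add: add_increasing2 order_trans)
    finally have "4 * (B ^ Suc k / 2 ^ j) * (u3 * Z.ecap D) \<le> 4 * (B ^ Suc k / 2 ^ j) * 1"
      using Bk(1)[of "Suc k" j] by (intro mult_left_mono) auto
    then show ?thesis by linarith
  qed
  ultimately show ?thesis unfolding eq by (rule sdom_mono)
qed

lemma start_sdom:
  assumes v: "w3 + (real (Suc k) * w1 + real j * w2) \<le> v"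
  shows "sdom (5 * (B ^ Suc k / 2 ^ j)) (bind_pmf (pmf_of_set (slice d N z)) (law n False (Suc k))) (poiA v)"
proof -
  have "sdom (5 * (B ^ Suc k / 2 ^ j)) (bind_pmf (pmf_of_set (slice d N z)) (law n False (Suc k)))
    (poiA (w3 + (real (Suc k) * w1 + real j * w2)))"
  proof (cases "\<bar>z\<bar> \<le> int N")
    case True then show ?thesis by (rule start_inside)
  next
    case False
    have "sdom (B ^ Suc k / 2 ^ j) (bind_pmf (pmf_of_set (slice d N z)) (law n False (Suc k))) (poiA (real (Suc k) * w1 + real j * w2))"
      by (rule start_outside) (use False in auto)
    then have "sdom (5 * (B ^ Suc k / 2 ^ j)) (bind_pmf (pmf_of_set (slice d N z)) (law n False (Suc k))) (poiA (real (Suc k) * w1 + real j * w2))"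
      by (rule sdom_mono) (use Bk(1)[of "Suc k" j] in linarith)
    then show ?thesis
      by (rule sdom_trans0) (intro Z.poi_mono finite_Abox intensity_nonneg, use pos in simp)
  qed
  then show ?thesis
    by (rule sdom_trans0) (intro Z.poi_mono finite_Abox v, use intensity_nonneg[of "Suc k" j] pos in simp)
qed

end

section \<open>Random subsets, path measure and gluing\<close>

definition set_space :: "'a set measure" where
  "set_space = sigma UNIV (range (\<lambda>p. {S. p \<in> S}))"

lemma space_set_space [simp]: "space set_space = UNIV"
  by (simp add: set_space_def)

lemma sets_member [measurable]: "{S. p \<in> S} \<in> sets set_space"
  unfolding set_space_def by (subst sets_measure_of) auto

lemma sets_Int_eq:
  assumes "finite A" shows "{S. S \<inter> A = T} \<in> sets set_space"
proof (cases "T \<subseteq> A")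
  case True
  have "{S. S \<inter> A = T} = {S \<in> space set_space. \<forall>p\<in>A. p \<in> S \<longleftrightarrow> p \<in> T}"
    using True by auto
  also have "\<dots> \<in> sets set_space"
  proof (rule sets.sets_Collect_finite_All[OF _ assms])
    fix p
    have "{S \<in> space set_space. p \<in> S \<longleftrightarrow> p \<in> T} = (if p \<in> T then {S. p \<in> S} else space set_space - {S. p \<in> S})" by auto
    then show "{S \<in> space set_space. p \<in> S \<longleftrightarrow> p \<in> T} \<in> sets set_space" by (cases "p \<in> T") (simp_all only: sets_member sets.compl_sets if_True if_False)
  qed
  finally show ?thesis .
next
  case False
  then have "{S. S \<inter> A = T} = {}" by auto
  then show ?thesis by simp
qed

text \<open>Kolmogorov extension. Sets are encoded as real-valued indicator functions, so that the
  projective limit over a Polish space applies; \<open>T\<close> decodes by reading where the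
  function equals 1.\<close>

lemma random_set_exists:
  fixes V :: "'a :: countable set" and \<mu> :: "'a set \<Rightarrow> 'a set pmf"
  assumes supp: "\<And>A. finite A \<Longrightarrow> A \<subseteq> V \<Longrightarrow> set_pmf (\<mu> A) \<subseteq> Pow A"
    and proj: "\<And>A B. A \<subseteq> B \<Longrightarrow> finite B \<Longrightarrow> B \<subseteq> V \<Longrightarrow> map_pmf (\<lambda>S. S \<inter> A) (\<mu> B) = \<mu> A"
  obtains M where "prob_space M" "sets M = sets set_space" "AE S in M. S \<subseteq> V"
    "\<And>A T. finite A \<Longrightarrow> A \<subseteq> V \<Longrightarrow> measure M {S. S \<inter> A = T} = pmf (\<mu> A) T"
proof -
  define g where "g J S = restrict (\<lambda>i. if i \<in> S then 1 else 0 :: real) J" for J S :: "'a set"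
  define P where "P J = distr (measure_pmf (\<mu> J)) (PiM J (\<lambda>_. borel)) (g J)" for J
  have gsp: "g J S \<in> space (PiM J (\<lambda>_. borel))" for J S by (simp add: g_def space_PiM)
  have gm: "g J \<in> measurable (measure_pmf X) (PiM J (\<lambda>_. borel))" for J X
    unfolding measurable_def using gsp by auto
  have P1: "P J = distr (P H) (PiM J (\<lambda>_. borel)) (\<lambda>f. restrict f J)"
    if JH: "J \<subseteq> H" "finite H" "H \<subseteq> V" for J H
  proof -
    have "distr (P H) (PiM J (\<lambda>_. borel)) (\<lambda>f. restrict f J) = distr (measure_pmf (\<mu> H)) (PiM J (\<lambda>_. borel)) ((\<lambda>f. restrict f J) \<circ> g H)"
      unfolding P_def by (rule distr_distr[OF measurable_restrict_subset[OF JH(1)] gm])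
    also have "(\<lambda>f. restrict f J) \<circ> g H = g J \<circ> (\<lambda>S. S \<inter> J)"
      using JH(1) by (auto simp: g_def fun_eq_iff restrict_def)
    also have "distr (measure_pmf (\<mu> H)) (PiM J (\<lambda>_. borel)) (g J \<circ> (\<lambda>S. S \<inter> J))
      = distr (distr (measure_pmf (\<mu> H)) (count_space UNIV) (\<lambda>S. S \<inter> J)) (PiM J (\<lambda>_. borel)) (g J)"
      by (rule distr_distr[symmetric]) (use gsp in \<open>auto simp: measurable_def\<close>)
    also have "distr (measure_pmf (\<mu> H)) (count_space UNIV) (\<lambda>S. S \<inter> J) = measure_pmf (\<mu> J)"
      unfolding proj[OF JH, symmetric] map_pmf_rep_eq ..
    finally show "P J = distr (P H) (PiM J (\<lambda>_. borel)) (\<lambda>f. restrict f J)" by (simp only: P_def)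
  qed
  have P2: "prob_space (P J)" for J unfolding P_def by (rule measure_pmf.prob_space_distr[OF gm])
  interpret polish_projective V P
    by (intro polish_projective.intro projective_family.intro P1 P2)
  define T where "T f = {p \<in> V. f p = (1 :: real)}" for f
  have Tm: "T \<in> measurable lim set_space"
    unfolding set_space_def
  proof (rule measurable_measure_of)
    fix Y :: "'a set set" assume "Y \<in> range (\<lambda>p. {S. p \<in> S})"
    then obtain p where Y: "Y = {S. p \<in> S}" by auto
    show "T -` Y \<inter> space lim \<in> sets lim"
    proof (cases "p \<in> V")
      case True
      have "T -` Y \<inter> space lim = {f \<in> space (PiM V (\<lambda>_. borel)). f p = (1 :: real)}"
        using True by (auto simp: Y T_def)
      also have "\<dots> \<in> sets (PiM V (\<lambda>_. borel))"
      proof -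
        have [measurable]: "(\<lambda>f. f p) \<in> measurable (PiM V (\<lambda>_. borel :: real measure)) borel"
          using True by (rule measurable_component_singleton)
        show ?thesis by measurable
      qed
      finally show ?thesis by simp
    next
      case False
      then have "T -` Y \<inter> space lim = {}" by (auto simp: Y T_def)
      then show ?thesis by simp
    qed
  qed auto
  have fin: "measure (distr lim set_space T) {S. S \<inter> A = B} = pmf (\<mu> A) B" if A: "finite A" "A \<subseteq> V" for A B
  proof -
    define X where "X = {f \<in> space (PiM A (\<lambda>_. borel)). {p \<in> A. f p = (1 :: real)} = B}"
    have X: "X \<in> sets (PiM A (\<lambda>_. borel))"
    proof (cases "B \<subseteq> A")
      case True
      have "X = {f \<in> space (PiM A (\<lambda>_. borel)). \<forall>p\<in>A. f p = (1 :: real) \<longleftrightarrow> p \<in> B}"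
        using True by (auto simp: X_def)
      also have "\<dots> \<in> sets (PiM A (\<lambda>_. borel))"
      proof (rule sets.sets_Collect_finite_All[OF _ A(1)])
        fix p assume "p \<in> A"
        then have [measurable]: "(\<lambda>f. f p) \<in> measurable (PiM A (\<lambda>_. borel :: real measure)) borel"
          by (rule measurable_component_singleton)
        show "{f \<in> space (PiM A (\<lambda>_. borel)). f p = (1 :: real) \<longleftrightarrow> p \<in> B} \<in> sets (PiM A (\<lambda>_. borel))"
          by measurable
      qed
      finally show ?thesis .
    next
      case False
      then have "X = {}" by (auto simp: X_def)
      then show ?thesis by simp
    qed
    have "measure (distr lim set_space T) {S. S \<inter> A = B} = measure lim (T -` {S. S \<inter> A = B} \<inter> space lim)"
      by (rule measure_distr[OF Tm sets_Int_eq[OF A(1)]])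
    also have "T -` {S. S \<inter> A = B} \<inter> space lim = emb V A X"
    proof -
      have "T f \<inter> A = {p \<in> A. restrict f A p = 1}" for f using A(2) by (auto simp: T_def)
      then show ?thesis
        using A(2) by (auto simp: X_def prod_emb_def space_PiM)
    qed
    also have "measure lim (emb V A X) = measure (P A) X" by (rule measure_lim_emb[OF A(2,1) X])
    also have "\<dots> = measure (measure_pmf (\<mu> A)) (g A -` X \<inter> space (measure_pmf (\<mu> A)))"
      unfolding P_def by (rule measure_distr[OF gm X])
    also have "g A -` X \<inter> space (measure_pmf (\<mu> A)) = {S. S \<inter> A = B}"
    proof -
      have "{p \<in> A. g A S p = 1} = S \<inter> A" for S by (auto simp: g_def)
      moreover have "g A S \<in> space (PiM A (\<lambda>_. borel))" for S by (auto simp: g_def space_PiM)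
      ultimately show ?thesis by (auto simp: X_def)
    qed
    also have "measure (measure_pmf (\<mu> A)) {S. S \<inter> A = B} = measure (measure_pmf (\<mu> A)) ({S. S \<inter> A = B} \<inter> set_pmf (\<mu> A))"
      by (simp add: measure_Int_set_pmf)
    also have "{S. S \<inter> A = B} \<inter> set_pmf (\<mu> A) = {B} \<inter> set_pmf (\<mu> A)"
      using supp[OF A] by auto
    also have "measure (measure_pmf (\<mu> A)) \<dots> = pmf (\<mu> A) B" by (simp add: measure_Int_set_pmf measure_pmf_single)
    finally show ?thesis .
  qed
  show ?thesis
  proof (rule that[of "distr lim set_space T"])
    show "prob_space (distr lim set_space T)" by (rule P.prob_space_distr[OF Tm])
    show "AE S in distr lim set_space T. S \<subseteq> V"
    proof -
      have "{S \<in> space set_space. S \<subseteq> V} = {S \<in> space set_space. \<forall>p\<in>-V. p \<notin> S}" by auto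
      also have "\<dots> \<in> sets set_space"
      proof (rule sets.sets_Collect_countable_All')
        fix p
        have "{S \<in> space set_space. p \<notin> S} = space set_space - {S. p \<in> S}" by auto
        then show "{S \<in> space set_space. p \<notin> S} \<in> sets set_space" by (simp only: sets_member sets.compl_sets)
      qed simp
      finally have "{S \<in> space set_space. S \<subseteq> V} \<in> sets set_space" .
      moreover have "AE f in lim. T f \<subseteq> V" by (auto simp: T_def)
      ultimately show ?thesis using Tm by (simp add: AE_distr_iff)
    qed
  qed (use fin in auto)
qed

text \<open>The product measure is reweighted by the density of the coupling with respect to the product of the marginals.\<close>

lemma glue:
  fixes M1 :: "'a measure" and M2 :: "'b measure" and F :: "'a \<Rightarrow> 'c" and G :: "'b \<Rightarrow> 'e"
    and \<pi> :: "('c \<times> 'e) pmf"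
  assumes M: "prob_space M1" "prob_space M2" and fin: "finite I" "finite J"
    and F: "\<And>a. a \<in> space M1 \<Longrightarrow> F a \<in> I" "\<And>f. {a \<in> space M1. F a = f} \<in> sets M1"
    and G: "\<And>b. b \<in> space M2 \<Longrightarrow> G b \<in> J" "\<And>g. {b \<in> space M2. G b = g} \<in> sets M2"
    and lF: "\<And>f. pmf (map_pmf fst \<pi>) f = measure M1 {a \<in> space M1. F a = f}"
    and lG: "\<And>g. pmf (map_pmf snd \<pi>) g = measure M2 {b \<in> space M2. G b = g}"
  obtains Q where "prob_space Q" "sets Q = sets (M1 \<Otimes>\<^sub>M M2)"
    "\<And>E. E \<in> sets M1 \<Longrightarrow> measure Q (E \<times> space M2) = measure M1 E"
    "\<And>E. E \<in> sets M2 \<Longrightarrow> measure Q (space M1 \<times> E) = measure M2 E"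
    "\<And>f g. measure Q ({a \<in> space M1. F a = f} \<times> {b \<in> space M2. G b = g}) = pmf \<pi> (f, g)"
proof -
  interpret M1: prob_space M1 by fact
  interpret M2: prob_space M2 by fact
  interpret P: pair_prob_space M1 M2 ..
  define Ff where "Ff f = {a \<in> space M1. F a = f}" for f
  define Gg where "Gg g = {b \<in> space M2. G b = g}" for g
  have [measurable]: "Ff f \<in> sets M1" "Gg g \<in> sets M2" for f g by (auto simp: Ff_def Gg_def F G)
  \<comment> \<open>The density on a cell. A cell of measure zero gets the value 0 of division by
    zero, which is consistent because the coupling gives such a cell no mass.\<close>
  define c where "c f g = pmf \<pi> (f, g) / (measure M1 (Ff f) * measure M2 (Gg g))" for f g
  have c0: "0 \<le> c f g" for f g by (simp add: c_def)
  define \<rho> where "\<rho> x = (\<Sum>(f, g)\<in>I \<times> J. ennreal (c f g) * indicator (Ff f \<times> Gg g) x)" for x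
  have \<rho>m: "\<rho> \<in> borel_measurable (M1 \<Otimes>\<^sub>M M2)" unfolding \<rho>_def[abs_def] split_beta by measurable
  define Q where "Q = density (M1 \<Otimes>\<^sub>M M2) \<rho>"
  have supp: "f \<in> I \<and> g \<in> J" if "(f, g) \<in> set_pmf \<pi>" for f g
  proof -
    have "f \<in> set_pmf (map_pmf fst \<pi>)" "g \<in> set_pmf (map_pmf snd \<pi>)" using that by force+
    then have "measure M1 (Ff f) \<noteq> 0" "measure M2 (Gg g) \<noteq> 0"
      unfolding set_pmf_iff lF lG Ff_def Gg_def by auto
    then have "Ff f \<noteq> {}" "Gg g \<noteq> {}" by auto
    then show ?thesis using F G by (auto simp: Ff_def Gg_def)
  qed
  have sumg: "(\<Sum>g\<in>J. pmf \<pi> (f, g)) = measure M1 (Ff f)" for f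
  proof -
    have "measure M1 (Ff f) = measure (measure_pmf \<pi>) (fst -` {f})" by (simp add: lF[symmetric] Ff_def pmf_map)
    also have "\<dots> = measure (measure_pmf \<pi>) (fst -` {f} \<inter> set_pmf \<pi>)" by (simp add: measure_Int_set_pmf)
    also have "fst -` {f} \<inter> set_pmf \<pi> = (Pair f ` J) \<inter> set_pmf \<pi>" using supp by auto
    also have "measure (measure_pmf \<pi>) \<dots> = measure (measure_pmf \<pi>) (Pair f ` J)" by (simp add: measure_Int_set_pmf)
    also have "\<dots> = sum (pmf \<pi>) (Pair f ` J)" by (rule measure_measure_pmf_finite) (use fin in auto)
    also have "\<dots> = (\<Sum>g\<in>J. pmf \<pi> (f, g))" by (subst sum.reindex) (auto simp: inj_on_def)
    finally show ?thesis by simp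
  qed
  have sumf: "(\<Sum>f\<in>I. pmf \<pi> (f, g)) = measure M2 (Gg g)" for g
  proof -
    have "measure M2 (Gg g) = measure (measure_pmf \<pi>) (snd -` {g})" by (simp add: lG[symmetric] Gg_def pmf_map)
    also have "\<dots> = measure (measure_pmf \<pi>) (snd -` {g} \<inter> set_pmf \<pi>)" by (simp add: measure_Int_set_pmf)
    also have "snd -` {g} \<inter> set_pmf \<pi> = ((\<lambda>f. (f, g)) ` I) \<inter> set_pmf \<pi>" using supp by auto
    also have "measure (measure_pmf \<pi>) \<dots> = measure (measure_pmf \<pi>) ((\<lambda>f. (f, g)) ` I)" by (simp add: measure_Int_set_pmf)
    also have "\<dots> = sum (pmf \<pi>) ((\<lambda>f. (f, g)) ` I)" by (rule measure_measure_pmf_finite) (use fin in auto)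
    also have "\<dots> = (\<Sum>f\<in>I. pmf \<pi> (f, g))" by (subst sum.reindex) (auto simp: inj_on_def)
    finally show ?thesis by simp
  qed
  have le1: "pmf \<pi> (f, g) \<le> measure M1 (Ff f)" and le2: "pmf \<pi> (f, g) \<le> measure M2 (Gg g)" for f g
  proof -
    have "pmf \<pi> (f, g) \<le> pmf (map_pmf fst \<pi>) f" "pmf \<pi> (f, g) \<le> pmf (map_pmf snd \<pi>) g"
      unfolding pmf_map measure_pmf_single[symmetric] by (auto intro!: measure_pmf.finite_measure_mono)
    then show "pmf \<pi> (f, g) \<le> measure M1 (Ff f)" "pmf \<pi> (f, g) \<le> measure M2 (Gg g)"
      by (auto simp: lF lG Ff_def Gg_def)
  qed
  have rect: "emeasure Q (E1 \<times> E2) = ennreal (\<Sum>f\<in>I. \<Sum>g\<in>J. c f g * (measure M1 (E1 \<inter> Ff f) * measure M2 (E2 \<inter> Gg g)))"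
    if [measurable]: "E1 \<in> sets M1" "E2 \<in> sets M2" for E1 E2
  proof -
    have "emeasure Q (E1 \<times> E2) = (\<integral>\<^sup>+x. \<rho> x * indicator (E1 \<times> E2) x \<partial>(M1 \<Otimes>\<^sub>M M2))"
      unfolding Q_def by (rule emeasure_density[OF \<rho>m]) measurable
    also have "\<dots> = (\<integral>\<^sup>+x. (\<Sum>(f, g)\<in>I \<times> J. ennreal (c f g) * indicator ((E1 \<inter> Ff f) \<times> (E2 \<inter> Gg g)) x) \<partial>(M1 \<Otimes>\<^sub>M M2))"
      unfolding \<rho>_def sum_distrib_right split_beta
      by (intro nn_integral_cong sum.cong refl) (auto simp: indicator_def split: if_splits)
    also have "\<dots> = (\<Sum>(f, g)\<in>I \<times> J. ennreal (c f g) * emeasure (M1 \<Otimes>\<^sub>M M2) ((E1 \<inter> Ff f) \<times> (E2 \<inter> Gg g)))"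
      unfolding split_beta by (subst nn_integral_sum) (auto simp: nn_integral_cmult_indicator)
    also have "\<dots> = (\<Sum>(f, g)\<in>I \<times> J. ennreal (c f g * (measure M1 (E1 \<inter> Ff f) * measure M2 (E2 \<inter> Gg g))))"
      by (intro sum.cong refl)
         (auto simp: M2.emeasure_pair_measure_Times M1.emeasure_eq_measure M2.emeasure_eq_measure ennreal_mult c0)
    also have "\<dots> = ennreal (\<Sum>(f, g)\<in>I \<times> J. c f g * (measure M1 (E1 \<inter> Ff f) * measure M2 (E2 \<inter> Gg g)))"
      unfolding split_beta by (rule sum_ennreal) (auto simp: c0)
    also have "(\<Sum>(f, g)\<in>I \<times> J. c f g * (measure M1 (E1 \<inter> Ff f) * measure M2 (E2 \<inter> Gg g)))
      = (\<Sum>f\<in>I. \<Sum>g\<in>J. c f g * (measure M1 (E1 \<inter> Ff f) * measure M2 (E2 \<inter> Gg g)))"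
      by (rule sum.cartesian_product[symmetric])
    finally show ?thesis .
  qed
  have part1: "(\<Sum>f\<in>I. measure M1 (E \<inter> Ff f)) = measure M1 E" if "E \<in> sets M1" for E
  proof -
    have "measure M1 (\<Union>f\<in>I. E \<inter> Ff f) = (\<Sum>f\<in>I. measure M1 (E \<inter> Ff f))"
      by (rule M1.finite_measure_finite_Union) (use that fin in \<open>auto simp: disjoint_family_on_def Ff_def F(2)\<close>)
    moreover have "(\<Union>f\<in>I. E \<inter> Ff f) = E" using F sets.sets_into_space[OF that] by (auto simp: Ff_def)
    ultimately show ?thesis by simp
  qed
  have part2: "(\<Sum>g\<in>J. measure M2 (E \<inter> Gg g)) = measure M2 E" if "E \<in> sets M2" for E
  proof -
    have "measure M2 (\<Union>g\<in>J. E \<inter> Gg g) = (\<Sum>g\<in>J. measure M2 (E \<inter> Gg g))"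
      by (rule M2.finite_measure_finite_Union) (use that fin in \<open>auto simp: disjoint_family_on_def Gg_def G(2)\<close>)
    moreover have "(\<Union>g\<in>J. E \<inter> Gg g) = E" using G sets.sets_into_space[OF that] by (auto simp: Gg_def)
    ultimately show ?thesis by simp
  qed
  have sp: "space M1 \<inter> Ff f = Ff f" "space M2 \<inter> Gg g = Gg g" for f g by (auto simp: Ff_def Gg_def)
  have m1: "emeasure Q (E \<times> space M2) = ennreal (measure M1 E)" if E: "E \<in> sets M1" for E
  proof -
    have "(\<Sum>g\<in>J. c f g * (measure M1 (E \<inter> Ff f) * measure M2 (space M2 \<inter> Gg g))) = measure M1 (E \<inter> Ff f)" for f
    proof (cases "measure M1 (Ff f) = 0")
      case True
      have "measure M1 (E \<inter> Ff f) \<le> measure M1 (Ff f)" by (rule M1.finite_measure_mono) auto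
      then have "measure M1 (E \<inter> Ff f) = 0" using True by (simp add: measure_le_0_iff)
      then show ?thesis by simp
    next
      case False
      have "(\<Sum>g\<in>J. c f g * (measure M1 (E \<inter> Ff f) * measure M2 (space M2 \<inter> Gg g)))
        = (\<Sum>g\<in>J. pmf \<pi> (f, g) * (measure M1 (E \<inter> Ff f) / measure M1 (Ff f)))"
      proof (rule sum.cong[OF refl])
        fix g
        show "c f g * (measure M1 (E \<inter> Ff f) * measure M2 (space M2 \<inter> Gg g)) = pmf \<pi> (f, g) * (measure M1 (E \<inter> Ff f) / measure M1 (Ff f))"
        proof (cases "measure M2 (Gg g) = 0")
          case True
          then have "pmf \<pi> (f, g) = 0" using le2[of f g] by (simp add: antisym)
          then show ?thesis by (simp add: c_def)
        qed (simp add: c_def sp)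
      qed
      also have "\<dots> = measure M1 (E \<inter> Ff f)" unfolding sum_distrib_right[symmetric] sumg using False by simp
      finally show ?thesis .
    qed
    then show ?thesis using rect[OF E sets.top] part1[OF E] by simp
  qed
  have m2: "emeasure Q (space M1 \<times> E) = ennreal (measure M2 E)" if E: "E \<in> sets M2" for E
  proof -
    have "(\<Sum>f\<in>I. c f g * (measure M1 (space M1 \<inter> Ff f) * measure M2 (E \<inter> Gg g))) = measure M2 (E \<inter> Gg g)" for g
    proof (cases "measure M2 (Gg g) = 0")
      case True
      have "measure M2 (E \<inter> Gg g) \<le> measure M2 (Gg g)" by (rule M2.finite_measure_mono) auto
      then have "measure M2 (E \<inter> Gg g) = 0" using True by (simp add: measure_le_0_iff)
      then show ?thesis by simp
    next
      case False
      have "(\<Sum>f\<in>I. c f g * (measure M1 (space M1 \<inter> Ff f) * measure M2 (E \<inter> Gg g)))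
        = (\<Sum>f\<in>I. pmf \<pi> (f, g) * (measure M2 (E \<inter> Gg g) / measure M2 (Gg g)))"
      proof (rule sum.cong[OF refl])
        fix f
        show "c f g * (measure M1 (space M1 \<inter> Ff f) * measure M2 (E \<inter> Gg g)) = pmf \<pi> (f, g) * (measure M2 (E \<inter> Gg g) / measure M2 (Gg g))"
        proof (cases "measure M1 (Ff f) = 0")
          case True
          then have "pmf \<pi> (f, g) = 0" using le1[of f g] by (simp add: antisym)
          then show ?thesis by (simp add: c_def)
        qed (simp add: c_def sp)
      qed
      also have "\<dots> = measure M2 (E \<inter> Gg g)" unfolding sum_distrib_right[symmetric] sumf using False by simp
      finally show ?thesis .
    qed
    moreover have "(\<Sum>f\<in>I. \<Sum>g\<in>J. c f g * (measure M1 (space M1 \<inter> Ff f) * measure M2 (E \<inter> Gg g)))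
      = (\<Sum>g\<in>J. \<Sum>f\<in>I. c f g * (measure M1 (space M1 \<inter> Ff f) * measure M2 (E \<inter> Gg g)))" by (rule sum.swap)
    ultimately show ?thesis using rect[OF sets.top E] part2[OF E] by simp
  qed
  have m3: "emeasure Q (Ff f \<times> Gg g) = ennreal (pmf \<pi> (f, g))" for f g
  proof -
    have "(\<Sum>f'\<in>I. \<Sum>g'\<in>J. c f' g' * (measure M1 (Ff f \<inter> Ff f') * measure M2 (Gg g \<inter> Gg g')))
        = (\<Sum>f'\<in>I. \<Sum>g'\<in>J. if g = g' then if f = f' then pmf \<pi> (f, g) else 0 else 0)"
    proof (intro sum.cong refl)
      fix f' g'
      show "c f' g' * (measure M1 (Ff f \<inter> Ff f') * measure M2 (Gg g \<inter> Gg g')) = (if g = g' then if f = f' then pmf \<pi> (f, g) else 0 else 0)"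
      proof (cases "f = f' \<and> g = g'")
        case True
        have "pmf \<pi> (f, g) = 0" if "measure M1 (Ff f) = 0 \<or> measure M2 (Gg g) = 0"
          using le1[of f g] le2[of f g] that by (auto simp: antisym)
        then show ?thesis using True by (auto simp: c_def)
      next
        case False
        then have "Ff f \<inter> Ff f' = {} \<or> Gg g \<inter> Gg g' = {}" by (auto simp: Ff_def Gg_def)
        then show ?thesis using False by auto
      qed
    qed
    also have "\<dots> = (if f \<in> I \<and> g \<in> J then pmf \<pi> (f, g) else 0)"
      using fin by (cases "g \<in> J") (simp_all add: sum.delta)
    also have "\<dots> = pmf \<pi> (f, g)" using supp[of f g] by (auto simp: set_pmf_iff)
    finally show ?thesis using rect[of "Ff f" "Gg g"] by simp
  qed
  have setsQ: "sets Q = sets (M1 \<Otimes>\<^sub>M M2)" by (simp add: Q_def)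
  have "emeasure Q (space Q) = 1"
  proof -
    have "space Q = space M1 \<times> space M2" by (simp add: Q_def space_pair_measure)
    then show ?thesis using m1[OF sets.top] M1.prob_space by simp
  qed
  then have "prob_space Q" by (rule prob_spaceI)
  then show ?thesis
    by (rule that[OF _ setsQ]) (use m1 m2 m3 in \<open>simp_all add: measure_def Ff_def Gg_def\<close>)
qed

section \<open>Path measure of the walk\<close>

definition path_space :: "(nat \<Rightarrow> 'a :: countable) measure" where
  "path_space = PiM UNIV (\<lambda>_. count_space UNIV)"

lemma space_path_space [simp]: "space path_space = UNIV"
  by (simp add: path_space_def space_PiM)

lemma sets_coordinate: "{w. w n = p} \<in> sets path_space"
proof -
  have "(\<lambda>w. w n) -` {p} \<inter> space path_space \<in> sets path_space"
    unfolding path_space_def by (rule measurable_sets[OF measurable_component_singleton]) auto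
  then show ?thesis by (simp add: vimage_def)
qed

text \<open>Over a countable state space there are countably many prefixes, so an event decided by a
  prefix is a countable union of cylinders. Measurability below is reduced to such
  dependence.\<close>

lemma sets_prefix:
  fixes X :: "(nat \<Rightarrow> 'a :: countable) set"
  assumes "\<And>w w'. (\<And>k. k \<le> n \<Longrightarrow> w k = w' k) \<Longrightarrow> w \<in> X \<Longrightarrow> w' \<in> X"
  shows "X \<in> sets path_space"
proof -
  have cyl: "{w. \<forall>k\<le>n. w k = l ! k} \<in> sets path_space" for l :: "'a list"
  proof -
    have "{w \<in> space path_space. \<forall>k\<in>{..n}. w k = l ! k} \<in> sets path_space"
      by (rule sets.sets_Collect_finite_All) (use sets_coordinate in auto)
    then show ?thesis by (simp add: atMost_def)
  qed
  have "X = (\<Union>l\<in>(\<lambda>w. map w [0..<Suc n]) ` X. {w. \<forall>k\<le>n. w k = l ! k})"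
  proof (intro set_eqI iffI)
    fix w assume "w \<in> X"
    then show "w \<in> (\<Union>l\<in>(\<lambda>w. map w [0..<Suc n]) ` X. {w. \<forall>k\<le>n. w k = l ! k})"
      by (auto intro!: bexI[of _ w] simp del: upt_Suc)
  next
    fix w assume "w \<in> (\<Union>l\<in>(\<lambda>w. map w [0..<Suc n]) ` X. {w. \<forall>k\<le>n. w k = l ! k})"
    then obtain w' where "w' \<in> X" "\<forall>k\<le>n. w k = map w' [0..<Suc n] ! k" by auto
    then show "w \<in> X" using assms[of w' w] by (auto simp del: upt_Suc)
  qed
  also have "\<dots> \<in> sets path_space"
    by (rule sets.countable_UN'') (use cyl in \<open>auto intro: countableI_type\<close>)
  finally show ?thesis .
qed

fun path :: "('a \<Rightarrow> nat \<Rightarrow> 'a) \<Rightarrow> 'a \<Rightarrow> nat stream \<Rightarrow> nat \<Rightarrow> 'a" where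
  "path mv p \<omega> 0 = p"
| "path mv p \<omega> (Suc n) = path mv (mv p (shd \<omega>)) (stl \<omega>) n"

lemma path_stake: "path mv p \<omega> n = foldl mv p (stake n \<omega>)"
  by (induction n arbitrary: p \<omega>) auto

lemma path_Cons: "path mv p (j ## \<omega>) = case_nat p (path mv (mv p j) \<omega>)"
  by (auto simp: fun_eq_iff split: nat.splits)

definition walks :: "nat \<Rightarrow> nat stream measure" where
  "walks m = stream_space (measure_pmf (steps m))"

lemma prob_space_walks: "prob_space (walks m)"
  unfolding walks_def by (rule prob_space.prob_space_stream_space[OF prob_space_measure_pmf])

lemma space_walks [simp]: "space (walks m) = UNIV"
  by (simp add: walks_def space_stream_space)

lemma measure_walks_step:
  assumes "0 < m" "{\<omega>. P \<omega>} \<in> sets (walks m)"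
  shows "measure (walks m) {\<omega>. P \<omega>} = av m (\<lambda>j. measure (walks m) {\<omega>. P (j ## \<omega>)})"
proof -
  have "ennreal (measure (walks m) {\<omega>. P \<omega>}) = (\<integral>\<^sup>+j. ennreal (measure (walks m) {\<omega>. P (j ## \<omega>)}) \<partial>measure_pmf (steps m))"
    using prob_space.prob_stream_space[OF prob_space_measure_pmf, of "steps m" P] assms(2)
    by (simp add: walks_def[symmetric])
  also have "\<dots> = ennreal (measure_pmf.expectation (steps m) (\<lambda>j. measure (walks m) {\<omega>. P (j ## \<omega>)}))"
    by (rule nn_integral_eq_integral)
       (auto intro!: measure_pmf.integrable_const_bound[where B=1] prob_space.prob_le_1[OF prob_space_walks])
  also have "\<dots> = ennreal (av m (\<lambda>j. measure (walks m) {\<omega>. P (j ## \<omega>)}))"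
    by (simp only: expectation_steps[OF assms(1)])
  finally show ?thesis by (subst (asm) ennreal_inj) (auto intro!: av_nonneg)
qed

lemma measurable_path:
  fixes mv :: "'a :: countable \<Rightarrow> nat \<Rightarrow> 'a"
  shows "path mv p \<in> measurable (walks m) path_space"
  unfolding path_space_def
proof (rule measurable_PiM_single')
  fix n :: nat
  have "stake n \<in> measurable (stream_space (count_space UNIV)) (count_space (UNIV :: nat list set))"
    by measurable
  moreover have "sets (walks m) = sets (stream_space (count_space UNIV))"
    unfolding walks_def by (rule sets_stream_space_cong) simp
  ultimately have "stake n \<in> measurable (walks m) (count_space (UNIV :: nat list set))"
    using measurable_cong_sets by blast
  then have "(\<lambda>\<omega>. foldl mv p (stake n \<omega>)) \<in> measurable (walks m) (count_space UNIV)"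
    by (rule measurable_compose) auto
  then show "(\<lambda>\<omega>. path mv p \<omega> n) \<in> measurable (walks m) (count_space UNIV)"
    by (simp add: path_stake)
qed auto

definition walk_law :: "nat \<Rightarrow> ('a :: countable \<Rightarrow> nat \<Rightarrow> 'a) \<Rightarrow> 'a \<Rightarrow> (nat \<Rightarrow> 'a) measure" where
  "walk_law m mv p = distr (walks m) path_space (path mv p)"

lemma prob_space_walk_law: "prob_space (walk_law m mv p)"
  unfolding walk_law_def by (rule prob_space.prob_space_distr[OF prob_space_walks measurable_path])

lemma sets_walk_law [simp]: "sets (walk_law m mv p) = sets path_space"
  by (simp add: walk_law_def)

lemma measure_walk_law:
  "X \<in> sets path_space \<Longrightarrow> measure (walk_law m mv p) X = measure (walks m) {\<omega>. path mv p \<omega> \<in> X}"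
  unfolding walk_law_def by (subst measure_distr[OF measurable_path]) (auto simp: vimage_def)

lemma sets_case_nat:
  fixes X :: "(nat \<Rightarrow> 'a :: countable) set"
  assumes "X \<in> sets path_space" shows "{w. case_nat p w \<in> X} \<in> sets path_space"
proof -
  have "case_nat p \<in> measurable path_space (path_space :: (nat \<Rightarrow> 'a) measure)"
    unfolding path_space_def
  proof (rule measurable_PiM_single')
    fix n :: nat
    show "(\<lambda>w. case_nat p w n) \<in> measurable (PiM UNIV (\<lambda>_. count_space UNIV)) (count_space (UNIV :: 'a set))"
    proof (cases n)
      case (Suc n')
      have "(\<lambda>w. w n') \<in> measurable (PiM UNIV (\<lambda>_. count_space (UNIV :: 'a set))) (count_space UNIV)"
        by (rule measurable_component_singleton) simp
      then show ?thesis using Suc by simp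
    qed simp
  qed auto
  from measurable_sets[OF this assms] show ?thesis by (simp add: vimage_def)
qed

lemma walk_law_step:
  assumes "0 < m" "X \<in> sets path_space"
  shows "measure (walk_law m mv p) X = av m (\<lambda>j. measure (walk_law m mv (mv p j)) {w. case_nat p w \<in> X})"
proof -
  have "{\<omega>. path mv p \<omega> \<in> X} \<in> sets (walks m)"
    using measurable_sets[OF measurable_path assms(2), of mv p m] by (simp add: vimage_def)
  then show ?thesis
    using measure_walks_step[OF assms(1), of "\<lambda>\<omega>. path mv p \<omega> \<in> X"] assms(2)
    by (simp add: measure_walk_law path_Cons sets_case_nat)
qed

lemma walk_law_start:
  "measure (walk_law m mv p) {w. w 0 = q \<and> P} = (if p = q \<and> P then 1 else 0)"
proof -
  have "{w. w 0 = q \<and> P} \<in> sets path_space" by (rule sets_prefix[of 0]) auto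
  then show ?thesis using prob_space.prob_space[OF prob_space_walks, of m] by (auto simp: measure_walk_law)
qed

lemma walk_law_prefix:
  assumes "0 < m"
  shows "measure (walk_law m mv p) {w. \<forall>k\<le>n. w k = ps k} =
    (if p = ps 0 then \<Prod>k<n. real (card {j. j < m \<and> mv (ps k) j = ps (Suc k)}) / real m else 0)"
proof (induction n arbitrary: p ps)
  case 0
  then show ?case using walk_law_start[of m mv p "ps 0" True] by simp
next
  case (Suc n)
  have X: "{w. \<forall>k\<le>Suc n. w k = ps k} \<in> sets path_space" by (rule sets_prefix[of "Suc n"]) auto
  have "{w. case_nat p w \<in> {w. \<forall>k\<le>Suc n. w k = ps k}} = (if p = ps 0 then {w. \<forall>k\<le>n. w k = ps (Suc k)} else {})"
  proof -
    have "(\<forall>k\<le>Suc n. P k) \<longleftrightarrow> P 0 \<and> (\<forall>k\<le>n. P (Suc k))" for P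
      by (metis Suc_le_mono le0 not0_implies_Suc)
    then show ?thesis by auto
  qed
  then have "measure (walk_law m mv p) {w. \<forall>k\<le>Suc n. w k = ps k}
     = (if p = ps 0 then av m (\<lambda>j. measure (walk_law m mv (mv p j)) {w. \<forall>k\<le>n. w k = ps (Suc k)}) else 0)"
    unfolding walk_law_step[OF assms X] by simp
  also have "\<dots> = (if p = ps 0 then av m (\<lambda>j. (if mv p j = ps 1 then 1 else 0) * (\<Prod>k<n. real (card {j. j < m \<and> mv (ps (Suc k)) j = ps (Suc (Suc k))}) / real m)) else 0)"
    unfolding Suc[of _ "\<lambda>k. ps (Suc k)"] by (auto intro!: av_cong)
  also have "\<dots> = (if p = ps 0 then real (card {j. j < m \<and> mv (ps 0) j = ps 1}) / real m * (\<Prod>k<n. real (card {j. j < m \<and> mv (ps (Suc k)) j = ps (Suc (Suc k))}) / real m) else 0)"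
  proof -
    have "av m (\<lambda>j. if mv q j = r then 1 else 0) = real (card {j. j < m \<and> mv q j = r}) / real m" for q r
      unfolding av_def by (simp add: sum.If_cases Int_def)
    then show ?thesis by (simp add: av_cmult_right)
  qed
  finally show ?case by (simp add: prod.lessThan_Suc_shift del: prod.lessThan_Suc)
qed

section \<open>Coupling of the walk and the interlacement\<close>

lemma firstafter_iff:
  "firstafter P s = enat m \<longleftrightarrow> (\<exists>l\<le>m. s = enat l \<and> P m \<and> (\<forall>i. l \<le> i \<and> i < m \<longrightarrow> \<not> P i))"
proof (cases s)
  case (enat l)
  show ?thesis
  proof (cases "\<exists>n\<ge>l. P n")
    case True
    define k where "k = (LEAST n. l \<le> n \<and> P n)"
    have k: "l \<le> k" "P k" using LeastI_ex[of "\<lambda>n. l \<le> n \<and> P n"] True by (auto simp: k_def)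
    have least: "k \<le> i" if "l \<le> i" "P i" for i unfolding k_def by (rule Least_le) (use that in auto)
    have "firstafter P s = enat k" using True by (auto simp: firstafter_def enat k_def)
    moreover have "k = m \<longleftrightarrow> l \<le> m \<and> P m \<and> (\<forall>i. l \<le> i \<and> i < m \<longrightarrow> \<not> P i)"
      using k least by (metis le_less_trans linorder_neqE_nat not_less)
    ultimately show ?thesis using enat by auto
  next
    case False then show ?thesis by (auto simp: firstafter_def enat)
  qed
qed (auto simp: firstafter_def)

lemma firstafter_prefix:
  assumes "\<And>l. l \<le> m \<Longrightarrow> s = enat l \<longleftrightarrow> s' = enat l" "\<And>l. l \<le> m \<Longrightarrow> P l = P' l"
  shows "firstafter P s = enat m \<longleftrightarrow> firstafter P' s' = enat m"
proof -
  have "(\<forall>i. l \<le> i \<and> i < m \<longrightarrow> \<not> P i) = (\<forall>i. l \<le> i \<and> i < m \<longrightarrow> \<not> P' i)" for l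
    using assms(2) by auto
  then show ?thesis unfolding firstafter_iff using assms by auto
qed

text \<open>The departure times are stopping times: the path up to \<open>m\<close> decides whether
  one of them equals \<open>m\<close>. The measurability of the good event rests on this.\<close>

lemma Dseq_prefix:
  assumes "\<And>l. l \<le> n \<Longrightarrow> P l = P' l" "\<And>l. l \<le> n \<Longrightarrow> R l = R' l"
  shows "m \<le> n \<Longrightarrow> Dseq P R k = enat m \<longleftrightarrow> Dseq P' R' k = enat m"
proof (induction k arbitrary: m)
  case (Suc k)
  have IH: "Dseq P R k = enat l \<longleftrightarrow> Dseq P' R' k = enat l" if "l \<le> n" for l
    using Suc.IH that by blast
  have "firstafter P (Dseq P R k) = enat l \<longleftrightarrow> firstafter P' (Dseq P' R' k) = enat l" if "l \<le> m" for l
    by (rule firstafter_prefix) (use IH Suc.prems assms that in \<open>auto simp del: Dseq.simps\<close>)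
  note fa = this
  show ?case unfolding Dseq.simps
    by (rule firstafter_prefix[OF fa]) (use Suc.prems assms in auto)
qed simp

lemma enat_le_iff: "enat n \<le> D \<longleftrightarrow> (\<forall>m<n. D \<noteq> enat m)"
  by (cases D) (auto simp: not_less[symmetric])

lemma le_Dseq_prefix:
  assumes "\<And>l. l \<le> n \<Longrightarrow> P l = P' l" "\<And>l. l \<le> n \<Longrightarrow> R l = R' l"
  shows "enat n \<le> Dseq P R k \<longleftrightarrow> enat n \<le> Dseq P' R' k"
  unfolding enat_le_iff using Dseq_prefix[of n P P' R R' _ k, OF assms] by auto

lemma length_subE: "length (subE d N p x) = d + 1"
  by (simp add: subE_def del: upt_Suc)

lemma subE_nth: "i \<le> d \<Longrightarrow> subE d N p x ! i = (if i < d then (p ! i - x ! i) mod int N else p ! i - x ! i)"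
  unfolding subE_def by (auto simp: nth_append simp del: upt_Suc)

lemma subE_Epts: "0 < N \<Longrightarrow> subE d N p x \<in> Epts d N"
  by (simp add: Epts_def length_subE subE_nth)

lemma subE_mvE:
  assumes "p \<in> Epts d N" "j < nm d"
  shows "subE d N (mvE d N p j) x = mvE d N (subE d N p x) j"
proof (rule nth_equalityI)
  have l: "length p = d + 1" using assms by (simp add: Epts_def)
  show "length (subE d N (mvE d N p j) x) = length (mvE d N (subE d N p x) j)"
    by (simp add: length_subE mvE_mvi)
  fix i assume "i < length (subE d N (mvE d N p j) x)"
  then have i: "i \<le> d" by (simp add: length_subE)
  have eq: "((a + s) mod n - c) mod n = ((a - c) mod n + s) mod n" for a s n c :: int
  proof -
    have "a + s - c = a - c + s" by simp
    then show ?thesis by (metis mod_diff_left_eq mod_add_left_eq)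
  qed
  show "subE d N (mvE d N p j) x ! i = mvE d N (subE d N p x) j ! i"
    using i l nm_div[OF assms(2)] by (cases "i = j div 2")
      (auto simp: subE_nth mvE_mvi mvi_def length_subE nth_list_update eq)
qed

lemma bij_subE:
  assumes N: "0 < N" and x: "length x = d + 1"
  shows "bij_betw (\<lambda>p. subE d N p x) (slice d N 0) (slice d N (- x ! d))"
proof (rule bij_betw_byWitness[where f'="\<lambda>q. subE d N q (map uminus x)"])
  have m: "map uminus x ! i = - x ! i" if "i \<le> d" for i using that x by simp
  have undo_sub: "subE d N (subE d N p x) y = p" if "p \<in> Epts d N" "\<And>i. i \<le> d \<Longrightarrow> y ! i = - x ! i" for p x y
  proof (rule nth_equalityI)
    show "length (subE d N (subE d N p x) y) = length p" using that by (simp add: length_subE Epts_def)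
    fix i assume "i < length (subE d N (subE d N p x) y)"
    then have i: "i \<le> d" by (simp add: length_subE)
    have "((p ! i - x ! i) mod int N + x ! i) mod int N = p ! i mod int N" by (simp add: mod_add_left_eq)
    then show "subE d N (subE d N p x) y ! i = p ! i"
      using that(1) that(2)[OF i] i by (auto simp: subE_nth Epts_def)
  qed
  show "\<forall>a\<in>slice d N 0. subE d N (subE d N a x) (map uminus x) = a"
    using undo_sub[of _ "map uminus x" x] m by (auto simp: slice_def)
  show "\<forall>a\<in>slice d N (- x ! d). subE d N (subE d N a (map uminus x)) x = a"
    using undo_sub[of _ x "map uminus x"] m by (auto simp: slice_def)
  show "(\<lambda>p. subE d N p x) ` slice d N 0 \<subseteq> slice d N (- x ! d)"
    using subE_Epts[OF N] by (auto simp: slice_def subE_nth)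
  show "(\<lambda>q. subE d N q (map uminus x)) ` slice d N (- x ! d) \<subseteq> slice d N 0"
    using subE_Epts[OF N] m[of d] by (auto simp: slice_def subE_nth)
qed

lemma walk_law_start_pred:
  fixes p :: "'a :: countable"
  shows "measure (walk_law m mv p) {w. P (w 0)} = (if P p then 1 else 0)"
proof -
  have "{w. P (w 0)} \<in> sets (path_space :: (nat \<Rightarrow> 'a) measure)" by (rule sets_prefix[of 0]) auto
  then show ?thesis using prob_space.prob_space[OF prob_space_walks, of m] by (auto simp: measure_walk_law)
qed

section \<open>The automaton along a path and the final coupling\<close>

context cylinder
begin

interpretation Z: rwalk "Zpts d" mvZ "nm d" flip by (rule rwalk_Z)
interpretation E: rwalk "Epts d N" "mvE d N" "nm d" flip by (rule rwalk_E[OF N])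

text \<open>The pathwise counterpart of \<open>law\<close>: the same recursion along a given path,
  so that its distribution is found by first steps.\<close>

fun FaP :: "nat \<Rightarrow> bool \<Rightarrow> nat \<Rightarrow> (nat \<Rightarrow> int list) \<Rightarrow> int list set" where
  "FaP 0 b k w = col (fst (upd b k (w 0))) (w 0)"
| "FaP (Suc n) b k w = col (fst (upd b k (w 0))) (w 0) \<union> FaP n (fst (upd b k (w 0))) (snd (upd b k (w 0))) (\<lambda>i. w (Suc i))"

fun St :: "bool \<Rightarrow> nat \<Rightarrow> (nat \<Rightarrow> int list) \<Rightarrow> nat \<Rightarrow> bool \<times> nat" where
  "St b k w 0 = upd b k (w 0)"
| "St b k w (Suc n) = upd (fst (St b k w n)) (snd (St b k w n)) (w (Suc n))"

lemma St_shift: "St b k w (Suc n) = St (fst (upd b k (w 0))) (snd (upd b k (w 0))) (\<lambda>i. w (Suc i)) n"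
  by (induction n) auto

lemma FaP_St: "FaP n b k w = (\<Union>i\<le>n. col (fst (St b k w i)) (w i))"
proof (induction n arbitrary: b k w)
  case (Suc n)
  have "(\<Union>i\<le>Suc n. col (fst (St b k w i)) (w i)) = col (fst (St b k w 0)) (w 0) \<union> (\<Union>i\<le>n. col (fst (St b k w (Suc i))) (w (Suc i)))"
    by (auto simp: atMost_Suc_eq_insert_0)
  then show ?case unfolding St_shift by (simp add: Suc)
qed simp

lemma FaP_prefix:
  assumes "\<And>i. i \<le> n \<Longrightarrow> w i = w' i" shows "FaP n b k w = FaP n b k w'"
  using assms
proof (induction n arbitrary: b k w w')
  case (Suc n)
  have "w 0 = w' 0" using Suc.prems by simp
  moreover have "FaP n c l (\<lambda>i. w (Suc i)) = FaP n c l (\<lambda>i. w' (Suc i))" for c l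
    by (rule Suc.IH) (use Suc.prems in simp)
  ultimately show ?case by simp
qed simp

lemma FaP_Abox: "FaP n b k w \<subseteq> Abox"
  unfolding FaP_St by (auto simp: col_def)

lemma FaP_mono: "n \<le> n' \<Longrightarrow> FaP n b k w \<subseteq> FaP n' b k w"
  unfolding FaP_St by (rule UN_mono) auto

text \<open>Invariant linking automaton and departure times. The difference of \<open>K\<close> and
  the counter is the number of departures so far, the last one at \<open>m\<close>. With the flag
  set, the current excursion began at the first return \<open>l\<close> and has not ended; with it
  cleared, either there was no return since \<open>m\<close> or all departures are used up.\<close>

lemma St_Dseq:
  fixes w :: "nat \<Rightarrow> int list"
  defines "Pin \<equiv> \<lambda>n. \<bar>w n ! d\<bar> \<le> int N" and "Pout \<equiv> \<lambda>n. int h \<le> \<bar>w n ! d\<bar>"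
  assumes K: "0 < K"
  shows "snd (St False K w n) \<le> K \<and>
    (if fst (St False K w n)
     then 0 < snd (St False K w n) \<and> (\<exists>m l. m \<le> l \<and> l \<le> n \<and> Dseq Pin Pout (K - snd (St False K w n)) = enat m \<and>
        firstafter Pin (enat m) = enat l \<and> (\<forall>j. l \<le> j \<and> j \<le> n \<longrightarrow> \<not> Pout j))
     else (\<exists>m\<le>n. Dseq Pin Pout (K - snd (St False K w n)) = enat m \<and>
        (if snd (St False K w n) = 0 then Pout m else \<forall>l. m \<le> l \<and> l \<le> n \<longrightarrow> \<not> Pin l)))"
    (is "?I n (St False K w n)")
proof (induction n)
  case 0
  have ex: "\<not> Pout 0" if "Pin 0" using that Nh by (auto simp: Pin_def Pout_def)
  show ?case
  proof (cases "Pin 0")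
    case True
    then have "upd False K (w 0) = (True, K)" using K by (auto simp: upd_def Pin_def)
    moreover have "firstafter Pin (enat 0) = enat 0" using True by (auto simp: firstafter_iff)
    ultimately show ?thesis using ex True K by (auto simp: zero_enat_def)
  next
    case False
    then have "upd False K (w 0) = (False, K)" using K by (auto simp: upd_def Pin_def)
    then show ?thesis using False K by (auto simp: zero_enat_def)
  qed
next
  case (Suc n)
  obtain b k where s: "St False K w n = (b, k)" by (cases "St False K w n")
  have I: "?I n (b, k)" using Suc unfolding s .
  have kK: "k \<le> K" using I by simp
  let ?t = "Suc n"
  have step: "St False K w ?t = upd b k (w ?t)" by (simp add: s)
  have excl: "\<not> (Pin l \<and> Pout l)" for l using Nh by (auto simp: Pin_def Pout_def)
  show ?case
  proof (cases b)
    case True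
    then obtain m l where ml: "0 < k" "m \<le> l" "l \<le> n" "Dseq Pin Pout (K - k) = enat m"
      "firstafter Pin (enat m) = enat l" "\<forall>j. l \<le> j \<and> j \<le> n \<longrightarrow> \<not> Pout j" using I by auto
    show ?thesis
    proof (cases "Pout ?t")
      case P: True
      have u: "upd b k (w ?t) = (False, k - 1)" using True P by (auto simp: upd_def Pout_def)
      have "K - (k - 1) = Suc (K - k)" using ml kK by simp
      moreover have "firstafter Pout (enat l) = enat ?t"
        unfolding firstafter_iff using ml P by (auto intro!: exI[of _ l])
      ultimately have D: "Dseq Pin Pout (K - (k - 1)) = enat ?t" using ml by simp
      have "\<not> Pin ?t" using excl P by blast
      then have "\<forall>i. ?t \<le> i \<and> i \<le> ?t \<longrightarrow> \<not> Pin i" by (metis le_antisym)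
      then show ?thesis unfolding step u using D P kK by auto
    next
      case P: False
      have u: "upd b k (w ?t) = (True, k)" using True P by (auto simp: upd_def Pout_def)
      have "\<forall>j. l \<le> j \<and> j \<le> ?t \<longrightarrow> \<not> Pout j" using ml P by (auto simp: le_Suc_eq)
      then show ?thesis unfolding step u using ml kK by (auto intro!: exI[of _ m] exI[of _ l])
    qed
  next
    case False
    then obtain m where m: "m \<le> n" "Dseq Pin Pout (K - k) = enat m" "if k = 0 then Pout m else \<forall>l. m \<le> l \<and> l \<le> n \<longrightarrow> \<not> Pin l"
      using I by auto
    show ?thesis
    proof (cases "0 < k \<and> Pin ?t")
      case P: True
      have u: "upd b k (w ?t) = (True, k)" using False P by (auto simp: upd_def Pin_def)
      have fa: "firstafter Pin (enat m) = enat ?t"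
        unfolding firstafter_iff using m P by (auto intro!: exI[of _ m])
      have "\<not> Pout ?t" using excl P by blast
      then have "\<forall>i. ?t \<le> i \<and> i \<le> ?t \<longrightarrow> \<not> Pout i" by (metis le_antisym)
      then have "\<exists>m l. m \<le> l \<and> l \<le> ?t \<and> Dseq Pin Pout (K - k) = enat m \<and> firstafter Pin (enat m) = enat l \<and> (\<forall>j. l \<le> j \<and> j \<le> ?t \<longrightarrow> \<not> Pout j)"
        using fa m by (intro exI[of _ m] exI[of _ ?t]) auto
      then show ?thesis unfolding step u using P kK by simp
    next
      case P: False
      have u: "upd b k (w ?t) = (False, k)" using False P by (auto simp: upd_def Pin_def)
      have "if k = 0 then Pout m else \<forall>l. m \<le> l \<and> l \<le> ?t \<longrightarrow> \<not> Pin l" using m P by (auto simp: le_Suc_eq)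
      then show ?thesis unfolding step u using m kK by (auto intro!: exI[of _ m])
    qed
  qed
qed

text \<open>At a time up to the last departure that is spent in the inner cylinder, the flag must be
  set. Otherwise a return has been overlooked, or the counter is zero and the time is that departure
  itself, when the height is at least \<open>h\<close>.\<close>

lemma FaP_covers:
  fixes w :: "nat \<Rightarrow> int list"
  assumes K: "0 < K" and n: "enat n \<le> Dseq (\<lambda>n. \<bar>w n ! d\<bar> \<le> int N) (\<lambda>n. int h \<le> \<bar>w n ! d\<bar>) K"
    and w: "\<bar>w n ! d\<bar> \<le> int N" "toZ d N (w n) \<in> Abox"
  shows "toZ d N (w n) \<in> FaP n False K w"
proof -
  have "fst (St False K w n)"
  proof (rule ccontr)
    assume False: "\<not> fst (St False K w n)"
    obtain m where m: "m \<le> n" "Dseq (\<lambda>n. \<bar>w n ! d\<bar> \<le> int N) (\<lambda>n. int h \<le> \<bar>w n ! d\<bar>) (K - snd (St False K w n)) = enat m"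
      "if snd (St False K w n) = 0 then int h \<le> \<bar>w m ! d\<bar> else \<forall>l. m \<le> l \<and> l \<le> n \<longrightarrow> \<not> \<bar>w l ! d\<bar> \<le> int N"
      using St_Dseq[OF K, of w n] False by auto
    show False
    proof (cases "snd (St False K w n) = 0")
      case True
      then have "m = n" using m n by simp
      then show False using True m(3) w Nh by simp
    next
      case False then show False using m w by auto
    qed
  qed
  then show ?thesis unfolding FaP_St using w by (auto simp: col_def)
qed

lemma sets_FaP: "{w. R (FaP n b k (\<lambda>i. subE d N (w i) x))} \<in> sets path_space"
proof (rule sets_prefix[of n])
  fix w w' :: "nat \<Rightarrow> int list" assume "\<And>k. k \<le> n \<Longrightarrow> w k = w' k" "w \<in> {w. R (FaP n b k (\<lambda>i. subE d N (w i) x))}"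
  then show "w' \<in> {w. R (FaP n b k (\<lambda>i. subE d N (w i) x))}"
    using FaP_prefix[of n "\<lambda>i. subE d N (w i) x" "\<lambda>i. subE d N (w' i) x" b k] by simp
qed

lemma FaP_law:
  assumes "p \<in> Epts d N"
  shows "measure (walk_law (nm d) (mvE d N) p) {w. R (FaP n b k (\<lambda>i. subE d N (w i) x))}
    = measure (measure_pmf (law n b k (subE d N p x))) {S. R S}"
  using assms
proof (induction n arbitrary: p b k R)
  case 0
  have "measure (walk_law (nm d) (mvE d N) p) {w. R (FaP 0 b k (\<lambda>i. subE d N (w i) x))}
    = (if R (FaP 0 b k (\<lambda>i. subE d N p x)) then 1 else 0)"
    using walk_law_start_pred[of "nm d" "mvE d N" p "\<lambda>q. R (FaP 0 b k (\<lambda>i. subE d N q x))"] by simp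
  then show ?case by (simp add: indicator_def)
next
  case (Suc n)
  let ?u = "upd b k (subE d N p x)"
  let ?C = "col (fst ?u) (subE d N p x)"
  have X: "{w. R (FaP (Suc n) b k (\<lambda>i. subE d N (w i) x))} \<in> sets path_space" by (rule sets_FaP)
  have "{w. case_nat p w \<in> {w. R (FaP (Suc n) b k (\<lambda>i. subE d N (w i) x))}}
    = {w. R (?C \<union> FaP n (fst ?u) (snd ?u) (\<lambda>i. subE d N (w i) x))}" by simp
  then have "measure (walk_law (nm d) (mvE d N) p) {w. R (FaP (Suc n) b k (\<lambda>i. subE d N (w i) x))}
    = av (nm d) (\<lambda>j. measure (walk_law (nm d) (mvE d N) (mvE d N p j)) {w. R (?C \<union> FaP n (fst ?u) (snd ?u) (\<lambda>i. subE d N (w i) x))})"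
    unfolding walk_law_step[OF nm_pos X] by simp
  also have "\<dots> = av (nm d) (\<lambda>j. measure (measure_pmf (law n (fst ?u) (snd ?u) (mvE d N (subE d N p x) j))) {S. R (?C \<union> S)})"
    by (rule av_cong) (use Suc.IH[of _ "\<lambda>S. R (?C \<union> S)"] E.closed[OF Suc.prems] subE_mvE[OF Suc.prems] in auto)
  also have "\<dots> = measure (measure_pmf (law (Suc n) b k (subE d N p x))) {S. R S}"
    by (simp add: vimage_def measure_bind_steps[OF nm_pos])
  finally show ?case .
qed

text \<open>The trace grows with the horizon inside a finite box, so along every path it is
  eventually constant. A horizon that suffices with probability above \<open>1 - e'\<close> reduces
  the claim to the domination for that horizon, whether or not the last departure time is
  finite.\<close>

lemma coupling_exists:
  assumes x: "x \<in> Epts d N" and K: "0 < K" and v: "0 \<le> v" and hh: "h = hN N"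
    and dom: "\<And>n. sdom e (bind_pmf (pmf_of_set (slice d N (- x ! d))) (law n False K)) (Z.poi Abox v)"
    and e': "0 < e'" and ball: "ballE d N \<beta> \<subseteq> ebox r"
  shows "\<exists>Q. is_coupling d N v Q \<and>
        measure Q {\<omega> \<in> space Q. \<forall>n. enat n \<le> Dtime d N (x ! d) K (fst \<omega>) \<longrightarrow>
             subE d N (fst \<omega> n) x \<in> ballE d N \<beta> \<longrightarrow>
             toZ d N (subE d N (fst \<omega> n) x) \<in> snd \<omega>}
        \<ge> 1 - e - e'"
proof -
  let ?S = "slice d N 0"
  have Sne: "?S \<noteq> {}" using card_slice[of d N 0] N by (metis card.empty power_not_zero less_irrefl)
  define W where "W = walk_law (nm d) (mvE d N)"
  define M1 where "M1 = bind (measure_pmf (pmf_of_set ?S)) W"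
  have Wm: "W \<in> measurable (measure_pmf (pmf_of_set ?S)) (subprob_algebra path_space)"
    unfolding W_def
    by (auto simp: measurable_def space_subprob_algebra prob_space_walk_law prob_space_imp_subprob_space)
  have sets1: "sets M1 = sets path_space"
    unfolding M1_def by (rule sets_bind) (auto simp: W_def)
  have space1: "space M1 = UNIV" using sets_eq_imp_space_eq[OF sets1] by simp
  interpret M1: prob_space M1
    unfolding M1_def by (rule measure_pmf.prob_space_bind[OF _ Wm]) (auto simp: W_def prob_space_walk_law)
  have m1: "measure M1 X = (\<Sum>p\<in>?S. measure (W p) X) / real N ^ d" if X: "X \<in> sets path_space" for X
  proof -
    have "emeasure M1 X = (\<integral>\<^sup>+p. emeasure (W p) X \<partial>measure_pmf (pmf_of_set ?S))"
      unfolding M1_def by (rule emeasure_bind[OF _ Wm X]) simp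
    also have "\<dots> = (\<integral>\<^sup>+p. ennreal (measure (W p) X) \<partial>measure_pmf (pmf_of_set ?S))"
      by (intro nn_integral_cong) (simp add: W_def finite_measure.emeasure_eq_measure prob_space.finite_measure prob_space_walk_law)
    also have "\<dots> = ennreal (measure_pmf.expectation (pmf_of_set ?S) (\<lambda>p. measure (W p) X))"
      by (rule nn_integral_eq_integral)
         (auto intro!: measure_pmf.integrable_const_bound[where B=1] simp: W_def prob_space.prob_le_1[OF prob_space_walk_law])
    also have "measure_pmf.expectation (pmf_of_set ?S) (\<lambda>p. measure (W p) X) = (\<Sum>p\<in>?S. measure (W p) X) / real N ^ d"
      by (simp add: integral_pmf_of_set[OF Sne finite_slice] card_slice)
    finally show ?thesis
      by (simp add: measure_def sum_nonneg)
  qed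
  define \<mu> where "\<mu> A = Z.poi A v" for A
  obtain M2 where M2: "prob_space M2" "sets M2 = sets set_space" "AE S in M2. S \<subseteq> Zpts d"
    "\<And>A T. finite A \<Longrightarrow> A \<subseteq> Zpts d \<Longrightarrow> measure M2 {S. S \<inter> A = T} = pmf (\<mu> A) T"
  proof (rule random_set_exists[of "Zpts d" \<mu>])
    fix A :: "int list set" assume A: "finite A" "A \<subseteq> Zpts d"
    show "set_pmf (\<mu> A) \<subseteq> Pow A" unfolding \<mu>_def by (rule Z.poi(1)[OF A v])
  next
    fix A B :: "int list set" assume "A \<subseteq> B" "finite B" "B \<subseteq> Zpts d"
    then show "map_pmf (\<lambda>S. S \<inter> A) (\<mu> B) = \<mu> A" unfolding \<mu>_def by (intro Z.poi_Int v)
  qed blast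
  have space2: "space M2 = UNIV" using sets_eq_imp_space_eq[OF M2(2)] by simp
  interpret M2: prob_space M2 by (rule M2(1))
  define F where "F n w = FaP n False K (\<lambda>i. subE d N (w i) x)" for n w
  \<comment> \<open>The paths whose trace no longer grows after time \<open>n\<close>; these events
    increase to the whole space.\<close>
  define St where "St n = {w. \<forall>n'. F n' w \<subseteq> F n w}" for n
  have St_sets: "St n \<in> sets path_space" for n
  proof -
    have "{w \<in> space path_space. \<forall>n'. F n' w \<subseteq> F n w} \<in> sets path_space"
    proof (rule sets.sets_Collect_countable_All)
      fix n'
      have "{w. F n' w \<subseteq> F n w} \<in> sets path_space"
      proof (rule sets_prefix[of "max n n'"])
        fix w w' :: "nat \<Rightarrow> int list" assume a: "\<And>k. k \<le> max n n' \<Longrightarrow> w k = w' k" "w \<in> {w. F n' w \<subseteq> F n w}"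
        have "F n w = F n w'" "F n' w = F n' w'" unfolding F_def by (rule FaP_prefix, simp add: a(1))+
        then show "w' \<in> {w. F n' w \<subseteq> F n w}" using a(2) by simp
      qed
      then show "{w \<in> space path_space. F n' w \<subseteq> F n w} \<in> sets path_space" by simp
    qed
    then show ?thesis by (simp add: St_def)
  qed
  have "(\<lambda>n. measure M1 (St n)) \<longlonglongrightarrow> measure M1 (\<Union>n. St n)"
  proof (rule M1.finite_Lim_measure_incseq)
    show "range St \<subseteq> sets M1" using St_sets sets1 by auto
    show "incseq St"
    proof (rule incseq_SucI)
      fix n
      have "F n w \<subseteq> F (Suc n) w" for w unfolding F_def by (rule FaP_mono) simp
      then show "St n \<subseteq> St (Suc n)" unfolding St_def by fast
    qed
  qed
  moreover have "(\<Union>n. St n) = UNIV"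
  proof -
    have "\<exists>n. \<forall>n'. F n' w \<subseteq> F n w" for w
    proof -
      have fin: "finite (\<Union>n. F n w)" by (rule finite_subset[OF _ finite_Abox(1)]) (auto simp: F_def dest: subsetD[OF FaP_Abox])
      have chain: "subset.chain (range (\<lambda>n. F n w)) (range (\<lambda>n. F n w))"
      proof -
        have "F n w \<subseteq> F n' w \<or> F n' w \<subseteq> F n w" for n n'
          unfolding F_def using FaP_mono[of n n'] FaP_mono[of n' n] nat_le_linear[of n n'] by meson
        then show ?thesis unfolding subset_chain_def by (auto simp: image_iff)
      qed
      have "\<exists>B\<in>range (\<lambda>n. F n w). (\<Union>n. F n w) \<subseteq> B"
        by (rule finite_subset_Union_chain[OF fin _ _ chain]) auto
      then show ?thesis by blast
    qed
    then show ?thesis by (auto simp: St_def)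
  qed
  ultimately have "(\<lambda>n. measure M1 (St n)) \<longlonglongrightarrow> 1" using M1.prob_space space1 by simp
  then have "\<forall>\<^sub>F n in sequentially. 1 - e' < measure M1 (St n)" by (rule order_tendstoD) (use e' in simp)
  then obtain n where n: "1 - e' < measure M1 (St n)" by (auto simp: eventually_sequentially)
  have lawF: "measure M1 {w. F n w = T} = pmf (bind_pmf (pmf_of_set (slice d N (- x ! d))) (law n False K)) T" for T
  proof -
    have X: "{w. F n w = T} \<in> sets path_space" unfolding F_def by (rule sets_FaP)
    have lx: "length x = d + 1" using x by (simp add: Epts_def)
    have ne: "slice d N (- x ! d) \<noteq> {}" using bij_betw_imp_surj_on[OF bij_subE[OF N lx]] Sne by auto
    have "measure (W p) {w. F n w = T} = pmf (law n False K (subE d N p x)) T" if "p \<in> ?S" for p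
    proof -
      have "p \<in> Epts d N" using that by (simp add: slice_def)
      then show ?thesis unfolding W_def F_def FaP_law[OF \<open>p \<in> Epts d N\<close>, of "\<lambda>S. S = T"] by (simp add: measure_pmf_single)
    qed
    then have "measure M1 {w. F n w = T} = (\<Sum>p\<in>?S. pmf (law n False K (subE d N p x)) T) / real N ^ d"
      unfolding m1[OF X] by simp
    also have "(\<Sum>p\<in>?S. pmf (law n False K (subE d N p x)) T) = (\<Sum>q\<in>slice d N (- x ! d). pmf (law n False K q) T)"
      by (rule sum.reindex_bij_betw[OF bij_subE[OF N lx]])
    finally show ?thesis
      by (simp add: pmf_bind integral_pmf_of_set[OF ne finite_slice] card_slice)
  qed
  obtain \<pi> where \<pi>: "map_pmf fst \<pi> = bind_pmf (pmf_of_set (slice d N (- x ! d))) (law n False K)"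
    "map_pmf snd \<pi> = Z.poi Abox v" "measure (measure_pmf \<pi>) {st. \<not> fst st \<subseteq> snd st} \<le> e"
    using dom[of n] unfolding sdom_def by blast
  obtain Q where Q: "prob_space Q" "sets Q = sets (M1 \<Otimes>\<^sub>M M2)"
    "\<And>E. E \<in> sets M1 \<Longrightarrow> measure Q (E \<times> space M2) = measure M1 E"
    "\<And>E. E \<in> sets M2 \<Longrightarrow> measure Q (space M1 \<times> E) = measure M2 E"
    "\<And>f g. measure Q ({a \<in> space M1. F n a = f} \<times> {b \<in> space M2. b \<inter> Abox = g}) = pmf \<pi> (f, g)"
  proof (rule glue[of M1 M2 "Pow Abox" "Pow Abox" "F n" "\<lambda>S. S \<inter> Abox" \<pi>])
    show "F n a \<in> Pow Abox" for a using FaP_Abox by (auto simp: F_def)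
    show "{a \<in> space M1. F n a = f} \<in> sets M1" for f using sets_FaP[of "\<lambda>S. S = f"] by (simp add: space1 sets1 F_def)
    show "{b \<in> space M2. b \<inter> Abox = g} \<in> sets M2" for g using sets_Int_eq[OF finite_Abox(1)] by (simp add: space2 M2(2))
    show "pmf (map_pmf fst \<pi>) f = measure M1 {a \<in> space M1. F n a = f}" for f by (simp add: \<pi>(1) lawF space1)
    show "pmf (map_pmf snd \<pi>) g = measure M2 {b \<in> space M2. b \<inter> Abox = g}" for g
      using M2(4)[OF finite_Abox, of g] by (simp add: \<pi>(2) \<mu>_def space2)
  qed (use M1.prob_space_axioms M2.prob_space_axioms finite_Abox in auto)
  interpret Q: prob_space Q by (rule Q(1))
  have spaceQ: "space Q = UNIV" using sets_eq_imp_space_eq[OF Q(2)] by (simp add: space_pair_measure space1 space2)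
  have rectQ: "E1 \<times> E2 \<in> sets Q" if "E1 \<in> sets path_space" "E2 \<in> sets set_space" for E1 E2
    unfolding Q(2) using that sets1 M2(2) by (intro pair_measureI) auto
  have fstQ: "measure Q {\<omega>. fst \<omega> \<in> X} = measure M1 X" if "X \<in> sets path_space" for X
  proof -
    have "{\<omega>. fst \<omega> \<in> X} = X \<times> space M2" by (auto simp: space2)
    then show ?thesis using Q(3)[of X] that sets1 by simp
  qed
  have sndQ: "measure Q {\<omega>. snd \<omega> \<in> X} = measure M2 X" if "X \<in> sets set_space" for X
  proof -
    have "{\<omega>. snd \<omega> \<in> X} = space M1 \<times> X" by (auto simp: space1)
    then show ?thesis using Q(4)[of X] that M2(2) by simp
  qed
  have coupling: "is_coupling d N v Q"
    unfolding is_coupling_def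
  proof (intro conjI allI impI)
    show "prob_space Q" by fact
    show "{\<omega> \<in> space Q. fst \<omega> m = p} \<in> sets Q" for m p
    proof -
      have "{\<omega> \<in> space Q. fst \<omega> m = p} = {w. w m = p} \<times> UNIV" by (auto simp: spaceQ)
      also have "\<dots> \<in> sets Q" by (rule rectQ[OF sets_coordinate]) (metis sets.top space_set_space)
      finally show ?thesis .
    qed
    show "{\<omega> \<in> space Q. p \<in> snd \<omega>} \<in> sets Q" for p
    proof -
      have "{\<omega> \<in> space Q. p \<in> snd \<omega>} = UNIV \<times> {S. p \<in> S}" by (auto simp: spaceQ)
      also have "\<dots> \<in> sets Q" by (rule rectQ[OF _ sets_member]) (metis sets.top space_path_space)
      finally show ?thesis .
    qed
    show "measure Q {\<omega> \<in> space Q. \<forall>k\<le>m. fst \<omega> k = ps k} = initE d N (ps 0) * (\<Prod>k<m. ptransE d N (ps k) (ps (Suc k)))" for m ps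
    proof -
      have X: "{w. \<forall>k\<le>m. w k = ps k} \<in> sets path_space" by (rule sets_prefix[of m]) auto
      have "measure Q {\<omega> \<in> space Q. \<forall>k\<le>m. fst \<omega> k = ps k} = measure M1 {w. \<forall>k\<le>m. w k = ps k}"
        using fstQ[OF X] by (simp add: spaceQ)
      also have "\<dots> = (\<Sum>p\<in>?S. if p = ps 0 then \<Prod>k<m. real (card {j. j < nm d \<and> mvE d N (ps k) j = ps (Suc k)}) / real (nm d) else 0) / real N ^ d"
        unfolding m1[OF X] W_def walk_law_prefix[OF nm_pos] ..
      also have "\<dots> = (if ps 0 \<in> ?S then \<Prod>k<m. real (card {j. j < nm d \<and> mvE d N (ps k) j = ps (Suc k)}) / real (nm d) else 0) / real N ^ d"
        by (simp add: sum.delta' finite_slice)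
      also have "\<dots> = initE d N (ps 0) * (\<Prod>k<m. ptransE d N (ps k) (ps (Suc k)))"
        by (simp add: initE_def ptransE_def slice_def nm_def)
      finally show ?thesis .
    qed
    show "AE \<omega> in Q. snd \<omega> \<subseteq> Zpts d"
    proof -
      have X: "{S. S \<subseteq> Zpts d} \<in> sets set_space"
      proof -
        have "{S \<in> space set_space. \<forall>p\<in>- Zpts d. p \<notin> S} \<in> sets set_space"
        proof (rule sets.sets_Collect_countable_All')
          fix p :: "int list"
          have "{S \<in> space set_space. p \<notin> S} = space set_space - {S. p \<in> S}" by auto
          then show "{S \<in> space set_space. p \<notin> S} \<in> sets set_space" by (simp only: sets_member sets.compl_sets)
        qed simp
        moreover have "{S \<in> space set_space. \<forall>p\<in>- Zpts d. p \<notin> S} = {S. S \<subseteq> Zpts d}" by auto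
        ultimately show ?thesis by simp
      qed
      have "measure M2 {S. S \<subseteq> Zpts d} = 1"
        by (rule M2.prob_eq_1[THEN iffD2]) (use X M2 in auto)
      then have "measure Q {\<omega>. snd \<omega> \<in> {S. S \<subseteq> Zpts d}} = 1" using sndQ[OF X] by simp
      moreover have "{\<omega>. snd \<omega> \<in> {S. S \<subseteq> Zpts d}} \<in> sets Q"
      proof -
        have "{\<omega>. snd \<omega> \<in> {S. S \<subseteq> Zpts d}} = (UNIV :: (nat \<Rightarrow> int list) set) \<times> {S. S \<subseteq> Zpts d}" by auto
        then show ?thesis using rectQ[OF _ X, of UNIV] by (metis sets.top space_path_space)
      qed
      ultimately have "AE \<omega> in Q. \<omega> \<in> {\<omega>. snd \<omega> \<in> {S. S \<subseteq> Zpts d}}" using Q.prob_eq_1 by blast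
      then show ?thesis by simp
    qed
    fix C :: "int list set" assume C: "finite C" "C \<subseteq> Zpts d"
    have "measure Q {\<omega> \<in> space Q. snd \<omega> \<inter> C = {}} = measure M2 {S. S \<inter> C = {}}"
      using sndQ[OF sets_Int_eq[OF C(1), of "{}"]] by (simp add: spaceQ)
    also have "\<dots> = pmf (Z.poi C v) {}" using M2(4)[OF C, of "{}"] by (simp add: \<mu>_def)
    also have "\<dots> = measure (measure_pmf (Z.poi C v)) ({{}} \<inter> set_pmf (Z.poi C v))"
      by (simp add: measure_Int_set_pmf measure_pmf_single)
    also have "{{}} \<inter> set_pmf (Z.poi C v) = {S. S \<inter> C = {}} \<inter> set_pmf (Z.poi C v)"
      using Z.poi(1)[OF C v] by auto
    also have "measure (measure_pmf (Z.poi C v)) \<dots> = avoid (Z.poi C v) C"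
      by (simp add: measure_Int_set_pmf avoid_def)
    also have "\<dots> = exp (- v * cap d C)" using Z.poi(2)[OF C v order_refl] by (simp add: cap_ecap)
    finally show "measure Q {\<omega> \<in> space Q. snd \<omega> \<inter> C = {}} = exp (- v * cap d C)" .
  qed
  define G where "G = {\<omega> \<in> space Q. \<forall>n. enat n \<le> Dtime d N (x ! d) K (fst \<omega>) \<longrightarrow>
             subE d N (fst \<omega> n) x \<in> ballE d N \<beta> \<longrightarrow> toZ d N (subE d N (fst \<omega> n) x) \<in> snd \<omega>}"
  define Y where "Y n q = {w. enat n \<le> Dtime d N (x ! d) K w \<and> subE d N (w n) x \<in> ballE d N \<beta> \<and> toZ d N (subE d N (w n) x) = q}" for n q
  have Y: "Y n q \<in> sets path_space" for n q
  proof (rule sets_prefix[of n])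
    fix w w' :: "nat \<Rightarrow> int list" assume a: "\<And>k. k \<le> n \<Longrightarrow> w k = w' k" "w \<in> Y n q"
    have "enat n \<le> Dtime d N (x ! d) K w \<longleftrightarrow> enat n \<le> Dtime d N (x ! d) K w'"
      unfolding Dtime_def by (rule le_Dseq_prefix) (simp_all add: a(1))
    then show "w' \<in> Y n q" using a by (simp add: Y_def)
  qed
  have compl: "space Q - G = (\<Union>n. \<Union>q. Y n q \<times> {S. q \<notin> S})" by (auto simp: G_def Y_def spaceQ)
  have nm: "{S. q \<notin> S} \<in> sets set_space" for q :: "int list"
  proof -
    have "{S. q \<notin> S} = space set_space - {S. q \<in> S}" by auto
    then show ?thesis by (simp only: sets_member sets.compl_sets)
  qed
  have complm: "space Q - G \<in> sets Q"
    unfolding compl by (intro sets.countable_UN' rectQ Y nm) (auto intro: sets.countable_UN' rectQ Y nm)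
  have G: "G \<in> sets Q"
  proof -
    have "G = space Q - (space Q - G)" by (auto simp: G_def)
    then show ?thesis using sets.compl_sets[OF complm] by simp
  qed
  \<comment> \<open>Failures are sorted by the finitely many pairs of traces, because
    \<open>glue\<close> gives the mass of each product cell.\<close>
  define P where "P = {fg \<in> Pow Abox \<times> Pow Abox. \<not> fst fg \<subseteq> snd fg}"
  have finP: "finite P" unfolding P_def by (rule finite_subset[of _ "Pow Abox \<times> Pow Abox"]) (use finite_Abox in auto)
  define Rr where "Rr fg = {w. F n w = fst fg} \<times> {S. S \<inter> Abox = snd fg}" for fg
  have Rs: "Rr fg \<in> sets Q" for fg
    unfolding Rr_def F_def by (intro rectQ sets_FaP sets_Int_eq finite_Abox)
  have St_c: "- St n \<in> sets path_space" using sets.compl_sets[OF St_sets[of n]] by (simp add: Compl_eq_Diff_UNIV)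
  have sub: "space Q - G \<subseteq> (\<Union>fg\<in>P. Rr fg) \<union> {\<omega>. fst \<omega> \<in> - St n}"
  proof
    fix \<omega> assume "\<omega> \<in> space Q - G"
    then obtain i q where iq: "fst \<omega> \<in> Y i q" "q \<notin> snd \<omega>" unfolding compl by auto
    show "\<omega> \<in> (\<Union>fg\<in>P. Rr fg) \<union> {\<omega>. fst \<omega> \<in> - St n}"
    proof (cases "fst \<omega> \<in> St n")
      case True
      define w where "w = (\<lambda>i. subE d N (fst \<omega> i) x)"
      have wd: "w i ! d = fst \<omega> i ! d - x ! d" for i by (simp add: w_def subE_nth)
      have we: "w i \<in> ebox r" "toZ d N (w i) = q" using iq(1) ball by (auto simp: Y_def w_def)
      have "Dtime d N (x ! d) K (fst \<omega>) = Dseq (\<lambda>n. \<bar>w n ! d\<bar> \<le> int N) (\<lambda>n. int h \<le> \<bar>w n ! d\<bar>) K"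
        by (simp add: Dtime_def wd hh)
      then have D: "enat i \<le> Dseq (\<lambda>n. \<bar>w n ! d\<bar> \<le> int N) (\<lambda>n. int h \<le> \<bar>w n ! d\<bar>) K" using iq(1) by (simp add: Y_def)
      have q: "q \<in> Abox" using we by (auto simp: ebox_def Abox_def)
      have "\<bar>toZ d N (w i) ! d\<bar> \<le> int r" using we(1) by (simp add: ebox_def zbox_def)
      then have "\<bar>w i ! d\<bar> \<le> int N" using rR RN by (simp add: toZ_nth)
      then have "q \<in> FaP i False K w" using FaP_covers[OF K D] we q by simp
      then have "q \<in> F n (fst \<omega>)" using True unfolding St_def F_def w_def by blast
      then have "\<not> F n (fst \<omega>) \<subseteq> snd \<omega> \<inter> Abox" using iq(2) by blast
      moreover have "F n (fst \<omega>) \<subseteq> Abox" unfolding F_def by (rule FaP_Abox)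
      ultimately have "(F n (fst \<omega>), snd \<omega> \<inter> Abox) \<in> P" by (auto simp: P_def)
      moreover have "\<omega> \<in> Rr (F n (fst \<omega>), snd \<omega> \<inter> Abox)" by (cases \<omega>) (simp add: Rr_def)
      ultimately show ?thesis by blast
    qed simp
  qed
  have fstSt: "{\<omega> :: (nat \<Rightarrow> int list) \<times> int list set. fst \<omega> \<in> - St n} \<in> sets Q"
  proof -
    have "{\<omega> :: (nat \<Rightarrow> int list) \<times> int list set. fst \<omega> \<in> - St n} = (- St n) \<times> UNIV" by auto
    also have "\<dots> \<in> sets Q" by (rule rectQ[OF St_c]) (metis sets.top space_set_space)
    finally show ?thesis .
  qed
  have "measure Q (space Q - G) \<le> measure Q ((\<Union>fg\<in>P. Rr fg) \<union> {\<omega>. fst \<omega> \<in> - St n})"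
    by (rule Q.finite_measure_mono[OF sub]) (intro sets.Un sets.finite_UN finP Rs fstSt)
  also have "\<dots> \<le> measure Q (\<Union>fg\<in>P. Rr fg) + measure Q {\<omega>. fst \<omega> \<in> - St n}"
    by (rule measure_Un_le) (intro sets.finite_UN finP Rs fstSt)+
  also have "measure Q (\<Union>fg\<in>P. Rr fg) \<le> (\<Sum>fg\<in>P. measure Q (Rr fg))"
    by (rule Q.finite_measure_subadditive_finite) (use finP Rs in auto)
  also have "(\<Sum>fg\<in>P. measure Q (Rr fg)) = (\<Sum>fg\<in>P. pmf \<pi> fg)"
    by (rule sum.cong[OF refl]) (use Q(5) in \<open>simp add: Rr_def space1 space2\<close>)
  also have "\<dots> = measure (measure_pmf \<pi>) P" by (rule measure_measure_pmf_finite[OF finP, symmetric])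
  also have "\<dots> \<le> measure (measure_pmf \<pi>) {st. \<not> fst st \<subseteq> snd st}"
    by (rule measure_pmf.finite_measure_mono) (auto simp: P_def)
  also have "\<dots> \<le> e" by (rule \<pi>(3))
  also have "measure Q {\<omega>. fst \<omega> \<in> - St n} = measure M1 (- St n)" by (rule fstQ[OF St_c])
  also have "\<dots> \<le> e'"
    using M1.prob_compl[of "St n"] St_sets sets1 n by (simp add: space1 Compl_eq_Diff_UNIV)
  finally have "measure Q (space Q - G) \<le> e + e'" by simp
  then have "1 - e - e' \<le> measure Q G" using Q.prob_compl[OF G] by simp
  then show ?thesis using coupling unfolding G_def by blast
qed

end

section \<open>Estimates at large scale\<close>

lemma mvZ_zbox:
  assumes p: "p \<in> zbox d R"
  shows "mvZ p j \<in> zbox d (Suc R)"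
proof -
  have "\<bar>mvZ p j ! i\<bar> \<le> int (Suc R)" if "i \<le> d" for i
  proof -
    have i: "i < length p" "\<bar>p ! i\<bar> \<le> int R" using p that by (auto simp: zbox_def)
    show ?thesis using i by (cases "i = j div 2") (auto simp: mvZ_sg sg_def)
  qed
  then show ?thesis using p by (auto simp: zbox_def mvZ_def)
qed

lemma nsq_notin_zbox:
  assumes "p \<in> Zpts d" "p \<notin> zbox d R" shows "(real R)\<^sup>2 \<le> nsq d p"
proof -
  obtain i where i: "i \<le> d" "int R < \<bar>p ! i\<bar>" using assms by (force simp: zbox_def Zpts_def)
  have "(real R)\<^sup>2 \<le> (real_of_int \<bar>p ! i\<bar>)\<^sup>2" by (rule power_mono) (use i in linarith, simp)
  then show ?thesis using nsq_ge[OF i(1), of p] by simp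
qed

lemma powr_minus_ratio:
  fixes s t b :: real
  assumes "0 < s" "0 < t" shows "t powr (- b) = s powr (- b) * (s / t) powr b"
  using assms by (simp add: powr_divide powr_minus divide_simps)

text \<open>\<open>1 - F / c\<close> is subharmonic and nonpositive on the small box, while outside
  the large box \<open>F / c\<close> is at most the given power of the ratio, hence at most
  \<open>\<delta>\<close>.\<close>

lemma avoid_far:
  assumes a: "2 \<le> a" "0 < b" and super: "\<And>p. p \<in> Zpts d \<Longrightarrow>
      av (nm d) (\<lambda>j. (a + nsq d (mvZ p j)) powr (- b)) \<le> (a + nsq d p) powr (- b)"
    and \<delta>: "((a + (real d + 1) * (real r)\<^sup>2) / (a + (real R)\<^sup>2)) powr b \<le> \<delta>"
    and p: "p \<in> Zpts d" "p \<notin> zbox d R"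
  shows "1 - \<delta> \<le> rwalk.avd mvZ (nm d) (zbox d r) n p"
proof -
  interpret Z: rwalk "Zpts d" mvZ "nm d" flip by (rule rwalk_Z)
  define F where "F p = (a + nsq d p) powr (- b)" for p
  define c where "c = (a + (real d + 1) * (real r)\<^sup>2) powr (- b)"
  have ar: "0 < a + (real d + 1) * (real r)\<^sup>2" by (rule add_pos_nonneg) (use a in auto)
  have aR: "0 < a + (real R)\<^sup>2" by (rule add_pos_nonneg) (use a in auto)
  have c: "0 < c" unfolding c_def using ar by simp
  have F0: "0 \<le> F p" for p by (simp add: F_def)
  have "F p \<le> (a + (real R)\<^sup>2) powr (- b)"
    unfolding F_def by (rule powr_mono2') (use a nsq_notin_zbox[OF p] in \<open>auto simp: add_pos_nonneg\<close>)
  also have "\<dots> = c * ((a + (real d + 1) * (real r)\<^sup>2) / (a + (real R)\<^sup>2)) powr b"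
    unfolding c_def by (rule powr_minus_ratio[OF ar aR])
  also have "\<dots> \<le> c * \<delta>" using \<delta> c by simp
  finally have "1 - \<delta> \<le> 1 - F p / c" using c by (simp add: field_simps)
  also have "\<dots> \<le> Z.avd (zbox d r) n p"
  proof (rule Z.subharmonic_le_avd)
    fix p assume "p \<in> Zpts d"
    then have "av (nm d) (\<lambda>j. F (mvZ p j)) / c \<le> F p / c"
      using super[of p] c unfolding F_def by (simp add: divide_right_mono)
    moreover have "av (nm d) (\<lambda>j. 1 - F (mvZ p j) / c) = 1 - av (nm d) (\<lambda>j. F (mvZ p j)) / c"
      using nm_pos[of d] unfolding av_def
      by (simp add: sum_subtractf diff_divide_distrib sum_divide_distrib mult.commute)
    ultimately show "1 - F p / c \<le> av (nm d) (\<lambda>j. 1 - F (mvZ p j) / c)" by simp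
  next
    fix p assume "p \<in> zbox d r"
    then have "nsq d p \<le> (real d + 1) * (real r)\<^sup>2" by (rule nsq_le_zbox)
    then have "c \<le> F p" unfolding F_def c_def
      by (intro powr_mono2') (use a nsq_nonneg[of d p] in auto)
    then show "1 - F p / c \<le> 0" using c by simp
  qed (use p F0 c in auto)
  finally show ?thesis .
qed

context cylinder
begin

interpretation Z: rwalk "Zpts d" mvZ "nm d" flip by (rule rwalk_Z)
interpretation E: rwalk "Epts d N" "mvE d N" "nm d" flip by (rule rwalk_E[OF N])

lemma ebox_step:
  assumes p: "p \<in> ebox R1" and j: "j < nm d"
  shows "toZ d N (mvE d N p j) = mvZ (toZ d N p) j" "mvE d N p j \<in> ebox (Suc R1)"
proof -
  have pE: "p \<in> Epts d N" "toZ d N p \<in> zbox d R1" using p by (auto simp: ebox_def)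
  show eq: "toZ d N (mvE d N p j) = mvZ (toZ d N p) j"
  proof (rule toZ_mvE[OF pE(1) j])
    fix i assume "i < d"
    then have "\<bar>toZ d N p ! i\<bar> \<le> int R1" using pE by (auto simp: zbox_def)
    moreover have "16 * (int R1 + 1) \<le> int N" using zle_int[of "16 * (R1 + 1)" N] RN by simp
    moreover have "0 \<le> int R1" by simp
    ultimately show "2 * \<bar>toZ d N p ! i\<bar> + 2 < int N" by (smt (verit))
  qed
  show "mvE d N p j \<in> ebox (Suc R1)" unfolding ebox_def using eq mvZ_zbox[OF pE(2)] E.closed[OF pE(1) j] by simp
qed

lemma exn_toZ:
  assumes "p \<in> ebox (Suc R1)"
  shows "E.exn (ebox r) (ebox R1) n p = Z.exn Abox (zbox d R1) n (toZ d N p)"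
  using assms
proof (induction n arbitrary: p)
  case 0 then show ?case by (auto simp: ebox_def Abox_def)
next
  case (Suc n)
  have "p \<in> ebox r \<longleftrightarrow> toZ d N p \<in> Abox" "p \<in> ebox R1 \<longleftrightarrow> toZ d N p \<in> zbox d R1"
    using Suc.prems by (auto simp: ebox_def Abox_def)
  moreover have "av (nm d) (\<lambda>j. E.exn (ebox r) (ebox R1) n (mvE d N p j)) = av (nm d) (\<lambda>j. Z.exn Abox (zbox d R1) n (mvZ (toZ d N p) j))"
    if "p \<in> ebox R1"
    by (rule av_cong) (use ebox_step[OF that] Suc.IH in auto)
  ultimately show ?case by simp
qed

text \<open>Until it leaves \<open>ebox R1\<close> the cylinder walk is the lattice walk seen
  through the chart. The exit factor produced by reversal is therefore evaluated on the lattice,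
  where \<open>far\<close> bounds it by the escape probability over
  \<open>1 - \<delta>\<close>.\<close>

lemma hit_sum_esc:
  assumes far: "\<And>p n. p \<in> Zpts d \<Longrightarrow> p \<notin> zbox d R1 \<Longrightarrow> 1 - \<delta> \<le> Z.avd Abox n p" and \<delta>: "0 \<le> \<delta>" "\<delta> < 1"
    and X: "finite X" "X \<subseteq> Epts d N" "X \<inter> ebox R1 = {}" and x: "x \<in> ebox r"
    and S: "\<And>p n. p \<in> ebox (Suc R1) \<Longrightarrow> p \<in> - Wout \<Longrightarrow> E.vis (- Wout) (\<lambda>p. if p \<in> X then 1 else 0) n p \<le> S" "0 \<le> S"
  shows "(\<Sum>q\<in>X. E.hitd (- Wout) n q x) \<le> S / (1 - \<delta>) * Z.esc Abox (toZ d N x)"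
proof -
  have xR: "x \<in> ebox R1" using ebox_mono[OF rR] x by auto
  have xE: "x \<in> Epts d N" using x by (simp add: ebox_def)
  have "(\<Sum>q\<in>X. E.hitd (- Wout) n q x) \<le> S * av (nm d) (\<lambda>j. E.exn (ebox r) (ebox R1) n (mvE d N x j))"
  proof (rule E.hit_sum_bound[where R="ebox (Suc R1)"])
    fix p j assume "p \<in> ebox R1" "j < nm d" then show "mvE d N p j \<in> ebox (Suc R1)" by (rule ebox_step(2))
  qed (use S X x xR xE in \<open>auto simp: Wout_def\<close>)
  also have "av (nm d) (\<lambda>j. E.exn (ebox r) (ebox R1) n (mvE d N x j)) = av (nm d) (\<lambda>j. Z.exn Abox (zbox d R1) n (mvZ (toZ d N x) j))"
    by (rule av_cong) (use exn_toZ ebox_step[OF xR] in auto)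
  also have "\<dots> \<le> Z.esc Abox (toZ d N x) / (1 - \<delta>)"
    using Z.exn_esc[where C="zbox d R1" and A=Abox and \<delta>=\<delta> and n=n and x="toZ d N x", OF far] \<delta> toZ_Zpts
    by (simp add: pos_le_divide_eq)
  finally show ?thesis using S(2) by (simp add: mult_left_mono)
qed

lemma hit_slice:
  assumes far: "\<And>p n. p \<in> Zpts d \<Longrightarrow> p \<notin> zbox d R1 \<Longrightarrow> 1 - \<delta> \<le> Z.avd Abox n p" and \<delta>: "0 \<le> \<delta>" "\<delta> < 1"
    and x: "x \<in> ebox r" and z: "\<bar>z\<bar> \<le> int N"
  shows "(\<Sum>q\<in>slice d N z - ebox R1. E.hitd (- Wout) n q x)
    \<le> (real d + 1) * (real h + real N) / (1 - \<delta>) * Z.esc Abox (toZ d N x)"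
proof (rule hit_sum_esc[OF far \<delta> _ _ _ x])
  fix p n assume p: "p \<in> ebox (Suc R1)" "p \<in> - Wout"
  \<comment> \<open>A Green function for the height: linear off the slice, and falling by exactly 1
    on it once scaled by \<open>d + 1\<close>, as a vertical step has probability
    \<open>1 / (d + 1)\<close>. It is nonnegative up to height \<open>h\<close> since
    \<open>z\<close> is at most \<open>N\<close> in absolute value.\<close>
  define \<psi> where "\<psi> p = (real d + 1) * (real h + real N - real_of_int \<bar>p ! d - z\<bar>)" for p :: "int list"
  have "E.vis (- Wout) (\<lambda>p. if p \<in> slice d N z - ebox R1 then 1 else 0) n p \<le> \<psi> p"
  proof (rule E.vis_super[where B="{p. \<bar>p ! d\<bar> < int h}"])
    fix p assume p: "p \<in> Epts d N" "p \<in> {p. \<bar>p ! d\<bar> < int h}"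
    have av: "av (nm d) (\<lambda>j. \<psi> (mvE d N p j)) = \<psi> p - (if p ! d = z then 1 else 0)"
    proof -
      define y where "y = real_of_int (p ! d - z)"
      have 1: "\<bar>y + 1\<bar> + \<bar>y - 1\<bar> = 2 * \<bar>y\<bar> + (if p ! d = z then 2 else 0)"
      proof -
        have "p ! d - z \<le> - 1 \<or> p ! d = z \<or> 1 \<le> p ! d - z" by linarith
        then show ?thesis
        proof (elim disjE)
          assume "p ! d - z \<le> - 1"
          then have "y \<le> real_of_int (- 1)" unfolding y_def by (simp only: of_int_le_iff)
          then show ?thesis using \<open>p ! d - z \<le> - 1\<close> by auto
        next
          assume "1 \<le> p ! d - z"
          then have "real_of_int 1 \<le> y" unfolding y_def by (simp only: of_int_le_iff)
          then show ?thesis using \<open>1 \<le> p ! d - z\<close> by auto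
        qed (simp add: y_def)
      qed
      have y: "real_of_int \<bar>p ! d + 1 - z\<bar> = \<bar>y + 1\<bar>" "real_of_int \<bar>p ! d - 1 - z\<bar> = \<bar>y - 1\<bar>" "real_of_int \<bar>p ! d - z\<bar> = \<bar>y\<bar>"
        by (simp_all add: y_def algebra_simps)
      have "av (nm d) (\<lambda>j. \<psi> (mvE d N p j)) = ((real d + 1) * (real h + real N - \<bar>y + 1\<bar>)
          + (real d + 1) * (real h + real N - \<bar>y - 1\<bar>) + 2 * real d * ((real d + 1) * (real h + real N - \<bar>y\<bar>))) / real (nm d)"
        unfolding \<psi>_def av_height_mvE[OF p(1), of "\<lambda>v. (real d + 1) * (real h + real N - real_of_int \<bar>v - z\<bar>)"] y ..
      also have "\<dots> = (2 * (real h + real N) - (\<bar>y + 1\<bar> + \<bar>y - 1\<bar>) + 2 * real d * (real h + real N - \<bar>y\<bar>)) / 2"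
        by (simp add: nm_def field_simps)
      also have "\<dots> = (real d + 1) * (real h + real N - \<bar>y\<bar>) - (if p ! d = z then 1 else 0)"
        unfolding 1 by (auto simp: field_simps)
      finally show ?thesis by (simp add: \<psi>_def y_def)
    qed
    show "(if p \<in> slice d N z - ebox R1 then 1 else 0) + av (nm d) (\<lambda>j. \<psi> (mvE d N p j)) \<le> \<psi> p"
      unfolding av by (auto simp: slice_def)
    fix j assume j: "j < nm d"
    show "0 \<le> \<psi> (mvE d N p j)"
      using height_mvE_le[OF p(1) j] p(2) z unfolding \<psi>_def by (intro mult_nonneg_nonneg) auto
  qed (use p in \<open>auto simp: Wout_def ebox_def\<close>)
  also have "\<psi> p \<le> (real d + 1) * (real h + real N)" unfolding \<psi>_def by (intro mult_left_mono) auto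
  finally show "E.vis (- Wout) (\<lambda>p. if p \<in> slice d N z - ebox R1 then 1 else 0) n p \<le> (real d + 1) * (real h + real N)" .
qed (use finite_slice[of d N z] in \<open>auto simp: slice_def\<close>)

lemma dens_bound:
  assumes z: "(real N) ^ d - (2 * real R1 + 1) ^ d > 0"
  shows "slice d N z - ebox R1 \<noteq> {}" "real (card (slice d N z - ebox R1)) \<ge> real N ^ d - (2 * real R1 + 1) ^ d"
proof -
  let ?L = "{ys. set ys \<subseteq> {- int R1..int R1} \<and> length ys = d}"
  have "inj_on (\<lambda>p. butlast (toZ d N p)) (slice d N z \<inter> ebox R1)"
  proof (rule inj_onI)
    fix p q assume p: "p \<in> slice d N z \<inter> ebox R1" "q \<in> slice d N z \<inter> ebox R1"
      and e: "butlast (toZ d N p) = butlast (toZ d N q)"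
    have "toZ d N p = toZ d N q"
    proof (rule nth_equalityI)
      show "length (toZ d N p) = length (toZ d N q)" by (simp add: length_toZ)
      fix i assume "i < length (toZ d N p)"
      then have i: "i \<le> d" by (simp add: length_toZ)
      show "toZ d N p ! i = toZ d N q ! i"
      proof (cases "i = d")
        case True then show ?thesis using p by (simp add: toZ_nth slice_def)
      next
        case False
        then have "butlast (toZ d N p) ! i = toZ d N p ! i" "butlast (toZ d N q) ! i = toZ d N q ! i"
          using i by (simp_all add: nth_butlast length_toZ)
        then show ?thesis using e by simp
      qed
    qed
    then show "p = q" using inj_onD[OF inj_on_toZ] p by (auto simp: slice_def)
  qed
  note inj = this
  have sub: "(\<lambda>p. butlast (toZ d N p)) ` (slice d N z \<inter> ebox R1) \<subseteq> ?L"
  proof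
    fix y assume "y \<in> (\<lambda>p. butlast (toZ d N p)) ` (slice d N z \<inter> ebox R1)"
    then obtain p where p: "p \<in> ebox R1" "y = butlast (toZ d N p)" by blast
    have l: "length y = d" using p by (simp add: length_toZ)
    have "y ! i \<in> {- int R1..int R1}" if "i < d" for i
    proof -
      have "\<bar>toZ d N p ! i\<bar> \<le> int R1" using p(1) that by (simp add: ebox_def zbox_def)
      moreover have "y ! i = toZ d N p ! i" using that by (simp add: p(2) nth_butlast length_toZ)
      ultimately show ?thesis by (simp add: abs_le_iff)
    qed
    then have "set y \<subseteq> {- int R1..int R1}" unfolding subset_iff in_set_conv_nth l by blast
    then show "y \<in> ?L" using l by simp
  qed
  have L: "finite ?L" "card ?L = (2 * R1 + 1) ^ d"
  proof -
    have c: "card {- int R1..int R1} = 2 * R1 + 1" by simp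
    show "finite ?L" by (rule finite_lists_length_eq) simp
    show "card ?L = (2 * R1 + 1) ^ d" using card_lists_length_eq[of "{- int R1..int R1}" d] unfolding c by simp
  qed
  have "card (slice d N z \<inter> ebox R1) \<le> (2 * R1 + 1) ^ d" using card_inj_on_le[OF inj sub L(1)] unfolding L(2) .
  then have "real (card (slice d N z \<inter> ebox R1)) \<le> real ((2 * R1 + 1) ^ d)" by (simp only: of_nat_le_iff)
  then have le: "real (card (slice d N z \<inter> ebox R1)) \<le> (2 * real R1 + 1) ^ d" by (simp add: add.commute)
  have "card (slice d N z) = card (slice d N z \<inter> ebox R1) + card (slice d N z - ebox R1)"
    using finite_slice[of d N z] by (rule card_Int_Diff)
  then have "real N ^ d = real (card (slice d N z \<inter> ebox R1)) + real (card (slice d N z - ebox R1))"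
    unfolding card_slice by (metis of_nat_add of_nat_power)
  then show c: "real (card (slice d N z - ebox R1)) \<ge> real N ^ d - (2 * real R1 + 1) ^ d"
    using le by linarith
  show "slice d N z - ebox R1 \<noteq> {}"
  proof
    assume "slice d N z - ebox R1 = {}"
    then show False using c z by (simp only: card.empty of_nat_0)
  qed
qed

text \<open>In the chart some coordinate of \<open>c\<close> exceeds a quarter of \<open>N\<close>,
  while those of \<open>p\<close> stay within a sixteenth. On a circle the difference thus spans an
  angle between \<open>3 * pi / 8\<close> and \<open>9 * pi / 8\<close>, whose cosine is at most
  1/2; vertically the plain square suffices.\<close>

lemma ccq_far:
  assumes p: "p \<in> ebox (Suc R1)" and c: "c \<in> Epts d N" "c \<notin> ebox (N div 4)"
  shows "(real N)\<^sup>2 / 64 \<le> ccq d N c p"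
proof -
  obtain i where i: "i \<le> d" "int (N div 4) < \<bar>toZ d N c ! i\<bar>"
    using c by (auto simp: ebox_def zbox_def length_toZ not_le)
  have "int N < 4 * \<bar>toZ d N c ! i\<bar>" using i(2) by linarith
  then have c1: "real N \<le> 4 * real_of_int \<bar>toZ d N c ! i\<bar>" by linarith
  have "\<bar>toZ d N p ! i\<bar> \<le> int (Suc R1)" using p i by (auto simp: ebox_def zbox_def)
  moreover have "16 * int (Suc R1) \<le> int N" using zle_int[of "16 * (R1 + 1)" N] RN by simp
  ultimately have "16 * \<bar>toZ d N p ! i\<bar> \<le> int N" by (smt (verit))
  then have p1: "16 * real_of_int \<bar>toZ d N p ! i\<bar> \<le> real N" by linarith
  define t where "t = toZ d N p ! i - toZ d N c ! i"
  have t: "3 * real N \<le> 16 * \<bar>real_of_int t\<bar>"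
    using c1 p1 abs_triangle_ineq2_sym[of "real_of_int (toZ d N c ! i)" "real_of_int (toZ d N p ! i)"]
    unfolding t_def of_int_diff of_int_abs by argo
  have "(real N)\<^sup>2 / 64 \<le> csq d N c i (p ! i)"
  proof (cases "i < d")
    case False
    then have "csq d N c i (p ! i) = (real_of_int t)\<^sup>2" using i by (simp add: csq_def t_def toZ_nth)
    moreover have "(real N / 8)\<^sup>2 \<le> (\<bar>real_of_int t\<bar>)\<^sup>2" by (rule power_mono) (use t in auto)
    ultimately show ?thesis by (simp add: power_divide)
  next
    case True
    let ?w = "2 * pi / real N"
    have tzc: "\<bar>tz N (c ! i)\<bar> * 2 \<le> int N"
      using c(1) True by (auto simp: tz_def Epts_def)
    have teq: "t = tz N (p ! i) - tz N (c ! i)" using True by (simp add: t_def toZ_nth)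
    have t2: "16 * \<bar>real_of_int t\<bar> \<le> 9 * real N"
    proof -
      have "16 * real_of_int \<bar>tz N (p ! i)\<bar> \<le> real N" using p1 True by (simp add: toZ_nth)
      moreover have "2 * real_of_int \<bar>tz N (c ! i)\<bar> \<le> real N" using tzc by linarith
      ultimately show ?thesis
        using abs_triangle_ineq4[of "real_of_int (tz N (p ! i))" "real_of_int (tz N (c ! i))"]
        unfolding teq of_int_diff of_int_abs by argo
    qed
    obtain k1 k2 :: int where "tz N (p ! i) = p ! i + k1 * int N" "tz N (c ! i) = c ! i + k2 * int N"
      by (rule that[of "if int N < 2 * p ! i then - 1 else 0" "if int N < 2 * c ! i then - 1 else 0"]) (simp_all add: tz_def)
    then have k: "t = p ! i - c ! i + (k1 - k2) * int N" unfolding teq by (simp add: algebra_simps)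
    have "?w * real_of_int t = ?w * real_of_int (p ! i - c ! i) + 2 * pi * real_of_int (k1 - k2)"
      using N unfolding k by (simp add: field_simps)
    then have e: "?w * real_of_int t = ?w * real_of_int (p ! i - c ! i) + real_of_int (k1 - k2) * (2 * of_real pi)" by simp
    have "cos (?w * real_of_int (p ! i - c ! i)) = cos (?w * real_of_int t)"
      unfolding e by (rule cos.plus_of_int[symmetric])
    also have "\<dots> = cos (?w * \<bar>real_of_int t\<bar>)"
      by (cases "t < 0") simp_all
    finally have cos: "cos (?w * real_of_int (p ! i - c ! i)) = cos (?w * \<bar>real_of_int t\<bar>)" .
    define \<theta> where "\<theta> = ?w * \<bar>real_of_int t\<bar>"
    have \<theta>: "3 * pi / 8 \<le> \<theta>" "\<theta> \<le> 9 * pi / 8"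
      using t t2 N pi_gt_zero unfolding \<theta>_def by (simp_all add: field_simps)
    have "cos \<theta> \<le> 1 / 2"
    proof (cases "\<theta> \<le> pi")
      case True
      have "cos \<theta> \<le> cos (pi / 3)" by (rule cos_monotone_0_pi_le) (use \<theta> True pi_gt_zero in auto)
      then show ?thesis by (simp add: cos_60)
    next
      case False
      have "0 \<le> cos (\<theta> - pi)" by (rule cos_ge_zero) (use \<theta> False pi_gt_zero in auto)
      then show ?thesis by (simp add: cos_diff)
    qed
    then have "2 / ?w\<^sup>2 * (1 / 2) \<le> 2 / ?w\<^sup>2 * (1 - cos \<theta>)" by (intro mult_left_mono) auto
    then have "2 / ?w\<^sup>2 * (1 / 2) \<le> csq d N c i (p ! i)"
      using True unfolding csq_def tsq_def cos \<theta>_def by simp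
    moreover have "2 / ?w\<^sup>2 * (1 / 2) = (real N)\<^sup>2 / (4 * pi\<^sup>2)" by (simp add: power_divide power_mult_distrib)
    moreover have "(real N)\<^sup>2 / 64 \<le> (real N)\<^sup>2 / (4 * pi\<^sup>2)"
    proof (rule divide_left_mono)
      have "pi\<^sup>2 \<le> 4\<^sup>2" by (rule power_mono) (use pi_less_4 in auto)
      then show "4 * pi\<^sup>2 \<le> 64" by simp
    qed auto
    ultimately show ?thesis by linarith
  qed
  also have "\<dots> \<le> ccq d N c p" unfolding ccq_def
    by (rule member_le_sum[where f="\<lambda>i. csq d N c i (p ! i)"]) (use i in \<open>auto intro: csq_nonneg\<close>)
  finally show ?thesis .
qed

lemma hit_point:
  assumes far: "\<And>p n. p \<in> Zpts d \<Longrightarrow> p \<notin> zbox d R1 \<Longrightarrow> 1 - \<delta> \<le> Z.avd Abox n p" and \<delta>: "0 \<le> \<delta>" "\<delta> < 1"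
    and green: "\<And>p c n. p \<in> Epts d N \<Longrightarrow> c \<in> Epts d N \<Longrightarrow> \<bar>p ! d\<bar> < int h \<Longrightarrow> (real N)\<^sup>2 / 64 \<le> ccq d N c p \<Longrightarrow>
       E.vis (- Wout) (\<lambda>p. if p = c then 1 else 0) n p \<le> S" "0 \<le> S"
    and p: "p \<in> Epts d N" "p \<notin> ebox (N div 4)" and x: "x \<in> ebox r"
  shows "E.hitd (- Wout) n p x \<le> S / (1 - \<delta>) * Z.esc Abox (toZ d N x)"
proof -
  have "(\<Sum>q\<in>{p}. E.hitd (- Wout) n q x) \<le> S / (1 - \<delta>) * Z.esc Abox (toZ d N x)"
  proof (rule hit_sum_esc[OF far \<delta> _ _ _ x])
    have "R1 \<le> N div 4" using RN by simp
    then show "{p} \<inter> ebox R1 = {}" using p(2) ebox_mono by auto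
    fix q n assume q: "q \<in> ebox (Suc R1)" "q \<in> - Wout"
    then have "E.vis (- Wout) (\<lambda>q. if q = p then 1 else 0) n q \<le> S"
      using green(1)[OF _ p(1) _ ccq_far[OF q(1) p]] by (auto simp: Wout_def ebox_def)
    then show "E.vis (- Wout) (\<lambda>q. if q \<in> {p} then 1 else 0) n q \<le> S" by simp
  qed (use p green in auto)
  then show ?thesis by simp
qed

end

lemma one_minus_exp_ge:
  fixes y :: real
  assumes "0 \<le> y" "y \<le> \<delta>" shows "y / (1 + \<delta>) \<le> 1 - exp (- y)"
proof -
  have "y / (1 + \<delta>) \<le> y / (1 + y)" using assms by (intro divide_left_mono) auto
  also have "\<dots> = 1 - 1 / (1 + y)" using assms by (simp add: field_simps)
  also have "\<dots> \<le> 1 - 1 / exp y"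
    using assms exp_ge_add_one_self[of y] by (intro diff_left_mono divide_left_mono) (auto simp: add.commute)
  finally show ?thesis by (simp add: exp_minus inverse_eq_divide)
qed

text \<open>Of the two factors \<open>1 + \<delta>\<close> in the level, one is the finite-horizon
  loss of the entrance comparison and the other covers the gap between \<open>y\<close> and
  \<open>1 - exp (- y)\<close> for small \<open>y\<close>.\<close>

lemma capacity_condition:
  fixes u c :: real
  assumes "0 \<le> u" "0 \<le> c" "0 < \<delta>" "(1 + \<delta>)\<^sup>2 * u * c \<le> \<delta>"
  shows "u * (1 + \<delta>) * c \<le> 1 - exp (- ((1 + \<delta>)\<^sup>2 * u) * c)"
  using one_minus_exp_ge[of "(1 + \<delta>)\<^sup>2 * u * c" \<delta>] assms by (simp add: power2_eq_square mult_ac)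

context cylinder
begin

interpretation Z: rwalk "Zpts d" mvZ "nm d" flip by (rule rwalk_Z)
interpretation E: rwalk "Epts d N" "mvE d N" "nm d" flip by (rule rwalk_E[OF N])

text \<open>Instance of \<open>cylinder_est\<close> with levels
  \<open>(1 + \<delta>)\<^sup>2\<close> times the densities and with \<open>\<rho>\<close> larger
  than the uniform density by the factor \<open>1 + \<delta>\<close>, which absorbs both the mixing
  error and the removal of the intermediate box.\<close>

lemma domination:
  assumes \<delta>: "0 < \<delta>" "\<delta> < 1"
    and a: "2 \<le> a" "0 < b" and super: "\<And>p. p \<in> Zpts d \<Longrightarrow>
      av (nm d) (\<lambda>j. (a + nsq d (mvZ p j)) powr (- b)) \<le> (a + nsq d p) powr (- b)"
    and ratio: "((a + (real d + 1) * (real r)\<^sup>2) / (a + (real R1)\<^sup>2)) powr b \<le> \<delta>"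
      "((a + (real d + 1) * (real R1)\<^sup>2) / (a + (real N)\<^sup>2 / 4)) powr b \<le> 1 / 2"
    and green: "\<And>p c n. p \<in> Epts d N \<Longrightarrow> c \<in> Epts d N \<Longrightarrow> \<bar>p ! d\<bar> < int h \<Longrightarrow> (real N)\<^sup>2 / 64 \<le> ccq d N c p \<Longrightarrow>
       E.vis (- Wout) (\<lambda>p. if p = c then 1 else 0) n p \<le> G" "0 < G"
    and mix: "1 / real N ^ d + real N ^ d / 2 ^ ((h - N) div (4 * d * N)) \<le> (1 + \<delta>) / real N ^ d"
    and dens: "real N ^ d / (1 + \<delta>) \<le> real N ^ d - (2 * real R1 + 1) ^ d"
    and u: "u1 = (1 + \<delta>) / real N ^ d * ((real d + 1) * (real h + real N) / (1 - \<delta>))"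
      "u2 = G / (1 - \<delta>)" "u3 = 4 * real N * (real d + 1) / real N ^ d"
    and small: "(1 + \<delta>)\<^sup>2 * u1 * Z.ecap Abox \<le> \<delta>" "(1 + \<delta>)\<^sup>2 * u2 * Z.ecap Abox \<le> \<delta>"
      "(1 + \<delta>)\<^sup>2 * u3 * Z.ecap (zbox d R1) \<le> \<delta>" "u2 * Z.ecap Abox \<le> 1 / 4"
    and v: "(1 + \<delta>)\<^sup>2 * (u3 + real (Suc k) * u1 + real j * u2) \<le> v"
  shows "sdom (5 * ((1 + 4 * (u1 * Z.ecap Abox)) ^ Suc k / 2 ^ j))
    (bind_pmf (pmf_of_set (slice d N z)) (law n False (Suc k))) (Z.poi Abox v)"
proof -
  have Nd: "0 < real N ^ d" using N by simp
  define S1 where "S1 = (real d + 1) * (real h + real N) / (1 - \<delta>)"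
  have S1: "0 < S1" using N \<delta> unfolding S1_def by (intro divide_pos_pos mult_pos_pos) auto
  have u_pos: "0 < u1" "0 < u2" "0 < u3" using S1 \<delta> Nd N green(2) unfolding u S1_def[symmetric] by (auto intro!: divide_pos_pos mult_pos_pos)
  have far: "1 - \<delta> \<le> Z.avd Abox n p" if "p \<in> Zpts d" "p \<notin> zbox d R1" for p n
    unfolding Abox_def by (rule avoid_far[OF a super ratio(1) that])
  have sq: "0 < (1 + \<delta>)\<^sup>2" "0 \<le> (1 + \<delta>) / real N ^ d" using \<delta> by simp_all
  note caps = small(1-3)[THEN capacity_condition[rotated 3]]
  have c: "u1 * (1 + \<delta>) * Z.ecap Abox \<le> 1 - exp (- ((1 + \<delta>)\<^sup>2 * u1) * Z.ecap Abox)"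
    "u2 * (1 + \<delta>) * Z.ecap Abox \<le> 1 - exp (- ((1 + \<delta>)\<^sup>2 * u2) * Z.ecap Abox)"
    "u3 * (1 + \<delta>) * Z.ecap (zbox d R1) \<le> 1 - exp (- ((1 + \<delta>)\<^sup>2 * u3) * Z.ecap (zbox d R1))"
    by (rule caps; use u_pos \<delta> Z.ecap_nonneg in simp)+
  have u1S: "u1 = (1 + \<delta>) / real N ^ d * S1" by (simp add: u(1) S1_def)
  interpret cylinder_est d N h r R1 u1 u2 u3 "(1 + \<delta>)\<^sup>2 * u1" "(1 + \<delta>)\<^sup>2 * u2" "(1 + \<delta>)\<^sup>2 * u3" \<delta> "(1 + \<delta>) / real N ^ d" S1
  proof unfold_locales
    fix n p q assume p: "p \<in> Epts d N" "\<bar>p ! d\<bar> = int h" and q: "q \<in> Epts d N" "\<bar>q ! d\<bar> = int N"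
    have "E.hitd (far d N) n p q \<le> 1 / real N ^ d + real N ^ d / 2 ^ ((nat \<bar>p ! d\<bar> - N) div (4 * d * N))"
      by (rule mixing[OF N d1 q p(1)]) (use p Nh in simp)
    then show "E.hitd (far d N) n p q \<le> (1 + \<delta>) / real N ^ d" using mix p(2) by simp
  next
    fix n x z assume x: "x \<in> ebox r" "\<bar>z\<bar> \<le> int N"
    show "(\<Sum>q\<in>slice d N z - ebox R1. E.hitd (- Wout) n q x) \<le> S1 * Z.esc Abox (toZ d N x)"
      unfolding S1_def by (rule hit_slice[OF far _ _ x]) (use \<delta> in auto)
  next
    fix n p x assume p: "p \<in> Epts d N" "\<bar>p ! d\<bar> < int h" "p \<notin> ebox (N div 4)" and x: "x \<in> ebox r"
    show "E.hitd (- Wout) n p x \<le> u2 * Z.esc Abox (toZ d N x)"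
      unfolding u by (rule hit_point[OF far _ _ green(1) _ p(1,3) x]) (use \<delta> green(2) in auto)
  next
    fix q z assume q: "q \<in> zbox d R1" "q ! d = z"
    define c where "c = (a + (real d + 1) * (real R1)\<^sup>2) powr (- b)"
    have aR: "0 < a + (real d + 1) * (real R1)\<^sup>2" "0 < a + (real N)\<^sup>2 / 4" by (rule add_pos_nonneg, use a in auto)+
    have "1 / (4 * real N * (real d + 1)) \<le> Z.esc {q \<in> zbox d R1. q ! d = z} q"
    proof (rule esc_disc[where F="\<lambda>p. (a + nsq d p) powr (- b)" and c=c and s=z, OF super])
      show "0 < c" unfolding c_def using aR by simp
      fix p assume "p \<in> {q \<in> zbox d R1. q ! d = z}"
      then show "c \<le> (a + nsq d p) powr (- b)" unfolding c_def
        by (intro powr_mono2') (use a nsq_le_zbox[of p d R1] nsq_nonneg[of d p] in auto)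
    next
      fix p assume p: "p \<in> Zpts d" "int N \<le> \<bar>p ! d - z\<bar>"
      have "\<bar>z\<bar> \<le> int R1" using q by (auto simp: zbox_def)
      moreover have "16 * int (Suc R1) \<le> int N" using zle_int[of "16 * (R1 + 1)" N] RN by simp
      moreover have "int (Suc R1) = int R1 + 1" "0 \<le> int R1" by simp_all
      ultimately have "int N \<le> 2 * \<bar>p ! d\<bar>" using p(2) by (smt (verit))
      then have "real N / 2 \<le> real_of_int \<bar>p ! d\<bar>" by linarith
      then have "(real N / 2)\<^sup>2 \<le> (real_of_int \<bar>p ! d\<bar>)\<^sup>2" by (rule power_mono) simp
      then have "(real N)\<^sup>2 / 4 \<le> nsq d p" using nsq_ge[of d d p] by (simp add: power_divide)
      then have "(a + nsq d p) powr (- b) \<le> (a + (real N)\<^sup>2 / 4) powr (- b)"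
        by (intro powr_mono2') (use a aR in auto)
      also have "\<dots> = c * ((a + (real d + 1) * (real R1)\<^sup>2) / (a + (real N)\<^sup>2 / 4)) powr b"
        unfolding c_def by (rule powr_minus_ratio[OF aR])
      also have "\<dots> \<le> c * (1 / 2)" by (rule mult_left_mono[OF ratio(2)]) (simp add: c_def)
      finally show "(a + nsq d p) powr (- b) \<le> c / 2" by simp
    qed (use N q zbox_Zpts in auto)
    then have "u3 * (1 / (4 * real N * (real d + 1))) \<le> u3 * Z.esc {q \<in> zbox d R1. q ! d = z} q"
      by (intro mult_left_mono) (use u_pos in auto)
    moreover have "u3 * (1 / (4 * real N * (real d + 1))) = 1 / real N ^ d" using N unfolding u by simp
    ultimately show "1 / real N ^ d \<le> u3 * Z.esc {q \<in> zbox d R1. q ! d = z} q" by simp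
  next
    fix z
    have pos: "0 < real N ^ d - (2 * real R1 + 1) ^ d" using dens Nd \<delta> by (smt (verit) divide_pos_pos)
    have "1 / real (card (slice d N z - ebox R1)) \<le> 1 / (real N ^ d / (1 + \<delta>))"
      using dens_bound(2)[OF pos, of z] dens Nd \<delta> by (intro divide_left_mono) (auto intro!: mult_pos_pos divide_pos_pos dest: less_le_trans[OF pos])
    then show "slice d N z - ebox R1 \<noteq> {} \<and> 1 / real (card (slice d N z - ebox R1)) \<le> (1 + \<delta>) / real N ^ d"
      using dens_bound(1)[OF pos, of z] by simp
  next
    show "1 / real N ^ d \<le> (1 + \<delta>) / real N ^ d" using Nd \<delta> by (simp add: divide_right_mono)
  qed (fact u1S c small(4) | use \<delta> u_pos sq S1 in \<open>simp add: mult_pos_pos less_imp_le\<close>)+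
  show ?thesis using start_sdom[of k j v z n] v by (simp add: B_def algebra_simps)
qed

end

section \<open>Choice of the parameters for large \<open>N\<close>\<close>

lemma hN_bounds:
  assumes "1 \<le> N"
  shows "real (hN N) \<le> real N * (2 + (ln (real N))\<^sup>2)" "real N * (2 + (ln (real N))\<^sup>2) - 1 \<le> real (hN N)" "2 * N \<le> hN N"
proof -
  let ?y = "real N * (2 + (ln (real N))\<^sup>2)"
  have y: "0 \<le> ?y" by simp
  show "real (hN N) \<le> ?y" unfolding hN_def using y by linarith
  show "?y - 1 \<le> real (hN N)" unfolding hN_def using y by linarith
  have "real N * 2 \<le> ?y" by (intro mult_left_mono) auto
  then have "int (2 * N) \<le> \<lfloor>?y\<rfloor>" by (simp add: le_floor_iff mult.commute)
  then show "2 * N \<le> hN N" unfolding hN_def by linarith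
qed

lemma nat_floor_bounds:
  assumes "0 \<le> t" shows "real (nat \<lfloor>t\<rfloor>) \<le> t" "t - 1 \<le> real (nat \<lfloor>t\<rfloor>)"
  using assms by linarith+

lemma tendsto_0_le: "(f \<longlongrightarrow> (0::real)) F \<Longrightarrow> 0 < c \<Longrightarrow> \<forall>\<^sub>F x in F. f x \<le> c"
  by (drule order_tendstoD(2)[where a=c]) (auto elim: eventually_mono)

lemma eventually_boxes:
  fixes \<delta> \<epsilon> a b d :: real
  assumes "0 < \<epsilon>" "\<epsilon> < 1" "0 < \<delta>" "0 < a" "0 < b" "0 < d"
  shows "\<forall>\<^sub>F x in at_top. 16 * (x powr (1 - \<epsilon> / 2) + 1) \<le> x"
    "\<forall>\<^sub>F x in at_top. ((a + (d + 1) * (x powr (1 - \<epsilon>))\<^sup>2) / (a + (x powr (1 - \<epsilon> / 2) - 1)\<^sup>2)) powr b \<le> \<delta>"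
    "\<forall>\<^sub>F x in at_top. ((a + (d + 1) * (x powr (1 - \<epsilon> / 2))\<^sup>2) / (a + x\<^sup>2 / 4)) powr b \<le> 1 / 2"
    "\<forall>\<^sub>F x in at_top. x powr (2 * d) * 2 powr (1 - (ln x)\<^sup>2 / (4 * d)) \<le> \<delta>"
    "\<forall>\<^sub>F x in at_top. (2 * x powr (1 - \<epsilon> / 2) + 1) / x \<le> \<delta> / (1 + \<delta>)"
proof -
  have d1: "0 < d + 1" and d2: "0 < \<delta> / (1 + \<delta>)" and half: "0 < 1 / (2 :: real)" using assms by simp_all
  show "\<forall>\<^sub>F x in at_top. 16 * (x powr (1 - \<epsilon> / 2) + 1) \<le> x"
    using assms by real_asymp
  show "\<forall>\<^sub>F x in at_top. ((a + (d + 1) * (x powr (1 - \<epsilon>))\<^sup>2) / (a + (x powr (1 - \<epsilon> / 2) - 1)\<^sup>2)) powr b \<le> \<delta>"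
    by (rule tendsto_0_le[OF _ assms(3)]) (use assms d1 in real_asymp)
  show "\<forall>\<^sub>F x in at_top. ((a + (d + 1) * (x powr (1 - \<epsilon> / 2))\<^sup>2) / (a + x\<^sup>2 / 4)) powr b \<le> 1 / 2"
    by (rule tendsto_0_le[OF _ half]) (use assms d1 in real_asymp)
  show "\<forall>\<^sub>F x in at_top. x powr (2 * d) * 2 powr (1 - (ln x)\<^sup>2 / (4 * d)) \<le> \<delta>"
    by (rule tendsto_0_le[OF _ assms(3)]) (use assms in real_asymp)
  show "\<forall>\<^sub>F x in at_top. (2 * x powr (1 - \<epsilon> / 2) + 1) / x \<le> \<delta> / (1 + \<delta>)"
    by (rule tendsto_0_le[OF _ d2]) (use assms in real_asymp)
qed

lemma eventually_budgets:
  fixes \<alpha> \<delta> \<eta> p k :: real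
  assumes "0 < \<alpha>" "0 < \<delta>" "0 < p" "0 < k"
  shows "\<forall>\<^sub>F x in at_top. k * (3 + (ln x)\<^sup>2) * x powr (- p) \<le> \<delta>"
    "\<forall>\<^sub>F x in at_top. k * (1 + (2 + (ln x)\<^sup>2)\<^sup>2) * x powr (- p) \<le> \<delta>"
    "\<forall>\<^sub>F x in at_top. k * x powr (- p) \<le> \<delta>"
    "\<forall>\<^sub>F x in at_top. 1 \<le> \<alpha> * x powr p / (2 + (ln x)\<^sup>2)"
    "\<forall>\<^sub>F x in at_top. 1 / (1 + (ln x)\<^sup>2) \<le> \<delta>"
proof -
  show "\<forall>\<^sub>F x in at_top. k * (3 + (ln x)\<^sup>2) * x powr (- p) \<le> \<delta>"
    by (rule tendsto_0_le[OF _ assms(2)]) (use assms in real_asymp)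
  show "\<forall>\<^sub>F x in at_top. k * (1 + (2 + (ln x)\<^sup>2)\<^sup>2) * x powr (- p) \<le> \<delta>"
    by (rule tendsto_0_le[OF _ assms(2)]) (use assms in real_asymp)
  show "\<forall>\<^sub>F x in at_top. k * x powr (- p) \<le> \<delta>"
    by (rule tendsto_0_le[OF _ assms(2)]) (use assms in real_asymp)
  show "\<forall>\<^sub>F x in at_top. 1 / (1 + (ln x)\<^sup>2) \<le> \<delta>"
    by (rule tendsto_0_le[OF _ assms(2)]) real_asymp
  show "\<forall>\<^sub>F x in at_top. 1 \<le> \<alpha> * x powr p / (2 + (ln x)\<^sup>2)" using assms by real_asymp
qed

text \<open>With \<open>p < q\<close>, the number of affordable returns, of order
  \<open>x powr q\<close> up to logarithms, beats the growth \<open>x powr p\<close> of the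
  logarithm of the error and also the logarithm coming from the target rate.\<close>

lemma eventually_error:
  fixes k k' p q d :: real
  assumes "0 < k" "0 < k'" "0 < p" "p < q" "0 < d"
  shows "\<forall>\<^sub>F x in at_top. k * x powr p - k' * x powr q / (1 + (2 + (ln x)\<^sup>2)\<^sup>2) + 3 * d * ln x + ln 5 + ln 2 \<le> 0"
proof -
  have "LIM x at_top. (k * x powr p - k' * x powr q / (1 + (2 + (ln x)\<^sup>2)\<^sup>2) + 3 * d * ln x + ln 5 + ln 2) :> at_bot"
    using assms by real_asymp
  then show ?thesis unfolding filterlim_at_bot by simp
qed

lemma cap_zbox_powr:
  assumes d: "2 \<le> d" and t: "1 \<le> t"
  shows "cap d (zbox d (nat \<lfloor>t\<rfloor>)) \<le> 17 * (4 * real d + 5) ^ (d + 1) * t powr (real d - 1)"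
proof -
  have r: "1 \<le> nat \<lfloor>t\<rfloor>" "real (nat \<lfloor>t\<rfloor>) \<le> t" using t by linarith+
  have "cap d (zbox d (nat \<lfloor>t\<rfloor>)) \<le> 17 * (4 * real d + 5) ^ (d + 1) * real (nat \<lfloor>t\<rfloor>) ^ (d - 1)"
    by (rule ecap_zbox) (use d r in auto)
  also have "\<dots> \<le> 17 * (4 * real d + 5) ^ (d + 1) * t ^ (d - 1)"
    by (intro mult_left_mono power_mono r) auto
  also have "t ^ (d - 1) = t powr (real d - 1)" using t d by (simp add: powr_realpow[symmetric] of_nat_diff)
  finally show ?thesis .
qed

text \<open>The power is bounded by an exponential, and rounding \<open>s\<close> down costs at most
  a factor 2, which is the summand \<open>ln 2\<close>.\<close>

lemma pow_error:
  fixes y s K :: real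
  assumes "0 \<le> y" "real n * y \<le> K"
  shows "5 * ((1 + 4 * y) ^ n / 2 ^ nat \<lfloor>s\<rfloor>) \<le> exp (4 * K - ln 2 * s + ln 5 + ln 2)"
proof -
  have "(1 + 4 * y) ^ n \<le> exp (4 * y) ^ n" by (rule power_mono) (use assms exp_ge_add_one_self[of "4 * y"] in auto)
  also have "\<dots> = exp (4 * (real n * y))" by (simp add: exp_of_nat_mult[symmetric] mult_ac)
  also have "\<dots> \<le> exp (4 * K)" using assms by simp
  finally have 1: "(1 + 4 * y) ^ n \<le> exp (4 * K)" .
  have "s - 1 \<le> real (nat \<lfloor>s\<rfloor>)" by linarith
  then have "exp (ln 2 * (s - 1)) \<le> exp (ln 2 * real (nat \<lfloor>s\<rfloor>))" by simp
  also have "\<dots> = 2 ^ nat \<lfloor>s\<rfloor>" by (simp add: exp_of_nat_mult mult.commute)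
  finally have 2: "exp (ln 2 * (s - 1)) \<le> 2 ^ nat \<lfloor>s\<rfloor>" .
  have "5 * ((1 + 4 * y) ^ n / 2 ^ nat \<lfloor>s\<rfloor>) \<le> 5 * (exp (4 * K) / exp (ln 2 * (s - 1)))"
    by (intro mult_left_mono frac_le 1 2) (use assms in auto)
  also have "\<dots> = exp (4 * K - ln 2 * s + ln 5 + ln 2)"
    by (simp add: exp_add exp_diff right_diff_distrib)
  finally show ?thesis .
qed

lemma coupling_at_scale:
  fixes d N :: nat and \<alpha> v \<epsilon> \<delta> \<eta> a b C :: real
  defines "D \<equiv> real d - 1" and "L \<equiv> ln (real N)" and "k \<equiv> 17 * (4 * real d + 5) ^ (d + 1)"
  assumes d: "2 \<le> d" and N: "1 \<le> N" and \<epsilon>: "0 < \<epsilon>" "\<epsilon> < 1" and \<delta>: "0 < \<delta>" "\<delta> < 1" and \<alpha>: "0 < \<alpha>" and \<eta>: "0 < \<eta>"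
    and v: "real (d + 1) * \<alpha> * (1 + \<delta>) ^ 4 / (1 - \<delta>) + 2 * \<eta> \<le> v"
    and a: "2 \<le> a" and b: "b = (1 - \<epsilon> / 2) * D / 2"
    and super: "\<And>p. p \<in> Zpts d \<Longrightarrow> av (nm d) (\<lambda>j. (a + nsq d (mvZ p j)) powr (- b)) \<le> (a + nsq d p) powr (- b)"
    and C: "0 < C" and green: "\<And>c p U n. p \<in> Epts d N \<Longrightarrow> c \<in> Epts d N \<Longrightarrow> \<bar>p ! d\<bar> < int (hN N) \<Longrightarrow>
       U \<subseteq> {p. \<bar>p ! d\<bar> < int (hN N)} \<Longrightarrow> (real N)\<^sup>2 / 64 \<le> ccq d N c p \<Longrightarrow>
       rwalk.vis (mvE d N) (nm d) U (\<lambda>p. if p = c then 1 else 0) n p \<le> C * real N powr (- 2 * b) * (1 + (real (hN N) / real N)\<^sup>2)"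
    and boxes: "16 * (real N powr (1 - \<epsilon> / 2) + 1) \<le> real N"
      "((a + (real d + 1) * (real N powr (1 - \<epsilon>))\<^sup>2) / (a + (real N powr (1 - \<epsilon> / 2) - 1)\<^sup>2)) powr b \<le> \<delta>"
      "((a + (real d + 1) * (real N powr (1 - \<epsilon> / 2))\<^sup>2) / (a + (real N)\<^sup>2 / 4)) powr b \<le> 1 / 2"
      "real N powr (2 * real d) * 2 powr (1 - L\<^sup>2 / (4 * real d)) \<le> \<delta>"
      "(2 * real N powr (1 - \<epsilon> / 2) + 1) / real N \<le> \<delta> / (1 + \<delta>)"
    and budgets: "(1 + \<delta>) ^ 3 * (real d + 1) / (1 - \<delta>) * k * (3 + L\<^sup>2) * real N powr (- (\<epsilon> * D)) \<le> \<delta>"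
      "(1 + \<delta>)\<^sup>2 * C / (1 - \<delta>) * k * (1 + (2 + L\<^sup>2)\<^sup>2) * real N powr (- (\<epsilon> / 2 * D)) \<le> min \<delta> (1 / 4)"
      "(1 + \<delta>)\<^sup>2 * 4 * (real d + 1) * k * real N powr (- (\<epsilon> / 2 * D)) \<le> \<delta>"
      "(1 + \<delta>)\<^sup>2 * 4 * (real d + 1) * real N powr (- D) \<le> \<eta>"
      "1 \<le> \<alpha> * real N powr D / (2 + L\<^sup>2)" "1 / (1 + L\<^sup>2) \<le> \<delta>"
    and error: "4 * v * k * real N powr ((1 - \<epsilon>) * D) - ln 2 * \<eta> * (1 - \<delta>) / ((1 + \<delta>)\<^sup>2 * C) * real N powr (2 * b) / (1 + (2 + L\<^sup>2)\<^sup>2)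
        + 3 * real d * L + ln 5 + ln 2 \<le> 0"
    and x: "x \<in> Epts d N"
  shows "\<exists>Q. is_coupling d N v Q \<and>
        measure Q {\<omega> \<in> space Q. \<forall>n. enat n \<le> Dtime d N (x ! d) (nat \<lfloor>\<alpha> * real N ^ d / real (hN N)\<rfloor>) (fst \<omega>) \<longrightarrow>
             subE d N (fst \<omega> n) x \<in> ballE d N (real N powr (1 - \<epsilon>)) \<longrightarrow>
             toZ d N (subE d N (fst \<omega> n) x) \<in> snd \<omega>}
        \<ge> 1 - 2 * real N powr (- 3 * real d)"
proof -
  define h where "h = hN N"
  define r where "r = nat \<lfloor>real N powr (1 - \<epsilon>)\<rfloor>"
  define R1 where "R1 = nat \<lfloor>real N powr (1 - \<epsilon> / 2)\<rfloor>"
  define X where "X = real N"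
  have X: "1 \<le> X" "0 < X" using N by (simp_all add: X_def)
  have D: "1 \<le> D" using d by (simp add: D_def)
  have b0: "0 < b" unfolding b using D \<epsilon> by (intro divide_pos_pos mult_pos_pos) auto
  have h: "real h \<le> X * (2 + L\<^sup>2)" "X * (2 + L\<^sup>2) - 1 \<le> real h" "2 * N \<le> h" using hN_bounds[OF N] by (simp_all add: h_def X_def L_def)
  have h0: "0 < real h" using h(3) N by simp
  have r: "real r \<le> X powr (1 - \<epsilon>)" unfolding r_def X_def by (rule nat_floor_bounds) simp
  have R1: "real R1 \<le> X powr (1 - \<epsilon> / 2)" "X powr (1 - \<epsilon> / 2) - 1 \<le> real R1" unfolding R1_def X_def by (rule nat_floor_bounds, simp)+
  have p1: "1 \<le> X powr (1 - \<epsilon>)" "1 \<le> X powr (1 - \<epsilon> / 2)" using X \<epsilon> by (auto intro: ge_one_powr_ge_zero)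
  have rR: "r \<le> R1" unfolding r_def R1_def using X \<epsilon> by (intro nat_mono floor_mono powr_mono) (auto simp: X_def)
  have RN: "16 * (R1 + 1) \<le> N"
  proof -
    have "16 * (real R1 + 1) \<le> 16 * (real N powr (1 - \<epsilon> / 2) + 1)" using R1(1) by (simp add: X_def)
    also have "\<dots> \<le> real N" by (rule boxes(1))
    finally have "real (16 * (R1 + 1)) \<le> real N" by simp
    then show ?thesis by (simp only: of_nat_le_iff)
  qed
  interpret cylinder d N h r R1 by unfold_locales (use N d h rR RN in auto)
  interpret Z: rwalk "Zpts d" mvZ "nm d" flip by (rule rwalk_Z)
  interpret E: rwalk "Epts d N" "mvE d N" "nm d" flip by (rule rwalk_E[OF N])
  have Xd: "X ^ d = X powr real d" using X by (simp add: powr_realpow)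
  have capA: "Z.ecap Abox \<le> k * X powr ((1 - \<epsilon>) * D)"
    using cap_zbox_powr[OF d p1(1)] unfolding Abox_def unfolding cap_ecap r_def X_def k_def D_def powr_powr .
  have capR: "Z.ecap (zbox d R1) \<le> k * X powr ((1 - \<epsilon> / 2) * D)"
    using cap_zbox_powr[OF d p1(2)] unfolding cap_ecap R1_def X_def k_def D_def powr_powr .
  have ecap0: "0 \<le> Z.ecap S" for S by (rule Z.ecap_nonneg)
  define G where "G = C * X powr (- 2 * b) * (1 + (real h / X)\<^sup>2)"
  define u1 where "u1 = (1 + \<delta>) / real N ^ d * ((real d + 1) * (real h + real N) / (1 - \<delta>))"
  define u2 where "u2 = G / (1 - \<delta>)"
  define u3 where "u3 = 4 * real N * (real d + 1) / real N ^ d"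
  have hX: "real h / X \<le> 2 + L\<^sup>2" using h(1) X by (simp add: divide_le_eq mult.commute)
  have G: "0 < G" unfolding G_def using C X by (intro mult_pos_pos add_pos_nonneg) auto
  have G_le: "G \<le> C * X powr (- 2 * b) * (1 + (2 + L\<^sup>2)\<^sup>2)"
    unfolding G_def using C hX X by (intro mult_left_mono add_left_mono power_mono) auto
  have hNX: "(real h + X) / X ^ d \<le> (3 + L\<^sup>2) * X powr (- D)"
  proof -
    have "(real h + X) / X ^ d \<le> X * (3 + L\<^sup>2) / X ^ d" by (rule divide_right_mono) (use h(1) X in \<open>auto simp: algebra_simps\<close>)
    also have "\<dots> = (3 + L\<^sup>2) * X powr (- D)" using X unfolding Xd D_def by (simp add: powr_diff)
    finally show ?thesis .
  qed
  have u1_eq: "u1 = (1 + \<delta>) * (real d + 1) / (1 - \<delta>) * ((real h + X) / X ^ d)" by (simp add: u1_def X_def mult_ac)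
  have u1_0: "0 \<le> u1" unfolding u1_eq using \<delta> X by (intro mult_nonneg_nonneg divide_nonneg_nonneg) auto
  have u2_0: "0 < u2" unfolding u2_def using \<delta> G by simp
  have u3_eq: "u3 = 4 * (real d + 1) * X powr (- D)" using X unfolding u3_def D_def X_def[symmetric] Xd by (simp add: powr_diff)
  have sq1: "1 \<le> (1 + \<delta>)\<^sup>2" using \<delta> by (simp add: one_le_power)
  have u1_le: "u1 \<le> (1 + \<delta>) * (real d + 1) / (1 - \<delta>) * ((3 + L\<^sup>2) * X powr (- D))"
    unfolding u1_eq by (rule mult_left_mono[OF hNX]) (use \<delta> in auto)
  have u2_le: "u2 \<le> C / (1 - \<delta>) * (1 + (2 + L\<^sup>2)\<^sup>2) * X powr (- 2 * b)"
    unfolding u2_def using divide_right_mono[OF G_le, of "1 - \<delta>"] \<delta> by (simp add: mult_ac)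
  have small1: "(1 + \<delta>)\<^sup>2 * u1 * Z.ecap Abox \<le> \<delta>"
  proof -
    have "(1 + \<delta>)\<^sup>2 * u1 * Z.ecap Abox \<le> (1 + \<delta>)\<^sup>2 * ((1 + \<delta>) * (real d + 1) / (1 - \<delta>) * ((3 + L\<^sup>2) * X powr (- D))) * (k * X powr ((1 - \<epsilon>) * D))"
      by (intro mult_mono mult_left_mono u1_le capA ecap0 mult_nonneg_nonneg u1_0) (use \<delta> in auto)
    also have "\<dots> = (1 + \<delta>) ^ 3 * (real d + 1) / (1 - \<delta>) * k * (3 + L\<^sup>2) * (X powr (- D) * X powr ((1 - \<epsilon>) * D))"
      by (simp add: power3_eq_cube power2_eq_square mult_ac)
    also have "X powr (- D) * X powr ((1 - \<epsilon>) * D) = X powr (- (\<epsilon> * D))" by (simp add: powr_add[symmetric] algebra_simps)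
    also note budgets(1)[folded X_def]
    finally show ?thesis .
  qed
  have small2: "(1 + \<delta>)\<^sup>2 * u2 * Z.ecap Abox \<le> min \<delta> (1 / 4)"
  proof -
    have "(1 + \<delta>)\<^sup>2 * u2 * Z.ecap Abox \<le> (1 + \<delta>)\<^sup>2 * (C / (1 - \<delta>) * (1 + (2 + L\<^sup>2)\<^sup>2) * X powr (- 2 * b)) * (k * X powr ((1 - \<epsilon>) * D))"
      by (intro mult_mono mult_left_mono u2_le capA ecap0 mult_nonneg_nonneg) (use \<delta> C u2_0 in auto)
    also have "\<dots> = (1 + \<delta>)\<^sup>2 * C / (1 - \<delta>) * k * (1 + (2 + L\<^sup>2)\<^sup>2) * (X powr (- 2 * b) * X powr ((1 - \<epsilon>) * D))"
      by (simp add: mult_ac)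
    \<comment> \<open>The choice of \<open>b\<close> enters here: \<open>2 * b\<close> exceeds the
      exponent of the capacity by \<open>\<epsilon> / 2 * D\<close>, so a return to the box is
      rare.\<close>
    also have "X powr (- 2 * b) * X powr ((1 - \<epsilon>) * D) = X powr (- (\<epsilon> / 2 * D))"
    proof -
      have "- 2 * b + (1 - \<epsilon>) * D = - (\<epsilon> / 2 * D)" unfolding b by (simp add: field_simps)
      then show ?thesis by (simp only: powr_add[symmetric])
    qed
    also note budgets(2)[folded X_def]
    finally show ?thesis .
  qed
  have small3: "(1 + \<delta>)\<^sup>2 * u3 * Z.ecap (zbox d R1) \<le> \<delta>"
  proof -
    have "(1 + \<delta>)\<^sup>2 * u3 * Z.ecap (zbox d R1) \<le> (1 + \<delta>)\<^sup>2 * (4 * (real d + 1) * X powr (- D)) * (k * X powr ((1 - \<epsilon> / 2) * D))"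
      unfolding u3_eq by (intro mult_left_mono capR) auto
    also have "\<dots> = (1 + \<delta>)\<^sup>2 * 4 * (real d + 1) * k * (X powr (- D) * X powr ((1 - \<epsilon> / 2) * D))"
      by (simp add: mult_ac)
    also have "X powr (- D) * X powr ((1 - \<epsilon> / 2) * D) = X powr (- (\<epsilon> / 2 * D))" by (simp add: powr_add[symmetric] algebra_simps)
    also note budgets(3)[folded X_def]
    finally show ?thesis .
  qed
  have small4: "u2 * Z.ecap Abox \<le> 1 / 4"
  proof -
    have "1 * (u2 * Z.ecap Abox) \<le> (1 + \<delta>)\<^sup>2 * (u2 * Z.ecap Abox)"
      by (rule mult_right_mono[OF sq1]) (use u2_0 ecap0 in simp)
    then show ?thesis using small2 by (simp only: mult.assoc mult_1 min.bounded_iff) linarith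
  qed
  define K where "K = nat \<lfloor>\<alpha> * X ^ d / real h\<rfloor>"
  \<comment> \<open>The number of further returns that a level \<open>\<eta>\<close> can pay
    for.\<close>
  define j where "j = nat \<lfloor>\<eta> / ((1 + \<delta>)\<^sup>2 * u2)\<rfloor>"
  have K_le: "real K \<le> \<alpha> * X ^ d / real h" unfolding K_def by (rule nat_floor_bounds) (use \<alpha> X h0 in auto)
  have K1: "1 \<le> K"
  proof -
    have "1 \<le> \<alpha> * X powr D / (2 + L\<^sup>2)" using budgets(5) by (simp add: X_def)
    also have "\<dots> = \<alpha> * X ^ d / (X * (2 + L\<^sup>2))" using X unfolding Xd D_def by (simp add: powr_diff)
    also have "\<dots> \<le> \<alpha> * X ^ d / real h" by (rule divide_left_mono[OF h(1)]) (use \<alpha> X h0 in \<open>auto intro!: mult_pos_pos add_pos_nonneg\<close>)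
    finally show ?thesis unfolding K_def by linarith
  qed
  then obtain k' where k': "K = Suc k'" by (cases K) auto
  \<comment> \<open>Of the four factors \<open>1 + \<delta>\<close>, two come from the level, one
    from the entrance density and one from \<open>(h + N) / h\<close>; the denominator comes from
    comparing exit with escape.\<close>
  have Ku1: "(1 + \<delta>)\<^sup>2 * (real K * u1) \<le> real (d + 1) * \<alpha> * (1 + \<delta>) ^ 4 / (1 - \<delta>)"
  proof -
    have "X * (1 + L\<^sup>2) \<le> real h" using h(2) X by (simp add: algebra_simps)
    then have "X / real h \<le> X / (X * (1 + L\<^sup>2))" by (intro divide_left_mono) (use X h0 in \<open>auto intro!: mult_pos_pos add_pos_nonneg\<close>)
    also have "\<dots> = 1 / (1 + L\<^sup>2)" using X by simp
    also have "\<dots> \<le> \<delta>" by (rule budgets(6))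
    finally have hr: "(real h + X) / real h \<le> 1 + \<delta>" using h0 by (simp add: add_divide_distrib)
    have "real K * u1 \<le> \<alpha> * X ^ d / real h * u1" by (rule mult_right_mono[OF K_le u1_0])
    also have "\<dots> = \<alpha> * (1 + \<delta>) * (real d + 1) / (1 - \<delta>) * ((real h + X) / real h)"
      unfolding u1_eq using X by (simp add: mult_ac)
    also have "\<dots> \<le> \<alpha> * (1 + \<delta>) * (real d + 1) / (1 - \<delta>) * (1 + \<delta>)" by (rule mult_left_mono[OF hr]) (use \<alpha> \<delta> in auto)
    finally have "(1 + \<delta>)\<^sup>2 * (real K * u1) \<le> (1 + \<delta>)\<^sup>2 * (\<alpha> * (1 + \<delta>) * (real d + 1) / (1 - \<delta>) * (1 + \<delta>))"
      by (rule mult_left_mono) simp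
    also have "\<dots> = real (d + 1) * \<alpha> * (1 + \<delta>) ^ 4 / (1 - \<delta>)"
      by (simp add: power2_eq_square power4_eq_xxxx mult_ac)
    finally show ?thesis .
  qed
  have ju2: "(1 + \<delta>)\<^sup>2 * (real j * u2) \<le> \<eta>"
  proof -
    have pos: "0 < (1 + \<delta>)\<^sup>2 * u2" by (rule mult_pos_pos[OF less_le_trans[OF zero_less_one sq1] u2_0])
    have "real j \<le> \<eta> / ((1 + \<delta>)\<^sup>2 * u2)" unfolding j_def by (rule nat_floor_bounds) (use \<eta> pos in simp)
    then show ?thesis using pos by (simp add: pos_le_divide_eq mult_ac)
  qed
  have budget: "(1 + \<delta>)\<^sup>2 * (u3 + real (Suc k') * u1 + real j * u2) \<le> v"
  proof -
    have "(1 + \<delta>)\<^sup>2 * u3 \<le> \<eta>" using budgets(4) unfolding u3_eq X_def by (simp add: mult.assoc)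
    then show ?thesis using Ku1 ju2 v unfolding k' distrib_left by linarith
  qed
  define e where "e = X powr (- 3 * real d)"
  have v0: "0 \<le> v"
  proof -
    have "0 \<le> real (d + 1) * \<alpha> * (1 + \<delta>) ^ 4 / (1 - \<delta>)" using \<alpha> \<delta> by (intro divide_nonneg_nonneg mult_nonneg_nonneg) auto
    then show ?thesis using v \<eta> by linarith
  qed
  have err: "5 * ((1 + 4 * (u1 * Z.ecap Abox)) ^ Suc k' / 2 ^ j) \<le> e"
  proof -
    have "real K * u1 \<le> v"
    proof -
      have "real K * u1 \<le> (1 + \<delta>)\<^sup>2 * (real K * u1)" using mult_right_mono[OF sq1, of "real K * u1"] u1_0 by simp
      then show ?thesis using Ku1 v \<eta> by linarith
    qed
    then have "real K * (u1 * Z.ecap Abox) \<le> v * (k * X powr ((1 - \<epsilon>) * D))"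
      unfolding mult.assoc[symmetric, of "real K"] by (rule mult_mono[OF _ capA v0 ecap0])
    then have "5 * ((1 + 4 * (u1 * Z.ecap Abox)) ^ K / 2 ^ j)
      \<le> exp (4 * (v * (k * X powr ((1 - \<epsilon>) * D))) - ln 2 * (\<eta> / ((1 + \<delta>)\<^sup>2 * u2)) + ln 5 + ln 2)"
      unfolding j_def by (rule pow_error[rotated]) (use u1_0 ecap0 in simp)
    also have "\<dots> \<le> exp (- 3 * real d * L)"
    proof -
      have "\<eta> * (1 - \<delta>) / ((1 + \<delta>)\<^sup>2 * C) * X powr (2 * b) / (1 + (2 + L\<^sup>2)\<^sup>2)
          = \<eta> / ((1 + \<delta>)\<^sup>2 * (C / (1 - \<delta>) * (1 + (2 + L\<^sup>2)\<^sup>2) * X powr (- 2 * b)))"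
        using \<delta> C X by (simp add: powr_minus field_simps)
      also have "\<dots> \<le> \<eta> / ((1 + \<delta>)\<^sup>2 * u2)"
        by (intro divide_left_mono mult_left_mono u2_le mult_pos_pos) (use \<eta> \<delta> C X u2_0 in \<open>auto intro!: mult_pos_pos divide_pos_pos add_pos_nonneg\<close>)
      finally have "ln 2 * (\<eta> * (1 - \<delta>) / ((1 + \<delta>)\<^sup>2 * C) * X powr (2 * b) / (1 + (2 + L\<^sup>2)\<^sup>2)) \<le> ln 2 * (\<eta> / ((1 + \<delta>)\<^sup>2 * u2))"
        by (rule mult_left_mono) simp
      then show ?thesis using error unfolding X_def[symmetric] by (simp add: mult.assoc)
    qed
    also have "\<dots> = e" unfolding e_def powr_def L_def X_def using N by simp
    finally show ?thesis by (simp add: k')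
  qed
  have e0: "0 < e" using X by (simp add: e_def)
  have dom: "sdom e (bind_pmf (pmf_of_set (slice d N (- x ! d))) (law n False K)) (Z.poi Abox v)" for n
    unfolding k'
  proof (rule sdom_mono[OF domination err])
    show "((a + (real d + 1) * (real r)\<^sup>2) / (a + (real R1)\<^sup>2)) powr b \<le> \<delta>"
    proof (rule order_trans[OF powr_mono2 boxes(2)])
      show "(a + (real d + 1) * (real r)\<^sup>2) / (a + (real R1)\<^sup>2) \<le> (a + (real d + 1) * (real N powr (1 - \<epsilon>))\<^sup>2) / (a + (real N powr (1 - \<epsilon> / 2) - 1)\<^sup>2)"
        using r R1 p1 a unfolding X_def
        by (intro frac_le add_left_mono mult_left_mono power_mono add_pos_nonneg) auto
    qed (use a b0 in \<open>auto intro!: divide_nonneg_nonneg\<close>)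
    show "((a + (real d + 1) * (real R1)\<^sup>2) / (a + (real N)\<^sup>2 / 4)) powr b \<le> 1 / 2"
    proof (rule order_trans[OF powr_mono2 boxes(3)])
      show "(a + (real d + 1) * (real R1)\<^sup>2) / (a + (real N)\<^sup>2 / 4) \<le> (a + (real d + 1) * (real N powr (1 - \<epsilon> / 2))\<^sup>2) / (a + (real N)\<^sup>2 / 4)"
        using R1 a unfolding X_def by (intro divide_right_mono add_left_mono mult_left_mono power_mono) auto
    qed (use a b0 in \<open>auto intro!: divide_nonneg_nonneg\<close>)
    show "E.vis (- Wout) (\<lambda>p. if p = c then 1 else 0) n p \<le> G"
      if "p \<in> Epts d N" "c \<in> Epts d N" "\<bar>p ! d\<bar> < int h" "(real N)\<^sup>2 / 64 \<le> ccq d N c p" for p c n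
    proof -
      have "- Wout \<subseteq> {p. \<bar>p ! d\<bar> < int h}" by (auto simp: Wout_def)
      then show ?thesis unfolding G_def X_def using green[folded h_def, OF that(1-3) _ that(4)] by blast
    qed
    show "1 / real N ^ d + real N ^ d / 2 ^ ((h - N) div (4 * d * N)) \<le> (1 + \<delta>) / real N ^ d"
    proof -
      \<comment> \<open>The squared logarithm in \<open>hN\<close> serves this estimate: between the
        heights \<open>N\<close> and \<open>h\<close> there are about
        \<open>L\<^sup>2 / (4 * d)\<close> mixing blocks, so the mixing error is smaller than any
        power of \<open>N\<close>.\<close>
      let ?q = "(h - N) div (4 * d * N)"
      have "X * (1 + L\<^sup>2) - 1 \<le> real (h - N)" using h by (simp add: of_nat_diff X_def algebra_simps)
      then have "X * L\<^sup>2 \<le> real (h - N)" using X by (simp add: algebra_simps)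
      then have "L\<^sup>2 / (4 * real d) \<le> real (h - N) / real (4 * d * N)"
        using X d by (simp add: X_def divide_le_eq le_divide_eq mult_ac)
      also have "\<dots> \<le> real ?q + 1"
        using floor_divide_of_nat_eq[of "h - N" "4 * d * N", where ?'a=real] by linarith
      finally have "2 powr (- real ?q) \<le> 2 powr (1 - L\<^sup>2 / (4 * real d))" by (intro powr_mono) auto
      then have "X powr (2 * real d) * 2 powr (- real ?q) \<le> X powr (2 * real d) * 2 powr (1 - L\<^sup>2 / (4 * real d))"
        by (rule mult_left_mono) simp
      also have "\<dots> \<le> \<delta>" using boxes(4) by (simp add: X_def)
      also have "X powr (2 * real d) = X ^ d * X ^ d" unfolding Xd by (simp flip: powr_add)
      also have "2 powr (- real ?q) = 1 / 2 ^ ?q" by (simp add: powr_minus powr_realpow inverse_eq_divide)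
      finally have "X ^ d / 2 ^ ?q * X ^ d \<le> \<delta>" by (simp add: mult_ac)
      then have "X ^ d / 2 ^ ?q \<le> \<delta> / X ^ d" using X by (simp add: pos_le_divide_eq)
      then show ?thesis by (simp add: X_def add_divide_distrib)
    qed
    show "real N ^ d / (1 + \<delta>) \<le> real N ^ d - (2 * real R1 + 1) ^ d"
    proof -
      have "(2 * real R1 + 1) / X \<le> (2 * X powr (1 - \<epsilon> / 2) + 1) / X" using R1 X by (intro divide_right_mono) auto
      also have "\<dots> \<le> \<delta> / (1 + \<delta>)" using boxes(5) by (simp add: X_def)
      finally have t: "(2 * real R1 + 1) / X \<le> \<delta> / (1 + \<delta>)" .
      have "((2 * real R1 + 1) / X) ^ d \<le> (\<delta> / (1 + \<delta>)) ^ d" by (rule power_mono[OF t]) (use X in auto)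
      also have "\<dots> \<le> (\<delta> / (1 + \<delta>)) ^ 1" by (rule power_decreasing) (use \<delta> d in auto)
      finally have "(2 * real R1 + 1) ^ d \<le> \<delta> / (1 + \<delta>) * X ^ d"
        using X by (simp add: power_divide pos_divide_le_eq)
      moreover have "X ^ d / (1 + \<delta>) = X ^ d - \<delta> / (1 + \<delta>) * X ^ d" using \<delta> by (simp add: field_simps)
      ultimately show ?thesis by (simp add: X_def)
    qed
  qed (use \<delta> a b0 G super u1_def u2_def u3_def small1 small2 small3 small4 budget in auto)
  have ball: "ballE d N (real N powr (1 - \<epsilon>)) \<subseteq> ebox r"
  proof
    fix q assume q: "q \<in> ballE d N (real N powr (1 - \<epsilon>))"
    have fl: "\<bar>t\<bar> \<le> int r" if "real_of_int \<bar>t\<bar> \<le> real N powr (1 - \<epsilon>)" for t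
      using that unfolding r_def by (simp add: le_floor_iff le_nat_iff)
    have "\<bar>toZ d N q ! i\<bar> \<le> int r" if "i \<le> d" for i
    proof (cases "i < d")
      case True
      then have "\<bar>tz N (q ! i)\<bar> = min (q ! i) (int N - q ! i)" using q by (auto simp: ballE_def Epts_def tz_def)
      then show ?thesis using True q fl[of "tz N (q ! i)"] by (simp add: ballE_def toZ_nth)
    next
      case False
      then show ?thesis using that q fl[of "q ! d"] by (simp add: ballE_def toZ_nth)
    qed
    then show "q \<in> ebox r" using q by (simp add: ebox_def ballE_def zbox_def length_toZ)
  qed
  have K0: "0 < K" and ee: "1 - e - e = 1 - 2 * e" using K1 by simp_all
  show ?thesis
    using coupling_exists[OF x K0 v0 h_def dom e0 ball] unfolding ee unfolding K_def h_def X_def e_def .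
qed

theorem theorem1p1:
  fixes d :: nat
  assumes "d \<ge> 2"
  shows "\<exists>c::real. \<forall>\<alpha> v \<epsilon> :: real. \<alpha> > 0 \<longrightarrow> v > real (d + 1) * \<alpha> \<longrightarrow> 0 < \<epsilon> \<longrightarrow> \<epsilon> < 1 \<longrightarrow>
    (\<exists>c0::real. \<forall>N::nat. N \<ge> 1 \<longrightarrow> real N \<ge> c0 \<longrightarrow>
      (\<forall>x \<in> Epts d N. \<exists>Q. is_coupling d N v Q \<and>
        measure Q {\<omega> \<in> space Q. \<forall>n. enat n \<le> Dtime d N (x ! d) (nat \<lfloor>\<alpha> * real N ^ d / real (hN N)\<rfloor>) (fst \<omega>) \<longrightarrow>
             subE d N (fst \<omega> n) x \<in> ballE d N (real N powr (1 - \<epsilon>)) \<longrightarrow>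
             toZ d N (subE d N (fst \<omega> n) x) \<in> snd \<omega>}
        \<ge> 1 - c * real N powr (- 3 * real d)))"
proof (rule exI[of _ 2], intro allI impI)
  \<comment> \<open>The constant 2 counts two errors of size \<open>N powr (- 3 * d)\<close>:
    failure of the domination, and growth of the trace after the chosen horizon.\<close>
  fix \<alpha> v \<epsilon> :: real assume \<alpha>: "0 < \<alpha>" and v: "real (d + 1) * \<alpha> < v" and \<epsilon>: "0 < \<epsilon>" "\<epsilon> < 1"
  define f where "f \<delta> = real (d + 1) * \<alpha> * (1 + \<delta>) ^ 4 / (1 - \<delta>)" for \<delta> :: real
  have "(f \<longlongrightarrow> f 0) (at_right 0)" unfolding f_def by (intro tendsto_eq_intros | simp)+
  then have "\<forall>\<^sub>F \<delta> in at_right 0. f \<delta> < v" by (rule order_tendstoD) (use v in \<open>simp add: f_def\<close>)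
  moreover have "\<forall>\<^sub>F \<delta> in at_right (0::real). \<delta> \<in> {0<..<1}" by (rule eventually_at_right_real) simp
  ultimately have "\<forall>\<^sub>F \<delta> in at_right 0. f \<delta> < v \<and> 0 < \<delta> \<and> \<delta> < 1" by eventually_elim auto
  then obtain \<delta> where \<delta>: "f \<delta> < v" "0 < \<delta>" "\<delta> < 1" using eventually_happens[of _ "at_right (0::real)"] by auto
  \<comment> \<open>The room between \<open>f \<delta>\<close> and \<open>v\<close> is halved: one
    share is for a start inside the intermediate box, the other for further returns.\<close>
  define \<eta> where "\<eta> = (v - f \<delta>) / 2"
  have \<eta>: "0 < \<eta>" "f \<delta> + 2 * \<eta> \<le> v" using \<delta> by (simp_all add: \<eta>_def field_simps)
  define D where "D = real d - 1"
  define k where "k = 17 * (4 * real d + 5) ^ (d + 1)"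
  have D: "0 < D" "0 < real d" "0 < real d + 1" using assms by (simp_all add: D_def)
  have v0: "0 < v" using v \<alpha> by (smt (verit) mult_nonneg_nonneg of_nat_0_le_iff)
  \<comment> \<open>Below the critical value \<open>(d - 1) / 2\<close>, as superharmonicity
    demands, yet large enough that \<open>(1 - \<epsilon>) * D < 2 * b\<close>, as the error
    estimate demands.\<close>
  define b where "b = (1 - \<epsilon> / 2) * D / 2"
  have b: "0 < b" "b < (real d - 1) / 2" using D \<epsilon> by (simp_all add: b_def D_def[symmetric])
  obtain a where a: "2 \<le> a" and super: "\<And>p. p \<in> Zpts d \<Longrightarrow>
     av (nm d) (\<lambda>j. (a + nsq d (mvZ p j)) powr (- b)) \<le> (a + nsq d p) powr (- b)"
    using superharmonic_Z[OF b] by blast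
  obtain C N0 where C: "0 < C" and green: "\<And>N h c p U n. N0 \<le> N \<Longrightarrow> 0 < N \<Longrightarrow> p \<in> Epts d N \<Longrightarrow> c \<in> Epts d N \<Longrightarrow> \<bar>p ! d\<bar> < int h \<Longrightarrow>
       U \<subseteq> {p. \<bar>p ! d\<bar> < int h} \<Longrightarrow> (real N)\<^sup>2 / 64 \<le> ccq d N c p \<Longrightarrow>
       rwalk.vis (mvE d N) (nm d) U (\<lambda>p. if p = c then 1 else 0) n p \<le> C * real N powr (- 2 * b) * (1 + (real h / real N)\<^sup>2)"
    using green_cylinder[OF b] by metis
  have a0: "0 < a" using a by simp
  have pos: "0 < k" "0 < (1 + \<delta>) ^ 3 * (real d + 1) / (1 - \<delta>) * k" "0 < (1 + \<delta>)\<^sup>2 * C / (1 - \<delta>) * k"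
      "0 < (1 + \<delta>)\<^sup>2 * 4 * (real d + 1) * k" "0 < (1 + \<delta>)\<^sup>2 * 4 * (real d + 1)" "0 < 4 * v * k"
      "0 < ln 2 * \<eta> * (1 - \<delta>) / ((1 + \<delta>)\<^sup>2 * C)" "0 < min \<delta> (1 / 4)"
    using \<delta> C \<eta> D v0 unfolding k_def by (auto intro!: mult_pos_pos divide_pos_pos zero_less_power add_pos_pos)
  have exps: "0 < \<epsilon> * D" "0 < \<epsilon> / 2 * D" "0 < (1 - \<epsilon>) * D" "(1 - \<epsilon>) * D < 2 * b" using D \<epsilon> by (simp_all add: b_def)
  have "\<forall>\<^sub>F t in at_top. \<forall>N\<ge>1. real N = t \<longrightarrow> (\<forall>x \<in> Epts d N. \<exists>Q. is_coupling d N v Q \<and>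
        measure Q {\<omega> \<in> space Q. \<forall>n. enat n \<le> Dtime d N (x ! d) (nat \<lfloor>\<alpha> * real N ^ d / real (hN N)\<rfloor>) (fst \<omega>) \<longrightarrow>
             subE d N (fst \<omega> n) x \<in> ballE d N (real N powr (1 - \<epsilon>)) \<longrightarrow>
             toZ d N (subE d N (fst \<omega> n) x) \<in> snd \<omega>}
        \<ge> 1 - 2 * real N powr (- 3 * real d))"
    using eventually_ge_at_top[of "real N0"] eventually_boxes[OF \<epsilon> \<delta>(2) a0 b(1) D(2)]
      eventually_budgets(1)[OF \<alpha> \<delta>(2) exps(1) pos(2)] eventually_budgets(2)[OF \<alpha> pos(8) exps(2) pos(3)]
      eventually_budgets(3)[OF \<alpha> \<delta>(2) exps(2) pos(4)] eventually_budgets(3)[OF \<alpha> \<eta>(1) D(1) pos(5)]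
      eventually_budgets(4)[OF \<alpha> \<delta>(2) D(1) pos(1)] eventually_budgets(5)[OF \<alpha> \<delta>(2) D(1) pos(1)]
      eventually_error[OF pos(6,7) exps(3,4) D(2)]
  proof eventually_elim
    case (elim t)
    show ?case
    proof (intro allI impI ballI)
      fix N :: nat and x assume N: "1 \<le> N" "real N = t" and x: "x \<in> Epts d N"
      have N0: "N0 \<le> N" "0 < N" using elim(1) N by simp_all
      note elim = elim[folded N(2)]
      show "\<exists>Q. is_coupling d N v Q \<and>
        measure Q {\<omega> \<in> space Q. \<forall>n. enat n \<le> Dtime d N (x ! d) (nat \<lfloor>\<alpha> * real N ^ d / real (hN N)\<rfloor>) (fst \<omega>) \<longrightarrow>
             subE d N (fst \<omega> n) x \<in> ballE d N (real N powr (1 - \<epsilon>)) \<longrightarrow>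
             toZ d N (subE d N (fst \<omega> n) x) \<in> snd \<omega>}
        \<ge> 1 - 2 * real N powr (- 3 * real d)"
        by (rule coupling_at_scale[OF assms N(1) \<epsilon> \<delta>(2,3) \<alpha> \<eta>(1) \<eta>(2)[unfolded f_def] a b_def[unfolded D_def] super C green[OF N0]
            elim(2-6) elim(7-12)[unfolded D_def k_def] elim(13)[unfolded D_def k_def] x])
    qed
  qed
  then show "\<exists>c0::real. \<forall>N::nat. N \<ge> 1 \<longrightarrow> real N \<ge> c0 \<longrightarrow>
      (\<forall>x \<in> Epts d N. \<exists>Q. is_coupling d N v Q \<and>
        measure Q {\<omega> \<in> space Q. \<forall>n. enat n \<le> Dtime d N (x ! d) (nat \<lfloor>\<alpha> * real N ^ d / real (hN N)\<rfloor>) (fst \<omega>) \<longrightarrow>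
             subE d N (fst \<omega> n) x \<in> ballE d N (real N powr (1 - \<epsilon>)) \<longrightarrow>
             toZ d N (subE d N (fst \<omega> n) x) \<in> snd \<omega>}
        \<ge> 1 - 2 * real N powr (- 3 * real d))"
    unfolding eventually_at_top_linorder by blast
qed

end
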